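(* Assume $\gamma_i>0$ for all $1\le i\le k$ and $\#\widetilde{\mathcal A}_k\ge2$. Let $$M^{\vec\gamma}=\max\{\dim_e^{\vec\gamma}(\mu):\ \mu\text{ a non-degenerate Mandelbrot measure supported on }K\}.$$ Then $$M^{\vec\gamma}=\begin{cases}P_{i_0}(\theta_{i_0})&\text{if }i_0\le k\\P_k(1)&\text{if }i_0=k+1,\end{cases}$$ and the maximum is uniquely attained at $\mu_{\nu_{i_0}}$, where $\nu_{i_0}$ is the equilibrium state of $P_{i_0}$ at $\theta_{i_0}$ (for $i_0=k+1$: the equilibrium state of $P_{k+1}:=P_k$ at $\theta_{k+1}:=1$, a measure on $\widetilde X_k$), and $\mu_{\nu_{i_0}}$ is the Mandelbrot measure associated with $\nu_{i_0}$.
   Context: Symbolic setting. Let $k\ge2$. For $1\le i\le k$ let $\mathcal A_i$ be a finite alphabet with at least 2 elements, $X_i=\mathcal A_i^{\{1,2,\dots\}}$ and $T_i$ the left shift on $X_i$. For $1\le i\le k-1$ let $\pi_i:\mathcal A_i\to\mathcal A_{i+1}$ be a surjective map, extended letter by letter to finite words and to $X_i$. Set $\Pi_i=\pi_{i-1}\circ\cdots\circ\pi_1$ ($\Pi_1$ the identity), and $\Pi_{i,j}=\pi_{j-1}\circ\cdots\circ\pi_i$ for $j>i$, $\Pi_{i,i}$ the identity. $f\nu$ denotes the push-forward of $\nu$ by $f$. $\mathcal A_i^*$ is the set of finite words (including the empty word $\epsilon$), $[u]$ the cylinder of points with prefix $u$, $x_{|n}$ the prefix of length $n$. $\vec\gamma=(\gamma_1,\dots,\gamma_k)$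 has positive entries. Random sponge. Let $A=(c_a)_{a\in\mathcal A_1}$ be a random element of $\{0,1\}^{\mathcal A_1}$, identified with $\{a:c_a=1\}$, with $\mathbb E(\#A)>1$. Let $(A(u))_{u\in\mathcal A_1^*}$ be independent copies of $A$, $K_n=\{x\in X_1:c_{x_j}(x_{|j-1})=1,\ 1\le j\le n\}$, $K=\bigcap_{n\ge1}K_n$. Mandelbrot measures on $K$. Let $W=(W_a)_{a\in\mathcal A_1}$ be a non-negative random vector defined simultaneously with $A$, with $\{W_a>0\}\subset\{c_a=1\}$ for all $a$ and $\mathbb E\sum_aW_a=1$; $T_W(q)=-\log\mathbb E\sum_aW_a^q$. Let $(A(u),W(u))_{u\in\mathcal A_1^*}$ be independent copies of $(A,W)$ ($K$ being built from the $A(u)$), $Q^u(v)=\prod_{j=1}^{|v|}W_{v_j}(u\cdot v_{|j-1})$, $Y(u)=\lim_n\sum_{|v|=n}Q^u(v)$ (a.s. martingale limit). The Mandelbrot measure $\mu$ is defined by $\mu([u])=Q^\epsilon(u)Y(u)$; it is supported on $K$, and is non-degenerate if $\mathbb P(\mu\ne0)>0$. Mandelbrot measures jointly defined with $K$ are identified when their weight vectors $W$ coincide almost surely. For non-degenerate $\mu$, $\dim_e(\mu)=T_W'(1^-)=-\sum_a\mathbb E(W_a\log W_a)$; $\nu_i=\mathbb E(\Pi_i\mu)$ is the Bernoulli product measure on $X_i$ with weights $p_b=\sum_{a:\Pi_i(a)=b}\mathbb E(W_a)$, and $$\dim_e^{\vec\gamma}(\mu)=\gamma_1\dim_e(\mu)+\sum_{i=2}^k\gamma_i\min(\dim_e(\mu),h_{\nu_i}(T_i)),$$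 where $h$ denotes measure-theoretic entropy. Pressures. For $1\le i\le k$, $b\in\mathcal A_i$: $N_b^{(i)}=\#\{a\in A:\Pi_i(a)=b\}$; $\widetilde{\mathcal A}_i=\{b\in\mathcal A_i:\mathbb E(N^{(i)}_b)>0\}$; $\widetilde X_i$ is the one-sided full shift space over $\widetilde{\mathcal A}_i$, and $\mathcal M(\widetilde X_i,T_i)$ the set of shift-invariant Borel probability measures on it. For $2\le i\le k$ and $\theta\in\mathbb R$, $$P_i(\theta)=\sup_{\nu\in\mathcal M(\widetilde X_i,T_i)}\Big\{\theta\int\phi_i\,d\nu+(\gamma_1+\cdots+\gamma_i)h_\nu(T_i)+\sum_{j=i+1}^k\gamma_jh_{\Pi_{i,j}\nu}(T_j)\Big\},\quad\phi_i(x)=(\gamma_1+\cdots+\gamma_i)\log\mathbb E(N^{(i)}_{x_1}).$$ The supremum is attained at a unique measure, called the equilibrium state of $P_i$ at $\theta$; it is a Bernoulli product measure fully supported on $\widetilde X_i$ (regarded also as a measure on $X_i$). $P_i$ is convex and differentiable. For $2\le i\le k$, $\widetilde\theta_i=\dfrac{\gamma_1+\cdots+\gamma_{i-1}}{\gamma_1+\cdots+\gamma_i}$. Let $\widetilde I=\{2\le i\le k:P_i'(1)\ge0\}$; $i_0=\min\widetilde I$ if $\widetilde I\neq\emptyset$ and $i_0=k+1$ otherwise; $\theta_{i_0}=\min\{\theta\in[\widetilde\theta_{i_0},1]:P_{i_0}'(\theta)\ge0\}$ if $i_0\le k$ and $\theta_{i_0}=1$ if $i_0=k+1$. Measures $\mu_{\nu_i}$.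 For a Bernoulli product measure $\nu_i$ on $X_i$ supported on $\widetilde X_i$, $\mu_{\nu_i}$ is the Mandelbrot measure generated by the vector $\widetilde W=(\widetilde W_a)_{a\in\mathcal A_1}$ with $\widetilde W_a=\nu_i([\Pi_i(a)])\,\mathbf 1_{\{a\in A\}}/\mathbb E(N^{(i)}_{\Pi_i(a)})$ if $\Pi_i(a)\in\widetilde{\mathcal A}_i$, and $\widetilde W_a=0$ otherwise. *)

theory Defs
  imports "HOL-Probability.Probability"
begin

section \<open>Measure-theoretic entropy\<close>

definition partition_entropy :: "'x measure \<Rightarrow> 'x set set \<Rightarrow> real" where
  "partition_entropy \<nu> \<xi> = - (\<Sum>B\<in>\<xi>. measure \<nu> B * ln (measure \<nu> B))"

text \<open>The join of \<open>\<xi>, T\<^sup>-\<^sup>1 \<xi>, \<dots>, T\<^sup>-\<^sup>(\<^sup>n\<^sup>-\<^sup>1\<^sup>) \<xi>\<close>. Its only possible degenerate member is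
  the empty set, which does not contribute to the entropy.\<close>

definition partition_join ::
    "'x measure \<Rightarrow> ('x \<Rightarrow> 'x) \<Rightarrow> 'x set set \<Rightarrow> nat \<Rightarrow> 'x set set" where
  "partition_join \<nu> T \<xi> n =
     (\<lambda>C. {x \<in> space \<nu>. \<forall>j<n. (T ^^ j) x \<in> C j}) ` ({..<n} \<rightarrow>\<^sub>E \<xi>)"

text \<open>Kolmogorov--Sinai entropy \<open>h\<^sub>\<nu>(T)\<close>. The supremum is taken in the extended reals; it is finite
  for all the full shifts over finite alphabets used below.\<close>

definition ks_entropy :: "'x measure \<Rightarrow> ('x \<Rightarrow> 'x) \<Rightarrow> real" where
  "ks_entropy \<nu> T = real_of_ereal
     (SUP \<xi>\<in>{\<xi>. finite \<xi> \<and> \<xi> \<subseteq> sets \<nu> \<and> partition_on (space \<nu>) \<xi>}.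
        ereal (lim (\<lambda>n. partition_entropy \<nu> (partition_join \<nu> T \<xi> n) / real n)))"


section \<open>Symbolic setting and random sponge\<close>

text \<open>The \<open>k\<close> alphabets are finite subsets of one common type, and only the indices
  \<open>1, \<dots>, k\<close> of \<open>alph\<close>, \<open>gam\<close> and \<open>1, \<dots>, k - 1\<close> of \<open>fac\<close> matter. The field \<open>surv\<close> is the family
  \<open>(A(u))\<close>, indexed by the words over \<open>alph 1\<close> and defined on the probability space \<open>Om\<close>;
  the subset \<open>surv u \<omega>\<close> stands for the 0-1 vector \<open>(c\<^sub>a(u))\<close>. The generic \<open>A\<close>
  is represented by the copy \<open>surv []\<close> attached to the empty word.\<close>

record ('a, 'w) sponge =
  levels :: nat
  alph :: "nat \<Rightarrow> 'a set"
  fac :: "nat \<Rightarrow> 'a \<Rightarrow> 'a"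
  gam :: "nat \<Rightarrow> real"
  Om :: "'w measure"
  surv :: "'a list \<Rightarrow> 'w \<Rightarrow> 'a set"

text \<open>The full shift space over \<open>B\<close> with its Borel sets; the shift map is \<open>stl\<close> and the
  cylinder of a word \<open>u\<close> is \<open>sstart B u\<close>.\<close>

abbreviation full_shift :: "'a set \<Rightarrow> 'a stream measure" where
  "full_shift B \<equiv> stream_space (count_space B)"

definition random_sponge :: "('a, 'w) sponge \<Rightarrow> bool" where
  "random_sponge S \<longleftrightarrow>
     2 \<le> levels S \<and>
     (\<forall>i\<in>{1..levels S}. finite (alph S i) \<and> 2 \<le> card (alph S i)) \<and>
     (\<forall>i\<in>{1..<levels S}. fac S i ` alph S i = alph S (Suc i)) \<and>
     prob_space (Om S) \<and>
     prob_space.indep_vars (Om S) (\<lambda>_. count_space (Pow (alph S 1))) (surv S)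
       (lists (alph S 1)) \<and>
     (\<forall>u\<in>lists (alph S 1).
        distr (Om S) (count_space (Pow (alph S 1))) (surv S u) =
        distr (Om S) (count_space (Pow (alph S 1))) (surv S [])) \<and>
     1 < (\<integral>\<omega>. real (card (surv S [] \<omega>)) \<partial>Om S)"

definition sponge_K_n :: "('a, 'w) sponge \<Rightarrow> nat \<Rightarrow> 'w \<Rightarrow> 'a stream set" where
  "sponge_K_n S n \<omega> =
     {x \<in> streams (alph S 1). \<forall>j\<in>{1..n}. x !! (j - 1) \<in> surv S (stake (j - 1) x) \<omega>}"

definition sponge_K :: "('a, 'w) sponge \<Rightarrow> 'w \<Rightarrow> 'a stream set" where
  "sponge_K S \<omega> = (\<Inter>n\<in>{1..}. sponge_K_n S n \<omega>)"

text \<open>\<open>Proj S i j\<close> is \<open>\<Pi>\<^sub>i\<^sub>,\<^sub>j = \<pi>\<^sub>j\<^sub>-\<^sub>1 \<circ> \<dots> \<circ> \<pi>\<^sub>i\<close>; in particular \<open>\<Pi>\<^sub>i\<close> is \<open>Proj S 1 i\<close>.\<close>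

definition Proj :: "('a, 'w) sponge \<Rightarrow> nat \<Rightarrow> nat \<Rightarrow> 'a \<Rightarrow> 'a" where
  "Proj S i j = fold (fac S) [i..<j]"


section \<open>Mandelbrot measures\<close>

text \<open>A Mandelbrot measure is encoded by its family of weights \<open>W u \<omega> a = W\<^sub>a(u)(\<omega>)\<close>, the generic
  vector being the one at the empty word. The pairs \<open>(A(u), W(u))\<close> are i.i.d., so the almost sure
  conditions imposed at the empty word hold at every word.\<close>

definition mandelbrot_weights ::
    "('a, 'w) sponge \<Rightarrow> ('a list \<Rightarrow> 'w \<Rightarrow> 'a \<Rightarrow> real) \<Rightarrow> bool" where
  "mandelbrot_weights S W \<longleftrightarrow>
     (let N = count_space (Pow (alph S 1)) \<Otimes>\<^sub>M (\<Pi>\<^sub>M a\<in>alph S 1. (borel :: real measure));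
          X = (\<lambda>u \<omega>. (surv S u \<omega>, restrict (W u \<omega>) (alph S 1)))
      in prob_space.indep_vars (Om S) (\<lambda>_. N) X (lists (alph S 1)) \<and>
         (\<forall>u\<in>lists (alph S 1). distr (Om S) N (X u) = distr (Om S) N (X []))) \<and>
     (AE \<omega> in Om S. \<forall>a\<in>alph S 1. 0 \<le> W [] \<omega> a \<and> (0 < W [] \<omega> a \<longrightarrow> a \<in> surv S [] \<omega>)) \<and>
     (\<integral>\<omega>. (\<Sum>a\<in>alph S 1. W [] \<omega> a) \<partial>Om S) = 1"

definition Qprod :: "('a list \<Rightarrow> 'w \<Rightarrow> 'a \<Rightarrow> real) \<Rightarrow> 'a list \<Rightarrow> 'a list \<Rightarrow> 'w \<Rightarrow> real" where
  "Qprod W u v \<omega> = (\<Prod>j<length v. W (u @ take j v) \<omega> (v ! j))"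

definition Ylim ::
    "('a, 'w) sponge \<Rightarrow> ('a list \<Rightarrow> 'w \<Rightarrow> 'a \<Rightarrow> real) \<Rightarrow> 'a list \<Rightarrow> 'w \<Rightarrow> real" where
  "Ylim S W u \<omega> = lim (\<lambda>n. \<Sum>v\<in>{v \<in> lists (alph S 1). length v = n}. Qprod W u v \<omega>)"

definition mandelbrot_spec ::
    "('a, 'w) sponge \<Rightarrow> ('a list \<Rightarrow> 'w \<Rightarrow> 'a \<Rightarrow> real) \<Rightarrow> 'w \<Rightarrow> 'a stream measure \<Rightarrow> bool" where
  "mandelbrot_spec S W \<omega> m \<longleftrightarrow>
     sets m = sets (full_shift (alph S 1)) \<and>
     (\<forall>u\<in>lists (alph S 1).
        emeasure m (sstart (alph S 1) u) = ennreal (Qprod W [] u \<omega> * Ylim S W u \<omega>))"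

text \<open>The prescription on cylinders is consistent, and then determines the measure, for almost every
  \<open>\<omega>\<close>; on the exceptional null set the measure is set to 0.\<close>

definition mandelbrot_measure ::
    "('a, 'w) sponge \<Rightarrow> ('a list \<Rightarrow> 'w \<Rightarrow> 'a \<Rightarrow> real) \<Rightarrow> 'w \<Rightarrow> 'a stream measure" where
  "mandelbrot_measure S W \<omega> =
     (if \<exists>m. mandelbrot_spec S W \<omega> m then (THE m. mandelbrot_spec S W \<omega> m)
      else null_measure (full_shift (alph S 1)))"

definition nondegenerate ::
    "('a, 'w) sponge \<Rightarrow> ('a list \<Rightarrow> 'w \<Rightarrow> 'a \<Rightarrow> real) \<Rightarrow> bool" where
  "nondegenerate S W \<longleftrightarrow>
     0 < measure (Om S)
           {\<omega> \<in> space (Om S). mandelbrot_measure S W \<omega> \<noteq> null_measure (full_shift (alph S 1))}"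

definition supported_on_K ::
    "('a, 'w) sponge \<Rightarrow> ('a list \<Rightarrow> 'w \<Rightarrow> 'a \<Rightarrow> real) \<Rightarrow> bool" where
  "supported_on_K S W \<longleftrightarrow>
     (AE \<omega> in Om S. AE x in mandelbrot_measure S W \<omega>. x \<in> sponge_K S \<omega>)"

text \<open>Support in \<open>K\<close> is automatic for \<open>mandelbrot_weights\<close>.\<close>

definition mandelbrot_on_K :: "('a, 'w) sponge \<Rightarrow> ('a list \<Rightarrow> 'w \<Rightarrow> 'a \<Rightarrow> real) set" where
  "mandelbrot_on_K S = {W. mandelbrot_weights S W \<and> nondegenerate S W \<and> supported_on_K S W}"

definition same_weights ::
    "('a, 'w) sponge \<Rightarrow> ('a list \<Rightarrow> 'w \<Rightarrow> 'a \<Rightarrow> real) \<Rightarrow> ('a list \<Rightarrow> 'w \<Rightarrow> 'a \<Rightarrow> real) \<Rightarrow> bool" where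
  "same_weights S W W' \<longleftrightarrow>
     (AE \<omega> in Om S. \<forall>u\<in>lists (alph S 1). \<forall>a\<in>alph S 1. W u \<omega> a = W' u \<omega> a)"

text \<open>\<open>T\<^sub>W'(1\<^sup>-)\<close>; in the non-degenerate case all the expectations are finite.\<close>

definition dim_e :: "('a, 'w) sponge \<Rightarrow> ('a list \<Rightarrow> 'w \<Rightarrow> 'a \<Rightarrow> real) \<Rightarrow> real" where
  "dim_e S W = - (\<Sum>a\<in>alph S 1. \<integral>\<omega>. W [] \<omega> a * ln (W [] \<omega> a) \<partial>Om S)"

text \<open>\<open>\<nu>\<^sub>i = E(\<Pi>\<^sub>i \<mu>)\<close>, the intensity of the random measure \<open>\<Pi>\<^sub>i \<mu>\<close>.\<close>

definition expected_image ::
    "('a, 'w) sponge \<Rightarrow> ('a list \<Rightarrow> 'w \<Rightarrow> 'a \<Rightarrow> real) \<Rightarrow> nat \<Rightarrow> 'a stream measure" where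
  "expected_image S W i =
     measure_of (streams (alph S i)) (sets (full_shift (alph S i)))
       (\<lambda>B. \<integral>\<^sup>+\<omega>. emeasure (distr (mandelbrot_measure S W \<omega>) (full_shift (alph S i))
                              (smap (Proj S 1 i))) B \<partial>Om S)"

definition dim_e_gam :: "('a, 'w) sponge \<Rightarrow> ('a list \<Rightarrow> 'w \<Rightarrow> 'a \<Rightarrow> real) \<Rightarrow> real" where
  "dim_e_gam S W =
     gam S 1 * dim_e S W +
     (\<Sum>i=2..levels S. gam S i * min (dim_e S W) (ks_entropy (expected_image S W i) stl))"


section \<open>Pressures and equilibrium states\<close>

definition EN :: "('a, 'w) sponge \<Rightarrow> nat \<Rightarrow> 'a \<Rightarrow> real" where
  "EN S i b = (\<integral>\<omega>. real (card {a \<in> surv S [] \<omega>. Proj S 1 i a = b}) \<partial>Om S)"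

definition alph_tilde :: "('a, 'w) sponge \<Rightarrow> nat \<Rightarrow> 'a set" where
  "alph_tilde S i = {b \<in> alph S i. 0 < EN S i b}"

definition invariant_measures :: "'a set \<Rightarrow> 'a stream measure set" where
  "invariant_measures B =
     {\<nu>. sets \<nu> = sets (full_shift B) \<and> prob_space \<nu> \<and> distr \<nu> \<nu> stl = \<nu>}"

definition gam_sum :: "('a, 'w) sponge \<Rightarrow> nat \<Rightarrow> real" where
  "gam_sum S i = (\<Sum>j=1..i. gam S j)"

definition potential :: "('a, 'w) sponge \<Rightarrow> nat \<Rightarrow> 'a stream \<Rightarrow> real" where
  "potential S i x = gam_sum S i * ln (EN S i (shd x))"

definition pressure_functional ::
    "('a, 'w) sponge \<Rightarrow> nat \<Rightarrow> real \<Rightarrow> 'a stream measure \<Rightarrow> real" where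
  "pressure_functional S i \<theta> \<nu> =
     \<theta> * (\<integral>x. potential S i x \<partial>\<nu>) + gam_sum S i * ks_entropy \<nu> stl +
     (\<Sum>j=i+1..levels S.
        gam S j * ks_entropy (distr \<nu> (full_shift (alph S j)) (smap (Proj S i j))) stl)"

definition pressure :: "('a, 'w) sponge \<Rightarrow> nat \<Rightarrow> real \<Rightarrow> real" where
  "pressure S i \<theta> =
     (SUP \<nu>\<in>invariant_measures (alph_tilde S i). pressure_functional S i \<theta> \<nu>)"

definition equilibrium_state :: "('a, 'w) sponge \<Rightarrow> nat \<Rightarrow> real \<Rightarrow> 'a stream measure" where
  "equilibrium_state S i \<theta> =
     (THE \<nu>. \<nu> \<in> invariant_measures (alph_tilde S i) \<and>
             pressure_functional S i \<theta> \<nu> = pressure S i \<theta>)"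

definition theta_tilde :: "('a, 'w) sponge \<Rightarrow> nat \<Rightarrow> real" where
  "theta_tilde S i = gam_sum S (i - 1) / gam_sum S i"

definition I_tilde :: "('a, 'w) sponge \<Rightarrow> nat set" where
  "I_tilde S = {i \<in> {2..levels S}. 0 \<le> deriv (pressure S i) 1}"

definition i_zero :: "('a, 'w) sponge \<Rightarrow> nat" where
  "i_zero S = (if I_tilde S \<noteq> {} then Min (I_tilde S) else levels S + 1)"

definition theta_zero :: "('a, 'w) sponge \<Rightarrow> real" where
  "theta_zero S =
     (if i_zero S \<le> levels S
      then (LEAST \<theta>. \<theta> \<in> {theta_tilde S (i_zero S)..1} \<and> 0 \<le> deriv (pressure S (i_zero S)) \<theta>)
      else 1)"

text \<open>The weights \<open>W~(u)\<close> of \<open>\<mu>\<^sub>\<nu>\<close>, for a measure \<open>\<nu>\<close> on the full shift over \<open>alph_tilde S i\<close>.\<close>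

definition weights_of ::
    "('a, 'w) sponge \<Rightarrow> nat \<Rightarrow> 'a stream measure \<Rightarrow> 'a list \<Rightarrow> 'w \<Rightarrow> 'a \<Rightarrow> real" where
  "weights_of S i \<nu> u \<omega> a =
     (let b = Proj S 1 i a in
      if b \<in> alph_tilde S i
      then measure \<nu> (sstart (alph_tilde S i) [b]) * indicator (surv S u \<omega>) a / EN S i b
      else 0)"

text \<open>The maximizer; \<open>min\<close> implements the convention that for \<open>i\<^sub>0 = k + 1\<close> the equilibrium state is
  that of \<open>P\<^sub>k\<close>, a measure on the full shift over \<open>alph_tilde S k\<close>.\<close>

definition optimal_weights :: "('a, 'w) sponge \<Rightarrow> 'a list \<Rightarrow> 'w \<Rightarrow> 'a \<Rightarrow> real" where
  "optimal_weights S =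
     (let i = min (i_zero S) (levels S)
      in weights_of S i (equilibrium_state S i (theta_zero S)))"

definition is_maximum :: "real set \<Rightarrow> real \<Rightarrow> bool" where
  "is_maximum R m \<longleftrightarrow> m \<in> R \<and> (\<forall>r\<in>R. r \<le> m)"

end

theory Submission
  imports Defs
begin

text \<open>
  On a full shift the entropy of an invariant measure is at most the Shannon entropy of its
  one-letter marginal, with equality exactly for Bernoulli measures, so every pressure is a finite
  dimensional maximum \<open>P\<^sub>i (\<theta>) = max F\<^sub>i\<^sub>,\<^sub>\<theta> (q)\<close> over probability vectors \<open>q\<close>. The functional
  \<open>F\<^sub>i\<^sub>,\<^sub>\<theta>\<close> is strongly concave, hence its maximizer is unique and depends continuously on \<open>\<theta>\<close>, and
  \<open>P\<^sub>i\<close> is differentiable.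

  For a Mandelbrot measure \<open>\<mu>\<close>, the Laplace transform of the martingale limit shows that
  non-degeneracy forces the limit to have mean one and \<open>W log W\<close> to be integrable. Hence \<open>E \<mu>\<close> is
  Bernoulli with weights \<open>p = E W\<close>, and Jensen's inequality gives
  \<open>dim\<^sub>e \<mu> \<le> H (p) + \<Sum>\<^sub>a p\<^sub>a log P (a \<in> A)\<close>, with equality only if \<open>W\<close> is a function of \<open>A\<close>.

  With \<open>d = dim\<^sub>e \<mu>\<close>, bounding \<open>min (d, h\<^sub>j)\<close> by \<open>d\<close> for \<open>j < i\<close>, by a convex combination of \<open>d\<close> and
  \<open>h\<^sub>i\<close> for \<open>j = i\<close>, and by \<open>h\<^sub>j\<close> for \<open>j > i\<close>, gives
  \<open>dim\<^sub>e\<^sup>\<gamma> \<mu> \<le> F\<^sub>i\<^sub>,\<^sub>\<theta> (\<Pi>\<^sub>i p) \<le> P\<^sub>i (\<theta>)\<close> for every \<open>\<theta>\<close> between \<open>\<theta>~\<^sub>i\<close> and \<open>1\<close>. The choice of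
  \<open>i\<^sub>0\<close> and \<open>\<theta>\<^sub>i\<^sub>0\<close> makes all these inequalities equalities at the equilibrium state.
\<close>

section \<open>Entropy of finite probability vectors\<close>

lemma xlnx_tangent_quadratic:
  fixes x m :: real
  assumes "0 \<le> x" "x \<le> 1" "0 < m" "m \<le> 1"
  shows "m * ln m + (ln m + 1) * (x - m) + (x - m)\<^sup>2 / 2 \<le> x * ln x"
proof (cases "x = 0")
  case True
  have "m\<^sup>2 \<le> m" using assms by (simp add: power2_eq_square mult_left_le)
  then show ?thesis using True assms by (auto simp: algebra_simps power2_eq_square)
next
  case False
  then have x: "0 < x" using assms by simp
  define g where "g = (\<lambda>t::real. t * ln t - m * ln m - (ln m + 1) * (t - m) - (t - m)\<^sup>2 / 2)"
  have d: "(g has_real_derivative (ln t - ln m - (t - m))) (at t)" if "0 < t" for t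
    unfolding g_def by (rule derivative_eq_intros refl | use that in \<open>simp add: field_simps\<close>)+
  \<comment> \<open>The slope of \<open>ln\<close> is at least 1 on (0, 1], so the derivative of
    \<open>g\<close> has the sign of \<open>t - m\<close> and \<open>g\<close> is minimal at
    \<open>m\<close>. This is the source of the quadratic gain.\<close>
  have le: "u - v \<le> ln u - ln v" if "0 < v" "v \<le> u" "u \<le> 1" for u v :: real
  proof -
    have "ln v - ln u \<le> (v - u) / u" using that by (intro ln_diff_le) auto
    moreover have "u * (u - v) \<le> 1 * (u - v)" using that by (intro mult_right_mono) auto
    then have "u - v \<le> (u - v) / u" using that by (simp add: pos_le_divide_eq mult.commute)
    then have "(v - u) / u \<le> v - u" by (simp add: diff_divide_distrib)
    ultimately show ?thesis by simp
  qed
  have "g m \<le> g x"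
  proof (cases "m \<le> x")
    case True
    show ?thesis
    proof (rule DERIV_nonneg_imp_nondecreasing[OF True])
      fix t assume "m \<le> t" "t \<le> x"
      then show "\<exists>y. (g has_real_derivative y) (at t) \<and> 0 \<le> y"
        using d[of t] le[of m t] assms by (intro exI[of _ "ln t - ln m - (t - m)"]) auto
    qed
  next
    case False
    then have "x \<le> m" by simp
    then show ?thesis
    proof (rule DERIV_nonpos_imp_nonincreasing)
      fix t assume "x \<le> t" "t \<le> m"
      then show "\<exists>y. (g has_real_derivative y) (at t) \<and> y \<le> 0"
        using d[of t] le[of t m] assms x by (intro exI[of _ "ln t - ln m - (t - m)"]) auto
    qed
  qed
  moreover have "g m = 0" by (simp add: g_def)
  ultimately show ?thesis by (simp add: g_def)
qed

text \<open>The tangent bounds at the midpoint are added: the linear parts cancel and each square is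
  a quarter of (x - y)^2. This modulus of convexity makes the entropy functionals below strongly
  concave.\<close>

lemma xlnx_midpoint:
  fixes x y :: real
  assumes "0 \<le> x" "x \<le> 1" "0 \<le> y" "y \<le> 1"
  shows "((x + y) / 2) * ln ((x + y) / 2) + (x - y)\<^sup>2 / 8 \<le> (x * ln x + y * ln y) / 2"
proof (cases "x + y = 0")
  case True
  then have "x = 0" "y = 0" using assms by auto
  then show ?thesis by simp
next
  case False
  define m where "m = (x + y) / 2"
  have m: "0 < m" "m \<le> 1" using False assms by (auto simp: m_def)
  have "m * ln m + (ln m + 1) * (x - m) + (x - m)\<^sup>2 / 2
      + (m * ln m + (ln m + 1) * (y - m) + (y - m)\<^sup>2 / 2) \<le> x * ln x + y * ln y"
    using xlnx_tangent_quadratic[OF assms(1,2) m] xlnx_tangent_quadratic[OF assms(3,4) m] by linarith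
  moreover have "(ln m + 1) * (x - m) + (ln m + 1) * (y - m) = 0"
    by (simp add: m_def field_simps)
  moreover have "(x - m)\<^sup>2 = (x - y)\<^sup>2 / 4" "(y - m)\<^sup>2 = (x - y)\<^sup>2 / 4"
    by (auto simp: m_def power2_eq_square field_simps)
  moreover have "a + d / 8 \<le> r / 2"
    if "a + p + s / 2 + (a + q + s' / 2) \<le> r" "p + q = 0" "s = d / 4" "s' = d / 4"
    for a p q s s' d r :: real
    using that by simp
  ultimately show ?thesis unfolding m_def[symmetric] by blast
qed

text \<open>The convex function x ln x lies above its tangent at \<open>c\<close> and meets it only
  there. Summed or integrated against a comparison vector of the same total mass, the terms
  \<open>x - c\<close> cancel and a relative entropy with its equality case remains; the Gibbs and
  Jensen arguments below all reduce to this.\<close>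

lemma xlnx_tangent:
  fixes x c :: real
  assumes "0 \<le> x" "0 < c"
  shows "x * ln c + x - c \<le> x * ln x"
    and "x * ln x = x * ln c + x - c \<Longrightarrow> x = c"
proof -
  have *: "x * ln c + x - c \<le> x * ln x \<and> (x * ln x = x * ln c + x - c \<longrightarrow> x = c)"
  proof (cases "x = 0")
    case True then show ?thesis using assms by auto
  next
    case False
    then have x: "0 < x" using assms by simp
    have l: "ln (c / x) = ln c - ln x" using x assms by (simp add: ln_div)
    have "ln (c / x) \<le> c / x - 1" using x assms by (intro ln_le_minus_one) auto
    then have "x * (ln c - ln x) \<le> x * (c / x - 1)" unfolding l using x by (intro mult_left_mono) auto
    then have "x * ln c - x * ln x \<le> c - x" using x by (simp add: algebra_simps)
    moreover have "x = c" if "x * ln x = x * ln c + x - c"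
    proof -
      have "x * (ln c - ln x) = c - x" using that by (simp add: algebra_simps)
      then have "ln (c / x) = c / x - 1" unfolding l using x by (simp add: field_simps)
      then have "c / x = 1" using x assms by (intro ln_eq_minus_one) auto
      then show ?thesis using x by simp
    qed
    ultimately show ?thesis by auto
  qed
  show "x * ln c + x - c \<le> x * ln x" "x * ln x = x * ln c + x - c \<Longrightarrow> x = c" using * by auto
qed

lemma continuous_on_xlnx: "continuous_on {0..} (\<lambda>x::real. x * ln x)"
proof -
  have "continuous (at x within {0..}) (\<lambda>x. x * ln x)" if x: "x \<in> {0..}" for x :: real
  proof (cases "x = 0")
    case False
    then show ?thesis using x by (intro continuous_intros) auto
  next
    case True
    \<comment> \<open>The inequality ln y \<le> y - 1 at y = 1 / sqrt t gives a bound that vanishes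
      at 0.\<close>
    have b: "\<bar>t * ln t\<bar> \<le> 2 * sqrt t" if "0 \<le> t" "t \<le> 1" for t :: real
    proof (cases "t = 0")
      case False
      then have t: "0 < t" using that by simp
      have "ln (1 / sqrt t) \<le> 1 / sqrt t - 1" using t by (intro ln_le_minus_one) auto
      then have "- ln t / 2 \<le> 1 / sqrt t" using t by (simp add: ln_div ln_sqrt)
      then have "- ln t \<le> 2 / sqrt t" by simp
      then have "t * (- ln t) \<le> t * (2 / sqrt t)" using t by (intro mult_left_mono) auto
      also have "\<dots> = 2 * sqrt t" using t by (simp add: field_simps)
      finally show ?thesis using t that by (simp add: abs_mult)
    qed simp
    have "((\<lambda>t::real. t * ln t) \<longlongrightarrow> 0) (at 0 within {0..})"
    proof (rule Lim_null_comparison)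
      show "\<forall>\<^sub>F t in at 0 within {0..}. norm (t * ln t) \<le> 2 * sqrt t"
        unfolding eventually_at using b by (intro exI[of _ 1]) (auto simp: dist_real_def)
      have "((\<lambda>t. 2 * sqrt t) \<longlongrightarrow> 2 * sqrt 0) (at 0 within {0..})"
        by (intro tendsto_intros)
      then show "((\<lambda>t. 2 * sqrt t) \<longlongrightarrow> 0) (at 0 within {0..})" by simp
    qed
    then show ?thesis using True by (simp add: continuous_within)
  qed
  then show ?thesis unfolding continuous_on_eq_continuous_within by blast
qed

section \<open>Shannon entropy of probability vectors and of their images\<close>

definition shannon :: "'a set \<Rightarrow> ('a \<Rightarrow> real) \<Rightarrow> real" where
  "shannon B q = - (\<Sum>b\<in>B. q b * ln (q b))"

text \<open>Vectors vanish off \<open>B\<close>, so agreement on \<open>B\<close> is equality of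
  functions and uniqueness of maximizers can be stated as an equation.\<close>

definition prob_vec :: "'a set \<Rightarrow> ('a \<Rightarrow> real) set" where
  "prob_vec B = {q. (\<forall>b\<in>B. 0 \<le> q b) \<and> sum q B = 1 \<and> (\<forall>b. b \<notin> B \<longrightarrow> q b = 0)}"

text \<open>Image of a vector under \<open>f\<close>, without normalization: it serves for
  probability vectors as well as for the expected counts \<open>EN\<close>.\<close>

definition pushv :: "'a set \<Rightarrow> ('a \<Rightarrow> 'b) \<Rightarrow> ('a \<Rightarrow> real) \<Rightarrow> 'b \<Rightarrow> real" where
  "pushv B f q c = (\<Sum>b\<in>{b\<in>B. f b = c}. q b)"

lemma prob_vecD:
  assumes "q \<in> prob_vec B" "finite B"
  shows "0 \<le> q b" "q b \<le> 1" "sum q B = 1" "b \<notin> B \<Longrightarrow> q b = 0"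
proof -
  show *: "0 \<le> q b" for b using assms by (cases "b \<in> B") (auto simp: prob_vec_def)
  show "sum q B = 1" using assms by (auto simp: prob_vec_def)
  show 0: "b \<notin> B \<Longrightarrow> q b = 0" using assms by (auto simp: prob_vec_def)
  show "q b \<le> 1"
  proof (cases "b \<in> B")
    case True
    then have "q b \<le> sum q B" using assms(2) * by (intro member_le_sum) auto
    then show ?thesis using assms by (auto simp: prob_vec_def)
  qed (simp add: 0)
qed

lemma shannon_nonneg:
  assumes "\<And>b. b \<in> B \<Longrightarrow> 0 \<le> q b \<and> q b \<le> 1"
  shows "0 \<le> shannon B q"
proof -
  have "q b * ln (q b) \<le> 0" if "b \<in> B" for b
  proof (cases "q b = 0")
    case False
    then have "ln (q b) \<le> 0" using assms[OF that] by simp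
    then show ?thesis using assms[OF that] by (simp add: mult_nonneg_nonpos)
  qed simp
  then show ?thesis unfolding shannon_def by (simp add: sum_nonpos)
qed

lemma sum_pushv:
  assumes "finite B" "finite C" "f ` B \<subseteq> C"
  shows "(\<Sum>c\<in>C. pushv B f q c * h c) = (\<Sum>b\<in>B. q b * h (f b))"
proof -
  have "(\<Sum>c\<in>C. pushv B f q c * h c) = (\<Sum>c\<in>C. \<Sum>b\<in>{b\<in>B. f b = c}. q b * h (f b))"
    by (intro sum.cong refl) (auto simp: pushv_def sum_distrib_right intro!: sum.cong)
  also have "\<dots> = (\<Sum>b\<in>B. q b * h (f b))" using assms by (intro sum.group) auto
  finally show ?thesis .
qed

lemma pushv_prob_vec:
  assumes "finite B" "finite C" "f ` B \<subseteq> C" "q \<in> prob_vec B"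
  shows "pushv B f q \<in> prob_vec C"
  unfolding prob_vec_def
proof (intro CollectI conjI ballI allI impI)
  show "sum (pushv B f q) C = 1"
    using sum_pushv[OF assms(1-3), of q "\<lambda>_. 1"] prob_vecD(3)[OF assms(4,1)] by simp
  show "0 \<le> pushv B f q c" for c
    unfolding pushv_def using prob_vecD(1)[OF assms(4,1)] by (intro sum_nonneg) auto
  show "pushv B f q c = 0" if "c \<notin> C" for c
    unfolding pushv_def using that assms(3) by (intro sum.neutral) auto
qed

lemma pushv_ge:
  assumes "finite B" "q \<in> prob_vec B" "b \<in> B"
  shows "q b \<le> pushv B f q (f b)"
  unfolding pushv_def using assms prob_vecD(1)[OF assms(2,1)]
  by (intro member_le_sum) auto

lemma pushv_comp:
  assumes "finite B" "finite C" "f ` B \<subseteq> C"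
  shows "pushv C g (pushv B f q) = pushv B (\<lambda>b. g (f b)) q"
proof
  fix d
  have "pushv C g (pushv B f q) d = (\<Sum>c\<in>C. pushv B f q c * (if g c = d then 1 else 0))"
    unfolding pushv_def[of C] using assms(2) by (simp add: sum.inter_filter if_distrib cong: if_cong)
  also have "\<dots> = (\<Sum>b\<in>B. q b * (if g (f b) = d then 1 else 0))" by (rule sum_pushv[OF assms])
  also have "\<dots> = pushv B (\<lambda>b. g (f b)) q d"
    unfolding pushv_def using assms(1) by (simp add: sum.inter_filter if_distrib cong: if_cong)
  finally show "pushv C g (pushv B f q) d = pushv B (\<lambda>b. g (f b)) q d" .
qed

lemma pushv_id:
  assumes "finite B" "q \<in> prob_vec B" "\<And>b. b \<in> B \<Longrightarrow> f b = b"
  shows "pushv B f q = q"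
proof
  fix c
  have "{b\<in>B. f b = c} = (if c \<in> B then {c} else {})" using assms(3) by auto
  then show "pushv B f q c = q c" unfolding pushv_def using prob_vecD(4)[OF assms(2,1)] by auto
qed

lemma shannon_pushv_le:
  assumes "finite B" "finite C" "f ` B \<subseteq> C" "q \<in> prob_vec B"
  shows "shannon C (pushv B f q) \<le> shannon B q"
proof -
  have "(\<Sum>b\<in>B. q b * ln (q b)) \<le> (\<Sum>b\<in>B. q b * ln (pushv B f q (f b)))"
  proof (intro sum_mono)
    fix b assume b: "b \<in> B"
    show "q b * ln (q b) \<le> q b * ln (pushv B f q (f b))"
    proof (cases "q b = 0")
      case False
      then have "0 < q b" using prob_vecD(1)[OF assms(4,1), of b] by simp
      then show ?thesis using pushv_ge[OF assms(1,4) b, of f] by (intro mult_left_mono) auto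
    qed simp
  qed
  then show ?thesis unfolding shannon_def using sum_pushv[OF assms(1-3)] by simp
qed

text \<open>Gibbs' inequality inside each fibre of \<open>f\<close>: for a given image
  \<open>q\<close>, the entropy plus the mean of \<open>ln N'\<close> is largest when each
  \<open>q b\<close> is distributed over its fibre proportionally to \<open>N'\<close>, and the
  largest value is the same expression for the image. The difference of the two sides is the
  relative entropy of \<open>q'\<close> with respect to that distribution.\<close>

lemma lumping:
  fixes N' :: "'a \<Rightarrow> real"
  assumes fin: "finite B'" "finite B" "f ` B' \<subseteq> B" and q': "q' \<in> prob_vec B'"
    and N': "\<And>a. a \<in> B' \<Longrightarrow> 0 < N' a" and N: "\<And>b. b \<in> B \<Longrightarrow> N b = pushv B' f N' b"
  defines "q \<equiv> pushv B' f q'"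
  shows "shannon B' q' + (\<Sum>a\<in>B'. q' a * ln (N' a)) \<le> shannon B q + (\<Sum>b\<in>B. q b * ln (N b))"
    and "shannon B' q' + (\<Sum>a\<in>B'. q' a * ln (N' a)) = shannon B q + (\<Sum>b\<in>B. q b * ln (N b))
      \<longleftrightarrow> (\<forall>a\<in>B'. q' a = q (f a) * N' a / N (f a))"
proof -
  define c where "c = (\<lambda>a. q (f a) * N' a / N (f a))"
  have Npos: "0 < N (f a)" if "a \<in> B'" for a
  proof -
    have "N' a \<le> pushv B' f N' (f a)" unfolding pushv_def using fin that N'
      by (intro member_le_sum) (auto intro: less_imp_le)
    then show ?thesis using N'[OF that] N[of "f a"] fin that by auto
  qed
  have q: "q \<in> prob_vec B" unfolding q_def by (rule pushv_prob_vec[OF fin q'])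
  have q0: "0 \<le> q b" for b using prob_vecD(1)[OF q fin(2)] .
  have q'0: "0 \<le> q' b" for b using prob_vecD(1)[OF q' fin(1)] .
  have cs: "sum c B' = 1"
  proof -
    have "sum c B' = (\<Sum>a\<in>B'. N' a * (q (f a) / N (f a)))" by (simp add: c_def mult.commute)
    also have "\<dots> = (\<Sum>b\<in>B. pushv B' f N' b * (q b / N b))" by (rule sum_pushv[symmetric, OF fin])
    also have "\<dots> = (\<Sum>b\<in>B. q b)"
    proof (intro sum.cong refl)
      fix b assume b: "b \<in> B"
      show "pushv B' f N' b * (q b / N b) = q b"
      proof (cases "N b = 0")
        case True
        then have "b \<notin> f ` B'" using Npos by force
        then have "q b = 0" unfolding q_def pushv_def by (intro sum.neutral) auto
        then show ?thesis by simp
      qed (simp add: N[OF b, symmetric])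
    qed
    finally show ?thesis using prob_vecD(3)[OF q fin(2)] by simp
  qed
  \<comment> \<open>\<open>ln (c a)\<close> is written out through its factors, so that the sum
    splits by \<open>sum_pushv\<close> even over letters with \<open>c a = 0\<close>, where
    \<open>q' a\<close> vanishes too.\<close>
  define t where "t = (\<lambda>a. q' a * ln (q' a) - q' a * (ln (q (f a)) + ln (N' a) - ln (N (f a))) - q' a + c a)"
  have t: "0 \<le> t a \<and> (t a = 0 \<longleftrightarrow> q' a = c a)" if a: "a \<in> B'" for a
  proof (cases "q (f a) = 0")
    case True
    then have "q' a = 0" using pushv_ge[OF fin(1) q' a, of f] q'0[of a] by (simp add: q_def)
    then show ?thesis using True by (simp add: t_def c_def)
  next
    case False
    then have p: "0 < q (f a)" using q0[of "f a"] by simp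
    then have cp: "0 < c a" using N'[OF a] Npos[OF a] by (simp add: c_def)
    have "ln (c a) = ln (q (f a)) + ln (N' a) - ln (N (f a))"
      unfolding c_def using p N'[OF a] Npos[OF a] by (simp add: ln_div ln_mult)
    then have "t a = q' a * ln (q' a) - (q' a * ln (c a) + q' a - c a)" unfolding t_def by simp
    then show ?thesis using xlnx_tangent[OF q'0[of a] cp] by auto
  qed
  have "sum t B' = (\<Sum>a\<in>B'. q' a * ln (q' a)) - (\<Sum>a\<in>B'. q' a * ln (q (f a)))
      - (\<Sum>a\<in>B'. q' a * ln (N' a)) + (\<Sum>a\<in>B'. q' a * ln (N (f a))) - sum q' B' + sum c B'"
    unfolding t_def by (simp add: sum.distrib sum_subtractf algebra_simps)
  also have "\<dots> = (shannon B q + (\<Sum>b\<in>B. q b * ln (N b))) - (shannon B' q' + (\<Sum>a\<in>B'. q' a * ln (N' a)))"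
    unfolding shannon_def cs prob_vecD(3)[OF q' fin(1)]
    using sum_pushv[OF fin, of q' "\<lambda>b. ln (q b)"] sum_pushv[OF fin, of q' "\<lambda>b. ln (N b)"]
    by (simp add: q_def)
  finally have st: "sum t B' = (shannon B q + (\<Sum>b\<in>B. q b * ln (N b)))
      - (shannon B' q' + (\<Sum>a\<in>B'. q' a * ln (N' a)))" .
  have "0 \<le> sum t B'" using t by (intro sum_nonneg) auto
  then show "shannon B' q' + (\<Sum>a\<in>B'. q' a * ln (N' a)) \<le> shannon B q + (\<Sum>b\<in>B. q b * ln (N b))"
    using st by simp
  have "sum t B' = 0 \<longleftrightarrow> (\<forall>a\<in>B'. t a = 0)" using t fin by (intro sum_nonneg_eq_0_iff) auto
  also have "\<dots> \<longleftrightarrow> (\<forall>a\<in>B'. q' a = c a)" using t by auto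
  finally have "sum t B' = 0 \<longleftrightarrow> (\<forall>a\<in>B'. q' a = c a)" .
  then show "shannon B' q' + (\<Sum>a\<in>B'. q' a * ln (N' a)) = shannon B q + (\<Sum>b\<in>B. q b * ln (N b))
      \<longleftrightarrow> (\<forall>a\<in>B'. q' a = q (f a) * N' a / N (f a))"
    unfolding c_def using st by auto
qed

lemma prob_vec_midpoint:
  assumes "p \<in> prob_vec B" "q \<in> prob_vec B"
  shows "(\<lambda>b. (p b + q b) / 2) \<in> prob_vec B"
  using assms by (auto simp: prob_vec_def sum.distrib simp flip: sum_divide_distrib)

lemma shannon_midpoint:
  assumes "finite B" "p \<in> prob_vec B" "q \<in> prob_vec B"
  shows "(shannon B p + shannon B q) / 2 + (\<Sum>b\<in>B. (p b - q b)\<^sup>2) / 8 \<le> shannon B (\<lambda>b. (p b + q b) / 2)"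
proof -
  have "(\<Sum>b\<in>B. ((p b + q b) / 2) * ln ((p b + q b) / 2) + (p b - q b)\<^sup>2 / 8)
     \<le> (\<Sum>b\<in>B. (p b * ln (p b) + q b * ln (q b)) / 2)"
    using prob_vecD[OF assms(2,1)] prob_vecD[OF assms(3,1)] by (intro sum_mono xlnx_midpoint) auto
  then have "(\<Sum>b\<in>B. ((p b + q b) / 2) * ln ((p b + q b) / 2)) + (\<Sum>b\<in>B. (p b - q b)\<^sup>2) / 8
     \<le> ((\<Sum>b\<in>B. p b * ln (p b)) + (\<Sum>b\<in>B. q b * ln (q b))) / 2"
    by (simp only: sum.distrib flip: sum_divide_distrib)
  moreover have "(- x + - y) / 2 + d \<le> - z" if "z + d \<le> (x + y) / 2" for x y z d :: real
    using that by (simp add: field_simps)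
  ultimately show ?thesis unfolding shannon_def by blast
qed

lemma pushv_midpoint:
  "pushv B f (\<lambda>b. (p b + q b) / 2) = (\<lambda>c. (pushv B f p c + pushv B f q c) / 2)"
  by (auto simp: pushv_def sum.distrib simp flip: sum_divide_distrib)

text \<open>The ambient function type may have infinitely many coordinates; Tychonoff applies
  because every coordinate outside \<open>B\<close> is confined to the single point 0.\<close>

lemma compact_prob_vec:
  assumes "finite B"
  shows "compact (prob_vec B)"
proof -
  have c: "compact (PiE UNIV (\<lambda>b. if b \<in> B then {0..1::real} else {0}))"
  proof -
    have "compactin (product_topology (\<lambda>_. euclidean) UNIV) (PiE UNIV (\<lambda>b. if b \<in> B then {0..1::real} else {0}))"
      by (subst compactin_PiE) (auto simp: compactin_euclidean_iff)
    then show ?thesis unfolding euclidean_product_topology compactin_euclidean_iff .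
  qed
  have cl: "closed {q :: 'a \<Rightarrow> real. sum q B = 1}"
    by (intro closed_Collect_eq continuous_intros continuous_on_product_coordinates)
  have "prob_vec B = PiE UNIV (\<lambda>b. if b \<in> B then {0..1::real} else {0}) \<inter> {q. sum q B = 1}"
  proof (intro set_eqI iffI)
    fix q assume q: "q \<in> prob_vec B"
    have "q b \<in> (if b \<in> B then {0..1} else {0})" for b
      using prob_vecD(1,2,4)[OF q assms, of b] by simp
    then show "q \<in> PiE UNIV (\<lambda>b. if b \<in> B then {0..1::real} else {0}) \<inter> {q. sum q B = 1}"
      using prob_vecD(3)[OF q assms] by blast
  next
    fix q assume q: "q \<in> PiE UNIV (\<lambda>b. if b \<in> B then {0..1::real} else {0}) \<inter> {q. sum q B = 1}"
    then have "q b \<in> (if b \<in> B then {0..1} else {0})" for b by blast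
    then have "\<forall>b\<in>B. 0 \<le> q b" "\<forall>b. b \<notin> B \<longrightarrow> q b = 0"
      by (metis atLeastAtMost_iff, metis singletonD)
    then show "q \<in> prob_vec B" using q by (simp add: prob_vec_def)
  qed
  then show ?thesis using c cl by (simp add: compact_Int_closed)
qed

lemma continuous_on_shannon_pushv:
  assumes "finite B" "finite C"
  shows "continuous_on (prob_vec B) (\<lambda>q. shannon C (pushv B f q))"
proof -
  have *: "continuous_on (prob_vec B) (\<lambda>q. (\<lambda>x. x * ln x) (pushv B f q c))" for c
  proof (rule continuous_on_compose2[OF continuous_on_xlnx])
    show cont: "continuous_on (prob_vec B) (\<lambda>q. pushv B f q c)"
    proof -
      have "continuous_on (prob_vec B) (\<lambda>q. q b)" for b
        by (rule continuous_on_subset[OF continuous_on_product_coordinates subset_UNIV])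
      then show ?thesis
        unfolding pushv_def by (rule continuous_on_sum)
    qed
    show "(\<lambda>q. pushv B f q c) ` prob_vec B \<subseteq> {0..}"
      using prob_vecD(1)[OF _ assms(1)] by (auto simp: pushv_def sum_nonneg)
  qed
  show ?thesis unfolding shannon_def
    by (intro continuous_intros *)
qed

section \<open>Maximization of a linear term plus entropies over probability vectors\<close>

locale pressure_opt =
  fixes B :: "'a set" and l :: "'a \<Rightarrow> real" and g :: real and J :: "'i set"
    and gam :: "'i \<Rightarrow> real" and C :: "'i \<Rightarrow> 'b set" and f :: "'i \<Rightarrow> 'a \<Rightarrow> 'b"
  assumes finB: "finite B" and B_ne: "B \<noteq> {}" and g_pos: "0 < g" and finJ: "finite J"
    and gam_nonneg: "\<And>j. j \<in> J \<Longrightarrow> 0 \<le> gam j" and finC: "\<And>j. j \<in> J \<Longrightarrow> finite (C j)"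
    and fC: "\<And>j. j \<in> J \<Longrightarrow> f j ` B \<subseteq> C j"
begin

definition obj :: "real \<Rightarrow> ('a \<Rightarrow> real) \<Rightarrow> real" where
  "obj \<theta> q = \<theta> * (\<Sum>b\<in>B. q b * l b) + g * shannon B q + (\<Sum>j\<in>J. gam j * shannon (C j) (pushv B (f j) q))"

text \<open>\<open>pushv\<close> is linear, so the image entropies are concave with a non-negative
  gain of their own, which is dropped; the term \<open>g * shannon B q\<close> with
  \<open>0 < g\<close> supplies the quadratic gain.\<close>

lemma obj_midpoint:
  assumes p: "p \<in> prob_vec B" and q: "q \<in> prob_vec B"
  shows "(obj \<theta> p + obj \<theta> q) / 2 + g * (\<Sum>b\<in>B. (p b - q b)\<^sup>2) / 8 \<le> obj \<theta> (\<lambda>b. (p b + q b) / 2)"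
proof -
  have 1: "g * ((shannon B p + shannon B q) / 2 + (\<Sum>b\<in>B. (p b - q b)\<^sup>2) / 8) \<le> g * shannon B (\<lambda>b. (p b + q b) / 2)"
    using shannon_midpoint[OF finB p q] g_pos by (intro mult_left_mono) auto
  have "(\<Sum>j\<in>J. gam j * ((shannon (C j) (pushv B (f j) p) + shannon (C j) (pushv B (f j) q)) / 2))
    \<le> (\<Sum>j\<in>J. gam j * shannon (C j) (pushv B (f j) (\<lambda>b. (p b + q b) / 2)))"
  proof (intro sum_mono mult_left_mono gam_nonneg)
    fix j assume j: "j \<in> J"
    have "0 \<le> (\<Sum>b\<in>C j. (pushv B (f j) p b - pushv B (f j) q b)\<^sup>2)" by (intro sum_nonneg) auto
    then show "(shannon (C j) (pushv B (f j) p) + shannon (C j) (pushv B (f j) q)) / 2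
        \<le> shannon (C j) (pushv B (f j) (\<lambda>b. (p b + q b) / 2))"
      unfolding pushv_midpoint
      using shannon_midpoint[OF finC[OF j] pushv_prob_vec[OF finB finC[OF j] fC[OF j] p]
          pushv_prob_vec[OF finB finC[OF j] fC[OF j] q]] by linarith
  qed
  then have 2: "((\<Sum>j\<in>J. gam j * shannon (C j) (pushv B (f j) p)) + (\<Sum>j\<in>J. gam j * shannon (C j) (pushv B (f j) q))) / 2
     \<le> (\<Sum>j\<in>J. gam j * shannon (C j) (pushv B (f j) (\<lambda>b. (p b + q b) / 2)))"
    by (simp add: sum.distrib distrib_left flip: sum_divide_distrib)
  have 3: "\<theta> * (\<Sum>b\<in>B. (p b + q b) / 2 * l b) = (\<theta> * (\<Sum>b\<in>B. p b * l b) + \<theta> * (\<Sum>b\<in>B. q b * l b)) / 2"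
    by (simp add: sum.distrib distrib_left distrib_right add_divide_distrib flip: sum_divide_distrib)
  show ?thesis unfolding obj_def 3 using 1 2 by (simp add: field_simps)
qed

lemma obj_attained: "\<exists>q\<in>prob_vec B. \<forall>p\<in>prob_vec B. obj \<theta> p \<le> obj \<theta> q"
proof (rule continuous_attains_sup)
  show "compact (prob_vec B)" by (rule compact_prob_vec[OF finB])
  obtain b where b: "b \<in> B" using B_ne by auto
  then have "(\<lambda>x. if x = b then 1 else 0) \<in> prob_vec B" using finB by (auto simp: prob_vec_def)
  then show "prob_vec B \<noteq> {}" by auto
  have "continuous_on (prob_vec B) (\<lambda>q. shannon B (pushv B (\<lambda>x. x) q))"
    by (rule continuous_on_shannon_pushv[OF finB finB])
  then have "continuous_on (prob_vec B) (shannon B)"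
    by (rule continuous_on_eq) (simp add: pushv_id[OF finB])
  then show "continuous_on (prob_vec B) (obj \<theta>)"
    unfolding obj_def
    by (intro continuous_intros continuous_on_subset[OF continuous_on_product_coordinates]
        continuous_on_shannon_pushv finB finC) auto
qed

definition qmax :: "real \<Rightarrow> 'a \<Rightarrow> real" where
  "qmax \<theta> = (SOME q. q \<in> prob_vec B \<and> (\<forall>p\<in>prob_vec B. obj \<theta> p \<le> obj \<theta> q))"

lemma qmax: "qmax \<theta> \<in> prob_vec B" "p \<in> prob_vec B \<Longrightarrow> obj \<theta> p \<le> obj \<theta> (qmax \<theta>)"
  using someI_ex[of "\<lambda>q. q \<in> prob_vec B \<and> (\<forall>p\<in>prob_vec B. obj \<theta> p \<le> obj \<theta> q)"] obj_attained[of \<theta>]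
  unfolding qmax_def[symmetric] by blast+

text \<open>The midpoint of \<open>p\<close> and the maximizer does not beat the maximizer; solving
  for the value at \<open>p\<close> doubles the constant g/8 of \<open>obj_midpoint\<close>.\<close>

lemma obj_gap:
  assumes "p \<in> prob_vec B"
  shows "obj \<theta> p + g * (\<Sum>b\<in>B. (p b - qmax \<theta> b)\<^sup>2) / 4 \<le> obj \<theta> (qmax \<theta>)"
  using obj_midpoint[OF assms qmax(1), of \<theta> \<theta>] qmax(2)[OF prob_vec_midpoint[OF assms qmax(1)[of \<theta>]], of \<theta>]
  by (simp add: add_divide_distrib)

lemma qmax_unique:
  assumes "p \<in> prob_vec B" "obj \<theta> p = obj \<theta> (qmax \<theta>)"
  shows "p = qmax \<theta>"
proof
  fix b
  have "g * (\<Sum>b\<in>B. (p b - qmax \<theta> b)\<^sup>2) / 4 \<le> 0" using obj_gap[OF assms(1), of \<theta>] assms(2) by simp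
  then have "(\<Sum>b\<in>B. (p b - qmax \<theta> b)\<^sup>2) \<le> 0" using g_pos by (simp add: mult_le_0_iff)
  moreover have "0 \<le> (\<Sum>b\<in>B. (p b - qmax \<theta> b)\<^sup>2)" by (intro sum_nonneg) auto
  ultimately have "(\<Sum>b\<in>B. (p b - qmax \<theta> b)\<^sup>2) = 0" by simp
  then have "\<forall>b\<in>B. (p b - qmax \<theta> b)\<^sup>2 = 0" using finB by (subst (asm) sum_nonneg_eq_0_iff) auto
  then show "p b = qmax \<theta> b"
    using prob_vecD(4)[OF assms(1) finB, of b] prob_vecD(4)[OF qmax(1)[of \<theta>] finB, of b] by (cases "b \<in> B") auto
qed

definition lin :: "real \<Rightarrow> real" where "lin \<theta> = (\<Sum>b\<in>B. qmax \<theta> b * l b)"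

lemma obj_shift: "obj \<theta>' q = obj \<theta> q + (\<theta>' - \<theta>) * (\<Sum>b\<in>B. q b * l b)"
  by (simp add: obj_def algebra_simps)

text \<open>The gap inequalities at \<open>\<theta>\<close> and \<open>\<theta>'\<close>, each
  tested with the other maximizer, are added: the entropies cancel, and the squared distance of the
  maximizers is at most a multiple of
  \<open>(\<theta> - \<theta>') * (lin \<theta> - lin \<theta>')\<close>. Cauchy-Schwarz bounds the
  square of the second factor by a multiple of the same squared distance.\<close>

lemma lin_lipschitz: "\<bar>lin \<theta> - lin \<theta>'\<bar> \<le> 2 * (\<Sum>b\<in>B. (l b)\<^sup>2) / g * \<bar>\<theta> - \<theta>'\<bar>"
proof -
  define d where "d = (\<Sum>b\<in>B. (qmax \<theta> b - qmax \<theta>' b)\<^sup>2)"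
  define K where "K = (\<Sum>b\<in>B. (l b)\<^sup>2)"
  define x where "x = \<bar>lin \<theta> - lin \<theta>'\<bar>"
  have d': "(\<Sum>b\<in>B. (qmax \<theta>' b - qmax \<theta> b)\<^sup>2) = d" unfolding d_def by (simp add: power2_commute)
  have "obj \<theta> (qmax \<theta>') + g * d / 4 \<le> obj \<theta> (qmax \<theta>)" using obj_gap[OF qmax(1)[of \<theta>'], of \<theta>] d' by simp
  moreover have "obj \<theta>' (qmax \<theta>) + g * d / 4 \<le> obj \<theta>' (qmax \<theta>')" using obj_gap[OF qmax(1)[of \<theta>], of \<theta>'] d_def by simp
  ultimately have "g * d / 2 \<le> (\<theta> - \<theta>') * (lin \<theta> - lin \<theta>')"
    using obj_shift[of \<theta>' "qmax \<theta>" \<theta>] obj_shift[of \<theta>' "qmax \<theta>'" \<theta>]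
    unfolding lin_def by (simp add: algebra_simps)
  also have "\<dots> \<le> \<bar>\<theta> - \<theta>'\<bar> * x" unfolding x_def using abs_ge_self[of "(\<theta> - \<theta>') * (lin \<theta> - lin \<theta>')"] by (simp add: abs_mult)
  finally have 1: "d \<le> 2 / g * \<bar>\<theta> - \<theta>'\<bar> * x" using g_pos by (simp add: field_simps)
  have "x\<^sup>2 = (\<Sum>b\<in>B. (qmax \<theta> b - qmax \<theta>' b) * l b)\<^sup>2"
    unfolding x_def lin_def by (simp add: left_diff_distrib sum_subtractf)
  also have "\<dots> \<le> d * K" unfolding d_def K_def by (rule Cauchy_Schwarz_ineq_sum)
  finally have 2: "x\<^sup>2 \<le> d * K" .
  have K: "0 \<le> K" unfolding K_def by (intro sum_nonneg) auto
  have "x\<^sup>2 \<le> (2 / g * \<bar>\<theta> - \<theta>'\<bar> * x) * K" using 1 2 K mult_right_mono order_trans by blast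
  then have "x * x \<le> (2 * K / g * \<bar>\<theta> - \<theta>'\<bar>) * x" by (simp add: power2_eq_square algebra_simps)
  then show ?thesis unfolding x_def[symmetric] K_def[symmetric]
  proof (cases "x = 0")
    case False
    then have "0 < x" by (simp add: x_def)
    then show "x \<le> 2 * K / g * \<bar>\<theta> - \<theta>'\<bar>"
      using \<open>x * x \<le> (2 * K / g * \<bar>\<theta> - \<theta>'\<bar>) * x\<close> mult_right_le_imp_le by blast
  qed (use K g_pos in auto)
qed

lemma continuous_on_lin: "continuous_on UNIV lin"
proof (rule lipschitz_on_continuous_on)
  show "(2 * (\<Sum>b\<in>B. (l b)\<^sup>2) / g)-lipschitz_on UNIV lin"
    using lin_lipschitz g_pos by (intro lipschitz_onI) (auto simp: dist_real_def sum_nonneg)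
qed

text \<open>Envelope argument: the maximizer at one parameter is a competitor at the other, which
  traps the error of the linear approximation between 0 and
  \<open>h * (lin (\<theta> + h) - lin \<theta>)\<close>, of order h^2 by the Lipschitz
  bound.\<close>

lemma has_derivative_obj_qmax: "((\<lambda>\<theta>. obj \<theta> (qmax \<theta>)) has_real_derivative lin \<theta>) (at \<theta>)"
proof -
  define P where "P = (\<lambda>\<theta>. obj \<theta> (qmax \<theta>))"
  define c where "c = 2 * (\<Sum>b\<in>B. (l b)\<^sup>2) / g"
  have b: "\<bar>(P (\<theta> + h) - P \<theta>) / h - lin \<theta>\<bar> \<le> c * \<bar>h\<bar>" if "h \<noteq> 0" for h
  proof -
    define e where "e = P (\<theta> + h) - P \<theta> - h * lin \<theta>"
    have "0 \<le> e"
      using qmax(2)[OF qmax(1)[of \<theta>], of "\<theta> + h"] obj_shift[of "\<theta> + h" "qmax \<theta>" \<theta>]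
      unfolding e_def P_def lin_def by simp
    moreover have "e \<le> h * (lin (\<theta> + h) - lin \<theta>)"
      using qmax(2)[OF qmax(1)[of "\<theta> + h"], of \<theta>] obj_shift[of "\<theta> + h" "qmax (\<theta> + h)" \<theta>]
      unfolding e_def P_def lin_def by (simp add: algebra_simps)
    moreover have "h * (lin (\<theta> + h) - lin \<theta>) \<le> \<bar>h\<bar> * (c * \<bar>h\<bar>)"
    proof -
      have "h * (lin (\<theta> + h) - lin \<theta>) \<le> \<bar>h\<bar> * \<bar>lin (\<theta> + h) - lin \<theta>\<bar>"
        using abs_ge_self[of "h * (lin (\<theta> + h) - lin \<theta>)"] by (simp add: abs_mult)
      also have "\<dots> \<le> \<bar>h\<bar> * (c * \<bar>h\<bar>)"
        using lin_lipschitz[of "\<theta> + h" \<theta>] by (intro mult_left_mono) (auto simp: c_def)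
      finally show ?thesis .
    qed
    ultimately have "\<bar>e\<bar> \<le> \<bar>h\<bar> * (c * \<bar>h\<bar>)" by simp
    then have "\<bar>e\<bar> / \<bar>h\<bar> \<le> c * \<bar>h\<bar>" using that by (simp add: field_simps)
    moreover have "(P (\<theta> + h) - P \<theta>) / h - lin \<theta> = e / h" using that by (simp add: e_def field_simps)
    ultimately show ?thesis by simp
  qed
  have "((\<lambda>h. (P (\<theta> + h) - P \<theta>) / h - lin \<theta>) \<longlongrightarrow> 0) (at 0)"
  proof (rule Lim_null_comparison)
    show "\<forall>\<^sub>F h in at 0. norm ((P (\<theta> + h) - P \<theta>) / h - lin \<theta>) \<le> c * \<bar>h\<bar>"
      unfolding eventually_at using b by (intro exI[of _ 1]) auto
    have "((\<lambda>h. c * \<bar>h\<bar>) \<longlongrightarrow> c * \<bar>0\<bar>) (at 0)" by (intro tendsto_intros)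
    then show "((\<lambda>h. c * \<bar>h\<bar>) \<longlongrightarrow> 0) (at 0)" by simp
  qed
  then have "((\<lambda>h. (P (\<theta> + h) - P \<theta>) / h) \<longlongrightarrow> lin \<theta>) (at 0)"
    by (simp add: LIM_zero_iff)
  then show ?thesis unfolding DERIV_def P_def .
qed

end

section \<open>Convergence of non-negative martingales\<close>

lemma (in prob_space) integrable_bounded_mult:
  fixes H y :: "'a \<Rightarrow> real"
  assumes [measurable]: "H \<in> borel_measurable M" and "integrable M y" and "\<And>x. \<bar>H x\<bar> \<le> B"
  shows "integrable M (\<lambda>x. H x * y x)"
proof (rule Bochner_Integration.integrable_bound)
  show "integrable M (\<lambda>x. B * y x)" using assms by simp
  show "(\<lambda>x. H x * y x) \<in> borel_measurable M" using assms by measurable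
  show "AE x in M. norm (H x * y x) \<le> norm (B * y x)"
  proof (rule AE_I2)
    fix x
    have "\<bar>H x\<bar> * \<bar>y x\<bar> \<le> B * \<bar>y x\<bar>" using assms(3) by (intro mult_right_mono) auto
    also have "\<dots> \<le> \<bar>B\<bar> * \<bar>y x\<bar>" by (intro mult_right_mono) auto
    finally show "norm (H x * y x) \<le> norm (B * y x)" by (simp add: abs_mult)
  qed
qed

text \<open>The equality on the sets of \<open>F\<close> says that \<open>y\<close> is a version of
  the conditional expectation of \<open>y'\<close>; bounded \<open>F\<close>-measurable factors can
  then be pulled out.\<close>

lemma (in prob_space) integral_mult_martingale:
  fixes H y y' :: "'a \<Rightarrow> real"
  assumes sub: "subalgebra M F" and y: "y \<in> borel_measurable F" and int: "integrable M y" "integrable M y'"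
    and eq: "\<And>A. A \<in> sets F \<Longrightarrow> (\<integral>\<omega>\<in>A. y' \<omega> \<partial>M) = (\<integral>\<omega>\<in>A. y \<omega> \<partial>M)"
    and H: "H \<in> borel_measurable F" "\<And>x. \<bar>H x\<bar> \<le> B"
  shows "(\<integral>\<omega>. H \<omega> * y' \<omega> \<partial>M) = (\<integral>\<omega>. H \<omega> * y \<omega> \<partial>M)"
proof -
  interpret finite_measure_subalgebra M F by standard (fact sub)
  have HM[measurable]: "H \<in> borel_measurable M" by (rule measurable_from_subalg[OF sub H(1)])
  have [measurable]: "y \<in> borel_measurable M" "y' \<in> borel_measurable M" using int by auto
  have "AE x in M. real_cond_exp M F y' x = y x"
    by (rule real_cond_exp_charact[OF eq int(2,1) y])
  then have "(\<integral>\<omega>. H \<omega> * y \<omega> \<partial>M) = (\<integral>\<omega>. H \<omega> * real_cond_exp M F y' \<omega> \<partial>M)"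
    by (intro integral_cong_AE) auto
  also have "\<dots> = (\<integral>\<omega>. H \<omega> * y' \<omega> \<partial>M)"
    using H(1) by (intro real_cond_exp_intg integrable_bounded_mult[OF HM int(2) H(2)]) auto
  finally show ?thesis by simp
qed

text \<open>The bounded submartingale \<open>exp (- Y n)\<close> is Cauchy in \<open>L\<^sup>2\<close>, and stopping it when it first
  moves by more than \<open>\<epsilon>\<close> gives a maximal inequality.\<close>

theorem (in prob_space) nonneg_martingale_convergent:
  fixes Y :: "nat \<Rightarrow> 'a \<Rightarrow> real"
  assumes sub: "\<And>n. subalgebra M (F n)" and Y: "\<And>i n. i \<le> n \<Longrightarrow> Y i \<in> borel_measurable (F n)"
    and int: "\<And>n. integrable M (Y n)" and nonneg: "\<And>n \<omega>. 0 \<le> Y n \<omega>"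
    and eq: "\<And>n A. A \<in> sets (F n) \<Longrightarrow> (\<integral>\<omega>\<in>A. Y (Suc n) \<omega> \<partial>M) = (\<integral>\<omega>\<in>A. Y n \<omega> \<partial>M)"
  shows "AE \<omega> in M. convergent (\<lambda>n. Y n \<omega>)"
proof -
  define Z where "Z = (\<lambda>n \<omega>. exp (- Y n \<omega>))"
  have Z0: "0 \<le> Z n \<omega>" "Z n \<omega> \<le> 1" "0 < Z n \<omega>" for n \<omega> using nonneg by (auto simp: Z_def)
  have ZF: "Z i \<in> borel_measurable (F n)" if "i \<le> n" for i n
    unfolding Z_def using Y[OF that] by measurable
  have fromF: "h \<in> borel_measurable (F n) \<Longrightarrow> h \<in> borel_measurable M" for h :: "'a \<Rightarrow> real" and n
    by (rule measurable_from_subalg[OF sub])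
  have ZM[measurable]: "Z n \<in> borel_measurable M" for n by (rule fromF[OF ZF[OF order_refl]])
  have bint: "integrable M h" if "h \<in> borel_measurable M" "\<And>\<omega>. \<bar>h \<omega>\<bar> \<le> 1" for h :: "'a \<Rightarrow> real"
    using that by (intro integrable_const_bound[of _ 1]) auto
  \<comment> \<open>Submartingale property of \<open>Z\<close>, tested against weights
    \<open>H\<close> in [0, 1] known at time \<open>n\<close>: convexity of exp gives Z (n+1) \<ge>
    Z n * (1 - (Y (n+1) - Y n)), and the increment of \<open>Y\<close> integrates to 0 against
    \<open>H * Z n\<close>.\<close>
  have sm: "(\<integral>\<omega>. H \<omega> * Z n \<omega> \<partial>M) \<le> (\<integral>\<omega>. H \<omega> * Z (Suc n) \<omega> \<partial>M)"
    if H: "H \<in> borel_measurable (F n)" "\<And>\<omega>. 0 \<le> H \<omega>" "\<And>\<omega>. H \<omega> \<le> 1" for H n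
  proof -
    note HM[measurable] = fromF[OF H(1)]
    have b: "\<bar>H \<omega> * Z m \<omega>\<bar> \<le> 1" for m \<omega> using H Z0 by (simp add: mult_le_one)
    have i1: "integrable M (\<lambda>\<omega>. H \<omega> * Z m \<omega> * Y k \<omega>)" for m k
      using b by (intro integrable_bounded_mult int) auto
    have i2: "integrable M (\<lambda>\<omega>. H \<omega> * Z m \<omega>)" for m using b by (intro bint) auto
    have e: "(\<integral>\<omega>. H \<omega> * Z n \<omega> * Y (Suc n) \<omega> \<partial>M) = (\<integral>\<omega>. H \<omega> * Z n \<omega> * Y n \<omega> \<partial>M)"
    proof (rule integral_mult_martingale[OF sub[of n] Y[OF order_refl] int int eq])
      show "(\<lambda>\<omega>. H \<omega> * Z n \<omega>) \<in> borel_measurable (F n)"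
        using H(1) ZF[OF order_refl, of n] by measurable
      show "\<bar>H \<omega> * Z n \<omega>\<bar> \<le> 1" for \<omega> by (rule b)
    qed
    have "(\<integral>\<omega>. H \<omega> * Z n \<omega> - (H \<omega> * Z n \<omega> * Y (Suc n) \<omega> - H \<omega> * Z n \<omega> * Y n \<omega>) \<partial>M)
        \<le> (\<integral>\<omega>. H \<omega> * Z (Suc n) \<omega> \<partial>M)"
    proof (intro integral_mono Bochner_Integration.integrable_diff i1 i2)
      fix \<omega>
      have "1 - (Y (Suc n) \<omega> - Y n \<omega>) \<le> exp (- (Y (Suc n) \<omega> - Y n \<omega>))"
        using exp_ge_add_one_self[of "- (Y (Suc n) \<omega> - Y n \<omega>)"] by linarith
      then have "Z n \<omega> * (1 - (Y (Suc n) \<omega> - Y n \<omega>)) \<le> Z n \<omega> * exp (- (Y (Suc n) \<omega> - Y n \<omega>))"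
        using Z0 by (intro mult_left_mono)
      also have "\<dots> = Z (Suc n) \<omega>" by (simp add: Z_def flip: exp_add)
      finally have "H \<omega> * (Z n \<omega> * (1 - (Y (Suc n) \<omega> - Y n \<omega>))) \<le> H \<omega> * Z (Suc n) \<omega>"
        using H by (intro mult_left_mono)
      then show "H \<omega> * Z n \<omega> - (H \<omega> * Z n \<omega> * Y (Suc n) \<omega> - H \<omega> * Z n \<omega> * Y n \<omega>) \<le> H \<omega> * Z (Suc n) \<omega>"
        by (simp add: algebra_simps)
    qed
    then show ?thesis using e i1 i2 by (simp add: Bochner_Integration.integral_diff Bochner_Integration.integrable_diff)
  qed
  have i3: "integrable M (\<lambda>\<omega>. H \<omega> * (Z m \<omega>)\<^sup>2)"
    if [measurable]: "H \<in> borel_measurable M" and "\<And>\<omega>. \<bar>H \<omega>\<bar> \<le> 1" for H m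
    using that Z0 by (intro bint) (auto simp: abs_mult mult_le_one power_le_one)
  \<comment> \<open>The same for squares, from (Z (n+1) - Z n)^2 \<ge> 0 and \<open>sm\<close> with
    the weight \<open>H * Z n\<close>.\<close>
  have sm2: "(\<integral>\<omega>. H \<omega> * (Z n \<omega>)\<^sup>2 \<partial>M) \<le> (\<integral>\<omega>. H \<omega> * (Z (Suc n) \<omega>)\<^sup>2 \<partial>M)"
    if H: "H \<in> borel_measurable (F n)" "\<And>\<omega>. 0 \<le> H \<omega>" "\<And>\<omega>. H \<omega> \<le> 1" for H n
  proof -
    note HM[measurable] = fromF[OF H(1)]
    have b: "\<bar>H \<omega> * Z n \<omega> * Z m \<omega>\<bar> \<le> 1" for m \<omega> using H Z0 by (simp add: mult_le_one)
    have i2: "integrable M (\<lambda>\<omega>. H \<omega> * Z n \<omega> * Z m \<omega>)" for m using b by (intro bint) auto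
    have le: "(\<integral>\<omega>. H \<omega> * Z n \<omega> * Z n \<omega> \<partial>M) \<le> (\<integral>\<omega>. H \<omega> * Z n \<omega> * Z (Suc n) \<omega> \<partial>M)"
      using H ZF[of n n] Z0 by (intro sm) (auto simp: mult_le_one)
    have i4: "integrable M (\<lambda>\<omega>. H \<omega> * (Z m \<omega>)\<^sup>2)" for m using H by (intro i3) auto
    have "(\<integral>\<omega>. H \<omega> * (Z n \<omega>)\<^sup>2 + 2 * (H \<omega> * Z n \<omega> * Z (Suc n) \<omega> - H \<omega> * Z n \<omega> * Z n \<omega>) \<partial>M)
        \<le> (\<integral>\<omega>. H \<omega> * (Z (Suc n) \<omega>)\<^sup>2 \<partial>M)"
    proof (intro integral_mono Bochner_Integration.integrable_add Bochner_Integration.integrable_diff integrable_mult_right i4 i2)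
      fix \<omega>
      have "0 \<le> H \<omega> * (Z (Suc n) \<omega> - Z n \<omega>)\<^sup>2" using H by simp
      then show "H \<omega> * (Z n \<omega>)\<^sup>2 + 2 * (H \<omega> * Z n \<omega> * Z (Suc n) \<omega> - H \<omega> * Z n \<omega> * Z n \<omega>) \<le> H \<omega> * (Z (Suc n) \<omega>)\<^sup>2"
        by (simp add: power2_eq_square algebra_simps)
    qed
    moreover have "(\<integral>\<omega>. H \<omega> * (Z n \<omega>)\<^sup>2 + 2 * (H \<omega> * Z n \<omega> * Z (Suc n) \<omega> - H \<omega> * Z n \<omega> * Z n \<omega>) \<partial>M)
      = (\<integral>\<omega>. H \<omega> * (Z n \<omega>)\<^sup>2 \<partial>M) + 2 * ((\<integral>\<omega>. H \<omega> * Z n \<omega> * Z (Suc n) \<omega> \<partial>M) - (\<integral>\<omega>. H \<omega> * Z n \<omega> * Z n \<omega> \<partial>M))"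
      using i2 i4 by simp
    moreover have "b \<le> a" if "x \<le> a" "x = b + 2 * (c - d)" "d \<le> c" for a b c d x :: real
      using that by (simp add: algebra_simps)
    ultimately show ?thesis using le by blast
  qed
  define s where "s = (\<lambda>n. \<integral>\<omega>. (Z n \<omega>)\<^sup>2 \<partial>M)"
  have s_mono: "s n \<le> s (Suc n)" for n unfolding s_def using sm2[of "\<lambda>_. 1" n] by simp
  have i5: "integrable M (\<lambda>\<omega>. (Z m \<omega>)\<^sup>2)" for m using i3[of "\<lambda>_. 1" m] by simp
  have s_le: "s n \<le> 1" for n
  proof -
    have "s n \<le> (\<integral>\<omega>. 1 \<partial>M)" unfolding s_def using Z0
      by (intro integral_mono i5) (auto simp: power_le_one)
    then show ?thesis by (simp add: prob_space)
  qed
  define D where "D = (\<lambda>\<epsilon> n j. {\<omega>\<in>space M. \<forall>i\<le>j. \<bar>Z (n + i) \<omega> - Z n \<omega>\<bar> \<le> \<epsilon>})"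
  have DM[measurable]: "D \<epsilon> n j \<in> sets M" for \<epsilon> n j unfolding D_def by measurable
  have spF: "space (F n) = space M" for n using sub[of n] by (simp add: subalgebra_def)
  have DF: "D \<epsilon> n j \<in> sets (F (n + j))" for \<epsilon> n j
  proof -
    have [measurable]: "Z n \<in> borel_measurable (F (n + j))" by (rule ZF) simp
    have [measurable]: "(\<lambda>\<omega>. if i \<le> j then Z (n + i) \<omega> else 0) \<in> borel_measurable (F (n + j))" for i
      using ZF[of "n + i" "n + j"] by (cases "i \<le> j") auto
    have "D \<epsilon> n j = {\<omega>\<in>space (F (n + j)). \<forall>i\<le>j. \<bar>(if i \<le> j then Z (n + i) \<omega> else 0) - Z n \<omega>\<bar> \<le> \<epsilon>}"
      unfolding D_def spF by auto
    also have "\<dots> \<in> sets (F (n + j))" by measurable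
    finally show ?thesis .
  qed
  have maximal: "\<epsilon>\<^sup>2 * prob (space M - D \<epsilon> n j) \<le> s (n + j) - s n" if \<epsilon>: "0 < \<epsilon>" for \<epsilon> n j
  proof -
    \<comment> \<open>\<open>V\<close> is \<open>Z\<close> started at time \<open>n\<close> and
      frozen once it has left the band of radius \<open>\<epsilon>\<close> around
      \<open>Z n\<close>; off \<open>D\<close> its distance from \<open>Z n\<close> therefore stays
      above \<open>\<epsilon>\<close>.\<close>
    define V where "V = rec_nat (Z n) (\<lambda>j v \<omega>. v \<omega> + indicator (D \<epsilon> n j) \<omega> * (Z (n + Suc j) \<omega> - Z (n + j) \<omega>))"
    have V0: "V 0 = Z n" and VS: "V (Suc j) \<omega> = V j \<omega> + indicator (D \<epsilon> n j) \<omega> * (Z (n + Suc j) \<omega> - Z (n + j) \<omega>)" for j \<omega>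
      by (simp_all add: V_def)
    have DS: "\<omega> \<in> D \<epsilon> n (Suc j) \<Longrightarrow> \<omega> \<in> D \<epsilon> n j" for j \<omega> by (auto simp: D_def)
    have VD: "\<omega> \<in> D \<epsilon> n j \<Longrightarrow> V j \<omega> = Z (n + j) \<omega>" for j \<omega>
      by (induction j) (auto simp: V0 VS dest: DS)
    have Vn: "\<omega> \<in> space M \<Longrightarrow> \<omega> \<notin> D \<epsilon> n j \<Longrightarrow> \<epsilon> < \<bar>V j \<omega> - Z n \<omega>\<bar>" for j \<omega>
    proof (induction j)
      case 0 then show ?case using \<epsilon> by (auto simp: D_def)
    next
      case (Suc j)
      show ?case
      proof (cases "\<omega> \<in> D \<epsilon> n j")
        case True
        then have "V (Suc j) \<omega> = Z (n + Suc j) \<omega>" using VD[OF True] by (simp add: VS)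
        moreover have "\<epsilon> < \<bar>Z (n + Suc j) \<omega> - Z n \<omega>\<bar>"
          using True Suc.prems by (auto simp: D_def le_Suc_eq)
        ultimately show ?thesis by simp
      qed (use Suc in \<open>auto simp: VS\<close>)
    qed
    have Vb: "0 \<le> V j \<omega> \<and> V j \<omega> \<le> 1" for j \<omega>
    proof (induction j)
      case (Suc j)
      show ?case using Suc Z0 VD[of \<omega> j] by (cases "\<omega> \<in> D \<epsilon> n j") (auto simp: VS)
    qed (simp add: V0 Z0)
    have VM[measurable]: "V j \<in> borel_measurable M" for j
      by (induction j) (auto simp: V0 VS[abs_def])
    have iVZ: "integrable M (\<lambda>\<omega>. V j \<omega> * Z n \<omega>)" for j using Vb Z0
      by (intro bint) (auto simp: abs_mult mult_le_one)
    have iV2: "integrable M (\<lambda>\<omega>. (V j \<omega>)\<^sup>2)" for j using Vb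
      by (intro bint) (auto simp: power_le_one)
    have iD: "integrable M (\<lambda>\<omega>. indicator (D \<epsilon> n j) \<omega> * Z n \<omega> * Z m \<omega>)" for j m
      using Z0 by (intro bint) (auto simp: abs_mult mult_le_one indicator_def)
    have iD2: "integrable M (\<lambda>\<omega>. indicator (D \<epsilon> n j) \<omega> * (Z m \<omega>)\<^sup>2)" for j m
      by (intro i3) (auto simp: indicator_def)
    \<comment> \<open>Stopping preserves the two inequalities needed to expand a square: the mixed
      moment with \<open>Z n\<close> stays above \<open>s n\<close>, and the second moment
      (\<open>E2\<close>) stays below \<open>s (n + j)\<close>. Hence the mean of (V j - Z n)^2 is
      at most \<open>s (n + j) - s n\<close>.\<close>
    have E1: "s n \<le> (\<integral>\<omega>. V j \<omega> * Z n \<omega> \<partial>M)" for j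
    proof (induction j)
      case 0 then show ?case by (simp add: V0 s_def power2_eq_square)
    next
      case (Suc j)
      have le: "(\<integral>\<omega>. indicator (D \<epsilon> n j) \<omega> * Z n \<omega> * Z (n + j) \<omega> \<partial>M) \<le> (\<integral>\<omega>. indicator (D \<epsilon> n j) \<omega> * Z n \<omega> * Z (Suc (n + j)) \<omega> \<partial>M)"
        using DF[of \<epsilon> n j] ZF[of n "n + j"] Z0 by (intro sm) (auto simp: indicator_def)
      have "(\<integral>\<omega>. V (Suc j) \<omega> * Z n \<omega> \<partial>M) = (\<integral>\<omega>. V j \<omega> * Z n \<omega> + (indicator (D \<epsilon> n j) \<omega> * Z n \<omega> * Z (Suc (n + j)) \<omega>
         - indicator (D \<epsilon> n j) \<omega> * Z n \<omega> * Z (n + j) \<omega>) \<partial>M)"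
        by (intro Bochner_Integration.integral_cong refl) (simp add: VS algebra_simps)
      also have "\<dots> = (\<integral>\<omega>. V j \<omega> * Z n \<omega> \<partial>M) + ((\<integral>\<omega>. indicator (D \<epsilon> n j) \<omega> * Z n \<omega> * Z (Suc (n + j)) \<omega> \<partial>M)
         - (\<integral>\<omega>. indicator (D \<epsilon> n j) \<omega> * Z n \<omega> * Z (n + j) \<omega> \<partial>M))"
        using iVZ iD by simp
      finally show ?case using le Suc by linarith
    qed
    have E2: "(\<integral>\<omega>. (V j \<omega>)\<^sup>2 \<partial>M) \<le> s (n + j)" for j
    proof (induction j)
      case 0 then show ?case by (simp add: V0 s_def)
    next
      case (Suc j)
      define H where "H = (\<lambda>\<omega>. 1 - indicator (D \<epsilon> n j) \<omega> :: real)"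
      have le: "(\<integral>\<omega>. H \<omega> * (Z (n + j) \<omega>)\<^sup>2 \<partial>M) \<le> (\<integral>\<omega>. H \<omega> * (Z (Suc (n + j)) \<omega>)\<^sup>2 \<partial>M)"
        unfolding H_def using DF[of \<epsilon> n j] by (intro sm2) (auto simp: indicator_def)
      have H1: "(\<integral>\<omega>. H \<omega> * (Z m \<omega>)\<^sup>2 \<partial>M) = s m - (\<integral>\<omega>. indicator (D \<epsilon> n j) \<omega> * (Z m \<omega>)\<^sup>2 \<partial>M)" for m
        unfolding H_def s_def using i5 iD2 by (simp add: left_diff_distrib)
      have "(\<integral>\<omega>. (V (Suc j) \<omega>)\<^sup>2 \<partial>M) = (\<integral>\<omega>. (V j \<omega>)\<^sup>2 + (indicator (D \<epsilon> n j) \<omega> * (Z (Suc (n + j)) \<omega>)\<^sup>2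
         - indicator (D \<epsilon> n j) \<omega> * (Z (n + j) \<omega>)\<^sup>2) \<partial>M)"
        by (intro Bochner_Integration.integral_cong refl) (auto simp: VS VD split: split_indicator)
      also have "\<dots> = (\<integral>\<omega>. (V j \<omega>)\<^sup>2 \<partial>M) + ((\<integral>\<omega>. indicator (D \<epsilon> n j) \<omega> * (Z (Suc (n + j)) \<omega>)\<^sup>2 \<partial>M)
         - (\<integral>\<omega>. indicator (D \<epsilon> n j) \<omega> * (Z (n + j) \<omega>)\<^sup>2 \<partial>M))"
        using iV2 iD2 by simp
      finally show ?case using le Suc H1[of "n + j"] H1[of "Suc (n + j)"] by simp
    qed
    have i6: "integrable M (\<lambda>\<omega>. (V j \<omega> - Z n \<omega>)\<^sup>2)"
      unfolding power2_diff using iV2 i5 iVZ by (simp add: mult.assoc)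
    have "\<epsilon>\<^sup>2 * prob (space M - D \<epsilon> n j) = (\<integral>\<omega>. indicator (space M - D \<epsilon> n j) \<omega> * \<epsilon>\<^sup>2 \<partial>M)"
      by simp
    also have "\<dots> \<le> (\<integral>\<omega>. (V j \<omega> - Z n \<omega>)\<^sup>2 \<partial>M)"
    proof (intro integral_mono i6)
      fix \<omega> assume "\<omega> \<in> space M"
      show "indicator (space M - D \<epsilon> n j) \<omega> * \<epsilon>\<^sup>2 \<le> (V j \<omega> - Z n \<omega>)\<^sup>2"
      proof (cases "\<omega> \<in> D \<epsilon> n j")
        case False
        then have "\<epsilon> \<le> \<bar>V j \<omega> - Z n \<omega>\<bar>" using Vn \<open>\<omega> \<in> space M\<close> by force
        then have "\<epsilon>\<^sup>2 \<le> \<bar>V j \<omega> - Z n \<omega>\<bar>\<^sup>2" using \<epsilon> by (intro power_mono) auto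
        then show ?thesis using False by (simp add: indicator_def)
      qed simp
    qed (auto intro!: integrable_mult_left integrable_real_indicator simp: emeasure_eq_measure)
    also have "\<dots> = (\<integral>\<omega>. (V j \<omega>)\<^sup>2 \<partial>M) + s n - 2 * (\<integral>\<omega>. V j \<omega> * Z n \<omega> \<partial>M)"
      unfolding power2_diff s_def using iV2 i5 iVZ by (simp add: mult.assoc)
    also have "\<dots> \<le> s (n + j) - s n" using E1[of j] E2[of j] by simp
    finally show ?thesis .
  qed
  have "incseq s" using s_mono by (rule incseq_SucI)
  then have "convergent s" using s_le by (intro Bseq_mono_convergent BseqI'[of _ 1])
    (auto simp: incseq_def s_def abs_le_iff intro: order_trans[of _ 0])
  then obtain s' where s': "s \<longlonglongrightarrow> s'" by (auto simp: convergent_def)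
  have s_le': "s n \<le> s'" for n using incseq_le[OF \<open>incseq s\<close> s'] .
  define bad where "bad = (\<lambda>\<epsilon>. {\<omega>\<in>space M. \<forall>n. \<exists>i. \<epsilon> < \<bar>Z (n + i) \<omega> - Z n \<omega>\<bar>})"
  have badM[measurable]: "bad \<epsilon> \<in> sets M" for \<epsilon> unfolding bad_def by measurable
  have bad0: "prob (bad \<epsilon>) = 0" if \<epsilon>: "0 < \<epsilon>" for \<epsilon>
  proof -
    have le: "\<epsilon>\<^sup>2 * prob (bad \<epsilon>) \<le> s' - s n" for n
    proof -
      have inc: "incseq (\<lambda>j. space M - D \<epsilon> n j)" by (auto simp: incseq_def D_def)
      have "(\<lambda>j. prob (space M - D \<epsilon> n j)) \<longlonglongrightarrow> prob (\<Union>j. space M - D \<epsilon> n j)"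
        by (rule finite_Lim_measure_incseq) (use inc in auto)
      then have "(\<lambda>j. \<epsilon>\<^sup>2 * prob (space M - D \<epsilon> n j)) \<longlonglongrightarrow> \<epsilon>\<^sup>2 * prob (\<Union>j. space M - D \<epsilon> n j)"
        by (intro tendsto_intros)
      moreover have "\<epsilon>\<^sup>2 * prob (space M - D \<epsilon> n j) \<le> s' - s n" for j
        using maximal[OF \<epsilon>, of n j] s_le'[of "n + j"] by simp
      ultimately have "\<epsilon>\<^sup>2 * prob (\<Union>j. space M - D \<epsilon> n j) \<le> s' - s n"
        by (intro LIMSEQ_le_const2) auto
      moreover have "prob (bad \<epsilon>) \<le> prob (\<Union>j. space M - D \<epsilon> n j)"
      proof (intro finite_measure_mono subsetI)
        fix \<omega> assume \<omega>: "\<omega> \<in> bad \<epsilon>"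
        then obtain i where "\<epsilon> < \<bar>Z (n + i) \<omega> - Z n \<omega>\<bar>" by (auto simp: bad_def)
        then have "\<omega> \<in> space M - D \<epsilon> n i" using \<omega> by (auto simp: bad_def D_def not_le)
        then show "\<omega> \<in> (\<Union>j. space M - D \<epsilon> n j)" by blast
      qed auto
      ultimately show ?thesis
        by (meson mult_left_mono order_trans zero_le_power2)
    qed
    have "(\<lambda>n. s' - s n) \<longlonglongrightarrow> s' - s'" by (intro tendsto_intros s')
    then have "\<epsilon>\<^sup>2 * prob (bad \<epsilon>) \<le> s' - s'" using le by (intro LIMSEQ_le_const) auto
    then show ?thesis using \<epsilon> by (simp add: mult_le_0_iff measure_le_0_iff)
  qed
  have "AE \<omega> in M. \<forall>k. \<omega> \<notin> bad (1 / real (Suc k))"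
    unfolding AE_all_countable
  proof
    fix k show "AE \<omega> in M. \<omega> \<notin> bad (1 / real (Suc k))"
      using bad0[of "1 / real (Suc k)"] by (intro AE_not_in) (auto simp: null_sets_def emeasure_eq_measure)
  qed
  \<comment> \<open>Convergence of exp (- Y) to 0 would mean that \<open>Y\<close> tends to
    infinity. Fatou's lemma with the constant mean of \<open>Y\<close> excludes this almost
    surely.\<close>
  moreover have "AE \<omega> in M. liminf (\<lambda>n. ennreal (Y n \<omega>)) \<noteq> \<infinity>"
  proof (rule nn_integral_PInf_AE)
    have [measurable]: "Y n \<in> borel_measurable M" for n using int[of n] by auto
    show "(\<lambda>\<omega>. liminf (\<lambda>n. ennreal (Y n \<omega>))) \<in> borel_measurable M" by measurable
    have const: "(\<integral>\<^sup>+\<omega>. ennreal (Y n \<omega>) \<partial>M) = ennreal (\<integral>\<omega>. Y 0 \<omega> \<partial>M)" for n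
    proof -
      have "(\<integral>\<omega>. Y n \<omega> \<partial>M) = (\<integral>\<omega>. Y 0 \<omega> \<partial>M)"
      proof (induction n)
        case (Suc n)
        have "space M \<in> sets (F n)" using sets.top[of "F n"] spF by simp
        from eq[OF this] show ?case using Suc int
          by (simp add: set_integral_space)
      qed simp
      then show ?thesis using int nonneg by (subst nn_integral_eq_integral) auto
    qed
    have "(\<integral>\<^sup>+\<omega>. liminf (\<lambda>n. ennreal (Y n \<omega>)) \<partial>M) \<le> liminf (\<lambda>n. \<integral>\<^sup>+\<omega>. ennreal (Y n \<omega>) \<partial>M)"
      by (rule nn_integral_liminf) simp
    also have "\<dots> = ennreal (\<integral>\<omega>. Y 0 \<omega> \<partial>M)" unfolding const by (simp add: Liminf_const)
    finally show "(\<integral>\<^sup>+\<omega>. liminf (\<lambda>n. ennreal (Y n \<omega>)) \<partial>M) \<noteq> \<infinity>"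
      by (auto simp: top_unique)
  qed
  ultimately show ?thesis using AE_space
  proof eventually_elim
    case (elim \<omega>)
    have "Cauchy (\<lambda>n. Z n \<omega>)"
    proof (rule metric_CauchyI)
      fix e :: real assume "0 < e"
      then obtain k where k: "1 / real (Suc k) < e / 2" using nat_approx_posE[of "e / 2"] by (auto simp: field_simps)
      obtain n where n: "\<And>i. \<bar>Z (n + i) \<omega> - Z n \<omega>\<bar> \<le> 1 / real (Suc k)"
        using elim unfolding bad_def by (auto simp: not_less)
      have "\<bar>Z m \<omega> - Z n \<omega>\<bar> < e / 2" if "n \<le> m" for m using n[of "m - n"] that k by simp
      then show "\<exists>n. \<forall>m\<ge>n. \<forall>m'\<ge>n. dist (Z m \<omega>) (Z m' \<omega>) < e"
        unfolding dist_real_def by (intro exI[of _ n]) (smt (verit) field_sum_of_halves)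
    qed
    then obtain z where z: "(\<lambda>n. Z n \<omega>) \<longlonglongrightarrow> z" by (auto simp: Cauchy_convergent_iff convergent_def)
    have "z \<noteq> 0"
    proof
      assume "z = 0"
      have "filterlim (\<lambda>n. Y n \<omega>) at_top sequentially"
      proof -
        have "filterlim (\<lambda>n. Z n \<omega>) (at_right 0) sequentially"
          using z Z0 unfolding \<open>z = 0\<close> filterlim_at by (auto simp: less_imp_neq[symmetric])
        then have "filterlim (\<lambda>n. ln (Z n \<omega>)) at_bot sequentially"
          by (rule filterlim_compose[OF ln_at_0])
        then have "filterlim (\<lambda>n. - Y n \<omega>) at_bot sequentially" by (simp add: Z_def)
        then show ?thesis by (simp add: filterlim_uminus_at_top)
      qed
      then have "((\<lambda>n. ennreal (Y n \<omega>)) \<longlongrightarrow> \<infinity>) sequentially"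
        by (simp add: ennreal_tendsto_top_eq_at_top)
      then have "liminf (\<lambda>n. ennreal (Y n \<omega>)) = \<infinity>" by (intro lim_imp_Liminf) auto
      then show False using elim by simp
    qed
    then have "(\<lambda>n. - ln (Z n \<omega>)) \<longlonglongrightarrow> - ln z"
      by (intro tendsto_intros z)
    then show ?case by (auto simp: Z_def convergent_def)
  qed
qed

section \<open>Measures on the full shift given by their cylinder masses\<close>

lemma sstart_eq_stake:
  "w \<in> lists A \<Longrightarrow> sstart A w = {x \<in> streams A. stake (length w) x = w}"
proof (induction w)
  case (Cons a w)
  show ?case
  proof (intro set_eqI)
    fix x
    have "x \<in> streams A \<longleftrightarrow> shd x \<in> A \<and> stl x \<in> streams A"
      by (metis streams_shd streams_stl streams_Stream stream.collapse)
    then show "x \<in> sstart A (a # w) \<longleftrightarrow> x \<in> {x \<in> streams A. stake (length (a # w)) x = a # w}"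
      using Cons by auto
  qed
qed simp

lemma sstart_sets_full_shift:
  assumes "finite A" "w \<in> lists A"
  shows "sstart A w \<in> sets (full_shift A)"
proof -
  have "sstart A ` lists A \<union> {{}} \<subseteq> Pow (streams A)" using sstart_in_streams[of _ A] by blast
  then show ?thesis using assms sets_stream_space_sstart[of A]
    by (auto simp: countable_finite intro: in_measure_of)
qed

lemma stake_lists: "x \<in> streams A \<Longrightarrow> stake n x \<in> lists A"
  by (induction n arbitrary: x) (auto dest: streams_shd streams_stl)

lemma stream_measure_eqI:
  assumes A: "finite A" and sets: "sets \<mu> = sets (full_shift A)" "sets \<nu> = sets (full_shift A)"
    and eq: "\<And>w. w \<in> lists A \<Longrightarrow> emeasure \<mu> (sstart A w) = emeasure \<nu> (sstart A w)"
    and fin: "emeasure \<mu> (streams A) \<noteq> \<infinity>"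
  shows "\<mu> = \<nu>"
proof (rule measure_eqI_generator_eq[where E="sstart A ` lists A \<union> {{}}" and A="\<lambda>_::nat. streams A" and \<Omega>="streams A"])
  show E: "sstart A ` lists A \<union> {{}} \<subseteq> Pow (streams A)" using sstart_in_streams[of _ A] by blast
  show "Int_stable (sstart A ` lists A \<union> {{}})" by (rule Int_stable_sstart)
  show "emeasure \<mu> X = emeasure \<nu> X" if "X \<in> sstart A ` lists A \<union> {{}}" for X
    using that eq by auto
  show "sets \<mu> = sigma_sets (streams A) (sstart A ` lists A \<union> {{}})"
    "sets \<nu> = sigma_sets (streams A) (sstart A ` lists A \<union> {{}})"
    unfolding sets using sets_stream_space_sstart[of A] A E by (simp_all add: countable_finite)
  have "sstart A [] \<in> sstart A ` lists A" by (intro imageI) simp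
  then show "range (\<lambda>_::nat. streams A) \<subseteq> sstart A ` lists A \<union> {{}}" by simp
qed (use fin in auto)

text \<open>An independent letter with law \<open>q w\<close> is attached to every word
  \<open>w\<close>; the stream that follows these choices from the empty word has the prescribed
  conditional masses, and scaling by \<open>m []\<close> restores the total. The extension problem
  is thereby reduced to a product measure.\<close>

lemma stream_measure_exists:
  fixes m :: "'a list \<Rightarrow> real"
  assumes A: "finite A" "A \<noteq> {}"
    and nonneg: "\<And>w. w \<in> lists A \<Longrightarrow> 0 \<le> m w"
    and cons: "\<And>w. w \<in> lists A \<Longrightarrow> m w = (\<Sum>a\<in>A. m (w @ [a]))"
  shows "\<exists>\<nu>. sets \<nu> = sets (full_shift A) \<and> (\<forall>w\<in>lists A. emeasure \<nu> (sstart A w) = ennreal (m w))"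
proof -
  obtain a0 where a0: "a0 \<in> A" using A by auto
  \<comment> \<open>Words of mass 0 get the point mass at \<open>a0\<close>, so that every
    \<open>q w\<close> is a probability vector; the extensions of such a word all have mass
    0.\<close>
  define q where "q = (\<lambda>w a. if w \<in> lists A \<and> 0 < m w then m (w @ [a]) / m w else if a = a0 then 1 else 0)"
  have q0: "0 \<le> q w a" if "a \<in> A" for w a
    using that nonneg[of "w @ [a]"] by (auto simp: q_def)
  have q1: "(\<Sum>a\<in>A. q w a) = 1" for w
  proof (cases "w \<in> lists A \<and> 0 < m w")
    case True
    then show ?thesis using cons[of w] by (simp add: q_def flip: sum_divide_distrib)
  next
    case False
    then have "(\<Sum>a\<in>A. q w a) = (\<Sum>a\<in>A. if a = a0 then 1 else 0)" by (intro sum.cong) (auto simp: q_def)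
    then show ?thesis using A a0 by simp
  qed
  have mq: "m (w @ [a]) = m w * q w a" if w: "w \<in> lists A" and a: "a \<in> A" for w a
  proof (cases "0 < m w")
    case False
    then have "m w = 0" using nonneg[OF w] by simp
    then have "(\<Sum>a\<in>A. m (w @ [a])) = 0" using cons[OF w] by simp
    then have "m (w @ [a]) = 0" using nonneg w a A by (subst (asm) sum_nonneg_eq_0_iff) auto
    then show ?thesis using \<open>m w = 0\<close> by simp
  qed (use w in \<open>simp add: q_def\<close>)
  define N where "N = (\<lambda>w. point_measure A (\<lambda>a. ennreal (q w a)))"
  have sN[simp, measurable_cong]: "sets (N w) = sets (count_space A)" "space (N w) = A" for w
    by (auto simp: N_def sets_point_measure space_point_measure)
  have eN: "emeasure (N w) {a} = ennreal (q w a)" if "a \<in> A" for w a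
    unfolding N_def using that A by (subst emeasure_point_measure_finite) auto
  have pN: "prob_space (N w)" for w
  proof
    show "emeasure (N w) (space (N w)) = 1"
      unfolding N_def using A q0 by (subst emeasure_point_measure_finite) (auto simp: space_point_measure q1)
  qed
  interpret product_prob_space N "lists A"
    using pN by (simp add: product_prob_space_def product_prob_space_axioms_def product_sigma_finite_def prob_space_imp_sigma_finite)
  define P where "P = PiM (lists A) N"
  \<comment> \<open>\<open>f\<close> assigns a next letter to every word; \<open>pre f n\<close> is
    the word reached after \<open>n\<close> choices.\<close>
  define pre where "pre = (\<lambda>f. rec_nat [] (\<lambda>_ w. w @ [f w :: 'a]))"
  have pre: "pre f 0 = []" "pre f (Suc n) = pre f n @ [f (pre f n)]" for f n by (simp_all add: pre_def)
  have lenpre: "length (pre f n) = n" for f n by (induction n) (auto simp: pre)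
  have fA: "f w \<in> A" if "f \<in> space P" "w \<in> lists A" for f w
    using that by (auto simp: P_def space_PiM PiE_iff)
  have preA: "pre f n \<in> lists A" if "f \<in> space P" for f n
    using that fA by (induction n) (auto simp: pre)
  have cA: "countable (lists A)" using A by (intro countable_lists countable_finite)
  have meas: "(\<lambda>f. pre f n) \<in> measurable P (count_space (lists A))
      \<and> (\<lambda>f. f (pre f n)) \<in> measurable P (count_space A)" for n
  proof (induction n)
    case 0
    have "(\<lambda>f. f []) \<in> measurable P (N [])" unfolding P_def by (rule measurable_component_singleton) simp
    then show ?case by (simp add: pre measurable_cong_sets[OF refl sN(1)])
  next
    case (Suc n)
    have 1: "(\<lambda>f. pre f (Suc n)) \<in> measurable P (count_space (lists A))"
    proof -
      have [measurable]: "(\<lambda>f. (pre f n, f (pre f n))) \<in> measurable P (count_space (lists A) \<Otimes>\<^sub>M count_space A)"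
        using Suc by (intro measurable_Pair) auto
      have [measurable]: "(\<lambda>(w, a). w @ [a]) \<in> measurable (count_space (lists A) \<Otimes>\<^sub>M count_space A) (count_space (lists A))"
        using A cA by (subst pair_measure_countable) (auto simp: countable_finite)
      have "(\<lambda>f. (\<lambda>(w, a). w @ [a]) (pre f n, f (pre f n))) \<in> measurable P (count_space (lists A))"
        by measurable
      then show ?thesis by (simp add: pre)
    qed
    have "(\<lambda>f. f (pre f (Suc n))) \<in> measurable P (count_space A)"
    proof (rule measurable_compose_countable'[OF _ 1 cA])
      fix w assume "w \<in> lists A"
      then have "(\<lambda>f. f w) \<in> measurable P (N w)" unfolding P_def by (rule measurable_component_singleton)
      then show "(\<lambda>f. f w) \<in> measurable P (count_space A)" by (simp add: measurable_cong_sets[OF refl sN(1)])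
    qed
    then show ?case using 1 by simp
  qed
  define X where "X = (\<lambda>f. to_stream (\<lambda>n. f (pre f n)))"
  have snX: "X f !! n = f (pre f n)" for f n by (simp add: X_def to_stream_def)
  have stX: "stake n (X f) = pre f n" for f n
    by (induction n) (simp_all add: pre stake_Suc snX del: stake.simps(2))
  have Xm[measurable]: "X \<in> measurable P (full_shift A)"
    by (rule measurable_stream_space2) (use meas snX in simp)
  have Xs: "X f \<in> streams A" if "f \<in> space P" for f
    using measurable_space[OF Xm that] by (simp add: space_stream_space)
  \<comment> \<open>Reaching \<open>w\<close> constrains \<open>f\<close> exactly at the proper
    prefixes of \<open>w\<close>. These are distinct coordinates, so the probability is a
    product.\<close>
  have preeq: "pre f (length w) = w \<longleftrightarrow> (\<forall>v\<in>{take j w |j. j < length w}. f v \<in> {w ! length v})" for f w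
  proof -
    have "pre f n = take n w \<longleftrightarrow> (\<forall>j<n. f (take j w) = w ! j)" if "n \<le> length w" for n
      using that
    proof (induction n)
      case (Suc n)
      have "pre f (Suc n) = take (Suc n) w \<longleftrightarrow> pre f n = take n w \<and> f (pre f n) = w ! n"
        using Suc.prems by (simp add: pre take_Suc_conv_app_nth)
      then show ?case using Suc by (auto simp: less_Suc_eq)
    qed (simp add: pre)
    from this[of "length w"] show ?thesis by auto
  qed
  have prob: "emeasure P {f \<in> space P. pre f (length w) = w} = (\<Prod>j<length w. ennreal (q (take j w) (w ! j)))"
    if w: "w \<in> lists A" for w
  proof -
    define J where "J = {take j w |j. j < length w}"
    have J: "finite J" "J \<subseteq> lists A" using w by (auto simp: J_def dest: in_set_takeD)
    have J': "J = (\<lambda>j. take j w) ` {..<length w}" by (auto simp: J_def)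
    have inj: "inj_on (\<lambda>j. take j w) {..<length w}"
      by (auto simp: inj_on_def) (metis length_take less_imp_le min.absorb2)
    have wA: "w ! j \<in> A" if "j < length w" for j using that w by auto
    have "emeasure P {f \<in> space P. \<forall>v\<in>J. f v \<in> {w ! length v}} = (\<Prod>v\<in>J. emeasure (N v) {w ! length v})"
      unfolding P_def using J wA by (intro emeasure_PiM_Collect) (auto simp: J_def)
    also have "\<dots> = (\<Prod>j<length w. emeasure (N (take j w)) {w ! j})"
      unfolding J' by (subst prod.reindex[OF inj]) simp
    also have "\<dots> = (\<Prod>j<length w. ennreal (q (take j w) (w ! j)))"
      using wA by (intro prod.cong) (auto simp: eN)
    finally show ?thesis unfolding preeq J_def .
  qed
  have mprod: "m w = m [] * (\<Prod>j<length w. q (take j w) (w ! j))" if "w \<in> lists A" for w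
    using that
  proof (induction w rule: rev_induct)
    case (snoc a w)
    have "(\<Prod>j<length w. q (take j (w @ [a])) ((w @ [a]) ! j)) = (\<Prod>j<length w. q (take j w) (w ! j))"
      by (intro prod.cong) (auto simp: nth_append)
    then show ?case using snoc mq[of w a] by (simp add: mult.assoc)
  qed simp
  define \<nu> where "\<nu> = scale_measure (ennreal (m [])) (distr P (full_shift A) X)"
  have "emeasure \<nu> (sstart A w) = ennreal (m w)" if w: "w \<in> lists A" for w
  proof -
    have wA: "w ! j \<in> A" if "j < length w" for j using that w by auto
    have "X -` sstart A w \<inter> space P = {f \<in> space P. pre f (length w) = w}"
      using Xs stX by (auto simp: sstart_eq_stake[OF w])
    then have "emeasure \<nu> (sstart A w) = ennreal (m []) * (\<Prod>j<length w. ennreal (q (take j w) (w ! j)))"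
      unfolding \<nu>_def using prob[OF w] sstart_sets_full_shift[OF A(1) w] by (simp add: emeasure_distr)
    also have "\<dots> = ennreal (m [] * (\<Prod>j<length w. q (take j w) (w ! j)))"
    proof -
      have "0 \<le> (\<Prod>j<length w. q (take j w) (w ! j))" using q0 wA by (intro prod_nonneg) auto
      then show ?thesis using q0 wA nonneg[of "[]"] by (subst prod_ennreal) (auto simp: ennreal_mult)
    qed
    finally show ?thesis using mprod[OF w] by simp
  qed
  moreover have "sets \<nu> = sets (full_shift A)" by (simp add: \<nu>_def)
  ultimately show ?thesis by blast
qed

section \<open>Kolmogorov--Sinai entropy of full shifts\<close>

definition ldist :: "'x measure \<Rightarrow> ('x \<Rightarrow> 'c) \<Rightarrow> 'c \<Rightarrow> real" where
  "ldist \<nu> X c = measure \<nu> {x \<in> space \<nu>. X x = c}"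

text \<open>Entropy of the partition into level sets. Labels replace cells: joins become tuples of
  labels, and by \<open>lent_eqI\<close> only the induced partition counts.\<close>

definition lent :: "'x measure \<Rightarrow> ('x \<Rightarrow> 'c) \<Rightarrow> real" where
  "lent \<nu> X = shannon (X ` space \<nu>) (ldist \<nu> X)"

lemma simple_function_level_set: "simple_function \<nu> X \<Longrightarrow> {x \<in> space \<nu>. X x = c} \<in> sets \<nu>"
  using simple_functionD(2)[of \<nu> X "{c}"] by (simp add: vimage_def Collect_conj_eq Int_commute)

lemma ldist_cong: "(\<And>x. x \<in> space \<nu> \<Longrightarrow> X x = Y x) \<Longrightarrow> ldist \<nu> X = ldist \<nu> Y"
  unfolding ldist_def by (intro ext arg_cong[where f="measure \<nu>"]) auto

lemma lent_cong: "(\<And>x. x \<in> space \<nu> \<Longrightarrow> X x = Y x) \<Longrightarrow> lent \<nu> X = lent \<nu> Y"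
  unfolding lent_def using ldist_cong[of \<nu> X Y] by (auto cong: image_cong)

text \<open>For X, Y, Z of joint law \<open>p\<close> this is H(X,Y,Z) + H(Z) \<le> H(X,Z) + H(Y,Z).
  The difference is the relative entropy of \<open>p\<close> with respect to the law
  \<open>q\<close> that has the same marginals for (X,Z) and (Y,Z) and makes X and Y conditionally
  independent given Z; equality forces \<open>p = q\<close>.\<close>

lemma ssa_prob_vec:
  fixes p :: "'a \<times> 'b \<times> 'c \<Rightarrow> real"
  assumes fin: "finite A" "finite B" "finite C" and p: "p \<in> prob_vec (A \<times> B \<times> C)"
  defines "I \<equiv> A \<times> B \<times> C"
  defines "pxz \<equiv> pushv I (\<lambda>(x, y, z). (x, z)) p" and "pyz \<equiv> pushv I (\<lambda>(x, y, z). (y, z)) p"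
    and "pz \<equiv> pushv I (\<lambda>(x, y, z). z) p"
  shows "shannon I p + shannon C pz \<le> shannon (A \<times> C) pxz + shannon (B \<times> C) pyz"
    and "shannon I p + shannon C pz = shannon (A \<times> C) pxz + shannon (B \<times> C) pyz \<Longrightarrow>
      x \<in> A \<Longrightarrow> y \<in> B \<Longrightarrow> z \<in> C \<Longrightarrow> p (x, y, z) = pxz (x, z) * pyz (y, z) / pz z"
proof -
  have finI: "finite I" and p: "p \<in> prob_vec I" using fin p by (auto simp: I_def)
  have m: "(\<lambda>(x, y, z). (x, z)) ` I \<subseteq> A \<times> C" "(\<lambda>(x, y, z). (y, z)) ` I \<subseteq> B \<times> C" "(\<lambda>(x, y, z). z) ` I \<subseteq> C"
    by (auto simp: I_def)
  have pv: "pxz \<in> prob_vec (A \<times> C)" "pyz \<in> prob_vec (B \<times> C)" "pz \<in> prob_vec C"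
    unfolding pxz_def pyz_def pz_def using fin finI m p by (intro pushv_prob_vec; auto)+
  have e1: "pushv (A \<times> C) snd pxz = pz" and e2: "pushv (B \<times> C) snd pyz = pz"
    unfolding pxz_def pyz_def pz_def using fin finI m by (subst pushv_comp; auto simp: case_prod_unfold)+
  have e3: "{b \<in> A \<times> C. snd b = z} = (\<lambda>x. (x, z)) ` A" and e4: "{b \<in> B \<times> C. snd b = z} = (\<lambda>x. (x, z)) ` B" if "z \<in> C" for z
    using that by auto
  have sums: "(\<Sum>x\<in>A. pxz (x, z)) = pz z" "(\<Sum>x\<in>B. pyz (x, z)) = pz z" if "z \<in> C" for z
  proof -
    have "pushv (A \<times> C) snd pxz z = (\<Sum>x\<in>(\<lambda>x. (x, z)) ` A. pxz x)"
      "pushv (B \<times> C) snd pyz z = (\<Sum>x\<in>(\<lambda>x. (x, z)) ` B. pyz x)"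
      by (simp_all only: pushv_def e3[OF that] e4[OF that])
    then have "pz z = (\<Sum>x\<in>(\<lambda>x. (x, z)) ` A. pxz x)" "pz z = (\<Sum>x\<in>(\<lambda>x. (x, z)) ` B. pyz x)"
      by (simp_all only: e1 e2)
    then show "(\<Sum>x\<in>A. pxz (x, z)) = pz z" "(\<Sum>x\<in>B. pyz (x, z)) = pz z"
      by (simp_all add: sum.reindex inj_on_def)
  qed
  define q where "q = (\<lambda>(x, y, z). pxz (x, z) * pyz (y, z) / pz z)"
  have "sum q I = (\<Sum>x\<in>A. \<Sum>y\<in>B. \<Sum>z\<in>C. pxz (x, z) * pyz (y, z) / pz z)"
    unfolding I_def q_def by (simp add: sum.cartesian_product)
  also have "\<dots> = (\<Sum>z\<in>C. \<Sum>x\<in>A. \<Sum>y\<in>B. pxz (x, z) * pyz (y, z) / pz z)"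
    by (subst sum.swap[of _ C B], subst sum.swap[of _ C A]) (rule refl)
  also have "\<dots> = (\<Sum>z\<in>C. (\<Sum>x\<in>A. pxz (x, z)) * (\<Sum>y\<in>B. pyz (y, z)) / pz z)"
    by (simp add: sum_product sum_divide_distrib)
  also have "\<dots> = (\<Sum>z\<in>C. pz z)" using sums by (intro sum.cong) auto
  also have "\<dots> = 1" using prob_vecD(3)[OF pv(3) fin(3)] .
  finally have sq: "sum q I = 1" .
  have nn: "0 \<le> p i" "0 \<le> pxz a" "0 \<le> pyz b" "0 \<le> pz c" for i :: "'a \<times> 'b \<times> 'c" and a b c
    using prob_vecD(1)[OF p finI] prob_vecD(1)[OF pv(1)] prob_vecD(1)[OF pv(2)] prob_vecD(1)[OF pv(3)] fin by auto
  define t where "t = (\<lambda>(x, y, z). p (x, y, z) * ln (p (x, y, z))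
     - p (x, y, z) * (ln (pxz (x, z)) + ln (pyz (y, z)) - ln (pz z)) - p (x, y, z) + q (x, y, z))"
  have t: "0 \<le> t i \<and> (t i = 0 \<longrightarrow> p i = q i)" if i: "i \<in> I" for i
  proof -
    obtain x y z where xyz: "i = (x, y, z)" by (cases i)
    have le: "p i \<le> pxz (x, z)" "p i \<le> pyz (y, z)" "p i \<le> pz z"
      using pushv_ge[OF finI p i, of "\<lambda>(x, y, z). (x, z)"] pushv_ge[OF finI p i, of "\<lambda>(x, y, z). (y, z)"]
        pushv_ge[OF finI p i, of "\<lambda>(x, y, z). z"] by (auto simp: xyz pxz_def pyz_def pz_def)
    show ?thesis
    proof (cases "q i = 0")
      case True
      then have "p i = 0" using le nn(1)[of i] by (auto simp: q_def xyz)
      then show ?thesis using True by (auto simp: t_def xyz)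
    next
      case False
      then have pos: "0 < pxz (x, z)" "0 < pyz (y, z)" "0 < pz z"
        using nn(2)[of "(x, z)"] nn(3)[of "(y, z)"] nn(4)[of z] by (auto simp: q_def xyz less_le)
      then have qp: "0 < q i" by (simp add: q_def xyz)
      have "ln (q i) = ln (pxz (x, z)) + ln (pyz (y, z)) - ln (pz z)"
        using pos by (simp add: q_def xyz ln_div ln_mult)
      then have "t i = p i * ln (p i) - (p i * ln (q i) + p i - q i)" by (simp add: t_def xyz)
      then show ?thesis using xlnx_tangent[OF nn(1)[of i] qp] by auto
    qed
  qed
  have "sum t I = (\<Sum>i\<in>I. p i * ln (p i)) - (\<Sum>i\<in>I. p i * ln (pxz ((\<lambda>(x, y, z). (x, z)) i)))
     - (\<Sum>i\<in>I. p i * ln (pyz ((\<lambda>(x, y, z). (y, z)) i))) + (\<Sum>i\<in>I. p i * ln (pz ((\<lambda>(x, y, z). z) i))) - sum p I + sum q I"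
    unfolding t_def by (simp add: sum.distrib sum_subtractf algebra_simps case_prod_unfold)
  also have "\<dots> = (shannon (A \<times> C) pxz + shannon (B \<times> C) pyz) - (shannon I p + shannon C pz)"
    unfolding shannon_def sq prob_vecD(3)[OF p finI]
    using sum_pushv[OF finI _ m(1), of p "\<lambda>a. ln (pxz a)"] sum_pushv[OF finI _ m(2), of p "\<lambda>a. ln (pyz a)"]
      sum_pushv[OF finI _ m(3), of p "\<lambda>a. ln (pz a)"] fin
    by (simp add: pxz_def pyz_def pz_def)
  finally have st: "sum t I = (shannon (A \<times> C) pxz + shannon (B \<times> C) pyz) - (shannon I p + shannon C pz)" .
  have "0 \<le> sum t I" using t by (intro sum_nonneg) auto
  then show "shannon I p + shannon C pz \<le> shannon (A \<times> C) pxz + shannon (B \<times> C) pyz" using st by simp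
  assume "shannon I p + shannon C pz = shannon (A \<times> C) pxz + shannon (B \<times> C) pyz" "x \<in> A" "y \<in> B" "z \<in> C"
  then have "sum t I = 0" "(x, y, z) \<in> I" using st by (auto simp: I_def)
  then have "t (x, y, z) = 0" using t finI by (subst (asm) sum_nonneg_eq_0_iff) auto
  then show "p (x, y, z) = pxz (x, z) * pyz (y, z) / pz z"
    using t[OF \<open>(x, y, z) \<in> I\<close>] by (simp add: q_def)
qed

context prob_space
begin

lemma ldist_comp:
  assumes X: "simple_function M X" and F: "finite F" "X ` space M \<subseteq> F"
  shows "ldist M (\<lambda>x. g (X x)) = pushv F g (ldist M X)"
proof
  fix d
  have "{x \<in> space M. g (X x) = d} = (\<Union>c\<in>{c\<in>F. g c = d}. {x \<in> space M. X x = c})" using F by auto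
  also have "measure M \<dots> = (\<Sum>c\<in>{c\<in>F. g c = d}. measure M {x \<in> space M. X x = c})"
    using F simple_function_level_set[OF X]
    by (intro finite_measure_finite_Union) (auto simp: disjoint_family_on_def)
  finally show "ldist M (\<lambda>x. g (X x)) d = pushv F g (ldist M X) d"
    by (simp add: ldist_def pushv_def)
qed

lemma ldist_outside: "c \<notin> X ` space M \<Longrightarrow> ldist M X c = 0"
proof -
  assume "c \<notin> X ` space M"
  then have "{x \<in> space M. X x = c} = {}" by auto
  then show ?thesis unfolding ldist_def by (simp only: measure_empty)
qed

lemma ldist_prob_vec:
  assumes X: "simple_function M X" and F: "finite F" "X ` space M \<subseteq> F"
  shows "ldist M X \<in> prob_vec F"
  unfolding prob_vec_def
proof (intro CollectI conjI ballI allI impI)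
  have "sum (ldist M X) F = pushv F (\<lambda>_. ()) (ldist M X) ()" by (simp add: pushv_def)
  also have "\<dots> = ldist M (\<lambda>x. ()) ()" using ldist_comp[OF X F, of "\<lambda>_. ()"] by simp
  also have "\<dots> = 1" by (simp add: ldist_def prob_space)
  finally show "sum (ldist M X) F = 1" .
next
  fix b assume "b \<notin> F"
  then show "ldist M X b = 0" using F by (intro ldist_outside) auto
qed (simp add: ldist_def)

lemma lent_eq:
  assumes F: "finite F" "X ` space M \<subseteq> F"
  shows "lent M X = shannon F (ldist M X)"
  unfolding lent_def shannon_def using F ldist_outside[of _ X]
  by (auto intro!: sum.mono_neutral_left)

lemma lent_nonneg: "0 \<le> lent M X"
  unfolding lent_def by (intro shannon_nonneg) (auto simp: ldist_def)

lemma lent_comp_le: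
  assumes X: "simple_function M X"
  shows "lent M (\<lambda>x. g (X x)) \<le> lent M X"
proof -
  have F: "finite (X ` space M)" using simple_functionD(1)[OF X] .
  have "lent M (\<lambda>x. g (X x)) = shannon (g ` X ` space M) (pushv (X ` space M) g (ldist M X))"
    using F by (subst lent_eq[of "g ` X ` space M"]) (auto simp: ldist_comp[OF X F order_refl])
  also have "\<dots> \<le> lent M X"
    unfolding lent_def using F by (intro shannon_pushv_le ldist_prob_vec X) auto
  finally show ?thesis .
qed

lemma lent_mono:
  assumes Y: "simple_function M Y"
    and dep: "\<And>x y. x \<in> space M \<Longrightarrow> y \<in> space M \<Longrightarrow> Y x = Y y \<Longrightarrow> X x = X y"
  shows "lent M X \<le> lent M Y"
proof -
  define g where "g = (\<lambda>c. X (SOME x. x \<in> space M \<and> Y x = c))"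
  have "g (Y x) = X x" if "x \<in> space M" for x
    unfolding g_def using dep that by (metis (mono_tags, lifting) someI_ex)
  then have "lent M X = lent M (\<lambda>x. g (Y x))" by (intro lent_cong) simp
  then show ?thesis using lent_comp_le[OF Y, of g] by simp
qed

lemma lent_eqI:
  assumes "simple_function M X" "simple_function M Y"
    and "\<And>x y. x \<in> space M \<Longrightarrow> y \<in> space M \<Longrightarrow> X x = X y \<longleftrightarrow> Y x = Y y"
  shows "lent M X = lent M Y"
  using assms by (intro antisym lent_mono) auto

lemma lent_ssa:
  assumes X: "simple_function M X" and Y: "simple_function M Y" and Z: "simple_function M Z"
  shows "lent M (\<lambda>x. (X x, Y x, Z x)) + lent M Z \<le> lent M (\<lambda>x. (X x, Z x)) + lent M (\<lambda>x. (Y x, Z x))"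
    and "lent M (\<lambda>x. (X x, Y x, Z x)) + lent M Z = lent M (\<lambda>x. (X x, Z x)) + lent M (\<lambda>x. (Y x, Z x)) \<Longrightarrow>
      a \<in> X ` space M \<Longrightarrow> b \<in> Y ` space M \<Longrightarrow> c \<in> Z ` space M \<Longrightarrow>
      ldist M (\<lambda>x. (X x, Y x, Z x)) (a, b, c) = ldist M (\<lambda>x. (X x, Z x)) (a, c) * ldist M (\<lambda>x. (Y x, Z x)) (b, c) / ldist M Z c"
proof -
  define A B C where "A = X ` space M" and "B = Y ` space M" and "C = Z ` space M"
  have fin: "finite A" "finite B" "finite C" using X Y Z by (auto simp: A_def B_def C_def simple_functionD(1))
  define V where "V = (\<lambda>x. (X x, Y x, Z x))"
  have V: "simple_function M V" unfolding V_def using X Y Z by (intro simple_function_Pair)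
  have VF: "V ` space M \<subseteq> A \<times> B \<times> C" by (auto simp: V_def A_def B_def C_def)
  have fI: "finite (A \<times> B \<times> C)" using fin by simp
  note p = ldist_prob_vec[OF V fI VF]
  have e: "ldist M Z = pushv (A \<times> B \<times> C) (\<lambda>(x, y, z). z) (ldist M V)"
    "ldist M (\<lambda>x. (X x, Z x)) = pushv (A \<times> B \<times> C) (\<lambda>(x, y, z). (x, z)) (ldist M V)"
    "ldist M (\<lambda>x. (Y x, Z x)) = pushv (A \<times> B \<times> C) (\<lambda>(x, y, z). (y, z)) (ldist M V)"
    by (subst ldist_comp[OF V fI VF, symmetric]; simp add: V_def)+
  have l: "lent M V = shannon (A \<times> B \<times> C) (ldist M V)" "lent M Z = shannon C (ldist M Z)"
    "lent M (\<lambda>x. (X x, Z x)) = shannon (A \<times> C) (ldist M (\<lambda>x. (X x, Z x)))"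
    "lent M (\<lambda>x. (Y x, Z x)) = shannon (B \<times> C) (ldist M (\<lambda>x. (Y x, Z x)))"
    using fin by (intro lent_eq; auto simp: V_def A_def B_def C_def)+
  show "lent M (\<lambda>x. (X x, Y x, Z x)) + lent M Z \<le> lent M (\<lambda>x. (X x, Z x)) + lent M (\<lambda>x. (Y x, Z x))"
    using ssa_prob_vec(1)[OF fin p] unfolding V_def[symmetric] l e .
  show "lent M (\<lambda>x. (X x, Y x, Z x)) + lent M Z = lent M (\<lambda>x. (X x, Z x)) + lent M (\<lambda>x. (Y x, Z x)) \<Longrightarrow>
      a \<in> X ` space M \<Longrightarrow> b \<in> Y ` space M \<Longrightarrow> c \<in> Z ` space M \<Longrightarrow>
      ldist M (\<lambda>x. (X x, Y x, Z x)) (a, b, c) = ldist M (\<lambda>x. (X x, Z x)) (a, c) * ldist M (\<lambda>x. (Y x, Z x)) (b, c) / ldist M Z c"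
    using ssa_prob_vec(2)[OF fin p, of a b c] unfolding V_def[symmetric] l e A_def[symmetric] B_def[symmetric] C_def[symmetric] .
qed

text \<open>Strong subadditivity with a constant third variable; its equality case becomes
  independence of the two labels.\<close>

lemma lent_subadd:
  assumes X: "simple_function M X" and Y: "simple_function M Y"
  shows "lent M (\<lambda>x. (X x, Y x)) \<le> lent M X + lent M Y"
    and "lent M (\<lambda>x. (X x, Y x)) = lent M X + lent M Y \<Longrightarrow>
      ldist M (\<lambda>x. (X x, Y x)) (a, b) = ldist M X a * ldist M Y b"
proof -
  have c: "simple_function M (\<lambda>x. ())" by simp
  have 0: "lent M (\<lambda>x. ()) = 0" using not_empty by (simp add: lent_def shannon_def ldist_def prob_space)
  have 1: "lent M (\<lambda>x. (X x, Y x, ())) = lent M (\<lambda>x. (X x, Y x))"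
    "lent M (\<lambda>x. (X x, ())) = lent M X" "lent M (\<lambda>x. (Y x, ())) = lent M Y"
    using X Y by (intro lent_eqI simple_function_Pair c; auto)+
  show "lent M (\<lambda>x. (X x, Y x)) \<le> lent M X + lent M Y"
    using lent_ssa(1)[OF X Y c] unfolding 0 1 by simp
  assume eq: "lent M (\<lambda>x. (X x, Y x)) = lent M X + lent M Y"
  show "ldist M (\<lambda>x. (X x, Y x)) (a, b) = ldist M X a * ldist M Y b"
  proof (cases "a \<in> X ` space M \<and> b \<in> Y ` space M")
    case True
    then show ?thesis using lent_ssa(2)[OF X Y c, of a b "()"] eq not_empty
      unfolding 0 1 by (auto simp: ldist_def prob_space)
  next
    case False
    then have "(a, b) \<notin> (\<lambda>x. (X x, Y x)) ` space M" by auto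
    then show ?thesis using False ldist_outside[of a X] ldist_outside[of b Y] ldist_outside[of "(a, b)" "\<lambda>x. (X x, Y x)"] by auto
  qed
qed

lemma ldist_diff_le:
  assumes U: "simple_function M U" and V: "simple_function M V" and S: "S \<in> sets M"
    and UV: "\<And>x. x \<in> space M \<Longrightarrow> x \<notin> S \<Longrightarrow> U x = V x"
  shows "\<bar>ldist M U c - ldist M V c\<bar> \<le> measure M S"
proof -
  have "ldist M U c \<le> measure M ({x \<in> space M. V x = c} \<union> S)"
    unfolding ldist_def using UV by (intro finite_measure_mono sets.Un S simple_function_level_set V) auto
  also have "\<dots> \<le> ldist M V c + measure M S" unfolding ldist_def
    by (intro measure_Un_le S simple_function_level_set V)
  finally have 1: "ldist M U c \<le> ldist M V c + measure M S" .
  have "ldist M V c \<le> measure M ({x \<in> space M. U x = c} \<union> S)"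
    unfolding ldist_def using UV by (intro finite_measure_mono sets.Un S simple_function_level_set U) fastforce+
  also have "\<dots> \<le> ldist M U c + measure M S" unfolding ldist_def
    by (intro measure_Un_le S simple_function_level_set U)
  finally show ?thesis using 1 by simp
qed

lemma lent_tendsto:
  assumes U: "\<And>n. simple_function M (U n)" and V: "simple_function M V" and S: "\<And>n. S n \<in> sets M"
    and UV: "\<And>n x. x \<in> space M \<Longrightarrow> x \<notin> S n \<Longrightarrow> U n x = V x"
    and H: "finite H" "\<And>n. U n ` space M \<subseteq> H" "V ` space M \<subseteq> H"
    and S0: "(\<lambda>n. measure M (S n)) \<longlonglongrightarrow> 0"
  shows "(\<lambda>n. lent M (U n)) \<longlonglongrightarrow> lent M V"
proof -
  have "(\<lambda>n. ldist M (U n) c - ldist M V c) \<longlonglongrightarrow> 0" for c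
    by (rule Lim_null_comparison[OF _ S0]) (use ldist_diff_le[OF U V S UV] in auto)
  then have "(\<lambda>n. ldist M (U n) c) \<longlonglongrightarrow> ldist M V c" for c by (simp add: LIM_zero_iff)
  then have "(\<lambda>n. (\<lambda>x. x * ln x) (ldist M (U n) c)) \<longlonglongrightarrow> (\<lambda>x. x * ln x) (ldist M V c)" for c
    by (intro continuous_on_tendsto_compose[OF continuous_on_xlnx]) (auto simp: ldist_def)
  then show ?thesis unfolding lent_eq[OF H(1,2)] lent_eq[OF H(1,3)] shannon_def
    by (intro tendsto_minus tendsto_sum)
qed

end

section \<open>Entropy rate of a measure preserving map and generating partitions\<close>

lemma fekete:
  fixes a :: "nat \<Rightarrow> real"
  assumes sub: "\<And>m n. a (m + n) \<le> a m + a n" and nonneg: "\<And>n. 0 \<le> a n"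
  shows "\<exists>L. (\<lambda>n. a n / real n) \<longlonglongrightarrow> L \<and> (\<forall>m\<ge>1. L \<le> a m / real m)"
proof -
  define S where "S = (\<lambda>m. a m / real m) ` {1..}"
  define L where "L = Inf S"
  have bdd: "bdd_below S" unfolding S_def using nonneg by (intro bdd_belowI[of _ 0]) auto
  have L: "L \<le> a m / real m" if "1 \<le> m" for m
    unfolding L_def using that by (intro cInf_lower bdd) (auto simp: S_def)
  have "(\<lambda>n. a n / real n) \<longlonglongrightarrow> L"
  proof (rule LIMSEQ_I)
    fix r :: real assume r: "0 < r"
    have "\<exists>x\<in>S. x < L + r / 2" unfolding L_def using r bdd by (subst cInf_less_iff[symmetric]) (auto simp: S_def)
    then obtain m where m: "1 \<le> m" "a m / real m < L + r / 2" by (auto simp: S_def)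
    define C where "C = (\<Sum>i<m. a i)"
    have C: "a i \<le> C" if "i < m" for i unfolding C_def using that nonneg by (intro member_le_sum) auto
    \<comment> \<open>Euclidean division n = k m + i leaves \<open>k\<close> copies of
      \<open>a m\<close> and one of finitely many remainders, all bounded by
      \<open>C\<close>.\<close>
    have q: "a (k * m + i) \<le> real k * a m + a i" for k i
    proof (induction k)
      case (Suc k)
      have "a (Suc k * m + i) \<le> a m + a (k * m + i)" using sub[of m "k * m + i"] by (simp add: add.assoc)
      then show ?case using Suc by (simp add: algebra_simps)
    qed simp
    have le: "a n / real n \<le> a m / real m + C / real n" if n: "1 \<le> n" for n
    proof -
      have "a n \<le> real (n div m) * a m + C"
        using q[of "n div m" "n mod m"] C[of "n mod m"] m by simp
      moreover have "real (n div m) * a m \<le> real n / real m * a m"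
        using nonneg[of m] by (intro mult_right_mono of_nat_div_le_of_nat) auto
      ultimately have "a n \<le> real n * (a m / real m) + C" by simp
      then have "a n / real n \<le> (real n * (a m / real m) + C) / real n" using n by (intro divide_right_mono) auto
      then show ?thesis using n by (simp add: add_divide_distrib)
    qed
    obtain N where N: "2 * C / r < real N" using reals_Archimedean2 by blast
    show "\<exists>no. \<forall>n\<ge>no. norm (a n / real n - L) < r"
    proof (intro exI[of _ "max 1 N"] allI impI)
      fix n assume n: "max 1 N \<le> n"
      then have "2 * C / r < real n" using N by (meson le_trans max.bounded_iff not_le of_nat_le_iff order_less_le_trans)
      then have "C / real n < r / 2" using r n by (simp add: field_simps)
      moreover have "a n / real n \<le> a m / real m + C / real n" using n by (intro le) simp
      ultimately have "a n / real n < L + r" using m by linarith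
      then show "norm (a n / real n - L) < r" using L[of n] n by simp
    qed
  qed
  then show ?thesis using L by blast
qed

locale measure_preserving = prob_space +
  fixes T :: "'a \<Rightarrow> 'a"
  assumes T_meas: "T \<in> measurable M M" and T_inv: "distr M M T = M"
begin

lemma funpow_meas: "T ^^ n \<in> measurable M M"
  by (induction n) (auto simp: id_def intro: measurable_compose[OF _ T_meas])

lemma funpow_inv: "distr M M (T ^^ n) = M"
proof (induction n)
  case 0 then show ?case by (simp add: id_def distr_id)
next
  case (Suc n)
  have "distr M M (T ^^ Suc n) = distr (distr M M (T ^^ n)) M T"
    using distr_distr[OF T_meas funpow_meas] by simp
  then show ?case by (simp only: Suc T_inv)
qed

lemma funpow_space: "x \<in> space M \<Longrightarrow> (T ^^ n) x \<in> space M"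
  using measurable_space[OF funpow_meas] .

lemma simple_function_funpow:
  "simple_function M X \<Longrightarrow> simple_function M (\<lambda>x. X ((T ^^ n) x))"
  using simple_function_comp[OF funpow_meas, of X n] by simp

lemma ldist_funpow:
  assumes X: "simple_function M X"
  shows "ldist M (\<lambda>x. X ((T ^^ n) x)) = ldist M X"
proof
  fix c
  have "measure M {x \<in> space M. X x = c} = measure (distr M M (T ^^ n)) {x \<in> space M. X x = c}"
    by (simp add: funpow_inv)
  also have "\<dots> = measure M ((T ^^ n) -` {x \<in> space M. X x = c} \<inter> space M)"
    using simple_function_level_set[OF X] by (intro measure_distr funpow_meas)
  also have "(T ^^ n) -` {x \<in> space M. X x = c} \<inter> space M = {x \<in> space M. X ((T ^^ n) x) = c}"
    using funpow_space by auto
  finally show "ldist M (\<lambda>x. X ((T ^^ n) x)) c = ldist M X c" by (simp add: ldist_def)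
qed

lemma lent_funpow:
  assumes X: "simple_function M X"
  shows "lent M (\<lambda>x. X ((T ^^ n) x)) = lent M X"
  using simple_functionD(1)[OF X] funpow_space
  by (subst lent_eq[of "X ` space M"]) (auto simp: ldist_funpow[OF X] lent_def)

text \<open>Restricted functions on \<open>{..<n}\<close> rather than lists, so that the values are
  the index functions used by \<open>partition_join\<close>.\<close>

definition itinerary :: "('a \<Rightarrow> 'c) \<Rightarrow> nat \<Rightarrow> 'a \<Rightarrow> nat \<Rightarrow> 'c" where
  "itinerary X n x = (\<lambda>j\<in>{..<n}. X ((T ^^ j) x))"

lemma itinerary_eq_iff: "itinerary X n x = itinerary X n y \<longleftrightarrow> (\<forall>j<n. X ((T ^^ j) x) = X ((T ^^ j) y))"
  by (auto simp: itinerary_def fun_eq_iff restrict_def)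

lemma itinerary_PiE: "x \<in> space M \<Longrightarrow> X ` space M \<subseteq> F \<Longrightarrow> itinerary X n x \<in> {..<n} \<rightarrow>\<^sub>E F"
  using funpow_space by (auto simp: itinerary_def)

lemma itinerary_level_set:
  "C \<in> extensional {..<n} \<Longrightarrow> {x \<in> space M. itinerary X n x = C} = {x \<in> space M. \<forall>j<n. X ((T ^^ j) x) = C j}"
  by (auto simp: itinerary_def fun_eq_iff extensional_def)

lemma simple_function_itinerary:
  assumes X: "simple_function M X"
  shows "simple_function M (itinerary X n)"
  unfolding simple_function_def
proof (intro conjI ballI)
  have "itinerary X n ` space M \<subseteq> {..<n} \<rightarrow>\<^sub>E X ` space M" by (intro image_subsetI itinerary_PiE order_refl)
  then show "finite (itinerary X n ` space M)"
    by (rule finite_subset) (intro finite_PiE simple_functionD(1)[OF X] finite_lessThan)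
  fix C assume "C \<in> itinerary X n ` space M"
  then have "C \<in> extensional {..<n}" by (auto simp: itinerary_def)
  from itinerary_level_set[OF this, of X]
  have "itinerary X n -` {C} \<inter> space M = {x \<in> space M. \<forall>j\<in>{..<n}. X ((T ^^ j) x) = C j}"
    by (simp add: vimage_def Collect_conj_eq Int_commute Ball_def)
  also have "\<dots> \<in> sets M"
    by (intro sets.sets_Collect_finite_All simple_function_level_set simple_function_funpow X) auto
  finally show "itinerary X n -` {C} \<inter> space M \<in> sets M" .
qed

lemma lent_itinerary_subadd:
  assumes X: "simple_function M X"
  shows "lent M (itinerary X (m + n)) \<le> lent M (itinerary X m) + lent M (itinerary X n)"
proof -
  note s = simple_function_itinerary[OF X]
  have "lent M (itinerary X (m + n)) \<le> lent M (\<lambda>x. (itinerary X m x, itinerary X n ((T ^^ m) x)))"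
  proof (intro lent_mono simple_function_Pair s simple_function_funpow)
    fix x y assume "(itinerary X m x, itinerary X n ((T ^^ m) x)) = (itinerary X m y, itinerary X n ((T ^^ m) y))"
    then have 1: "\<And>j. j < m \<Longrightarrow> X ((T ^^ j) x) = X ((T ^^ j) y)"
      and 2: "\<And>j. j < n \<Longrightarrow> X ((T ^^ (j + m)) x) = X ((T ^^ (j + m)) y)"
      by (auto simp: itinerary_eq_iff funpow_add)
    show "itinerary X (m + n) x = itinerary X (m + n) y"
      unfolding itinerary_eq_iff
    proof (intro allI impI)
      fix j assume "j < m + n"
      then show "X ((T ^^ j) x) = X ((T ^^ j) y)" using 1[of j] 2[of "j - m"] by (cases "j < m") auto
    qed
  qed
  also have "\<dots> \<le> lent M (itinerary X m) + lent M (\<lambda>x. itinerary X n ((T ^^ m) x))"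
    by (intro lent_subadd(1) s simple_function_funpow)
  also have "lent M (\<lambda>x. itinerary X n ((T ^^ m) x)) = lent M (itinerary X n)"
    by (intro lent_funpow s)
  finally show ?thesis .
qed

definition rate :: "('a \<Rightarrow> 'c) \<Rightarrow> real" where
  "rate X = lim (\<lambda>n. lent M (itinerary X n) / real n)"

lemma rate:
  assumes X: "simple_function M X"
  shows "(\<lambda>n. lent M (itinerary X n) / real n) \<longlonglongrightarrow> rate X"
    and "1 \<le> m \<Longrightarrow> rate X \<le> lent M (itinerary X m) / real m"
proof -
  obtain L where L: "(\<lambda>n. lent M (itinerary X n) / real n) \<longlonglongrightarrow> L" "\<And>m. 1 \<le> m \<Longrightarrow> L \<le> lent M (itinerary X m) / real m"
    using fekete[of "\<lambda>n. lent M (itinerary X n)"] lent_itinerary_subadd[OF X] lent_nonneg by blast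
  then have "rate X = L" unfolding rate_def by (intro limI)
  then show "(\<lambda>n. lent M (itinerary X n) / real n) \<longlonglongrightarrow> rate X"
    "1 \<le> m \<Longrightarrow> rate X \<le> lent M (itinerary X m) / real m" using L by auto
qed

text \<open>\<open>lent (X, Y) - lent Y\<close> plays the role of the conditional entropy \<open>H(X | Y)\<close>.\<close>

lemma lent_itinerary_relative:
  fixes L :: nat
  assumes X: "simple_function M X" and Y: "simple_function M Y"
  defines "d \<equiv> lent M (\<lambda>x. (X x, itinerary Y L x)) - lent M (itinerary Y L)"
  shows "n + L \<le> N \<Longrightarrow> lent M (\<lambda>x. (itinerary X n x, itinerary Y N x)) \<le> lent M (itinerary Y N) + real n * d"
proof (induction n)
  case 0
  have "lent M (\<lambda>x. (itinerary X 0 x, itinerary Y N x)) \<le> lent M (itinerary Y N)"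
    by (intro lent_mono simple_function_itinerary Y) (auto simp: itinerary_def)
  then show ?case by simp
next
  case (Suc n)
  define X1 where "X1 = (\<lambda>x. X ((T ^^ n) x))"
  define YL where "YL = (\<lambda>x. itinerary Y L ((T ^^ n) x))"
  have s: "simple_function M X1" "simple_function M YL" "simple_function M (itinerary X n)" "simple_function M (itinerary Y N)"
    unfolding X1_def YL_def by (intro simple_function_itinerary simple_function_funpow X Y)+
  have "lent M (\<lambda>x. (itinerary X (Suc n) x, itinerary Y N x)) \<le> lent M (\<lambda>x. (itinerary X n x, X1 x, itinerary Y N x))"
    by (intro lent_mono simple_function_Pair s) (auto simp: itinerary_eq_iff X1_def less_Suc_eq)
  also have "\<dots> \<le> lent M (\<lambda>x. (itinerary X n x, itinerary Y N x)) + lent M (\<lambda>x. (X1 x, itinerary Y N x)) - lent M (itinerary Y N)"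
    using lent_ssa(1)[OF s(3,1,4)] by simp
  finally have 1: "lent M (\<lambda>x. (itinerary X (Suc n) x, itinerary Y N x))
     \<le> lent M (\<lambda>x. (itinerary X n x, itinerary Y N x)) + lent M (\<lambda>x. (X1 x, itinerary Y N x)) - lent M (itinerary Y N)" .
  \<comment> \<open>As \<open>Suc n + L \<le> N\<close>, the block of \<open>L\<close> symbols seen
    from time \<open>n\<close> on is part of the first \<open>N\<close> symbols; conditioning on
    more can only lower the entropy of \<open>X1\<close>.\<close>
  have dep: "YL x = YL y" if "itinerary Y N x = itinerary Y N y" for x y
    unfolding YL_def itinerary_eq_iff
  proof (intro allI impI)
    fix j assume "j < L"
    then have "j + n < N" using Suc.prems by simp
    then show "Y ((T ^^ j) ((T ^^ n) x)) = Y ((T ^^ j) ((T ^^ n) y))"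
      using that[unfolded itinerary_eq_iff, rule_format, of "j + n"] by (simp add: funpow_add)
  qed
  have "lent M (\<lambda>x. (X1 x, itinerary Y N x)) \<le> lent M (\<lambda>x. (X1 x, itinerary Y N x, YL x))"
    by (intro lent_mono simple_function_Pair s) auto
  moreover have "lent M (\<lambda>x. (itinerary Y N x, YL x)) \<le> lent M (itinerary Y N)"
  proof (intro lent_mono s)
    fix x y assume "itinerary Y N x = itinerary Y N y"
    then show "(itinerary Y N x, YL x) = (itinerary Y N y, YL y)" using dep[of x y] by simp
  qed
  moreover have "lent M (\<lambda>x. (X1 x, YL x)) = lent M (\<lambda>x. (X x, itinerary Y L x))"
    unfolding X1_def YL_def
    by (rule lent_funpow[where X="\<lambda>x. (X x, itinerary Y L x)"]) (intro simple_function_Pair simple_function_itinerary X Y)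
  moreover have "lent M YL = lent M (itinerary Y L)"
    unfolding YL_def by (intro lent_funpow simple_function_itinerary Y)
  ultimately have "lent M (\<lambda>x. (X1 x, itinerary Y N x)) - lent M (itinerary Y N) \<le> d"
    using lent_ssa(1)[OF s(1,4,2)] unfolding d_def by linarith
  then show ?case using 1 Suc by (simp add: algebra_simps)
qed

text \<open>The preceding estimate with N = n + L, divided by n: the surplus of \<open>L\<close>
  symbols costs at most a constant, which vanishes in the limit.\<close>

lemma rate_le_relative:
  assumes X: "simple_function M X" and Y: "simple_function M Y"
  shows "rate X \<le> rate Y + (lent M (\<lambda>x. (X x, itinerary Y L x)) - lent M (itinerary Y L))" (is "_ \<le> _ + ?d")
proof -
  have s: "simple_function M (itinerary X n)" "simple_function M (itinerary Y n)" for n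
    by (intro simple_function_itinerary X Y)+
  have le0: "lent M (itinerary X n) \<le> lent M (itinerary Y n) + lent M (itinerary Y L) + real n * ?d" for n
  proof -
    have "lent M (itinerary X n) \<le> lent M (\<lambda>x. (itinerary X n x, itinerary Y (n + L) x))"
      by (intro lent_mono simple_function_Pair s) auto
    then show ?thesis
      using lent_itinerary_relative[OF X Y, of n L "n + L"] lent_itinerary_subadd[OF Y, of n L] by simp
  qed
  have le: "lent M (itinerary X n) / real n \<le> lent M (itinerary Y n) / real n + lent M (itinerary Y L) / real n + ?d"
    if "1 \<le> n" for n
  proof -
    have "lent M (itinerary X n) / real n \<le> (lent M (itinerary Y n) + lent M (itinerary Y L) + real n * ?d) / real n"
      using le0 by (intro divide_right_mono) auto
    also have "\<dots> = lent M (itinerary Y n) / real n + lent M (itinerary Y L) / real n + ?d"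
      using that by (simp only: add_divide_distrib) simp
    finally show ?thesis .
  qed
  have "(\<lambda>n. lent M (itinerary Y n) / real n + lent M (itinerary Y L) / real n + ?d) \<longlonglongrightarrow> rate Y + 0 + ?d"
    by (intro tendsto_intros rate(1)[OF Y] lim_const_over_n)
  then have "rate X \<le> rate Y + 0 + ?d"
    by (rule LIMSEQ_le[OF rate(1)[OF X]]) (use le in blast)
  then show ?thesis by simp
qed

text \<open>Core of the Kolmogorov-Sinai theorem: \<open>X\<close> is approximated by variables
  \<open>X' n\<close> readable from finitely many symbols of \<open>Y\<close>. The conditional
  entropy of \<open>X\<close> given those symbols is at most H(X | X' n), which tends to 0 along
  with the probability of X \<noteq> X' n.\<close>

lemma rate_le_generator:
  assumes X: "simple_function M X" and Y: "simple_function M Y"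
    and gen: "\<And>A \<epsilon>. A \<in> sets M \<Longrightarrow> 0 < \<epsilon> \<Longrightarrow>
      \<exists>L G. measure M {x \<in> space M. (x \<in> A) \<noteq> (itinerary Y L x \<in> G)} < (\<epsilon>::real)"
  shows "rate X \<le> rate Y"
proof -
  define F where "F = X ` space M"
  have finF: "finite F" using simple_functionD(1)[OF X] by (simp add: F_def)
  define Q where "Q = (\<lambda>n c L G. measure M {x \<in> space M. (X x = c) \<noteq> (itinerary Y L x \<in> G)} < 1 / real (Suc n))"
  have "\<exists>L G. \<forall>n c. Q n c (L n c) (G n c)"
  proof -
    have "\<exists>L G. measure M {x \<in> space M. (X x = c) \<noteq> (itinerary Y L x \<in> G)} < 1 / real (Suc n)" for n c
      proof -
      obtain L G where "measure M {x \<in> space M. (x \<in> {x \<in> space M. X x = c}) \<noteq> (itinerary Y L x \<in> G)} < 1 / real (Suc n)"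
        using gen[OF simple_function_level_set[OF X, of c], of "1 / real (Suc n)"] by auto
      moreover have "{x \<in> space M. (x \<in> {x \<in> space M. X x = c}) \<noteq> (itinerary Y L x \<in> G)}
        = {x \<in> space M. (X x = c) \<noteq> (itinerary Y L x \<in> G)}" by (intro Collect_cong conj_cong refl) simp
      ultimately have "measure M {x \<in> space M. (X x = c) \<noteq> (itinerary Y L x \<in> G)} < 1 / real (Suc n)" by simp
      then show ?thesis by blast
    qed
    then have "\<forall>n c. \<exists>L G. Q n c L G" by (simp add: Q_def)
    then show ?thesis by metis
  qed
  then obtain L G where LG: "\<And>n c. measure M {x \<in> space M. (X x = c) \<noteq> (itinerary Y (L n c) x \<in> G n c)} < 1 / real (Suc n)"
    unfolding Q_def by blast
  define K where "K = (\<lambda>n. Max (insert 0 (L n ` F)))"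
  have K: "c \<in> F \<Longrightarrow> L n c \<le> K n" for n c unfolding K_def using finF by (intro Max_ge) auto
  \<comment> \<open>Each value \<open>c\<close> of \<open>X\<close> has its own approximate test
    through \<open>G n c\<close>. A point is decoded only if exactly one test succeeds; otherwise
    the value \<open>X x0\<close> keeps \<open>X' n\<close> inside \<open>F\<close>.\<close>
  define sel where "sel = (\<lambda>n x c. c \<in> F \<and> itinerary Y (L n c) x \<in> G n c)"
  obtain x0 where x0: "x0 \<in> space M" using not_empty by auto
  define X' where "X' = (\<lambda>n x. if \<exists>!c. sel n x c then (THE c. sel n x c) else X x0)"
  have sy: "simple_function M (itinerary Y n)" for n by (intro simple_function_itinerary Y)
  have dep: "X' n x = X' n y" if "itinerary Y (K n) x = itinerary Y (K n) y" for n x y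
  proof -
    have "itinerary Y (L n c) x = itinerary Y (L n c) y" if "c \<in> F" for c
      using \<open>itinerary Y (K n) x = itinerary Y (K n) y\<close> K[OF that, of n] by (auto simp: itinerary_eq_iff)
    then have "sel n x = sel n y" unfolding sel_def by (intro ext) (simp cong: conj_cong)
    then show ?thesis by (simp add: X'_def)
  qed
  have s': "simple_function M (X' n)" for n
  proof -
    define g where "g = (\<lambda>c. X' n (SOME x. x \<in> space M \<and> itinerary Y (K n) x = c))"
    have "g (itinerary Y (K n) x) = X' n x" if "x \<in> space M" for x
      unfolding g_def by (rule dep) (metis (mono_tags, lifting) someI_ex that)
    moreover have "simple_function M (\<lambda>x. g (itinerary Y (K n) x))"
      using simple_function_compose[OF sy, of g] by (simp add: o_def)
    ultimately show ?thesis by (subst simple_function_cong[of M _ "\<lambda>x. g (itinerary Y (K n) x)"]) auto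
  qed
  have X'F: "X' n x \<in> F" for n x
  proof (cases "\<exists>!c. sel n x c")
    case True
    from theI'[OF this] have "(THE c. sel n x c) \<in> F" by (simp add: sel_def)
    then show ?thesis using True by (simp add: X'_def)
  qed (use x0 in \<open>auto simp: X'_def F_def\<close>)
  define e where "e = (\<lambda>n. measure M {x \<in> space M. X x \<noteq> X' n x})"
  have se: "{x \<in> space M. X x \<noteq> X' n x} \<in> sets M" for n
    using simple_function_level_set[OF simple_function_compose2[OF X s', of "(\<noteq>)"], of n True] by simp
  have e_le: "e n \<le> real (card F) * (1 / real (Suc n))" for n
  proof -
    define E where "E = (\<lambda>c. {x \<in> space M. (X x = c) \<noteq> (itinerary Y (L n c) x \<in> G n c)})"
    have sE: "E c \<in> sets M" for c
    proof -
      have "simple_function M (\<lambda>x. (X x, itinerary Y (L n c) x))" by (intro simple_function_Pair X sy)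
      from simple_function_level_set[OF simple_function_compose[OF this, of "\<lambda>(a, b). (a = c) \<noteq> (b \<in> G n c)"], of True]
      show ?thesis by (simp add: E_def o_def)
    qed
    \<comment> \<open>Outside the error sets \<open>E c\<close> the test of the true value is the
      only one to succeed, so the decoding is correct.\<close>
    have "{x \<in> space M. X x \<noteq> X' n x} \<subseteq> (\<Union>c\<in>F. E c)"
    proof (rule ccontr)
      assume "\<not> ?thesis"
      then obtain x where x: "x \<in> space M" "X x \<noteq> X' n x" "\<And>c. c \<in> F \<Longrightarrow> x \<notin> E c" by auto
      then have "sel n x = (\<lambda>c. c = X x)" by (intro ext iffI)
        (use x in \<open>force simp: sel_def E_def\<close>, use x in \<open>force simp: sel_def E_def F_def\<close>)
      then show False using x by (simp add: X'_def)
    qed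
    then have "e n \<le> measure M (\<Union>c\<in>F. E c)" unfolding e_def using finF sE by (intro finite_measure_mono) auto
    also have "\<dots> \<le> (\<Sum>c\<in>F. measure M (E c))" using finF sE by (intro finite_measure_subadditive_finite) auto
    also have "\<dots> \<le> (\<Sum>c\<in>F. 1 / real (Suc n))" unfolding E_def by (intro sum_mono less_imp_le LG)
    finally show ?thesis by simp
  qed
  have "(\<lambda>n. real (card F) * (1 / real (Suc n))) \<longlonglongrightarrow> real (card F) * 0"
    by (intro tendsto_mult tendsto_const LIMSEQ_Suc[OF lim_1_over_n])
  then have e0: "e \<longlonglongrightarrow> 0"
    by (intro tendsto_sandwich[OF _ _ tendsto_const, of 0 e]) (use e_le in \<open>auto simp: e_def\<close>)
  have t1: "(\<lambda>n. lent M (\<lambda>x. (X x, X' n x))) \<longlonglongrightarrow> lent M (\<lambda>x. (X x, X x))"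
    by (rule lent_tendsto[where H="F \<times> F" and S="\<lambda>n. {x \<in> space M. X x \<noteq> X' n x}"])
      (use finF X'F X s' se e0 in \<open>auto simp: F_def e_def intro!: simple_function_Pair\<close>)
  have t2: "(\<lambda>n. lent M (X' n)) \<longlonglongrightarrow> lent M X"
    by (rule lent_tendsto[where H=F and S="\<lambda>n. {x \<in> space M. X x \<noteq> X' n x}"])
      (use finF X'F X s' se e0 in \<open>auto simp: F_def e_def\<close>)
  have t3: "lent M (\<lambda>x. (X x, X x)) = lent M X" by (intro lent_eqI simple_function_Pair X) auto
  have "(\<lambda>n. rate Y + (lent M (\<lambda>x. (X x, X' n x)) - lent M (X' n))) \<longlonglongrightarrow> rate Y + (lent M X - lent M X)"
    using t1 t2 unfolding t3 by (intro tendsto_intros)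
  moreover have "rate X \<le> rate Y + (lent M (\<lambda>x. (X x, X' n x)) - lent M (X' n))" for n
  proof -
    have "lent M (\<lambda>x. (X x, itinerary Y (K n) x)) \<le> lent M (\<lambda>x. (X x, itinerary Y (K n) x, X' n x))"
      by (intro lent_mono simple_function_Pair X sy s') auto
    moreover have "lent M (\<lambda>x. (itinerary Y (K n) x, X' n x)) \<le> lent M (itinerary Y (K n))"
    proof (intro lent_mono sy)
      fix x y assume "itinerary Y (K n) x = itinerary Y (K n) y"
      then show "(itinerary Y (K n) x, X' n x) = (itinerary Y (K n) y, X' n y)" using dep[of n x y] by simp
    qed
    ultimately show ?thesis
      using lent_ssa(1)[OF X sy[of "K n"] s'[of n]] rate_le_relative[OF X Y, of "K n"] by linarith
  qed
  ultimately have "rate X \<le> rate Y + (lent M X - lent M X)" by (intro LIMSEQ_le_const) auto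
  then show ?thesis by simp
qed

definition block :: "'a set set \<Rightarrow> 'a \<Rightarrow> 'a set" where
  "block \<xi> x = (THE A. A \<in> \<xi> \<and> x \<in> A)"

lemma block:
  assumes "partition_on (space M) \<xi>" "x \<in> space M"
  shows "block \<xi> x \<in> \<xi>" "x \<in> block \<xi> x" "A \<in> \<xi> \<Longrightarrow> x \<in> A \<longleftrightarrow> block \<xi> x = A"
proof -
  have "\<exists>!A. A \<in> \<xi> \<and> x \<in> A"
    using assms by (auto simp: partition_on_def disjoint_def)
  from theI'[OF this] have b: "block \<xi> x \<in> \<xi>" "x \<in> block \<xi> x" unfolding block_def by auto
  then show "block \<xi> x \<in> \<xi>" "x \<in> block \<xi> x" "A \<in> \<xi> \<Longrightarrow> x \<in> A \<longleftrightarrow> block \<xi> x = A"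
    using \<open>\<exists>!A. A \<in> \<xi> \<and> x \<in> A\<close> by auto
qed

lemma simple_function_block:
  assumes "finite \<xi>" "\<xi> \<subseteq> sets M" "partition_on (space M) \<xi>"
  shows "simple_function M (block \<xi>)"
  unfolding simple_function_def
proof (intro conjI ballI)
  show "finite (block \<xi> ` space M)" using block(1)[OF assms(3)] by (intro finite_subset[OF _ assms(1)]) blast
  fix A assume "A \<in> block \<xi> ` space M"
  then have A: "A \<in> \<xi>" using block(1)[OF assms(3)] by blast
  then have sA: "A \<in> sets M" using assms(2) by blast
  have "block \<xi> -` {A} \<inter> space M = {x \<in> space M. x \<in> A}"
    using block(3)[OF assms(3) _ A] by blast
  also have "\<dots> = A" using sets.sets_into_space[OF sA] by blast
  finally show "block \<xi> -` {A} \<inter> space M \<in> sets M" using sA by simp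
qed

text \<open>Cells are indexed by possible itineraries. Two indices can give the same cell only if it
  is empty, and empty cells contribute 0 on both sides.\<close>

lemma partition_entropy_join:
  assumes \<xi>: "finite \<xi>" "\<xi> \<subseteq> sets M" "partition_on (space M) \<xi>"
  shows "partition_entropy M (partition_join M T \<xi> n) = lent M (itinerary (block \<xi>) n)"
proof -
  define P where "P = {..<n} \<rightarrow>\<^sub>E \<xi>"
  define S where "S = (\<lambda>C. {x \<in> space M. \<forall>j<n. (T ^^ j) x \<in> C j})"
  have finP: "finite P" unfolding P_def using \<xi> by (intro finite_PiE) auto
  have S: "S C = {x \<in> space M. itinerary (block \<xi>) n x = C}" if C: "C \<in> P" for C
  proof -
    have "C \<in> extensional {..<n}" "\<And>j. j < n \<Longrightarrow> C j \<in> \<xi>" using C by (auto simp: P_def PiE_def)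
    then show ?thesis unfolding itinerary_level_set[OF \<open>C \<in> extensional {..<n}\<close>] S_def
      using block(3)[OF \<xi>(3) funpow_space] by auto
  qed
  have "partition_entropy M (partition_join M T \<xi> n) = - (\<Sum>B\<in>S ` P. measure M B * ln (measure M B))"
    by (simp add: partition_entropy_def partition_join_def P_def S_def)
  also have "(\<Sum>B\<in>S ` P. measure M B * ln (measure M B)) = (\<Sum>C\<in>P. measure M (S C) * ln (measure M (S C)))"
  proof (subst sum.reindex_nontrivial[OF finP])
    fix C D assume CD: "C \<in> P" "D \<in> P" "C \<noteq> D" "S C = S D"
    then have "S C = {}" using S[OF CD(1)] S[OF CD(2)] by auto
    then show "measure M (S C) * ln (measure M (S C)) = 0" by simp
  qed simp
  also have "\<dots> = (\<Sum>C\<in>P. ldist M (itinerary (block \<xi>) n) C * ln (ldist M (itinerary (block \<xi>) n) C))"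
    using S by (intro sum.cong) (auto simp: ldist_def)
  also have "- \<dots> = lent M (itinerary (block \<xi>) n)"
    using itinerary_PiE[of _ "block \<xi>" \<xi> n] block(1)[OF \<xi>(3)] finP unfolding P_def
    by (subst lent_eq[of "{..<n} \<rightarrow>\<^sub>E \<xi>"]) (auto simp: shannon_def)
  finally show ?thesis .
qed

text \<open>The level sets of \<open>Y\<close> form an admissible partition, which bounds the
  supremum from below; \<open>rate_le_generator\<close> bounds the contribution of every partition
  from above.\<close>

lemma ks_entropy_generator:
  assumes Y: "simple_function M Y"
    and gen: "\<And>A \<epsilon>. A \<in> sets M \<Longrightarrow> 0 < \<epsilon> \<Longrightarrow>
      \<exists>L G. measure M {x \<in> space M. (x \<in> A) \<noteq> (itinerary Y L x \<in> G)} < (\<epsilon>::real)"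
  shows "ks_entropy M T = rate Y"
proof -
  define \<Xi> where "\<Xi> = {\<xi>. finite \<xi> \<and> \<xi> \<subseteq> sets M \<and> partition_on (space M) \<xi>}"
  have val: "lim (\<lambda>n. partition_entropy M (partition_join M T \<xi> n) / real n) = rate (block \<xi>)" if "\<xi> \<in> \<Xi>" for \<xi>
    using that by (simp add: partition_entropy_join \<Xi>_def rate_def)
  define \<xi>0 where "\<xi>0 = (\<lambda>c. {x \<in> space M. Y x = c}) ` (Y ` space M)"
  have \<xi>0: "\<xi>0 \<in> \<Xi>"
    unfolding \<Xi>_def
  proof (intro CollectI conjI)
    show "finite \<xi>0" unfolding \<xi>0_def by (intro finite_imageI simple_functionD(1)[OF Y])
    show "\<xi>0 \<subseteq> sets M" unfolding \<xi>0_def using simple_function_level_set[OF Y] by blast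
    show "partition_on (space M) \<xi>0" unfolding \<xi>0_def by (rule partition_onI) (auto simp: disjnt_def)
  qed
  have sb: "simple_function M (block \<xi>)" if "\<xi> \<in> \<Xi>" for \<xi> using that by (intro simple_function_block) (auto simp: \<Xi>_def)
  have b0: "block \<xi>0 x = block \<xi>0 y \<longleftrightarrow> Y x = Y y" if "x \<in> space M" "y \<in> space M" for x y
  proof -
    have p: "partition_on (space M) \<xi>0" using \<xi>0 by (simp add: \<Xi>_def)
    have S: "{z \<in> space M. Y z = Y x} \<in> \<xi>0" unfolding \<xi>0_def using that by blast
    have "block \<xi>0 x = {z \<in> space M. Y z = Y x}" using block(3)[OF p that(1) S] that by simp
    moreover have "Y y = Y x \<longleftrightarrow> block \<xi>0 y = {z \<in> space M. Y z = Y x}"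
      using block(3)[OF p that(2) S] that by simp
    ultimately show ?thesis by metis
  qed
  have "lent M (itinerary (block \<xi>0) n) = lent M (itinerary Y n)" for n
    using b0 funpow_space by (intro lent_eqI simple_function_itinerary sb \<xi>0 Y) (auto simp: itinerary_eq_iff)
  then have r0: "rate (block \<xi>0) = rate Y" by (simp add: rate_def)
  have "(SUP \<xi>\<in>\<Xi>. ereal (lim (\<lambda>n. partition_entropy M (partition_join M T \<xi> n) / real n))) = ereal (rate Y)"
  proof (rule antisym)
    show "(SUP \<xi>\<in>\<Xi>. ereal (lim (\<lambda>n. partition_entropy M (partition_join M T \<xi> n) / real n))) \<le> ereal (rate Y)"
      using rate_le_generator[OF sb Y gen] by (intro SUP_least) (simp add: val)
    show "ereal (rate Y) \<le> (SUP \<xi>\<in>\<Xi>. ereal (lim (\<lambda>n. partition_entropy M (partition_join M T \<xi> n) / real n)))"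
      using \<xi>0 by (intro SUP_upper2[OF \<xi>0]) (simp add: val r0)
  qed
  then show ?thesis by (simp add: ks_entropy_def \<Xi>_def)
qed

end

section \<open>Invariant measures on the full shift\<close>

lemma finite_words: "finite A \<Longrightarrow> finite {w \<in> lists A. length w = n}"
  using finite_lists_length_eq[of A n] by (simp add: lists_eq_set)

lemma set_stakeD: "y \<in> set (stake n x) \<Longrightarrow> x \<in> streams A \<Longrightarrow> y \<in> A"
  using stake_lists[of x A n] by auto

lemma simple_function_stake:
  assumes A: "finite A" and sets: "sets \<nu> = sets (full_shift A)"
  shows "simple_function \<nu> (stake n)"
  unfolding simple_function_def
proof (intro conjI ballI)
  have sp: "space \<nu> = streams A" using sets_eq_imp_space_eq[OF sets] by (simp add: space_stream_space)
  have "stake n ` space \<nu> \<subseteq> {w \<in> lists A. length w = n}" using stake_lists sp by auto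
  then show "finite (stake n ` space \<nu>)" using finite_words[OF A] finite_subset by blast
  fix w assume "w \<in> stake n ` space \<nu>"
  then have w: "w \<in> lists A" "length w = n" using stake_lists sp by auto
  have "stake n -` {w} \<inter> space \<nu> = sstart A w" unfolding sstart_eq_stake[OF w(1)] w(2) sp by auto
  then show "stake n -` {w} \<inter> space \<nu> \<in> sets \<nu>" using sstart_sets_full_shift[OF A w(1)] sets by simp
qed

lemma ldist_stake:
  assumes sets: "sets \<nu> = sets (full_shift A)" and w: "w \<in> lists A"
  shows "ldist \<nu> (stake (length w)) w = measure \<nu> (sstart A w)"
proof -
  have "space \<nu> = streams A" using sets_eq_imp_space_eq[OF sets] by (simp add: space_stream_space)
  then show ?thesis by (simp add: ldist_def sstart_eq_stake[OF w])
qed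

text \<open>The sets that can be approximated by events depending on finitely many letters contain
  the cylinders and are closed under complements, finite unions and, by continuity of the measure,
  countable unions.\<close>

lemma cylinder_approx:
  fixes M :: "'a stream measure"
  assumes "prob_space M" and A: "finite A" and sets: "sets M = sets (full_shift A)"
    and E: "E \<in> sets M" and \<epsilon>: "0 < (\<epsilon>::real)"
  shows "\<exists>L W. measure M {x \<in> space M. (x \<in> E) \<noteq> (stake L x \<in> W)} < \<epsilon>"
proof -
  interpret prob_space M by fact
  have sp: "space M = streams A" using sets_eq_imp_space_eq[OF sets] by (simp add: space_stream_space)
  have cyl: "{x \<in> space M. stake L x \<in> W} \<in> sets M" for L W
    using simple_functionD(2)[OF simple_function_stake[OF A sets], of L W]
    by (simp add: vimage_def Collect_conj_eq Int_commute)
  have dm: "{x \<in> space M. (x \<in> E) \<noteq> (stake L x \<in> W)} \<in> sets M" if "E \<in> sets M" for E L W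
  proof -
    have "{x \<in> space M. (x \<in> E) \<noteq> (stake L x \<in> W)}
       = (E - {x \<in> space M. stake L x \<in> W}) \<union> ({x \<in> space M. stake L x \<in> W} - E)"
      using sets.sets_into_space[OF that] by auto
    also have "\<dots> \<in> sets M" using that cyl by auto
    finally show ?thesis .
  qed
  define P where "P = (\<lambda>E. E \<in> sets M \<and> (\<forall>\<epsilon>>0. \<exists>L W. measure M {x \<in> space M. (x \<in> E) \<noteq> (stake L x \<in> W)} < \<epsilon>))"
  have PI: "P E" if "E \<in> sets M" "\<And>x. x \<in> space M \<Longrightarrow> x \<in> E \<longleftrightarrow> stake L x \<in> W" for E L W
  proof -
    have "{x \<in> space M. (x \<in> E) \<noteq> (stake L x \<in> W)} = {}" using that by auto
    then have "measure M {x \<in> space M. (x \<in> E) \<noteq> (stake L x \<in> W)} = 0" by (simp only: measure_empty)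
    then have "measure M {x \<in> space M. (x \<in> E) \<noteq> (stake L x \<in> W)} < \<epsilon>" if "0 < \<epsilon>" for \<epsilon>
      using that by (simp only:)
    then show ?thesis unfolding P_def using that(1) by blast
  qed
  have PD: "\<exists>L W. measure M {x \<in> space M. (x \<in> E) \<noteq> (stake L x \<in> W)} < \<epsilon>" if "P E" "0 < \<epsilon>" for E and \<epsilon> :: real
    using that unfolding P_def by blast
  have PUn: "P (E \<union> F)" if E: "P E" and F: "P F" for E F
    unfolding P_def
  proof (intro conjI allI impI)
    show EF: "E \<union> F \<in> sets M" using E F by (auto simp: P_def)
    fix \<epsilon> :: real assume "0 < \<epsilon>"
    then have "0 < \<epsilon> / 2" by simp
    from PD[OF E this] obtain L1 W1 where 1: "measure M {x \<in> space M. (x \<in> E) \<noteq> (stake L1 x \<in> W1)} < \<epsilon> / 2" by blast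
    from PD[OF F \<open>0 < \<epsilon> / 2\<close>] obtain L2 W2 where 2: "measure M {x \<in> space M. (x \<in> F) \<noteq> (stake L2 x \<in> W2)} < \<epsilon> / 2" by blast
    \<comment> \<open>Both approximations are read off the longer of the two prefixes through
      \<open>take\<close>.\<close>
    define L where "L = max L1 L2"
    define W where "W = {w. take L1 w \<in> W1 \<or> take L2 w \<in> W2}"
    have tk: "take L1 (stake L x) = stake L1 x" "take L2 (stake L x) = stake L2 x" for x
      by (auto simp: L_def take_stake min_def)
    have "measure M {x \<in> space M. (x \<in> E \<union> F) \<noteq> (stake L x \<in> W)}
      \<le> measure M ({x \<in> space M. (x \<in> E) \<noteq> (stake L1 x \<in> W1)} \<union> {x \<in> space M. (x \<in> F) \<noteq> (stake L2 x \<in> W2)})"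
      using E F by (intro finite_measure_mono sets.Un dm) (auto simp: W_def tk P_def)
    also have "\<dots> \<le> measure M {x \<in> space M. (x \<in> E) \<noteq> (stake L1 x \<in> W1)} + measure M {x \<in> space M. (x \<in> F) \<noteq> (stake L2 x \<in> W2)}"
      using E F by (intro measure_Un_le dm) (auto simp: P_def)
    finally show "\<exists>L W. measure M {x \<in> space M. (x \<in> E \<union> F) \<noteq> (stake L x \<in> W)} < \<epsilon>"
      using 1 2 by (intro exI[of _ L] exI[of _ W]) simp
  qed
  have P0: "P {}" by (rule PI[of _ 0 "{}"]) auto
  have eqs: "sets M = sigma_sets (streams A) (sstart A ` lists A \<union> {{}})"
  proof -
    have "sstart A ` lists A \<union> {{}} \<subseteq> Pow (streams A)" using sstart_in_streams[of _ A] by blast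
    then show ?thesis unfolding sets using sets_stream_space_sstart[of A] A by (simp add: countable_finite)
  qed
  have "P E" if "E \<in> sigma_sets (streams A) (sstart A ` lists A \<union> {{}})" for E
    using that
  proof (induction rule: sigma_sets.induct)
    case (Basic E)
    then consider w where "w \<in> lists A" "E = sstart A w" | "E = {}" by blast
    then show ?case
    proof cases
      case 1
      then show ?thesis using sstart_sets_full_shift[OF A 1(1)]
        by (intro PI[of _ "length w" "{w}"]) (auto simp: sets sp sstart_eq_stake)
    qed (simp add: P0)
  next
    case Empty then show ?case by (rule P0)
  next
    case (Compl E)
    show ?case unfolding P_def
    proof (intro conjI allI impI)
      show "streams A - E \<in> sets M" using Compl by (auto simp: P_def simp flip: sp)
      fix \<epsilon> :: real assume "0 < \<epsilon>"
      then obtain L W where "measure M {x \<in> space M. (x \<in> E) \<noteq> (stake L x \<in> W)} < \<epsilon>" using Compl by (auto simp: P_def)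
      moreover have "{x \<in> space M. (x \<in> streams A - E) \<noteq> (stake L x \<in> - W)} = {x \<in> space M. (x \<in> E) \<noteq> (stake L x \<in> W)}"
        using sp by auto
      ultimately have "measure M {x \<in> space M. (x \<in> streams A - E) \<noteq> (stake L x \<in> - W)} < \<epsilon>" by simp
      then show "\<exists>L W. measure M {x \<in> space M. (x \<in> streams A - E) \<noteq> (stake L x \<in> W)} < \<epsilon>" by blast
    qed
  next
    case (Union E)
    define F where "F = (\<lambda>k. \<Union>i<k. E i)"
    have PF: "P (F k)" for k
      by (induction k) (simp_all add: F_def P0 lessThan_Suc PUn Union.IH)
    have sE: "E i \<in> sets M" for i using Union.IH by (auto simp: P_def)
    show ?case unfolding P_def
    proof (intro conjI allI impI)
      show SE: "\<Union> (range E) \<in> sets M" using sE by auto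
      fix \<epsilon> :: real assume \<epsilon>: "0 < \<epsilon>"
      have "(\<lambda>k. measure M (F k)) \<longlonglongrightarrow> measure M (\<Union>k. F k)"
        proof (rule finite_Lim_measure_incseq)
        show "range F \<subseteq> sets M" using PF by (auto simp: P_def)
        show "incseq F" unfolding incseq_def F_def by (intro allI impI UN_mono) auto
      qed
      moreover have "(\<Union>k. F k) = \<Union> (range E)" by (auto simp: F_def)
      ultimately have "(\<lambda>k. measure M (F k)) \<longlonglongrightarrow> measure M (\<Union> (range E))" by simp
      then obtain k where k: "\<bar>measure M (F k) - measure M (\<Union> (range E))\<bar> < \<epsilon> / 2"
        using LIMSEQ_D[of _ _ "\<epsilon> / 2"] \<epsilon> by (metis half_gt_zero order_refl real_norm_def)
      obtain L W where LW: "measure M {x \<in> space M. (x \<in> F k) \<noteq> (stake L x \<in> W)} < \<epsilon> / 2"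
        using PD[OF PF[of k], of "\<epsilon> / 2"] \<epsilon> by auto
      have sF: "F k \<in> sets M" using PF by (simp add: P_def)
      have sub: "F k \<subseteq> \<Union> (range E)" by (auto simp: F_def)
      have "measure M {x \<in> space M. (x \<in> \<Union> (range E)) \<noteq> (stake L x \<in> W)}
        \<le> measure M ({x \<in> space M. (x \<in> F k) \<noteq> (stake L x \<in> W)} \<union> (\<Union> (range E) - F k))"
        using sub by (intro finite_measure_mono sets.Un dm sF sets.Diff SE) auto
      also have "\<dots> \<le> measure M {x \<in> space M. (x \<in> F k) \<noteq> (stake L x \<in> W)} + measure M (\<Union> (range E) - F k)"
        by (intro measure_Un_le dm sF sets.Diff SE)
      also have "measure M (\<Union> (range E) - F k) = measure M (\<Union> (range E)) - measure M (F k)"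
        by (intro finite_measure_Diff SE sF sub)
      finally show "\<exists>L W. measure M {x \<in> space M. (x \<in> \<Union> (range E)) \<noteq> (stake L x \<in> W)} < \<epsilon>"
        using k LW by (intro exI[of _ L] exI[of _ W]) (simp add: abs_if split: if_splits)
    qed
  qed
  then have "P E" using E eqs by simp
  then show ?thesis using \<epsilon> by (simp add: P_def)
qed

lemma funpow_stl: "(stl ^^ n) x = sdrop n x"
  by (induction n arbitrary: x) (simp_all add: funpow_swap1)

lemma invariant_measuresD:
  assumes "\<nu> \<in> invariant_measures B"
  shows "sets \<nu> = sets (full_shift B)" "space \<nu> = streams B" "prob_space \<nu>" "measure_preserving \<nu> stl"
proof -
  show s: "sets \<nu> = sets (full_shift B)" and p: "prob_space \<nu>" using assms by (auto simp: invariant_measures_def)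
  show "space \<nu> = streams B" using sets_eq_imp_space_eq[OF s] by (simp add: space_stream_space)
  have "stl \<in> measurable \<nu> \<nu>" unfolding measurable_cong_sets[OF s s] using measurable_stl by simp
  then show "measure_preserving \<nu> stl" using assms p
    by (simp add: measure_preserving_def measure_preserving_axioms_def invariant_measures_def)
qed

lemma simple_function_shd:
  assumes "finite B" "\<nu> \<in> invariant_measures B"
  shows "simple_function \<nu> shd"
proof -
  have "simple_function \<nu> (\<lambda>x. hd (stake 1 x))"
    using simple_function_compose[OF simple_function_stake[OF assms(1) invariant_measuresD(1)[OF assms(2)], of 1], of hd]
    by (simp add: o_def)
  then show ?thesis by simp
qed

text \<open>The first letter is a generator, and its itinerary of length \<open>n\<close> carries
  the same information as the prefix of length \<open>n\<close>.\<close>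

theorem ks_entropy_full_shift:
  assumes B: "finite B" and \<nu>: "\<nu> \<in> invariant_measures B"
  shows "(\<lambda>n. lent \<nu> (stake n) / real n) \<longlonglongrightarrow> ks_entropy \<nu> stl"
    and "1 \<le> m \<Longrightarrow> ks_entropy \<nu> stl \<le> lent \<nu> (stake m) / real m"
proof -
  note D = invariant_measuresD[OF \<nu>]
  interpret measure_preserving \<nu> stl by (rule D(4))
  have s: "simple_function \<nu> shd" by (rule simple_function_shd[OF B \<nu>])
  have it: "itinerary shd n x = itinerary shd n y \<longleftrightarrow> stake n x = stake n y" for n x y
    unfolding itinerary_eq_iff
    by (auto simp: funpow_stl list_eq_iff_nth_eq)
  have l: "lent \<nu> (itinerary shd n) = lent \<nu> (stake n)" for n
    by (intro lent_eqI simple_function_itinerary s simple_function_stake[OF B D(1)] it)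
  have "ks_entropy \<nu> stl = rate shd"
  proof (rule ks_entropy_generator[OF s])
    fix E and \<epsilon> :: real assume "E \<in> sets \<nu>" "0 < \<epsilon>"
    then obtain L W where LW: "measure \<nu> {x \<in> space \<nu>. (x \<in> E) \<noteq> (stake L x \<in> W)} < \<epsilon>"
      using cylinder_approx[OF prob_space_axioms B D(1)] by blast
    define G where "G = itinerary shd L ` {y. stake L y \<in> W}"
    have "itinerary shd L x \<in> G \<longleftrightarrow> stake L x \<in> W" for x
    proof
      assume "itinerary shd L x \<in> G"
      then obtain y where "itinerary shd L x = itinerary shd L y" "stake L y \<in> W" by (auto simp: G_def)
      then show "stake L x \<in> W" using it[of L x y] by simp
    qed (simp add: G_def)
    then have "measure \<nu> {x \<in> space \<nu>. (x \<in> E) \<noteq> (itinerary shd L x \<in> G)} < \<epsilon>" using LW by simp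
    then show "\<exists>L G. measure \<nu> {x \<in> space \<nu>. (x \<in> E) \<noteq> (itinerary shd L x \<in> G)} < \<epsilon>" by blast
  qed
  then show "(\<lambda>n. lent \<nu> (stake n) / real n) \<longlonglongrightarrow> ks_entropy \<nu> stl"
    "1 \<le> m \<Longrightarrow> ks_entropy \<nu> stl \<le> lent \<nu> (stake m) / real m"
    using rate[OF s] l by simp_all
qed

section \<open>Bernoulli measures and the entropy bound by the one-letter marginal\<close>

definition bernoulli :: "'a set \<Rightarrow> ('a \<Rightarrow> real) \<Rightarrow> 'a stream measure \<Rightarrow> bool" where
  "bernoulli B q \<nu> \<longleftrightarrow> sets \<nu> = sets (full_shift B) \<and>
     (\<forall>w\<in>lists B. emeasure \<nu> (sstart B w) = ennreal (prod_list (map q w)))"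

lemma prod_list_nonneg_real: "(\<And>x. x \<in> set xs \<Longrightarrow> 0 \<le> (x::real)) \<Longrightarrow> 0 \<le> prod_list xs"
  by (induction xs) auto

lemma bernoulli_exists:
  assumes B: "finite B" and q: "q \<in> prob_vec B"
  shows "\<exists>\<nu>. bernoulli B q \<nu>"
proof -
  have "B \<noteq> {}" using q by (auto simp: prob_vec_def)
  moreover have "prod_list (map q w) = (\<Sum>a\<in>B. prod_list (map q (w @ [a])))" for w
    using prob_vecD(3)[OF q B] by (simp flip: sum_distrib_left)
  moreover have "0 \<le> prod_list (map q w)" for w
    by (rule prod_list_nonneg_real) (use prob_vecD(1)[OF q B] in auto)
  ultimately show ?thesis unfolding bernoulli_def
    using stream_measure_exists[OF B, of "\<lambda>w. prod_list (map q w)"] by blast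
qed

lemma bernoulli_unique:
  assumes B: "finite B" and "bernoulli B q \<mu>" "bernoulli B q \<nu>"
  shows "\<mu> = \<nu>"
proof (rule stream_measure_eqI[OF B])
  have "emeasure \<mu> (sstart B []) = ennreal (prod_list (map q []))" using assms(2) unfolding bernoulli_def by blast
  then show "emeasure \<mu> (streams B) \<noteq> \<infinity>" by simp
qed (use assms in \<open>auto simp: bernoulli_def simp del: in_listsD in_lists_conv_set\<close>)

lemma bernoulliD:
  assumes "bernoulli B q \<nu>" "finite B" "q \<in> prob_vec B"
  shows "sets \<nu> = sets (full_shift B)" "space \<nu> = streams B" "prob_space \<nu>"
    "w \<in> lists B \<Longrightarrow> measure \<nu> (sstart B w) = prod_list (map q w)"
proof -
  show s: "sets \<nu> = sets (full_shift B)" using assms by (simp add: bernoulli_def)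
  show sp: "space \<nu> = streams B" using sets_eq_imp_space_eq[OF s] by (simp add: space_stream_space)
  have "emeasure \<nu> (sstart B []) = ennreal (prod_list (map q []))" using assms(1) unfolding bernoulli_def by blast
  then show "prob_space \<nu>" using sp by (intro prob_spaceI) simp
  have "0 \<le> prod_list (map q w)"
    by (rule prod_list_nonneg_real) (use prob_vecD(1)[OF assms(3,2)] in auto)
  then show "w \<in> lists B \<Longrightarrow> measure \<nu> (sstart B w) = prod_list (map q w)"
    using assms(1) by (simp add: bernoulli_def measure_def)
qed

lemma bernoulliI:
  assumes "sets \<nu> = sets (full_shift B)" "finite_measure \<nu>"
    and "\<And>w. w \<in> lists B \<Longrightarrow> measure \<nu> (sstart B w) = prod_list (map q w)"
  shows "bernoulli B q \<nu>"
  using assms by (simp add: bernoulli_def finite_measure.emeasure_eq_measure)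

text \<open>The preimage of the cylinder of \<open>w\<close> is the disjoint union of the cylinders
  of the words \<open>v\<close> with \<open>map f v = w\<close>; summing the product weights letter
  by letter gives the product of the fibre sums.\<close>

lemma bernoulli_image:
  assumes b: "bernoulli B q \<nu>" and B: "finite B" and C: "finite C" and f: "f ` B \<subseteq> C" and q: "q \<in> prob_vec B"
  shows "bernoulli C (pushv B f q) (distr \<nu> (full_shift C) (smap f))"
proof (rule bernoulliI)
  note D = bernoulliD[OF b B q]
  interpret prob_space \<nu> by (rule D(3))
  have m: "smap f \<in> measurable \<nu> (full_shift C)"
    unfolding measurable_cong_sets[OF D(1) refl] by (rule measurable_smap) (use f in auto)
  then show "finite_measure (distr \<nu> (full_shift C) (smap f))" by (rule finite_measure_distr)
  show "sets (distr \<nu> (full_shift C) (smap f)) = sets (full_shift C)" by simp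
  fix w assume w: "w \<in> lists C"
  define V where "V = (\<lambda>w. {v \<in> lists B. map f v = w})"
  have finV: "finite (V w)" for w
    by (rule finite_subset[OF _ finite_words[OF B, of "length w"]]) (auto simp: V_def)
  have "smap f -` sstart C w \<inter> space \<nu> = (\<Union>v\<in>V w. sstart B v)"
  proof (intro set_eqI iffI)
    fix x assume x: "x \<in> smap f -` sstart C w \<inter> space \<nu>"
    then have "stake (length w) x \<in> V w" using D(2)
      by (auto simp: V_def sstart_eq_stake[OF w] dest: set_stakeD)
    moreover have "x \<in> sstart B (stake (length w) x)"
      using x D(2) by (subst sstart_eq_stake) (auto dest: set_stakeD)
    ultimately show "x \<in> (\<Union>v\<in>V w. sstart B v)" by blast
  next
    fix x assume "x \<in> (\<Union>v\<in>V w. sstart B v)"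
    then obtain v where v: "v \<in> lists B" "map f v = w" "x \<in> sstart B v" by (auto simp: V_def)
    then have x: "x \<in> streams B" "stake (length v) x = v" by (auto simp: sstart_eq_stake)
    moreover have "smap f x \<in> streams C" using smap_streams[of x B f C] x f by auto
    ultimately show "x \<in> smap f -` sstart C w \<inter> space \<nu>"
      using v D(2) by (auto simp: sstart_eq_stake[OF w])
  qed
  then have "measure (distr \<nu> (full_shift C) (smap f)) (sstart C w) = measure \<nu> (\<Union>v\<in>V w. sstart B v)"
    using sstart_sets_full_shift[OF C w] by (subst measure_distr[OF m]) auto
  also have "\<dots> = (\<Sum>v\<in>V w. measure \<nu> (sstart B v))"
  proof (rule finite_measure_finite_Union[OF finV])
    show "sstart B ` V w \<subseteq> sets \<nu>" using sstart_sets_full_shift[OF B] D(1) by (auto simp: V_def)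
    show "disjoint_family_on (sstart B) (V w)"
      unfolding disjoint_family_on_def
    proof (intro ballI impI)
      fix u v assume "u \<in> V w" "v \<in> V w" "u \<noteq> v"
      then have "length u = length v" "u \<in> lists B" "v \<in> lists B" by (auto simp: V_def dest: map_eq_imp_length_eq)
      then show "sstart B u \<inter> sstart B v = {}" using \<open>u \<noteq> v\<close> by (auto simp: sstart_eq_stake)
    qed
  qed
  also have "\<dots> = (\<Sum>v\<in>V w. prod_list (map q v))" by (intro sum.cong refl D(4)) (auto simp: V_def)
  also have "\<dots> = prod_list (map (pushv B f q) w)"
  proof (induction w)
    case Nil
    have "V [] = {[]}" by (auto simp: V_def)
    then show ?case by simp
  next
    case (Cons c w)
    have "V (c # w) = (\<lambda>(b, v). b # v) ` ({b\<in>B. f b = c} \<times> V w)"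
      by (auto simp: V_def Cons_eq_map_conv image_iff)
    then have "(\<Sum>v\<in>V (c # w). prod_list (map q v)) = (\<Sum>(b, v)\<in>{b\<in>B. f b = c} \<times> V w. q b * prod_list (map q v))"
      by (simp add: sum.reindex inj_on_def case_prod_unfold)
    also have "\<dots> = pushv B f q c * (\<Sum>v\<in>V w. prod_list (map q v))"
      by (simp add: pushv_def sum_product sum.cartesian_product)
    finally show ?case using Cons by simp
  qed
  finally show "measure (distr \<nu> (full_shift C) (smap f)) (sstart C w) = prod_list (map (pushv B f q) w)" .
qed

lemma bernoulli_invariant:
  assumes b: "bernoulli B q \<nu>" and B: "finite B" and q: "q \<in> prob_vec B"
  shows "\<nu> \<in> invariant_measures B"
proof -
  note D = bernoulliD[OF b B q]
  interpret prob_space \<nu> by (rule D(3))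
  have m: "stl \<in> measurable \<nu> \<nu>" unfolding measurable_cong_sets[OF D(1) D(1)] using measurable_stl by simp
  have "bernoulli B q (distr \<nu> \<nu> stl)"
  proof (rule bernoulliI)
    show "sets (distr \<nu> \<nu> stl) = sets (full_shift B)" using D(1) by simp
    show "finite_measure (distr \<nu> \<nu> stl)" using m by (rule finite_measure_distr)
    fix w assume w: "w \<in> lists B"
    have "stl -` sstart B w \<inter> space \<nu> = (\<Union>a\<in>B. sstart B (a # w))"
    proof (intro set_eqI)
      fix x
      have "x \<in> streams B" if "shd x \<in> B" "stl x \<in> sstart B w"
        using that sstart_in_streams[OF w] by (metis streams_Stream stream.collapse subsetD)
      then show "x \<in> stl -` sstart B w \<inter> space \<nu> \<longleftrightarrow> x \<in> (\<Union>a\<in>B. sstart B (a # w))"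
        using D(2) by (auto dest: streams_shd)
    qed
    then have "measure (distr \<nu> \<nu> stl) (sstart B w) = measure \<nu> (\<Union>a\<in>B. sstart B (a # w))"
      using sstart_sets_full_shift[OF B w] D(1) by (subst measure_distr[OF m]) auto
    also have "\<dots> = (\<Sum>a\<in>B. measure \<nu> (sstart B (a # w)))"
      using w D(1) B
      by (intro finite_measure_finite_Union) (auto simp: disjoint_family_on_def simp del: sstart.simps intro!: sstart_sets_full_shift)
    also have "\<dots> = (\<Sum>a\<in>B. q a * prod_list (map q w))"
      using w by (intro sum.cong refl) (subst D(4), auto)
    also have "\<dots> = prod_list (map q w)" using prob_vecD(3)[OF q B] by (simp flip: sum_distrib_right)
    finally show "measure (distr \<nu> \<nu> stl) (sstart B w) = prod_list (map q w)" .
  qed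
  then have "distr \<nu> \<nu> stl = \<nu>" using bernoulli_unique[OF B] b by blast
  then show ?thesis using D by (simp add: invariant_measures_def)
qed

lemma xlnx_mult: "0 \<le> x \<Longrightarrow> 0 \<le> y \<Longrightarrow> (x * y) * ln (x * y) = y * (x * ln x) + x * (y * ln (y::real))"
  by (cases "x = 0 \<or> y = 0") (auto simp: ln_mult algebra_simps)

lemma bernoulli_lent_stake:
  assumes b: "bernoulli B q \<nu>" and B: "finite B" and q: "q \<in> prob_vec B"
  shows "lent \<nu> (stake n) = real n * shannon B q"
proof -
  note D = bernoulliD[OF b B q]
  interpret prob_space \<nu> by (rule D(3))
  define H where "H = (\<lambda>n. {w \<in> lists B. length w = n})"
  have fin: "finite (H n)" for n unfolding H_def by (rule finite_words[OF B])
  have HS: "H (Suc n) = (\<lambda>(b, v). b # v) ` (B \<times> H n)" for n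
    by (auto simp: H_def length_Suc_conv image_iff)
  define g where "g = (\<lambda>w. prod_list (map q w))"
  have g0: "0 \<le> g w" for w unfolding g_def by (rule prod_list_nonneg_real) (use prob_vecD(1)[OF q B] in auto)
  have tot: "(\<Sum>w\<in>H n. g w) = 1" for n
  proof (induction n)
    case 0
    have "H 0 = {[]}" by (auto simp: H_def)
    then show ?case by (simp add: g_def)
  next
    case (Suc n)
    have "(\<Sum>w\<in>H (Suc n). g w) = (\<Sum>(b, v)\<in>B \<times> H n. q b * g v)"
      unfolding HS by (simp add: sum.reindex inj_on_def case_prod_unfold g_def)
    also have "\<dots> = sum q B * sum g (H n)" by (simp add: sum_product sum.cartesian_product)
    finally show ?case using Suc prob_vecD(3)[OF q B] by simp
  qed
  have "lent \<nu> (stake n) = shannon (H n) (ldist \<nu> (stake n))"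
    using fin by (intro lent_eq) (auto simp: H_def D(2) dest: set_stakeD)
  also have "\<dots> = shannon (H n) g"
    unfolding shannon_def
  proof (intro arg_cong[where f=uminus] sum.cong refl)
    fix w assume "w \<in> H n"
    then have "ldist \<nu> (stake n) w = g w"
      using ldist_stake[OF D(1), of w] D(4)[of w] by (auto simp: H_def g_def)
    then show "ldist \<nu> (stake n) w * ln (ldist \<nu> (stake n) w) = g w * ln (g w)" by simp
  qed
  also have "shannon (H n) g = real n * shannon B q"
  proof (induction n)
    case 0
    have "H 0 = {[]}" by (auto simp: H_def)
    then show ?case by (simp add: shannon_def g_def)
  next
    case (Suc n)
    have "(\<Sum>w\<in>H (Suc n). g w * ln (g w)) = (\<Sum>(b, v)\<in>B \<times> H n. (q b * g v) * ln (q b * g v))"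
      unfolding HS by (simp add: sum.reindex inj_on_def case_prod_unfold g_def)
    also have "\<dots> = (\<Sum>(b, v)\<in>B \<times> H n. g v * (q b * ln (q b)) + q b * (g v * ln (g v)))"
      using g0 prob_vecD(1)[OF q B] by (simp only: xlnx_mult)
    also have "\<dots> = (\<Sum>b\<in>B. \<Sum>v\<in>H n. q b * ln (q b) * g v) + (\<Sum>b\<in>B. \<Sum>v\<in>H n. q b * (g v * ln (g v)))"
      by (simp add: sum.distrib case_prod_unfold sum.cartesian_product mult.commute)
    also have "\<dots> = (\<Sum>b\<in>B. q b * ln (q b)) * (\<Sum>v\<in>H n. g v) + (\<Sum>b\<in>B. q b) * (\<Sum>v\<in>H n. g v * ln (g v))"
      by (simp only: sum_product)
    finally show ?case using Suc tot prob_vecD(3)[OF q B] by (simp add: shannon_def algebra_simps)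
  qed
  finally show ?thesis .
qed

lemma bernoulli_ks_entropy:
  assumes b: "bernoulli B q \<nu>" and B: "finite B" and q: "q \<in> prob_vec B"
  shows "ks_entropy \<nu> stl = shannon B q"
proof (rule LIMSEQ_unique[OF ks_entropy_full_shift(1)[OF B bernoulli_invariant[OF b B q]]])
  have "\<forall>\<^sub>F n in sequentially. shannon B q = lent \<nu> (stake n) / real n"
    using eventually_gt_at_top[of 0] by eventually_elim (simp add: bernoulli_lent_stake[OF b B q])
  then show "(\<lambda>n. lent \<nu> (stake n) / real n) \<longlonglongrightarrow> shannon B q"
    by (rule Lim_transform_eventually[OF tendsto_const])
qed

lemma ldist_shd:
  assumes "sets \<nu> = sets (full_shift B)" "b \<in> B"
  shows "ldist \<nu> shd b = measure \<nu> (sstart B [b])"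
proof -
  have "space \<nu> = streams B" using sets_eq_imp_space_eq[OF assms(1)] by (simp add: space_stream_space)
  moreover have "{x \<in> streams B. shd x = b} = sstart B [b]" using assms(2) by (subst sstart_eq_stake) auto
  ultimately show ?thesis by (simp add: ldist_def)
qed

lemma ldist_shd_prob_vec:
  assumes B: "finite B" and \<nu>: "\<nu> \<in> invariant_measures B"
  shows "ldist \<nu> shd \<in> prob_vec B"
proof -
  interpret prob_space \<nu> by (rule invariant_measuresD(3)[OF \<nu>])
  show ?thesis using B invariant_measuresD(2)[OF \<nu>]
    by (intro ldist_prob_vec simple_function_shd[OF B \<nu>]) (auto dest: streams_shd)
qed

lemma bernoulli_ldist_shd:
  assumes b: "bernoulli B q \<nu>" and B: "finite B" and q: "q \<in> prob_vec B"
  shows "ldist \<nu> shd = q"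
proof
  fix c
  show "ldist \<nu> shd c = q c"
  proof (cases "c \<in> B")
    case True
    then show ?thesis using ldist_shd[OF bernoulliD(1)[OF b B q] True] bernoulliD(4)[OF b B q, of "[c]"] by simp
  next
    case False
    then show ?thesis using prob_vecD(4)[OF q B] prob_vecD(4)[OF ldist_shd_prob_vec[OF B bernoulli_invariant[OF b B q]] B] by simp
  qed
qed

text \<open>Subadditivity gives h \<le> H(n letters) / n \<le> H(1 letter). If the two ends agree,
  everything between is tight: each new letter is independent of the preceding word, and the measure
  is a product. This equality case later yields uniqueness of the equilibrium state.\<close>

theorem ks_entropy_le_marginal:
  assumes B: "finite B" and \<nu>: "\<nu> \<in> invariant_measures B"
  defines "q \<equiv> ldist \<nu> shd"
  shows "ks_entropy \<nu> stl \<le> shannon B q"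
    and "ks_entropy \<nu> stl = shannon B q \<Longrightarrow> bernoulli B q \<nu>"
proof -
  note D = invariant_measuresD[OF \<nu>]
  interpret measure_preserving \<nu> stl by (rule D(4))
  note ss = simple_function_stake[OF B D(1)] and sh = simple_function_shd[OF B \<nu>]
  have h1: "lent \<nu> shd = shannon B q" unfolding q_def using D(2) B by (intro lent_eq) (auto dest: streams_shd)
  have "lent \<nu> (stake 1) = lent \<nu> shd" by (intro lent_eqI ss sh) simp
  then show "ks_entropy \<nu> stl \<le> shannon B q" using ks_entropy_full_shift(2)[OF B \<nu>, of 1] h1 by simp
  assume eq: "ks_entropy \<nu> stl = shannon B q"
  define Xn where "Xn = (\<lambda>n (x :: 'a stream). shd ((stl ^^ n) x))"
  have sX: "simple_function \<nu> (Xn n)" for n unfolding Xn_def by (intro simple_function_funpow sh)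
  have lX: "lent \<nu> (Xn n) = shannon B q" "ldist \<nu> (Xn n) = q" for n
    unfolding Xn_def using lent_funpow[OF sh] ldist_funpow[OF sh] h1 by (auto simp: q_def)
  have stS: "stake (Suc n) x = w @ [a] \<longleftrightarrow> stake n x = w \<and> Xn n x = a" if "length w = n" for n x w a
    using that by (auto simp: stake_Suc Xn_def funpow_stl simp del: stake.simps(2))
  have pair: "lent \<nu> (stake (Suc n)) = lent \<nu> (\<lambda>x. (stake n x, Xn n x))" for n
    by (intro lent_eqI simple_function_Pair ss sX)
      (auto simp: stake_Suc Xn_def funpow_stl simp del: stake.simps(2))
  have up: "lent \<nu> (stake (Suc n)) \<le> lent \<nu> (stake n) + shannon B q" for n
    unfolding pair using lent_subadd(1)[OF ss[of n] sX[of n]] lX by simp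
  have lo: "real n * shannon B q \<le> lent \<nu> (stake n)" for n
    using ks_entropy_full_shift(2)[OF B \<nu>, of n] eq lent_nonneg[of "stake n"] by (cases "n = 0") (auto simp: field_simps)
  have st: "lent \<nu> (stake n) = real n * shannon B q" for n
  proof (induction n)
    case 0
    have "stake 0 ` space \<nu> = {[]}" using not_empty by auto
    then show ?case by (simp add: lent_def shannon_def ldist_def prob_space)
  next
    case (Suc n) then show ?case using up[of n] lo[of "Suc n"] by (simp add: algebra_simps del: stake.simps(2))
  qed
  have ind: "ldist \<nu> (\<lambda>x. (stake n x, Xn n x)) (w, a) = ldist \<nu> (stake n) w * q a" for n w a
    using lent_subadd(2)[OF ss[of n] sX[of n], of w a] lX st[of n] st[of "Suc n"] pair[of n]
    by (simp add: algebra_simps)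
  have "ldist \<nu> (stake (length w)) w = prod_list (map q w)" for w
  proof (induction w rule: rev_induct)
    case Nil then show ?case by (simp add: ldist_def prob_space)
  next
    case (snoc a w)
    have "ldist \<nu> (stake (length (w @ [a]))) (w @ [a]) = ldist \<nu> (\<lambda>x. (stake (length w) x, Xn (length w) x)) (w, a)"
      unfolding ldist_def using stS[of w "length w" _ a] by (simp del: stake.simps(2))
    then show ?case using ind snoc by (simp del: stake.simps(2))
  qed
  then show "bernoulli B q \<nu>"
    using ldist_stake[OF D(1)] by (intro bernoulliI D(1)) (auto simp: finite_measure_axioms)
qed

lemma invariant_image:
  assumes B: "finite B" and C: "finite C" and f: "f ` B \<subseteq> C" and \<nu>: "\<nu> \<in> invariant_measures B"
  defines "\<nu>' \<equiv> distr \<nu> (full_shift C) (smap f)"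
  shows "\<nu>' \<in> invariant_measures C" "ldist \<nu>' shd = pushv B f (ldist \<nu> shd)"
proof -
  note D = invariant_measuresD[OF \<nu>]
  interpret measure_preserving \<nu> stl by (rule D(4))
  have m: "smap f \<in> measurable \<nu> (full_shift C)"
    unfolding measurable_cong_sets[OF D(1) refl] by (rule measurable_smap) (use f in auto)
  have ms: "stl \<in> measurable (full_shift C) (full_shift C)" using measurable_stl by simp
  have "distr \<nu>' \<nu>' stl = distr \<nu>' (full_shift C) stl" by (rule distr_cong) (auto simp: \<nu>'_def)
  also have "\<dots> = distr \<nu> (full_shift C) (stl \<circ> smap f)" unfolding \<nu>'_def by (rule distr_distr[OF ms m])
  also have "stl \<circ> smap f = smap f \<circ> stl" by auto
  also have "distr \<nu> (full_shift C) (smap f \<circ> stl) = distr (distr \<nu> \<nu> stl) (full_shift C) (smap f)"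
    by (rule distr_distr[symmetric, OF m T_meas])
  also have "\<dots> = \<nu>'" using T_inv by (simp add: \<nu>'_def)
  finally show inv: "\<nu>' \<in> invariant_measures C"
    using prob_space_distr[OF m] by (simp add: invariant_measures_def \<nu>'_def)
  have sh: "shd ` space \<nu> \<subseteq> B" using D(2) by (auto dest: streams_shd)
  show "ldist \<nu>' shd = pushv B f (ldist \<nu> shd)"
  proof
    fix c
    have "{x \<in> space \<nu>'. shd x = c} \<in> sets (full_shift C)"
      using simple_function_level_set[OF simple_function_shd[OF C inv], of c] by (simp add: \<nu>'_def)
    then have "ldist \<nu>' shd c = measure \<nu> (smap f -` {x \<in> space \<nu>'. shd x = c} \<inter> space \<nu>)"
      unfolding ldist_def by (subst \<nu>'_def) (rule measure_distr[OF m])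
    also have "smap f -` {x \<in> space \<nu>'. shd x = c} \<inter> space \<nu> = {x \<in> space \<nu>. f (shd x) = c}"
      using measurable_space[OF m] by (auto simp: \<nu>'_def)
    also have "measure \<nu> \<dots> = ldist \<nu> (\<lambda>x. f (shd x)) c" by (simp add: ldist_def)
    also have "\<dots> = pushv B f (ldist \<nu> shd) c"
      by (subst ldist_comp[OF simple_function_shd[OF B \<nu>] B sh]) (rule refl)
    finally show "ldist \<nu>' shd c = pushv B f (ldist \<nu> shd) c" .
  qed
qed

section \<open>Mandelbrot cascades\<close>

text \<open>Canonical model: \<open>D\<close> is the law of one weight vector, and the tree of
  weights is a product of copies of \<open>D\<close> over all words. Mandelbrot weights on a given
  probability space are compared with it through their law.\<close>

locale cascade =
  fixes A :: "'a set" and D :: "('a \<Rightarrow> real) measure"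
  assumes finA: "finite A" and D_prob: "prob_space D" and sets_D: "sets D = sets (PiM A (\<lambda>_. borel))"
    and int_D: "\<And>a. a \<in> A \<Longrightarrow> integrable D (\<lambda>w. max 0 (w a))"
    and mean_D: "(\<Sum>a\<in>A. \<integral>w. max 0 (w a) \<partial>D) = 1"
begin

sublocale D: prob_space D by (rule D_prob)

sublocale PP: product_prob_space "\<lambda>_::'a list. D" "lists A"
  by (simp add: product_prob_space_def product_prob_space_axioms_def product_sigma_finite_def D_prob prob_space_imp_sigma_finite)

definition L :: "('a list \<Rightarrow> 'a \<Rightarrow> real) measure" where "L = PiM (lists A) (\<lambda>_. D)"

sublocale L: prob_space L unfolding L_def by (rule PP.P.prob_space_axioms)

sublocale LA: product_prob_space "\<lambda>_::'a. L" A
  by (simp add: product_prob_space_def product_prob_space_axioms_def product_sigma_finite_def L.prob_space_axioms prob_space_imp_sigma_finite)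

text \<open>Weights are truncated at \<open>0\<close>, so that non-negativity holds everywhere and not only almost surely.\<close>

definition pw :: "'a \<Rightarrow> ('a \<Rightarrow> real) \<Rightarrow> real" where "pw a w = max 0 (w a)"
definition p :: "'a \<Rightarrow> real" where "p a = (\<integral>w. pw a w \<partial>D)"
definition shf :: "'a list \<Rightarrow> ('a list \<Rightarrow> 'a \<Rightarrow> real) \<Rightarrow> 'a list \<Rightarrow> 'a \<Rightarrow> real" where
  "shf u x = (\<lambda>v\<in>lists A. x (u @ v))"
definition qp :: "('a list \<Rightarrow> 'a \<Rightarrow> real) \<Rightarrow> 'a list \<Rightarrow> real" where
  "qp x v = (\<Prod>j<length v. pw (v ! j) (x (take j v)))"
definition words :: "nat \<Rightarrow> 'a list set" where "words n = {v \<in> lists A. length v = n}"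
definition ms :: "('a list \<Rightarrow> 'a \<Rightarrow> real) \<Rightarrow> nat \<Rightarrow> real" where "ms x n = (\<Sum>v\<in>words n. qp x v)"
definition lm :: "('a list \<Rightarrow> 'a \<Rightarrow> real) \<Rightarrow> real" where "lm x = lim (ms x)"

lemma pw_nonneg: "0 \<le> pw a w" by (simp add: pw_def)

lemma measurable_pw[measurable]: "a \<in> A \<Longrightarrow> pw a \<in> borel_measurable D"
  unfolding pw_def measurable_cong_sets[OF sets_D refl] by measurable

lemma int_pw: "a \<in> A \<Longrightarrow> integrable D (pw a)"
  using int_D by (simp add: pw_def[abs_def])

lemma p_nonneg: "0 \<le> p a" unfolding p_def by (intro Bochner_Integration.integral_nonneg) (simp add: pw_nonneg)

lemma sum_p: "(\<Sum>a\<in>A. p a) = 1" using mean_D by (simp add: p_def pw_def)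

lemma nn_pw: "a \<in> A \<Longrightarrow> (\<integral>\<^sup>+w. ennreal (pw a w) \<partial>D) = ennreal (p a)"
  unfolding p_def using int_pw by (intro nn_integral_eq_integral) (auto simp: pw_nonneg)

lemma words_Suc: "words (Suc n) = (\<lambda>(a, v). a # v) ` (A \<times> words n)"
  by (auto simp: words_def length_Suc_conv image_iff)

lemma words_Suc': "words (Suc n) = (\<lambda>(v, a). v @ [a]) ` (words n \<times> A)"
proof (intro set_eqI iffI)
  fix w assume "w \<in> words (Suc n)"
  then have "w \<noteq> []" "w \<in> lists A" "length w = Suc n" by (auto simp: words_def)
  then have "w = butlast w @ [last w]" "butlast w \<in> words n" "last w \<in> A"
    by (auto simp: words_def dest: in_set_butlastD)
  then show "w \<in> (\<lambda>(v, a). v @ [a]) ` (words n \<times> A)" by (metis (no_types, lifting) SigmaI case_prod_conv imageI)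
qed (auto simp: words_def)

lemma measurable_coord[measurable]: "v \<in> lists A \<Longrightarrow> (\<lambda>x. x v) \<in> measurable L D"
  unfolding L_def by (rule measurable_component_singleton)

lemma measurable_qp[measurable]:
  assumes "v \<in> lists A"
  shows "(\<lambda>x. qp x v) \<in> borel_measurable L"
  unfolding qp_def
proof (intro borel_measurable_prod)
  fix j assume "j \<in> {..<length v}"
  then have "v ! j \<in> A" "take j v \<in> lists A" using assms by (auto dest: in_set_takeD)
  then show "(\<lambda>x. pw (v ! j) (x (take j v))) \<in> borel_measurable L"
    by (intro measurable_compose[OF measurable_coord measurable_pw])
qed

lemma measurable_ms[measurable]: "(\<lambda>x. ms x n) \<in> borel_measurable L"
  unfolding ms_def by (intro borel_measurable_sum measurable_qp) (auto simp: words_def)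

lemma measurable_lm[measurable]: "lm \<in> borel_measurable L"
  unfolding lm_def[abs_def] by (rule borel_measurable_lim_metric) measurable

lemma measurable_shf[measurable]: "u \<in> lists A \<Longrightarrow> shf u \<in> measurable L L"
  unfolding shf_def[abs_def] by (subst (2) L_def) (rule measurable_restrict, auto intro!: measurable_coord)

lemma distr_shf:
  assumes "u \<in> lists A"
  shows "distr L L (shf u) = L"
proof -
  have "distr (PiM (lists A) (\<lambda>_. D)) (PiM (lists A) (\<lambda>_. D)) (\<lambda>\<omega>. \<lambda>n\<in>lists A. \<omega> (u @ n)) = PiM (lists A) (\<lambda>_. D)"
    by (rule distr_PiM_reindex[where M="\<lambda>_. D" and f="\<lambda>v. u @ v"]) (use assms D_prob in \<open>auto simp: inj_on_def\<close>)
  then show ?thesis unfolding L_def shf_def[abs_def] .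
qed

lemma qp_nonneg: "0 \<le> qp x v" unfolding qp_def by (intro prod_nonneg) (simp add: pw_nonneg)

lemma ms_nonneg: "0 \<le> ms x n" unfolding ms_def by (intro sum_nonneg) (simp add: qp_nonneg)

lemma qp_Nil[simp]: "qp x [] = 1" by (simp add: qp_def)

lemma qp_Cons:
  assumes "a \<in> A" "v \<in> lists A"
  shows "qp x (a # v) = pw a (x []) * qp (shf [a] x) v"
proof -
  have "take j v \<in> lists A" for j using assms by (auto dest: in_set_takeD)
  then show ?thesis unfolding qp_def shf_def using assms
    by (simp add: prod.lessThan_Suc_shift del: prod.lessThan_Suc)
qed

lemma qp_snoc: "qp x (v @ [a]) = qp x v * pw a (x v)"
proof -
  have "(\<Prod>j<length v. pw ((v @ [a]) ! j) (x (take j (v @ [a])))) = (\<Prod>j<length v. pw (v ! j) (x (take j v)))"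
    by (intro prod.cong) (auto simp: nth_append)
  then show ?thesis by (simp add: qp_def)
qed

lemma ms_0[simp]: "ms x 0 = 1"
proof -
  have "words 0 = {[]}" by (auto simp: words_def)
  then show ?thesis by (simp add: ms_def)
qed

lemma ms_Suc: "ms x (Suc n) = (\<Sum>a\<in>A. pw a (x []) * ms (shf [a] x) n)"
proof -
  have "ms x (Suc n) = (\<Sum>(a, v)\<in>A \<times> words n. qp x (a # v))"
    unfolding ms_def words_Suc by (simp add: sum.reindex inj_on_def case_prod_unfold)
  also have "\<dots> = (\<Sum>(a, v)\<in>A \<times> words n. pw a (x []) * qp (shf [a] x) v)"
    by (intro sum.cong refl) (auto simp: words_def intro!: qp_Cons)
  finally show ?thesis by (simp add: ms_def sum_distrib_left sum.cartesian_product)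
qed

lemma ms_Suc': "ms x (Suc n) = (\<Sum>v\<in>words n. qp x v * (\<Sum>a\<in>A. pw a (x v)))"
proof -
  have "ms x (Suc n) = (\<Sum>(v, a)\<in>words n \<times> A. qp x (v @ [a]))"
    unfolding ms_def words_Suc' by (simp add: sum.reindex inj_on_def case_prod_unfold)
  then show ?thesis by (simp add: qp_snoc sum_distrib_left sum.cartesian_product)
qed

text \<open>Inverse of splitting a tree into its root vector \<open>x []\<close> and the subtrees
  \<open>shf [a] x\<close>.\<close>

definition glue :: "('a \<Rightarrow> real) \<times> ('a \<Rightarrow> 'a list \<Rightarrow> 'a \<Rightarrow> real) \<Rightarrow> 'a list \<Rightarrow> 'a \<Rightarrow> real" where
  "glue z = (\<lambda>v\<in>lists A. case v of [] \<Rightarrow> fst z | a # v' \<Rightarrow> snd z a v')"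

abbreviation "LL \<equiv> PiM A (\<lambda>_. L)"

lemma measurable_glue[measurable]: "glue \<in> measurable (D \<Otimes>\<^sub>M LL) L"
  unfolding glue_def[abs_def]
proof (subst (2) L_def, rule measurable_restrict)
  fix v assume v: "v \<in> lists A"
  show "(\<lambda>z. case v of [] \<Rightarrow> fst z | a # v' \<Rightarrow> snd z a v') \<in> measurable (D \<Otimes>\<^sub>M LL) D"
  proof (cases v)
    case (Cons a v')
    then have "a \<in> A" "v' \<in> lists A" using v by auto
    then have "(\<lambda>z. snd z a v') \<in> measurable (D \<Otimes>\<^sub>M LL) D"
      by (intro measurable_compose[OF measurable_snd]
          measurable_compose[OF measurable_component_singleton[where M="\<lambda>_. L"] measurable_coord])
    then show ?thesis using Cons by simp
  qed simp
qed

text \<open>Branching property: an independent root vector and independent subtrees, glued together,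
  have the law of the whole tree. It is checked on finite rectangles, whose factors are sorted by
  the first letter of the word.\<close>

lemma distr_glue: "distr (D \<Otimes>\<^sub>M LL) L glue = L"
  unfolding L_def[symmetric]
proof -
  have "distr (D \<Otimes>\<^sub>M LL) L glue = PiM (lists A) (\<lambda>_. D)"
  proof (rule PP.PiM_eq)
    show "sets (distr (D \<Otimes>\<^sub>M LL) L glue) = sets (PiM (lists A) (\<lambda>_. D))" by (simp add: L_def)
  next
    fix J :: "'a list set" and F assume J: "finite J" "J \<subseteq> lists A" and F: "\<And>j. j \<in> J \<Longrightarrow> F j \<in> sets D"
    \<comment> \<open>\<open>Ja a\<close> collects the constraints on the subtree of
      \<open>a\<close>, and \<open>F0\<close> the one at the root, which is the whole space if the
      rectangle leaves the root free.\<close>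
    define Ja where "Ja = (\<lambda>a. {v. a # v \<in> J})"
    define E where "E = (\<lambda>a. {x \<in> space L. \<forall>v\<in>Ja a. x v \<in> F (a # v)})"
    define F0 where "F0 = (if [] \<in> J then F [] else space D)"
    have Ja: "finite (Ja a)" for a
    proof -
      have "Ja a = (\<lambda>v. a # v) -` J" by (auto simp: Ja_def)
      then show ?thesis using J by (simp add: finite_vimageI inj_def)
    qed
    have Ja': "Ja a \<subseteq> lists A" for a using J by (auto simp: Ja_def)
    have sF: "F (a # v) \<in> sets D" if "v \<in> Ja a" for a v using F that by (auto simp: Ja_def)
    have eE: "emeasure L (E a) = (\<Prod>v\<in>Ja a. emeasure D (F (a # v)))" for a
      unfolding E_def L_def using Ja Ja' sF by (intro PP.emeasure_PiM_Collect) auto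
    have sE: "E a \<in> sets L" for a
    proof -
      have "E a = {x \<in> space L. \<forall>v\<in>Ja a. x v \<in> F (a # v)}" by (simp add: E_def)
      also have "\<dots> \<in> sets L"
      proof (rule sets.sets_Collect_finite_All[OF _ Ja])
        fix v assume v: "v \<in> Ja a"
        then have "v \<in> lists A" using Ja' by auto
        then show "{x \<in> space L. x v \<in> F (a # v)} \<in> sets L"
          using measurable_sets[OF measurable_coord sF[OF v], of v] by (simp add: vimage_def Int_def conj_commute)
      qed
      finally show ?thesis .
    qed
    have sF0: "F0 \<in> sets D" using F by (auto simp: F0_def)
    have "glue -` prod_emb (lists A) (\<lambda>_. D) J (Pi\<^sub>E J F) \<inter> space (D \<Otimes>\<^sub>M LL) = F0 \<times> Pi\<^sub>E A E"
    proof (intro set_eqI iffI)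
      fix z assume z: "z \<in> glue -` prod_emb (lists A) (\<lambda>_. D) J (Pi\<^sub>E J F) \<inter> space (D \<Otimes>\<^sub>M LL)"
      obtain w y where wy: "z = (w, y)" by (cases z)
      have sp: "w \<in> space D" "y \<in> A \<rightarrow>\<^sub>E space L" using z wy by (auto simp: space_pair_measure space_PiM)
      have F: "glue z j \<in> F j" if "j \<in> J" for j
      proof -
        have "restrict (glue z) J \<in> Pi\<^sub>E J F" using z by (simp add: prod_emb_def)
        then have "restrict (glue z) J j \<in> F j" using that by (rule PiE_mem)
        then show ?thesis using that by simp
      qed
      have "w \<in> F0" using F[of "[]"] sp(1) by (simp add: F0_def glue_def wy)
      moreover have "y a \<in> E a" if "a \<in> A" for a
      proof -
        have "y a v \<in> F (a # v)" if "v \<in> Ja a" for v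
        proof -
          have "a # v \<in> J" "a # v \<in> lists A" using that J by (auto simp: Ja_def)
          then show ?thesis using F[of "a # v"] by (simp add: glue_def wy)
        qed
        then show ?thesis using PiE_mem[OF sp(2) that] by (simp add: E_def)
      qed
      ultimately show "z \<in> F0 \<times> Pi\<^sub>E A E" using sp wy by (auto simp: PiE_iff)
    next
      fix z assume z: "z \<in> F0 \<times> Pi\<^sub>E A E"
      then obtain w y where wy: "z = (w, y)" "w \<in> F0" "y \<in> Pi\<^sub>E A E" by auto
      have sp: "z \<in> space (D \<Otimes>\<^sub>M LL)"
        using wy sets.sets_into_space[OF sF0] by (auto simp: space_pair_measure space_PiM PiE_iff E_def)
      have "glue z j \<in> F j" if "j \<in> J" for j
        using that wy J by (cases j) (auto simp: glue_def F0_def E_def Ja_def PiE_iff)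
      moreover have "glue z \<in> space L" using measurable_space[OF measurable_glue sp] .
      ultimately show "z \<in> glue -` prod_emb (lists A) (\<lambda>_. D) J (Pi\<^sub>E J F) \<inter> space (D \<Otimes>\<^sub>M LL)"
        using sp by (auto simp: prod_emb_def L_def space_PiM)
    qed
    then have "emeasure (distr (D \<Otimes>\<^sub>M LL) L glue) (prod_emb (lists A) (\<lambda>_. D) J (Pi\<^sub>E J F)) = emeasure (D \<Otimes>\<^sub>M LL) (F0 \<times> Pi\<^sub>E A E)"
    proof (subst emeasure_distr[OF measurable_glue])
      show "prod_emb (lists A) (\<lambda>_. D) J (Pi\<^sub>E J F) \<in> sets L"
        unfolding L_def using F J by (intro sets_PiM_I) auto
    qed (rule arg_cong)
    also have "\<dots> = emeasure D F0 * emeasure LL (Pi\<^sub>E A E)"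
      using sE sF0 finA by (intro LA.P.emeasure_pair_measure_Times sets_PiM_I_finite) auto
    also have "emeasure LL (Pi\<^sub>E A E) = (\<Prod>a\<in>A. \<Prod>v\<in>Ja a. emeasure D (F (a # v)))"
      using finA sE by (subst LA.emeasure_PiM) (auto simp: eE)
    also have "\<dots> = (\<Prod>(a, v)\<in>(SIGMA a:A. Ja a). emeasure D (F (a # v)))"
      using finA Ja by (intro prod.Sigma) auto
    also have "\<dots> = (\<Prod>j\<in>J - {[]}. emeasure D (F j))"
    proof -
      have "(\<lambda>(a, v). a # v) ` (SIGMA a:A. Ja a) = J - {[]}"
      proof (intro set_eqI iffI)
        fix j assume j: "j \<in> J - {[]}"
        then obtain a v where "j = a # v" by (cases j) auto
        then show "j \<in> (\<lambda>(a, v). a # v) ` (SIGMA a:A. Ja a)" using j J by (force simp: Ja_def)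
      qed (auto simp: Ja_def)
      then have "(\<Prod>j\<in>J - {[]}. emeasure D (F j)) = (\<Prod>j\<in>(\<lambda>(a, v). a # v) ` (SIGMA a:A. Ja a). emeasure D (F j))" by simp
      also have "\<dots> = (\<Prod>(a, v)\<in>(SIGMA a:A. Ja a). emeasure D (F (a # v)))"
        by (subst prod.reindex) (auto simp: inj_on_def case_prod_unfold)
      finally show ?thesis by simp
    qed
    also have "emeasure D F0 * \<dots> = (\<Prod>j\<in>J. emeasure D (F j))"
      using J by (cases "[] \<in> J") (auto simp: F0_def D.emeasure_space_1 prod.remove)
    finally show "emeasure (distr (D \<Otimes>\<^sub>M LL) L glue) (prod_emb (lists A) (\<lambda>_. D) J (Pi\<^sub>E J F)) = (\<Prod>j\<in>J. emeasure D (F j))" .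
  qed
  then show "distr (D \<Otimes>\<^sub>M LL) L glue = L" by (simp add: L_def)
qed

lemma glue_Nil: "glue (w, y) [] = w" by (simp add: glue_def)

lemma glue_shf:
  assumes "y \<in> space LL" "a \<in> A"
  shows "shf [a] (glue (w, y)) = y a"
proof -
  have "y a \<in> space L" using assms by (auto simp: space_PiM)
  then have "y a \<in> extensional (lists A)" by (simp add: L_def space_PiM PiE_iff)
  then show ?thesis using assms by (auto simp: shf_def glue_def fun_eq_iff extensional_def)
qed

text \<open>Under \<open>L\<close> the root vector and the subtrees are independent. The recursions
  for means, fractional moments and Laplace transforms below are special cases of this
  formula.\<close>

lemma nn_integral_branch:
  assumes f[measurable]: "f \<in> borel_measurable (D \<Otimes>\<^sub>M LL)"
  shows "(\<integral>\<^sup>+x. f (x [], \<lambda>a\<in>A. shf [a] x) \<partial>L) = (\<integral>\<^sup>+w. \<integral>\<^sup>+y. f (w, y) \<partial>LL \<partial>D)"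
proof -
  have [measurable]: "(\<lambda>x. (x [], \<lambda>a\<in>A. shf [a] x)) \<in> measurable L (D \<Otimes>\<^sub>M LL)"
    by (intro measurable_Pair measurable_restrict) (auto intro!: measurable_coord measurable_shf)
  have "(\<integral>\<^sup>+x. f (x [], \<lambda>a\<in>A. shf [a] x) \<partial>L) = (\<integral>\<^sup>+x. f (x [], \<lambda>a\<in>A. shf [a] x) \<partial>distr (D \<Otimes>\<^sub>M LL) L glue)"
    by (simp add: distr_glue)
  also have "\<dots> = (\<integral>\<^sup>+z. f (glue z [], \<lambda>a\<in>A. shf [a] (glue z)) \<partial>(D \<Otimes>\<^sub>M LL))"
    by (subst nn_integral_distr) auto
  also have "\<dots> = (\<integral>\<^sup>+z. f z \<partial>(D \<Otimes>\<^sub>M LL))"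
  proof (rule nn_integral_cong)
    fix z assume z: "z \<in> space (D \<Otimes>\<^sub>M LL)"
    then obtain w y where wy: "z = (w, y)" "y \<in> space LL" by (auto simp: space_pair_measure)
    then have "(\<lambda>a\<in>A. shf [a] (glue z)) = y"
      using glue_shf[OF wy(2)] by (auto simp: fun_eq_iff space_PiM PiE_iff extensional_def)
    then show "f (glue z [], \<lambda>a\<in>A. shf [a] (glue z)) = f z" by (simp add: wy glue_Nil)
  qed
  also have "\<dots> = (\<integral>\<^sup>+w. \<integral>\<^sup>+y. f (w, y) \<partial>LL \<partial>D)"
    by (rule LA.P.nn_integral_fst[symmetric]) measurable
  finally show ?thesis .
qed

lemma nn_integral_branch_one:
  assumes a: "a \<in> A" and g[measurable]: "g \<in> borel_measurable D" and h[measurable]: "h \<in> borel_measurable L"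
  shows "(\<integral>\<^sup>+x. g (x []) * h (shf [a] x) \<partial>L) = (\<integral>\<^sup>+w. g w \<partial>D) * (\<integral>\<^sup>+x. h x \<partial>L)"
proof -
  have [measurable]: "(\<lambda>y. y a) \<in> measurable LL L" using a by (rule measurable_component_singleton)
  have "(\<integral>\<^sup>+x. g (x []) * h (shf [a] x) \<partial>L) = (\<integral>\<^sup>+x. (\<lambda>z. g (fst z) * h (snd z a)) (x [], \<lambda>a\<in>A. shf [a] x) \<partial>L)"
    using a by simp
  also have "\<dots> = (\<integral>\<^sup>+w. \<integral>\<^sup>+y. g w * h (y a) \<partial>LL \<partial>D)"
    by (subst nn_integral_branch) simp_all
  also have "\<dots> = (\<integral>\<^sup>+w. g w * (\<integral>\<^sup>+y. h (y a) \<partial>LL) \<partial>D)"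
    by (intro nn_integral_cong nn_integral_cmult) measurable
  also have "(\<integral>\<^sup>+y. h (y a) \<partial>LL) = (\<integral>\<^sup>+x. h x \<partial>distr LL L (\<lambda>y. y a))"
    by (subst nn_integral_distr) auto
  also have "distr LL L (\<lambda>y. y a) = L" using LA.PiM_component[OF a] .
  finally show ?thesis by (simp add: nn_integral_multc)
qed

lemma nn_integral_branch_prod:
  assumes f: "\<And>a. a \<in> A \<Longrightarrow> f a \<in> borel_measurable (D \<Otimes>\<^sub>M L)"
  shows "(\<integral>\<^sup>+x. (\<Prod>a\<in>A. f a (x [], shf [a] x)) \<partial>L) = (\<integral>\<^sup>+w. (\<Prod>a\<in>A. \<integral>\<^sup>+x. f a (w, x) \<partial>L) \<partial>D)"
proof -
  have m: "(\<lambda>z. f a (fst z, snd z a)) \<in> borel_measurable (D \<Otimes>\<^sub>M LL)" if "a \<in> A" for a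
    by (rule measurable_compose[OF _ f[OF that]])
      (use that in \<open>intro measurable_Pair measurable_fst measurable_compose[OF measurable_snd measurable_component_singleton]\<close>)
  have "(\<integral>\<^sup>+x. (\<Prod>a\<in>A. f a (x [], shf [a] x)) \<partial>L) = (\<integral>\<^sup>+x. (\<lambda>z. \<Prod>a\<in>A. f a (fst z, snd z a)) (x [], \<lambda>a\<in>A. shf [a] x) \<partial>L)"
    by (intro nn_integral_cong) (simp cong: prod.cong)
  also have "\<dots> = (\<integral>\<^sup>+w. \<integral>\<^sup>+y. (\<Prod>a\<in>A. f a (w, y a)) \<partial>LL \<partial>D)"
    using m by (subst nn_integral_branch) simp_all
  also have "\<dots> = (\<integral>\<^sup>+w. (\<Prod>a\<in>A. \<integral>\<^sup>+x. f a (w, x) \<partial>L) \<partial>D)"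
  proof (rule nn_integral_cong)
    fix w assume "w \<in> space D"
    then show "(\<integral>\<^sup>+y. (\<Prod>a\<in>A. f a (w, y a)) \<partial>LL) = (\<Prod>a\<in>A. \<integral>\<^sup>+x. f a (w, x) \<partial>L)"
      using f by (intro LA.product_nn_integral_prod finA) (auto intro: measurable_Pair_compose_split measurable_Pair2)
  qed
  finally show ?thesis .
qed

lemma prod_list_p_nonneg: "0 \<le> prod_list (map p v)"
  by (rule prod_list_nonneg_real) (auto simp: p_nonneg)

lemma nn_integral_qp:
  assumes "v \<in> lists A"
  shows "(\<integral>\<^sup>+x. ennreal (qp x v) \<partial>L) = ennreal (prod_list (map p v))"
  using assms
proof (induction v)
  case Nil then show ?case by (simp add: L.emeasure_space_1)
next
  case (Cons a v)
  then have a: "a \<in> A" "v \<in> lists A" by auto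
  have "(\<integral>\<^sup>+x. ennreal (qp x (a # v)) \<partial>L) = (\<integral>\<^sup>+x. ennreal (pw a (x [])) * ennreal (qp (shf [a] x) v) \<partial>L)"
    by (simp add: qp_Cons a ennreal_mult pw_nonneg qp_nonneg)
  also have "\<dots> = ennreal (p a) * ennreal (prod_list (map p v))"
    using a by (subst nn_integral_branch_one) (auto simp: nn_pw Cons.IH)
  also have "\<dots> = ennreal (prod_list (map p (a # v)))"
    by (simp add: ennreal_mult p_nonneg prod_list_p_nonneg)
  finally show ?case .
qed

lemma integrable_qp: "v \<in> lists A \<Longrightarrow> integrable L (\<lambda>x. qp x v)"
  by (rule integrableI_nonneg) (auto simp: qp_nonneg nn_integral_qp)

lemma integrable_ms: "integrable L (\<lambda>x. ms x n)"
  unfolding ms_def by (intro Bochner_Integration.integrable_sum integrable_qp) (auto simp: words_def)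

lemma AE_shf: "u \<in> lists A \<Longrightarrow> AE x in L. P x \<Longrightarrow> AE x in L. P (shf u x)"
proof -
  assume u: "u \<in> lists A" and "AE x in L. P x"
  then have "AE x in distr L L (shf u). P x" by (simp only: distr_shf[OF u])
  then show ?thesis by (rule AE_distrD[OF measurable_shf[OF u]])
qed

text \<open>The filtration of the martingale: generation \<open>n\<close> uses only the weights
  attached to words of length below \<open>n\<close>.\<close>

definition prefix_algebra :: "nat \<Rightarrow> ('a list \<Rightarrow> 'a \<Rightarrow> real) measure" where
  "prefix_algebra n = vimage_algebra (space L) (\<lambda>x. restrict x {v \<in> lists A. length v < n}) (PiM {v \<in> lists A. length v < n} (\<lambda>_. D))"

lemma measurable_restrict_prefix:
  "(\<lambda>x. restrict x {v \<in> lists A. length v < n}) \<in> measurable L (PiM {v \<in> lists A. length v < n} (\<lambda>_. D))"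
  unfolding L_def by (rule measurable_restrict_subset) auto

lemma subalgebra_prefix: "subalgebra L (prefix_algebra n)"
  unfolding prefix_algebra_def subalgebra_def
  using sets_image_in_sets[OF refl measurable_restrict_prefix[of n]] by simp

lemma measurable_coord_prefix:
  assumes "v \<in> lists A" "length v < n"
  shows "(\<lambda>x. x v) \<in> measurable (prefix_algebra n) D"
proof -
  let ?K = "{v \<in> lists A. length v < n}"
  have 1: "(\<lambda>x. restrict x ?K) \<in> measurable (prefix_algebra n) (PiM ?K (\<lambda>_. D))"
    unfolding prefix_algebra_def
    by (rule measurable_vimage_algebra1) (use measurable_space[OF measurable_restrict_prefix] in auto)
  have "(\<lambda>x. (restrict x ?K) v) \<in> measurable (prefix_algebra n) D"
    using assms by (intro measurable_compose[OF 1] measurable_component_singleton) auto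
  then show ?thesis using assms by simp
qed

lemma indep_coords: "L.indep_vars (\<lambda>_. D) (\<lambda>v x. x v) (lists A)"
proof (subst L.indep_vars_iff_distr_eq_PiM')
  have "distr L (PiM (lists A) (\<lambda>_. D)) (\<lambda>x. \<lambda>v\<in>lists A. x v) = distr L L (\<lambda>x. x)"
    by (rule distr_cong) (auto simp: L_def space_PiM fun_eq_iff PiE_iff extensional_def)
  also have "\<dots> = L" by (rule distr_id2) simp
  also have "\<dots> = PiM (lists A) (\<lambda>v. distr L D (\<lambda>x. x v))"
    unfolding L_def by (intro PiM_cong refl) (simp add: PP.PiM_component)
  finally show "distr L (PiM (lists A) (\<lambda>_. D)) (\<lambda>x. \<lambda>v\<in>lists A. x v) = PiM (lists A) (\<lambda>v. distr L D (\<lambda>x. x v))" .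
qed (auto intro: measurable_coord)

text \<open>The weight vectors at words of length \<open>n\<close> are independent of
  \<open>prefix_algebra n\<close>, and the entries of each have total mean 1.\<close>

lemma ms_martingale:
  assumes B: "B \<in> sets (prefix_algebra n)"
  shows "(\<integral>x\<in>B. ms x (Suc n) \<partial>L) = (\<integral>x\<in>B. ms x n \<partial>L)"
proof -
  let ?K = "{v \<in> lists A. length v < n}"
  obtain C where C: "C \<in> sets (PiM ?K (\<lambda>_. D))" and BC: "B = (\<lambda>x. restrict x ?K) -` C \<inter> space L"
    using B unfolding prefix_algebra_def
    by (subst (asm) sets_vimage_algebra2) (use measurable_space[OF measurable_restrict_prefix] in auto)
  have BL: "B \<in> sets L" using B subalgebra_prefix by (auto simp: subalgebra_def)
  have key: "integrable L (\<lambda>x. indicator B x * qp x v * (\<Sum>a\<in>A. pw a (x v)))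
    \<and> (\<integral>x. indicator B x * qp x v * (\<Sum>a\<in>A. pw a (x v)) \<partial>L) = (\<integral>x. indicator B x * qp x v \<partial>L)"
    if v: "v \<in> words n" for v
  proof -
    have vA: "v \<in> lists A" "length v = n" using v by (auto simp: words_def)
    \<comment> \<open>\<open>indicator B x * qp x v\<close> is rewritten as a function of the
      coordinates in \<open>?K\<close>, so that independence of disjoint blocks of coordinates
      applies.\<close>
    define g where "g = (\<lambda>y. indicator C y * (\<Prod>j<length v. pw (v ! j) (y (take j v))) :: real)"
    define h where "h = (\<lambda>y :: 'a list \<Rightarrow> 'a \<Rightarrow> real. \<Sum>a\<in>A. pw a (y v))"
    have g[measurable]: "g \<in> borel_measurable (PiM ?K (\<lambda>_. D))"
      unfolding g_def
    proof (intro borel_measurable_times borel_measurable_prod borel_measurable_indicator C)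
      fix j assume "j \<in> {..<length v}"
      then have "take j v \<in> ?K" "v ! j \<in> A" using vA by (auto dest: in_set_takeD)
      then show "(\<lambda>y. pw (v ! j) (y (take j v))) \<in> borel_measurable (PiM ?K (\<lambda>_. D))"
        by (intro measurable_compose[OF measurable_component_singleton[where M="\<lambda>_. D"] measurable_pw])
    qed
    have h[measurable]: "h \<in> borel_measurable (PiM {v} (\<lambda>_. D))"
      unfolding h_def by (intro borel_measurable_sum measurable_compose[OF measurable_component_singleton[where M="\<lambda>_. D"] measurable_pw]) auto
    have gr: "g (restrict x ?K) = indicator B x * qp x v" if "x \<in> space L" for x
    proof -
      have "restrict x ?K (take j v) = x (take j v)" if "j < length v" for j
        using that vA by (auto dest: in_set_takeD)
      then show ?thesis using that by (simp add: g_def qp_def BC indicator_def)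
    qed
    have hr: "h (restrict x {v}) = (\<Sum>a\<in>A. pw a (x v))" for x by (simp add: h_def)
    have "L.indep_var (PiM ?K (\<lambda>_. D)) (\<lambda>x. restrict (\<lambda>i. x i) ?K) (PiM {v} (\<lambda>_. D)) (\<lambda>x. restrict (\<lambda>i. x i) {v})"
      using vA by (intro L.indep_var_restrict[OF indep_coords]) auto
    from L.indep_var_compose[OF this g h]
    have ind: "L.indep_var borel (\<lambda>x. g (restrict x ?K)) borel (\<lambda>x. h (restrict x {v}))" by (simp add: o_def)
    have i1: "integrable L (\<lambda>x. g (restrict x ?K))"
    proof (subst Bochner_Integration.integrable_cong[OF refl gr])
      show "integrable L (\<lambda>x. indicator B x * qp x v)"
        using integrable_mult_indicator[OF BL integrable_qp[OF vA(1)]] by simp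
    qed
    have dc: "distr L D (\<lambda>x. x v) = D" unfolding L_def using PP.PiM_component[OF vA(1)] .
    have i2': "integrable L (\<lambda>x. pw a (x v))" "(\<integral>x. pw a (x v) \<partial>L) = p a" if "a \<in> A" for a
    proof -
      have "integrable (distr L D (\<lambda>x. x v)) (pw a)" using int_pw[OF that] dc by simp
      then show "integrable L (\<lambda>x. pw a (x v))"
        by (subst (asm) integrable_distr_eq) (use vA that in \<open>auto intro: measurable_coord\<close>)
      have "p a = (\<integral>w. pw a w \<partial>distr L D (\<lambda>x. x v))" by (simp add: p_def dc)
      also have "\<dots> = (\<integral>x. pw a (x v) \<partial>L)"
        by (subst integral_distr) (use vA that in \<open>auto intro: measurable_coord\<close>)
      finally show "(\<integral>x. pw a (x v) \<partial>L) = p a" by simp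
    qed
    have i2: "integrable L (\<lambda>x. h (restrict x {v}))" "(\<integral>x. h (restrict x {v}) \<partial>L) = 1"
      unfolding hr using i2' by (auto simp: sum_p)
    have "integrable L (\<lambda>x. g (restrict x ?K) * h (restrict x {v}))"
      by (rule L.indep_var_integrable[OF ind i1 i2(1)])
    moreover have "(\<integral>x. g (restrict x ?K) * h (restrict x {v}) \<partial>L) = (\<integral>x. g (restrict x ?K) \<partial>L)"
      using L.indep_var_lebesgue_integral[OF ind i1 i2(1)] i2(2) by simp
    moreover have "integrable L (\<lambda>x. g (restrict x ?K) * h (restrict x {v})) \<longleftrightarrow> integrable L (\<lambda>x. indicator B x * qp x v * (\<Sum>a\<in>A. pw a (x v)))"
      by (intro Bochner_Integration.integrable_cong refl) (simp add: gr hr)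
    moreover have "(\<integral>x. g (restrict x ?K) * h (restrict x {v}) \<partial>L) = (\<integral>x. indicator B x * qp x v * (\<Sum>a\<in>A. pw a (x v)) \<partial>L)"
      by (intro Bochner_Integration.integral_cong refl) (simp add: gr hr)
    moreover have "(\<integral>x. g (restrict x ?K) \<partial>L) = (\<integral>x. indicator B x * qp x v \<partial>L)"
      by (intro Bochner_Integration.integral_cong refl) (simp add: gr)
    ultimately show ?thesis by simp
  qed
  have iq: "integrable L (\<lambda>x. indicator B x * qp x v)" if "v \<in> words n" for v
    using integrable_mult_indicator[OF BL integrable_qp[of v]] that by (auto simp: words_def)
  have "(\<integral>x\<in>B. ms x (Suc n) \<partial>L) = (\<integral>x. (\<Sum>v\<in>words n. indicator B x * qp x v * (\<Sum>a\<in>A. pw a (x v))) \<partial>L)"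
    by (simp add: set_lebesgue_integral_def ms_Suc' sum_distrib_left mult.assoc)
  also have "\<dots> = (\<Sum>v\<in>words n. \<integral>x. indicator B x * qp x v \<partial>L)"
    using key by (subst Bochner_Integration.integral_sum) auto
  also have "\<dots> = (\<integral>x. (\<Sum>v\<in>words n. indicator B x * qp x v) \<partial>L)"
    using iq by (subst Bochner_Integration.integral_sum) auto
  also have "\<dots> = (\<integral>x\<in>B. ms x n \<partial>L)"
    by (simp add: set_lebesgue_integral_def ms_def sum_distrib_left)
  finally show ?thesis .
qed

theorem AE_convergent_ms: "AE x in L. convergent (ms x)"
proof -
  have "AE x in L. convergent (\<lambda>n. ms x n)"
  proof (rule L.nonneg_martingale_convergent[where F=prefix_algebra])
    show "subalgebra L (prefix_algebra n)" for n by (rule subalgebra_prefix)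
    show "(\<lambda>x. ms x i) \<in> borel_measurable (prefix_algebra n)" if "i \<le> n" for i n
      unfolding ms_def qp_def
    proof (intro borel_measurable_sum borel_measurable_prod)
      fix v j assume v: "v \<in> words i" "j \<in> {..<length v}"
      then have "take j v \<in> lists A" "length (take j v) < n" "v ! j \<in> A"
        using that by (auto simp: words_def dest: in_set_takeD)
      then show "(\<lambda>x. pw (v ! j) (x (take j v))) \<in> borel_measurable (prefix_algebra n)"
        by (intro measurable_compose[OF measurable_coord_prefix measurable_pw])
    qed
  qed (auto simp: integrable_ms ms_nonneg ms_martingale)
  then show ?thesis by simp
qed

lemma AE_convergent_all: "AE x in L. \<forall>u\<in>lists A. convergent (ms (shf u x))"
  by (subst AE_ball_countable) (use finA AE_shf[OF _ AE_convergent_ms] in \<open>auto intro: countable_lists countable_finite\<close>)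

end

section \<open>Elementary inequalities for powers and the exponential\<close>

lemma sum_powr_le:
  fixes z :: "'a \<Rightarrow> real"
  assumes fin: "finite A" and z: "\<And>a. a \<in> A \<Longrightarrow> 0 \<le> z a" and h: "0 < h" "h \<le> 1"
  shows "(\<Sum>a\<in>A. z a) powr h \<le> (\<Sum>a\<in>A. z a powr h)"
proof (cases "(\<Sum>a\<in>A. z a) = 0")
  case True
  then show ?thesis by (simp add: sum_nonneg)
next
  case False
  define T where "T = (\<Sum>a\<in>A. z a)"
  have T: "0 < T" using False z by (simp add: T_def less_le sum_nonneg)
  \<comment> \<open>After division by the total every term is at most 1, and there a power of
    exponent \<open>h \<le> 1\<close> is no smaller.\<close>
  have "1 = (\<Sum>a\<in>A. z a / T)" using T by (simp add: T_def flip: sum_divide_distrib)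
  also have "\<dots> \<le> (\<Sum>a\<in>A. (z a / T) powr h)"
  proof (rule sum_mono)
    fix a assume a: "a \<in> A"
    have "z a \<le> T" unfolding T_def using fin a z by (intro member_le_sum) auto
    then have "(z a / T) powr 1 \<le> (z a / T) powr h" using T z[OF a] h by (intro powr_mono') auto
    then show "z a / T \<le> (z a / T) powr h" using T z[OF a] by simp
  qed
  also have "\<dots> = (\<Sum>a\<in>A. z a powr h) / T powr h"
    using z T by (simp add: powr_divide sum_divide_distrib)
  finally show ?thesis using T by (simp add: T_def field_simps)
qed

text \<open>\<open>1 - x \<le> exp (- x)\<close> gives exp x - 1 - x \<le> x (exp x - 1). For
  negative x the factor exp x - 1 is at least x, for positive x it is at most x exp x; both cases
  yield the square.\<close>

lemma exp_le_quadratic: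
  fixes x :: real
  assumes "x \<le> B" "0 \<le> B"
  shows "exp x \<le> 1 + x + x\<^sup>2 * exp B"
proof -
  have "1 - x \<le> exp (- x)" using exp_ge_add_one_self[of "- x"] by simp
  then have "exp x * (1 - x) \<le> exp x * exp (- x)" by (intro mult_left_mono) auto
  then have 1: "exp x - 1 - x \<le> x * (exp x - 1)" by (simp add: algebra_simps flip: exp_add)
  have "x * (exp x - 1) \<le> x\<^sup>2 * exp B"
  proof (cases "0 \<le> x")
    case True
    have "exp x - 1 \<le> x * exp x" using 1 by (simp add: algebra_simps)
    also have "\<dots> \<le> x * exp B" using True assms by (intro mult_left_mono) auto
    finally have "x * (exp x - 1) \<le> x * (x * exp B)" using True by (intro mult_left_mono) auto
    then show ?thesis by (simp add: power2_eq_square)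
  next
    case False
    have "x \<le> exp x - 1" using exp_ge_add_one_self[of x] by linarith
    then have "x * (exp x - 1) \<le> x * x" using False by (intro mult_left_mono_neg) auto
    also have "\<dots> \<le> x\<^sup>2 * exp B" using assms by (simp add: power2_eq_square mult_le_cancel_left1)
    finally show ?thesis .
  qed
  then show ?thesis using 1 by simp
qed

text \<open>For x \<ge> 1 the slope is non-negative. For 0 < x < 1 it is at least
  \<open>x powr h * ln x\<close>, and u (- ln u) \<le> 1 with u = x^h bounds this below by -1/h,
  hence by -2 as h \<ge> 1/2. Fatou's lemma will need this uniform bound.\<close>

lemma powr_slope_ge:
  fixes x h :: real
  assumes "0 \<le> x" "1/2 \<le> h" "h < 1"
  shows "- 2 \<le> (x - x powr h) / (1 - h)"
proof (cases "x < 1 \<and> x \<noteq> 0")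
  case False
  then have "x powr h \<le> x" using assms powr_mono[of h 1 x] by (cases "x = 0") auto
  then have "0 \<le> (x - x powr h) / (1 - h)" using assms by (intro divide_nonneg_nonneg) auto
  then show ?thesis by simp
next
  case True
  then have x: "0 < x" "x < 1" using assms by auto
  define u where "u = x powr h"
  have u: "0 < u" using x by (simp add: u_def)
  have "ln (1 / u) \<le> 1 / u - 1" using u by (intro ln_le_minus_one) auto
  then have "u * (- ln u) \<le> u * (1 / u - 1)" using u by (intro mult_left_mono) (auto simp: ln_div)
  then have "u * (- ln u) \<le> 1" using u by (simp add: algebra_simps)
  then have "h * (u * (- ln x)) \<le> 1" using x by (simp add: u_def ln_powr algebra_simps)
  moreover have nn: "0 \<le> u * (- ln x)" using u x by (intro mult_nonneg_nonneg) auto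
  then have "1/2 * (u * (- ln x)) \<le> h * (u * (- ln x))" using assms by (intro mult_right_mono) auto
  ultimately have ul: "u * (- ln x) \<le> 2" by simp
  have "1 + (1 - h) * ln x \<le> exp ((1 - h) * ln x)" by (rule exp_ge_add_one_self)
  also have "\<dots> = x powr (1 - h)" using x by (simp add: powr_def)
  finally have "u * (1 + (1 - h) * ln x) \<le> u * x powr (1 - h)" using u by (intro mult_left_mono) auto
  also have "\<dots> = x" using x by (simp add: u_def flip: powr_add)
  finally have "u - x \<le> (1 - h) * (u * (- ln x))" by (simp add: algebra_simps)
  also have "\<dots> \<le> (1 - h) * 2" using ul assms by (intro mult_left_mono) auto
  finally show ?thesis using assms by (simp add: u_def field_simps)
qed

text \<open>Derivative of x^s at s = 1 along the exponents 1 - 1/(n + 2); the shift by 2 keeps them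
  at least 1/2, as \<open>powr_slope_ge\<close> requires.\<close>

lemma powr_slope_tendsto:
  fixes x :: real
  assumes "0 \<le> x"
  shows "(\<lambda>n. (x - x powr (1 - 1 / real (n + 2))) / (1 / real (n + 2))) \<longlonglongrightarrow> x * ln x"
proof (cases "x = 0")
  case False
  then have x: "0 < x" using assms by simp
  have "((\<lambda>s. exp (s * ln x)) has_real_derivative ln x) (at 0)"
    by (auto intro!: derivative_eq_intros)
  then have 1: "((\<lambda>s. (exp (s * ln x) - 1) / s) \<longlongrightarrow> ln x) (at 0)" by (simp add: DERIV_def)
  have "filterlim (\<lambda>n. - (1 / real (n + 2))) (at 0) sequentially"
    unfolding filterlim_at
  proof (intro conjI)
    have "(\<lambda>n. 1 / real (n + 2)) \<longlonglongrightarrow> 0" using LIMSEQ_ignore_initial_segment[OF lim_1_over_n, of 2] by simp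
    then show "(\<lambda>n. - (1 / real (n + 2))) \<longlonglongrightarrow> 0" using tendsto_minus by fastforce
  qed auto
  from filterlim_compose[OF 1 this]
  have "(\<lambda>n. x * ((exp (- (1 / real (n + 2)) * ln x) - 1) / - (1 / real (n + 2)))) \<longlonglongrightarrow> x * ln x"
    by (intro tendsto_mult tendsto_const)
  moreover have eq: "x * ((exp (- \<delta> * ln x) - 1) / - \<delta>) = (x - x powr (1 - \<delta>)) / \<delta>" if "\<delta> \<noteq> 0" for \<delta>
  proof -
    have "x powr (1 - \<delta>) = x * exp (- \<delta> * ln x)" using x by (simp add: powr_def left_diff_distrib exp_diff exp_minus divide_inverse)
    then show ?thesis using that by (simp add: field_simps)
  qed
  have "(\<lambda>n. x * ((exp (- (1 / real (n + 2)) * ln x) - 1) / - (1 / real (n + 2))))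
    = (\<lambda>n. (x - x powr (1 - 1 / real (n + 2))) / (1 / real (n + 2)))"
    by (intro ext eq) simp
  ultimately show ?thesis by (simp only:)
qed simp

section \<open>Laplace transforms and non-degeneracy\<close>

context cascade
begin

text \<open>\<open>lm\<close> is an unspecified real where the martingale diverges; the truncation
  makes the limit variable non-negative everywhere and changes nothing where the martingale
  converges.\<close>

definition lp :: "('a list \<Rightarrow> 'a \<Rightarrow> real) \<Rightarrow> real" where "lp x = max 0 (lm x)"

definition chi :: "(('a list \<Rightarrow> 'a \<Rightarrow> real) \<Rightarrow> real) \<Rightarrow> real \<Rightarrow> real" where
  "chi U s = (\<integral>x. exp (- (s * U x)) \<partial>L)"

lemma measurable_lp[measurable]: "lp \<in> borel_measurable L"
  unfolding lp_def[abs_def] by measurable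

lemma lp_nonneg: "0 \<le> lp x" by (simp add: lp_def)

lemma LIMSEQ_ms: "convergent (ms x) \<Longrightarrow> ms x \<longlonglongrightarrow> lp x"
proof -
  assume "convergent (ms x)"
  then have l: "ms x \<longlonglongrightarrow> lm x" unfolding lm_def by (rule convergent_LIMSEQ_iff[THEN iffD1])
  then have "0 \<le> lm x" by (rule LIMSEQ_le_const) (auto simp: ms_nonneg)
  then show ?thesis using l by (simp add: lp_def)
qed

lemma lp_rec:
  assumes "\<And>a. a \<in> A \<Longrightarrow> convergent (ms (shf [a] x))"
  shows "ms x \<longlonglongrightarrow> (\<Sum>a\<in>A. pw a (x []) * lp (shf [a] x))" "lp x = (\<Sum>a\<in>A. pw a (x []) * lp (shf [a] x))"
proof -
  have "(\<lambda>n. ms x (Suc n)) \<longlonglongrightarrow> (\<Sum>a\<in>A. pw a (x []) * lp (shf [a] x))"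
    unfolding ms_Suc by (intro tendsto_sum tendsto_mult tendsto_const LIMSEQ_ms assms)
  then show 1: "ms x \<longlonglongrightarrow> (\<Sum>a\<in>A. pw a (x []) * lp (shf [a] x))" by (rule LIMSEQ_imp_Suc)
  then have "ms x \<longlonglongrightarrow> lp x" by (intro LIMSEQ_ms) (auto simp: convergent_def)
  then show "lp x = (\<Sum>a\<in>A. pw a (x []) * lp (shf [a] x))" using 1 by (rule LIMSEQ_unique)
qed

lemma AE_lp_rec: "AE x in L. lp x = (\<Sum>a\<in>A. pw a (x []) * lp (shf [a] x))"
  using AE_convergent_all
proof eventually_elim
  case (elim x)
  then show ?case by (intro lp_rec(2)) auto
qed

lemma bounded_integrable:
  assumes "f \<in> borel_measurable N" "finite_measure N" "\<And>x. 0 \<le> f x" "\<And>x. f x \<le> (1::real)"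
  shows "integrable N f"
  using assms by (intro finite_measure.integrable_const_bound[where B=1]) auto

context
  fixes U :: "('a list \<Rightarrow> 'a \<Rightarrow> real) \<Rightarrow> real"
  assumes U[measurable]: "U \<in> borel_measurable L" and U0: "\<And>x. 0 \<le> U x"
begin

lemma integrable_exp: "0 \<le> s \<Longrightarrow> integrable L (\<lambda>x. exp (- (s * U x)))"
  using U0 by (intro bounded_integrable L.finite_measure_axioms) auto

lemma chi_bounds: "0 \<le> s \<Longrightarrow> 0 \<le> chi U s" "0 \<le> s \<Longrightarrow> chi U s \<le> 1"
proof -
  assume s: "0 \<le> s"
  show "0 \<le> chi U s" unfolding chi_def by simp
  have "chi U s \<le> (\<integral>x. 1 \<partial>L)" unfolding chi_def using s U0
    by (intro integral_mono integrable_exp) auto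
  then show "chi U s \<le> 1" by (simp add: L.prob_space)
qed

lemma nn_chi: "0 \<le> s \<Longrightarrow> (\<integral>\<^sup>+x. ennreal (exp (- (s * U x))) \<partial>L) = ennreal (chi U s)"
  unfolding chi_def by (intro nn_integral_eq_integral integrable_exp) auto

lemma measurable_chi: "a \<in> A \<Longrightarrow> (\<lambda>w. chi U (t * pw a w)) \<in> borel_measurable D"
proof -
  assume [simp]: "a \<in> A"
  have [measurable]: "(\<lambda>(w, x). exp (- (t * pw a w * U x))) \<in> borel_measurable (D \<Otimes>\<^sub>M L)" by measurable
  show ?thesis unfolding chi_def by (rule L.borel_measurable_lebesgue_integral) measurable
qed

lemma integrable_prod_chi:
  assumes "0 \<le> t"
  shows "integrable D (\<lambda>w. \<Prod>a\<in>A. chi U (t * pw a w))"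
  using assms chi_bounds
  by (intro bounded_integrable D.finite_measure_axioms borel_measurable_prod measurable_chi prod_nonneg prod_le_1)
    (auto simp: pw_nonneg)

text \<open>Given the root vector, the subtrees are independent copies of the tree, so the Laplace
  transform of their weighted sum is a product of Laplace transforms.\<close>

lemma laplace_branch:
  assumes t: "0 \<le> t"
  shows "(\<integral>x. exp (- (t * (\<Sum>a\<in>A. pw a (x []) * U (shf [a] x)))) \<partial>L) = (\<integral>w. (\<Prod>a\<in>A. chi U (t * pw a w)) \<partial>D)"
proof -
  define f where "f = (\<lambda>a (z :: ('a \<Rightarrow> real) \<times> ('a list \<Rightarrow> 'a \<Rightarrow> real)). ennreal (exp (- (t * pw a (fst z) * U (snd z)))))"
  have f: "f a \<in> borel_measurable (D \<Otimes>\<^sub>M L)" if "a \<in> A" for a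
    unfolding f_def using that by measurable
  have m: "(\<lambda>x. exp (- (t * (\<Sum>a\<in>A. pw a (x []) * U (shf [a] x))))) \<in> borel_measurable L"
  proof -
    have "(\<lambda>x. pw a (x []) * U (shf [a] x)) \<in> borel_measurable L" if "a \<in> A" for a
      using that by (intro borel_measurable_times measurable_compose[OF measurable_coord measurable_pw] measurable_compose[OF measurable_shf U]) auto
    then show ?thesis by measurable
  qed
  have "ennreal (\<integral>x. exp (- (t * (\<Sum>a\<in>A. pw a (x []) * U (shf [a] x)))) \<partial>L)
      = (\<integral>\<^sup>+x. ennreal (exp (- (t * (\<Sum>a\<in>A. pw a (x []) * U (shf [a] x))))) \<partial>L)"
    using t U0 pw_nonneg
    by (intro nn_integral_eq_integral[symmetric] bounded_integrable m L.finite_measure_axioms) (auto intro!: mult_nonneg_nonneg sum_nonneg)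
  also have "\<dots> = (\<integral>\<^sup>+x. (\<Prod>a\<in>A. f a (x [], shf [a] x)) \<partial>L)"
    by (intro nn_integral_cong)
      (simp add: f_def prod_ennreal exp_sum finA sum_distrib_left mult.assoc flip: sum_negf)
  also have "\<dots> = (\<integral>\<^sup>+w. (\<Prod>a\<in>A. \<integral>\<^sup>+x. f a (w, x) \<partial>L) \<partial>D)" by (rule nn_integral_branch_prod[OF f])
  also have "\<dots> = (\<integral>\<^sup>+w. ennreal (\<Prod>a\<in>A. chi U (t * pw a w)) \<partial>D)"
    using t by (intro nn_integral_cong) (simp add: f_def nn_chi pw_nonneg prod_ennreal chi_bounds)
  also have "\<dots> = ennreal (\<integral>w. (\<Prod>a\<in>A. chi U (t * pw a w)) \<partial>D)"
    using t by (intro nn_integral_eq_integral integrable_prod_chi) (auto intro!: prod_nonneg chi_bounds simp: pw_nonneg)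
  finally show ?thesis
    using t by (subst (asm) ennreal_inj) (auto intro!: Bochner_Integration.integral_nonneg prod_nonneg chi_bounds simp: pw_nonneg)
qed

end

definition psi :: "nat \<Rightarrow> real \<Rightarrow> real" where "psi n = chi (\<lambda>x. ms x n)"

lemma psi_0: "psi 0 t = exp (- t)" by (simp add: psi_def chi_def L.prob_space)

lemma psi_Suc: "0 \<le> t \<Longrightarrow> psi (Suc n) t = (\<integral>w. (\<Prod>a\<in>A. psi n (t * pw a w)) \<partial>D)"
proof -
  assume "0 \<le> t"
  from laplace_branch[OF measurable_ms ms_nonneg this, of n]
  show ?thesis unfolding psi_def ms_Suc[symmetric] by (simp only: chi_def)
qed

lemma chi_lp: "0 \<le> t \<Longrightarrow> chi lp t = (\<integral>w. (\<Prod>a\<in>A. chi lp (t * pw a w)) \<partial>D)"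
proof -
  assume t: "0 \<le> t"
  have m: "(\<lambda>x. pw a (x []) * lp (shf [a] x)) \<in> borel_measurable L" if "a \<in> A" for a
    using that by (intro borel_measurable_times measurable_compose[OF measurable_coord measurable_pw] measurable_compose[OF measurable_shf measurable_lp]) auto
  have "chi lp t = (\<integral>x. exp (- (t * (\<Sum>a\<in>A. pw a (x []) * lp (shf [a] x)))) \<partial>L)"
    unfolding chi_def
  proof (rule integral_cong_AE)
    show "(\<lambda>x. exp (- (t * (\<Sum>a\<in>A. pw a (x []) * lp (shf [a] x))))) \<in> borel_measurable L" using m by measurable
    show "AE x in L. exp (- (t * lp x)) = exp (- (t * (\<Sum>a\<in>A. pw a (x []) * lp (shf [a] x))))"
      using AE_lp_rec by eventually_elim simp
  qed measurable
  then show ?thesis using laplace_branch[OF measurable_lp lp_nonneg t] by simp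
qed

lemma psi_tendsto: "0 \<le> t \<Longrightarrow> (\<lambda>n. psi n t) \<longlonglongrightarrow> chi lp t"
  unfolding psi_def chi_def
proof (rule integral_dominated_convergence[where w="\<lambda>_. 1"])
  assume t: "0 \<le> t"
  show "AE x in L. (\<lambda>n. exp (- (t * ms x n))) \<longlonglongrightarrow> exp (- (t * lp x))"
    using AE_convergent_ms by eventually_elim (intro tendsto_intros LIMSEQ_ms)
  show "AE x in L. norm (exp (- (t * ms x n))) \<le> 1" for n
    using t by (auto simp: ms_nonneg)
qed (auto simp: L.finite_measure_axioms)

lemma nn_ms: "(\<integral>\<^sup>+x. ennreal (ms x n) \<partial>L) = 1"
proof -
  have "(\<integral>x. ms x n \<partial>L) = 1"
  proof (induction n)
    case (Suc n)
    have sp: "space (prefix_algebra n) = space L" using subalgebra_prefix[of n] by (simp add: subalgebra_def)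
    have "space L \<in> sets (prefix_algebra n)" using sets.top[of "prefix_algebra n"] sp by simp
    from ms_martingale[OF this] show ?case using Suc integrable_ms by (simp add: set_integral_space)
  qed (simp add: L.prob_space)
  then show ?thesis using nn_integral_eq_integral[OF integrable_ms, of n] by (simp add: ms_nonneg)
qed

lemma nn_lp_le: "(\<integral>\<^sup>+x. ennreal (lp x) \<partial>L) \<le> 1"
proof -
  have "(\<integral>\<^sup>+x. ennreal (lp x) \<partial>L) \<le> (\<integral>\<^sup>+x. liminf (\<lambda>n. ennreal (ms x n)) \<partial>L)"
  proof (rule nn_integral_mono_AE)
    show "AE x in L. ennreal (lp x) \<le> liminf (\<lambda>n. ennreal (ms x n))"
      using AE_convergent_ms
    proof eventually_elim
      case (elim x)
      have "(\<lambda>n. ennreal (ms x n)) \<longlonglongrightarrow> ennreal (lp x)" by (intro tendsto_ennrealI LIMSEQ_ms elim)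
      then show ?case using lim_imp_Liminf[of sequentially] by fastforce
    qed
  qed
  also have "\<dots> \<le> liminf (\<lambda>n. \<integral>\<^sup>+x. ennreal (ms x n) \<partial>L)" by (rule nn_integral_liminf) simp
  also have "\<dots> = 1" by (simp add: nn_ms Liminf_const)
  finally show ?thesis .
qed

lemma integrable_lp: "integrable L lp"
  using nn_lp_le by (intro integrableI_nonneg) (auto simp: lp_nonneg le_less_trans)

text \<open>By iterating the Laplace fixed point equation from \<open>exp (- c t) \<le> chi lp t\<close> with \<open>c = E lp\<close>, one gets
  \<open>chi lp c \<le> chi lp 1\<close>, which for \<open>c \<le> 1\<close> is only possible if \<open>c lp = lp\<close> almost surely.\<close>

theorem mean_lp:
  assumes nd: "\<not> (AE x in L. lp x = 0)"
  shows "(\<integral>x. lp x \<partial>L) = 1"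
proof -
  define c where "c = (\<integral>x. lp x \<partial>L)"
  have c0: "0 \<le> c" unfolding c_def using lp_nonneg by simp
  have "ennreal c = (\<integral>\<^sup>+x. ennreal (lp x) \<partial>L)"
    unfolding c_def using lp_nonneg by (intro nn_integral_eq_integral[symmetric] integrable_lp) auto
  then have "ennreal c \<le> 1" using nn_lp_le by simp
  then have c1: "c \<le> 1" by simp
  \<comment> \<open>The tangent of exp at \<open>- (c * t)\<close> bounds
    \<open>exp (- (t * lp x))\<close> below by an affine function of \<open>lp x\<close> whose mean
    is \<open>exp (- (c * t))\<close>.\<close>
  have jensen: "exp (- (c * t)) \<le> chi lp t" if t: "0 \<le> t" for t
  proof -
    have "(\<integral>x. exp (- (c * t)) * (1 - t * (lp x - c)) \<partial>L) \<le> chi lp t"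
      unfolding chi_def
    proof (intro integral_mono integrable_exp measurable_lp lp_nonneg t)
      show "integrable L (\<lambda>x. exp (- (c * t)) * (1 - t * (lp x - c)))"
        using integrable_lp by simp
      fix x
      have "1 - t * (lp x - c) \<le> exp (- (t * (lp x - c)))" using exp_ge_add_one_self[of "- (t * (lp x - c))"] by linarith
      then have "exp (- (c * t)) * (1 - t * (lp x - c)) \<le> exp (- (c * t)) * exp (- (t * (lp x - c)))" by (intro mult_left_mono) auto
      also have "\<dots> = exp (- (t * lp x))" by (simp add: algebra_simps flip: exp_add)
      finally show "exp (- (c * t)) * (1 - t * (lp x - c)) \<le> exp (- (t * lp x))" .
    qed
    moreover have "(\<integral>x. exp (- (c * t)) * (1 - t * (lp x - c)) \<partial>L) = exp (- (c * t))"
      using integrable_lp by (simp add: L.prob_space flip: c_def)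
    ultimately show ?thesis by simp
  qed
  \<comment> \<open>Induction through the recursion shared by \<open>psi\<close> and
    \<open>chi lp\<close>, in which products of non-negative factors are monotone. For t = 1 the
    left side tends to \<open>chi lp c\<close>.\<close>
  have ge: "psi n (c * t) \<le> chi lp t" if "0 \<le> t" for n t
    using that
  proof (induction n arbitrary: t)
    case 0 then show ?case using jensen by (simp add: psi_0)
  next
    case (Suc n)
    have ct: "0 \<le> c * t" using Suc.prems c0 by simp
    have "psi (Suc n) (c * t) = (\<integral>w. (\<Prod>a\<in>A. psi n (c * t * pw a w)) \<partial>D)" by (rule psi_Suc[OF ct])
    also have "\<dots> \<le> (\<integral>w. (\<Prod>a\<in>A. chi lp (t * pw a w)) \<partial>D)"
    proof (rule integral_mono)
      show "integrable D (\<lambda>w. \<Prod>a\<in>A. psi n (c * t * pw a w))"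
        unfolding psi_def using ct by (intro integrable_prod_chi) (auto simp: ms_nonneg)
      show "integrable D (\<lambda>w. \<Prod>a\<in>A. chi lp (t * pw a w))"
        using Suc.prems by (intro integrable_prod_chi) (auto simp: lp_nonneg)
      fix w
      show "(\<Prod>a\<in>A. psi n (c * t * pw a w)) \<le> (\<Prod>a\<in>A. chi lp (t * pw a w))"
      proof (intro prod_mono conjI)
        fix a
        show "0 \<le> psi n (c * t * pw a w)" unfolding psi_def using ct
          by (intro chi_bounds) (auto simp: ms_nonneg pw_nonneg)
        show "psi n (c * t * pw a w) \<le> chi lp (t * pw a w)"
          using Suc.IH[of "t * pw a w"] Suc.prems by (simp add: pw_nonneg mult.assoc)
      qed
    qed
    also have "\<dots> = chi lp t" by (rule chi_lp[OF Suc.prems, symmetric])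
    finally show ?case .
  qed
  have "chi lp c \<le> chi lp 1"
    using psi_tendsto[of c] ge[of 1] c0 by (intro LIMSEQ_le_const2[of "\<lambda>n. psi n c"]) auto
  then have "(\<integral>x. exp (- (c * lp x)) - exp (- (1 * lp x)) \<partial>L) \<le> 0"
    using integrable_exp[OF measurable_lp lp_nonneg c0] integrable_exp[OF measurable_lp lp_nonneg, of 1]
    by (simp add: chi_def)
  moreover have nn: "0 \<le> exp (- (c * lp x)) - exp (- (1 * lp x))" for x
    using mult_right_mono[OF c1 lp_nonneg[of x]] by simp
  ultimately have "(\<integral>x. exp (- (c * lp x)) - exp (- (1 * lp x)) \<partial>L) = 0"
    by (intro antisym Bochner_Integration.integral_nonneg)
  then have "AE x in L. exp (- (c * lp x)) - exp (- (1 * lp x)) = 0"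
    using integral_nonneg_eq_0_iff_AE[of L "\<lambda>x. exp (- (c * lp x)) - exp (- (1 * lp x))"] nn
      integrable_exp[OF measurable_lp lp_nonneg c0] integrable_exp[OF measurable_lp lp_nonneg, of 1]
    by simp
  then have "AE x in L. (1 - c) * lp x = 0" by eventually_elim (simp add: algebra_simps)
  then have "c = 1" using nd by (cases "c = 1") auto
  then show ?thesis by (simp add: c_def)
qed

text \<open>One letter is split off at a time by \<open>nn_integral_branch_one\<close>; the base
  case is where the mean 1 of the limit, hence non-degeneracy, enters.\<close>

lemma nn_qp_lp:
  assumes nd: "\<not> (AE x in L. lp x = 0)" and u: "u \<in> lists A"
  shows "(\<integral>\<^sup>+x. ennreal (qp x u * lp (shf u x)) \<partial>L) = ennreal (prod_list (map p u))"
  using u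
proof (induction u)
  case Nil
  have "(\<integral>\<^sup>+x. ennreal (lp (shf [] x)) \<partial>L) = (\<integral>\<^sup>+x. ennreal (lp x) \<partial>L)"
    by (subst (2) distr_shf[of "[]", symmetric]) (simp_all add: nn_integral_distr measurable_shf)
  also have "\<dots> = 1"
    using nn_integral_eq_integral[OF integrable_lp] mean_lp[OF nd] by (simp add: lp_nonneg)
  finally show ?case by simp
next
  case (Cons a u)
  then have a: "a \<in> A" "u \<in> lists A" by auto
  have [measurable]: "(\<lambda>x. lp (shf u x)) \<in> borel_measurable L" using a by (intro measurable_compose[OF measurable_shf measurable_lp])
  have ss: "shf (a # u) x = shf u (shf [a] x)" for x using a by (auto simp: shf_def fun_eq_iff)
  have "(\<integral>\<^sup>+x. ennreal (qp x (a # u) * lp (shf (a # u) x)) \<partial>L)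
     = (\<integral>\<^sup>+x. ennreal (pw a (x [])) * ennreal (qp (shf [a] x) u * lp (shf u (shf [a] x))) \<partial>L)"
    by (intro nn_integral_cong) (simp add: qp_Cons a ss ennreal_mult pw_nonneg qp_nonneg lp_nonneg mult.assoc)
  also have "\<dots> = ennreal (p a) * ennreal (prod_list (map p u))"
    using a by (subst nn_integral_branch_one[OF a(1), where h="\<lambda>y. ennreal (qp y u * lp (shf u y))"])
      (auto simp: nn_pw Cons.IH)
  also have "\<dots> = ennreal (prod_list (map p (a # u)))"
    by (simp add: ennreal_mult p_nonneg prod_list_p_nonneg)
  finally show ?case .
qed

lemma powr_le_one_plus: "0 \<le> x \<Longrightarrow> 0 < h \<Longrightarrow> h \<le> 1 \<Longrightarrow> x powr h \<le> 1 + (x::real)"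
  by (cases "x \<le> 1") (use powr_mono[of h 1 x] powr_mono2[of h x 1] in auto)

lemma integrable_pw_powr: "a \<in> A \<Longrightarrow> 0 < h \<Longrightarrow> h \<le> 1 \<Longrightarrow> integrable D (\<lambda>w. pw a w powr h)"
  by (rule Bochner_Integration.integrable_bound[where f="\<lambda>w. 1 + pw a w"])
    (auto simp: int_pw pw_nonneg powr_le_one_plus)

text \<open>Take moments of order \<open>h\<close> in the fixed point equation of \<open>lp\<close> and use that \<open>x powr h\<close> is subadditive.\<close>

lemma sum_pw_powr_ge:
  assumes nd: "\<not> (AE x in L. lp x = 0)" and h: "0 < h" "h \<le> 1"
  shows "1 \<le> (\<Sum>a\<in>A. \<integral>w. pw a w powr h \<partial>D)"
proof -
  define m where "m = (\<integral>x. lp x powr h \<partial>L)"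
  have im: "integrable L (\<lambda>x. lp x powr h)"
    by (rule Bochner_Integration.integrable_bound[where f="\<lambda>x. 1 + lp x"])
      (use h in \<open>auto simp: integrable_lp lp_nonneg powr_le_one_plus\<close>)
  have nm: "(\<integral>\<^sup>+x. ennreal (lp x powr h) \<partial>L) = ennreal m"
    unfolding m_def by (intro nn_integral_eq_integral im) simp
  define s where "s = (\<Sum>a\<in>A. \<integral>w. pw a w powr h \<partial>D)"
  \<comment> \<open>Non-degeneracy makes the moment positive; being finite as well, it can be
    cancelled from \<open>m \<le> s * m\<close>.\<close>
  have m: "0 < m"
  proof (rule ccontr)
    assume "\<not> 0 < m"
    then have "ennreal m = 0" by (simp add: ennreal_neg)
    then have "(\<integral>\<^sup>+x. ennreal (lp x powr h) \<partial>L) = 0" using nm by simp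
    then have "AE x in L. ennreal (lp x powr h) = 0" by (subst (asm) nn_integral_0_iff_AE) auto
    then have "AE x in L. lp x = 0" by eventually_elim (simp add: lp_nonneg)
    then show False using nd by simp
  qed
  have "ennreal m \<le> (\<integral>\<^sup>+x. (\<Sum>a\<in>A. ennreal (pw a (x []) powr h) * ennreal (lp (shf [a] x) powr h)) \<partial>L)"
    unfolding nm[symmetric]
  proof (rule nn_integral_mono_AE)
    show "AE x in L. ennreal (lp x powr h) \<le> (\<Sum>a\<in>A. ennreal (pw a (x []) powr h) * ennreal (lp (shf [a] x) powr h))"
      using AE_lp_rec
    proof eventually_elim
      case (elim x)
      have "lp x powr h \<le> (\<Sum>a\<in>A. (pw a (x []) * lp (shf [a] x)) powr h)"
        unfolding elim using h by (intro sum_powr_le finA) (auto simp: pw_nonneg lp_nonneg)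
      also have "\<dots> = (\<Sum>a\<in>A. pw a (x []) powr h * lp (shf [a] x) powr h)"
        by (simp add: powr_mult pw_nonneg lp_nonneg)
      finally have "ennreal (lp x powr h) \<le> ennreal (\<Sum>a\<in>A. pw a (x []) powr h * lp (shf [a] x) powr h)"
        by (rule ennreal_leI)
      also have "\<dots> = (\<Sum>a\<in>A. ennreal (pw a (x []) powr h) * ennreal (lp (shf [a] x) powr h))"
        by (simp add: sum_ennreal[symmetric] ennreal_mult)
      finally show ?case .
    qed
  qed
  also have "\<dots> = (\<Sum>a\<in>A. \<integral>\<^sup>+x. ennreal (pw a (x []) powr h) * ennreal (lp (shf [a] x) powr h) \<partial>L)"
  proof (rule nn_integral_sum)
    fix a assume a: "a \<in> A"
    have [measurable]: "(\<lambda>x. pw a (x [])) \<in> borel_measurable L" "(\<lambda>x. lp (shf [a] x)) \<in> borel_measurable L"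
      using measurable_compose[OF measurable_coord measurable_pw, of "[]" a]
        measurable_compose[OF measurable_shf measurable_lp, of "[a]"] a by auto
    show "(\<lambda>x. ennreal (pw a (x []) powr h) * ennreal (lp (shf [a] x) powr h)) \<in> borel_measurable L"
      by measurable
  qed
  also have "\<dots> = (\<Sum>a\<in>A. (\<integral>\<^sup>+w. ennreal (pw a w powr h) \<partial>D) * ennreal m)"
  proof (rule sum.cong[OF refl])
    fix a assume a: "a \<in> A"
    show "(\<integral>\<^sup>+x. ennreal (pw a (x []) powr h) * ennreal (lp (shf [a] x) powr h) \<partial>L) = (\<integral>\<^sup>+w. ennreal (pw a w powr h) \<partial>D) * ennreal m"
      using a nm by (subst nn_integral_branch_one[OF a, where g="\<lambda>w. ennreal (pw a w powr h)" and h="\<lambda>y. ennreal (lp y powr h)"]) auto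
  qed
  also have "\<dots> = ennreal (s * m)"
    using h m by (simp add: s_def nn_integral_eq_integral integrable_pw_powr sum_distrib_right ennreal_mult flip: sum_ennreal)
  finally have "m \<le> s * m" using m by (subst (asm) ennreal_le_iff) (auto simp: s_def intro!: mult_nonneg_nonneg sum_nonneg)
  then have "1 * m \<le> s * m" by simp
  then show ?thesis using m unfolding s_def by (rule mult_right_le_imp_le)
qed

text \<open>The slopes \<open>(W - W powr h) / (1 - h)\<close> converge to \<open>W ln W\<close> as \<open>h \<rightarrow> 1\<close>, and the lower bound on
  \<open>E (W powr h)\<close> keeps their expectations bounded above.\<close>

theorem integrable_pw_ln:
  assumes nd: "\<not> (AE x in L. lp x = 0)" and a: "a \<in> A"
  shows "integrable D (\<lambda>w. pw a w * ln (pw a w))"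
proof -
  define h where "h = (\<lambda>n. 1 - 1 / real (n + 2))"
  have h: "1/2 \<le> h n" "h n < 1" "0 < h n" "1 - h n = 1 / real (n + 2)" for n by (auto simp: h_def field_simps)
  \<comment> \<open>The summand 2 compensates the lower bound -2 of the slopes, so that Fatou's
    lemma is applied to non-negative functions.\<close>
  define G where "G = (\<lambda>n w. \<Sum>a\<in>A. (pw a w - pw a w powr h n) / (1 - h n) + 2)"
  define G' where "G' = (\<lambda>w. \<Sum>a\<in>A. pw a w * ln (pw a w) + 2)"
  have Gm: "G n \<in> borel_measurable D" for n unfolding G_def by measurable
  have G'm: "G' \<in> borel_measurable D" unfolding G'_def by measurable
  have g0: "0 \<le> (pw a w - pw a w powr h n) / (1 - h n) + 2" for a w n
    using powr_slope_ge[OF pw_nonneg h(1,2), of a w n] by simp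
  have G0: "0 \<le> G n w" for n w unfolding G_def by (intro sum_nonneg g0)
  have iG: "integrable D (G n)" "(\<integral>w. G n w \<partial>D) \<le> 2 * real (card A)" for n
  proof -
    have i: "integrable D (\<lambda>w. (pw a w - pw a w powr h n) / (1 - h n))"
      "(\<integral>w. (pw a w - pw a w powr h n) / (1 - h n) \<partial>D) = (p a - (\<integral>w. pw a w powr h n \<partial>D)) / (1 - h n)" if "a \<in> A" for a
      using int_pw[OF that] integrable_pw_powr[OF that h(3)[of n] less_imp_le[OF h(2)]] by (auto simp: p_def)
    show "integrable D (G n)" unfolding G_def using i(1) by simp
    have "(\<integral>w. G n w \<partial>D) = (\<Sum>a\<in>A. \<integral>w. (pw a w - pw a w powr h n) / (1 - h n) + 2 \<partial>D)"
      unfolding G_def using i(1) by (intro Bochner_Integration.integral_sum Bochner_Integration.integrable_add) auto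
    also have "\<dots> = (\<Sum>a\<in>A. (p a - (\<integral>w. pw a w powr h n \<partial>D)) / (1 - h n) + 2)"
    proof (rule sum.cong[OF refl])
      fix a assume a: "a \<in> A"
      have "(\<integral>w. (pw a w - pw a w powr h n) / (1 - h n) + 2 \<partial>D) = (\<integral>w. (pw a w - pw a w powr h n) / (1 - h n) \<partial>D) + (\<integral>w. 2 \<partial>D)"
        by (intro Bochner_Integration.integral_add i(1)[OF a]) auto
      then show "(\<integral>w. (pw a w - pw a w powr h n) / (1 - h n) + 2 \<partial>D) = (p a - (\<integral>w. pw a w powr h n \<partial>D)) / (1 - h n) + 2"
        unfolding i(2)[OF a] by (simp add: D.prob_space)
    qed
    also have "\<dots> = (1 - (\<Sum>a\<in>A. \<integral>w. pw a w powr h n \<partial>D)) / (1 - h n) + 2 * real (card A)"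
      by (simp add: sum.distrib sum_subtractf sum_p flip: sum_divide_distrib)
    \<comment> \<open>By \<open>sum_pw_powr_ge\<close> the moments of order \<open>h n\<close> sum
      to at least 1, so the numerator is not positive.\<close>
    also have "\<dots> \<le> 2 * real (card A)"
      using sum_pw_powr_ge[OF nd h(3) less_imp_le[OF h(2)], of n] h(2)[of n] by (simp add: divide_nonpos_pos)
    finally show "(\<integral>w. G n w \<partial>D) \<le> 2 * real (card A)" .
  qed
  have lim: "(\<lambda>n. G n w) \<longlonglongrightarrow> G' w" for w
    unfolding G_def G'_def h(4)
    by (intro tendsto_sum tendsto_add tendsto_const, unfold h_def) (rule powr_slope_tendsto[OF pw_nonneg])
  have "(\<integral>\<^sup>+w. ennreal (G' w) \<partial>D) = (\<integral>\<^sup>+w. liminf (\<lambda>n. ennreal (G n w)) \<partial>D)"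
  proof (rule nn_integral_cong)
    fix w
    have "(\<lambda>n. ennreal (G n w)) \<longlonglongrightarrow> ennreal (G' w)" by (intro tendsto_ennrealI lim)
    then show "ennreal (G' w) = liminf (\<lambda>n. ennreal (G n w))" using lim_imp_Liminf[of sequentially] by fastforce
  qed
  also have "\<dots> \<le> liminf (\<lambda>n. \<integral>\<^sup>+w. ennreal (G n w) \<partial>D)" using Gm by (intro nn_integral_liminf) simp
  also have "\<dots> \<le> ennreal (2 * real (card A))"
  proof -
    have "(\<integral>\<^sup>+w. ennreal (G n w) \<partial>D) \<le> ennreal (2 * real (card A))" for n
      using iG[of n] G0 by (subst nn_integral_eq_integral) (auto intro: ennreal_leI)
    then have "liminf (\<lambda>n. \<integral>\<^sup>+w. ennreal (G n w) \<partial>D) \<le> liminf (\<lambda>n. ennreal (2 * real (card A)))"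
      by (intro Liminf_mono) simp
    then show ?thesis by (simp add: Liminf_const)
  qed
  finally have fin: "(\<integral>\<^sup>+w. ennreal (G' w) \<partial>D) < \<infinity>" by (simp add: le_less_trans)
  have g'0: "0 \<le> pw a w * ln (pw a w) + 2" for a w
  proof -
    have "- 2 \<le> pw a w * ln (pw a w)"
      by (rule LIMSEQ_le_const[OF powr_slope_tendsto[OF pw_nonneg]])
        (use powr_slope_ge[OF pw_nonneg h(1,2)] in \<open>auto simp: h(4)[symmetric] h_def\<close>)
    then show ?thesis by simp
  qed
  then have G'0: "0 \<le> G' w" for w unfolding G'_def by (intro sum_nonneg)
  have iG': "integrable D G'" using fin G'm G'0 by (intro integrableI_nonneg) auto
  have "integrable D (\<lambda>w. pw a w * ln (pw a w) + 2)"
  proof (rule Bochner_Integration.integrable_bound[OF iG'])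
    show "AE w in D. norm (pw a w * ln (pw a w) + 2) \<le> norm (G' w)"
    proof (rule AE_I2)
      fix w
      have "pw a w * ln (pw a w) + 2 \<le> G' w" unfolding G'_def
        by (rule member_le_sum[OF a _ finA]) (simp add: g'0)
      then show "norm (pw a w * ln (pw a w) + 2) \<le> norm (G' w)" using g'0[of a w] by simp
    qed
  qed (use a in measurable)
  then have "integrable D (\<lambda>w. pw a w * ln (pw a w) + 2 - 2)" by (intro Bochner_Integration.integrable_diff) auto
  then show ?thesis by simp
qed

text \<open>Induction on \<open>n\<close> gives \<open>psi n t \<le> 1 - t + C t powr q\<close>, which survives the limit.\<close>

theorem nondegenerate_bounded:
  assumes B: "0 \<le> B" "AE w in D. \<forall>a\<in>A. pw a w \<le> B" and q: "1 < q" "q \<le> 2"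
    and lt: "(\<Sum>a\<in>A. \<integral>w. pw a w powr q \<partial>D) < 1"
  shows "\<not> (AE x in L. lp x = 0)"
proof -
  define \<rho> where "\<rho> = (\<Sum>a\<in>A. \<integral>w. pw a w powr q \<partial>D)"
  \<comment> \<open>\<open>R0\<close> bounds \<open>R w\<close> and the exponent \<open>X w\<close>,
    \<open>s * K0\<close> bounds the absolute value of \<open>X w\<close>, and \<open>K1\<close> is
    the constant of the quadratic remainder from \<open>exp_le_quadratic\<close>. \<open>C\<close>
    is so large that \<open>C * \<rho> + K1 \<le> C\<close>, which closes the induction.\<close>
  define R0 where "R0 = real (card A) * B powr q"
  define K0 where "K0 = real (card A) * B + R0"
  define K1 where "K1 = K0\<^sup>2 * exp R0"
  define C where "C = max 1 (K1 / (1 - \<rho>))"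
  have C: "1 \<le> C" "K1 \<le> C * (1 - \<rho>)"
  proof -
    show "1 \<le> C" by (simp add: C_def)
    have "K1 / (1 - \<rho>) \<le> C" by (simp add: C_def)
    then show "K1 \<le> C * (1 - \<rho>)" using lt by (simp add: \<rho>_def field_simps)
  qed
  have R0: "0 \<le> R0" "0 \<le> K0" using B by (auto simp: R0_def K0_def)
  define S where "S = (\<lambda>w. \<Sum>a\<in>A. pw a w)"
  define R where "R = (\<lambda>w. \<Sum>a\<in>A. pw a w powr q)"
  have iS: "integrable D S" "(\<integral>w. S w \<partial>D) = 1" unfolding S_def using int_pw sum_p by (auto simp: p_def)
  have ipq: "integrable D (\<lambda>w. pw a w powr q)" if "a \<in> A" for a
  proof (rule D.integrable_const_bound[where B="B powr q"])
    show "AE w in D. norm (pw a w powr q) \<le> B powr q"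
      using B(2) by eventually_elim (use that q in \<open>auto intro!: powr_mono2 simp: pw_nonneg\<close>)
  qed (use that in measurable)
  have iR: "integrable D R" "(\<integral>w. R w \<partial>D) = \<rho>" unfolding R_def \<rho>_def using ipq by auto
  have psi01: "0 \<le> psi n s" "psi n s \<le> 1" if "0 \<le> s" for n s
    unfolding psi_def using that by (intro chi_bounds; auto simp: ms_nonneg)+
  have key: "psi n s \<le> 1 - s + C * s powr q" if "0 \<le> s" for n s
    using that
  proof (induction n arbitrary: s)
    case 0
    show ?case
    proof (cases "s < 1")
      case False
      then have "s powr 1 \<le> s powr q" using q by (intro powr_mono) auto
      then have "s \<le> s powr q" using False by simp
      moreover have "s powr q \<le> C * s powr q" using mult_right_mono[of 1 C "s powr q"] C by simp
      ultimately show ?thesis using psi01(2)[OF 0, of 0] by linarith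
    next
      case True
      have "exp (- s) \<le> 1 + - s + (- s)\<^sup>2 * exp 0" using 0 by (intro exp_le_quadratic) auto
      moreover have "s powr 2 \<le> s powr q" using q True 0 by (intro powr_mono') auto
      moreover have "1 * s powr q \<le> C * s powr q" using C by (intro mult_right_mono) auto
      ultimately show ?thesis using 0 by (simp add: psi_0)
    qed
  next
    case (Suc n)
    \<comment> \<open>If s \<le> C s^q the claim follows from \<open>psi\<close> being at most 1.
      Otherwise s < 1, hence s^2 \<le> s^q, and the quadratic remainder becomes a term of order
      s^q.\<close>
    show ?case
    proof (cases "s \<le> C * s powr q")
      case True
      then show ?thesis using psi01(2)[OF Suc.prems, of "Suc n"] by simp
    next
      case False
      then have s: "0 < s" "C * s powr q < s" using Suc.prems by (cases "s = 0"; simp)+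
      have s1: "s < 1"
      proof (rule ccontr)
        assume "\<not> s < 1"
        then have "s powr 1 \<le> s powr q" using q by (intro powr_mono) auto
        moreover have "1 * s powr q \<le> C * s powr q" using C by (intro mult_right_mono) auto
        ultimately show False using s by simp
      qed
      have s2: "s\<^sup>2 \<le> s powr q" using powr_mono'[of q 2 s] q s s1 by simp
      define X where "X = (\<lambda>w. - (s * S w) + C * s powr q * R w)"
      have le: "AE w in D. (\<Prod>a\<in>A. psi n (s * pw a w)) \<le> 1 + X w + s powr q * K1"
        using B(2)
      proof eventually_elim
        case (elim w)
        have "(\<Prod>a\<in>A. psi n (s * pw a w)) \<le> (\<Prod>a\<in>A. exp (- (s * pw a w) + C * (s * pw a w) powr q))"
        proof (intro prod_mono conjI)
          fix a
          have 0: "0 \<le> s * pw a w" using s by (simp add: pw_nonneg)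
          show "0 \<le> psi n (s * pw a w)" by (rule psi01(1)[OF 0])
          show "psi n (s * pw a w) \<le> exp (- (s * pw a w) + C * (s * pw a w) powr q)"
            using Suc.IH[OF 0] exp_ge_add_one_self[of "- (s * pw a w) + C * (s * pw a w) powr q"] by linarith
        qed
        also have "\<dots> = exp (\<Sum>a\<in>A. - (s * pw a w) + C * (s * pw a w) powr q)" by (simp add: exp_sum finA)
        also have "(\<Sum>a\<in>A. - (s * pw a w) + C * (s * pw a w) powr q) = X w"
          using s by (simp add: X_def S_def R_def sum.distrib sum_negf sum_subtractf sum_distrib_left powr_mult pw_nonneg mult.assoc)
        also have "exp (X w) \<le> 1 + X w + (X w)\<^sup>2 * exp R0"
        proof (rule exp_le_quadratic[OF _ R0(1)])
          have "S w \<le> (\<Sum>a\<in>A. B)" unfolding S_def using elim by (intro sum_mono) auto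
          then have Sb: "0 \<le> S w" "S w \<le> real (card A) * B" by (auto simp: S_def pw_nonneg sum_nonneg)
          have "R w \<le> (\<Sum>a\<in>A. B powr q)" unfolding R_def using elim q by (intro sum_mono powr_mono2) (auto simp: pw_nonneg)
          then have Rb: "0 \<le> R w" "R w \<le> R0" by (auto simp: R_def R0_def sum_nonneg)
          have "C * s powr q * R w \<le> s * R w" using s Rb by (intro mult_right_mono) auto
          also have "\<dots> \<le> 1 * R0" using s s1 Rb R0 by (intro mult_mono) auto
          finally have "C * s powr q * R w \<le> R0" by simp
          moreover have "0 \<le> s * S w" using s Sb by simp
          ultimately show "X w \<le> R0" unfolding X_def by linarith
        qed
        also have "\<dots> \<le> 1 + X w + s powr q * K1"
        proof -
          have "S w \<le> (\<Sum>a\<in>A. B)" unfolding S_def using elim by (intro sum_mono) auto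
          then have Sb: "0 \<le> S w" "S w \<le> real (card A) * B" by (auto simp: S_def pw_nonneg sum_nonneg)
          have "R w \<le> (\<Sum>a\<in>A. B powr q)" unfolding R_def using elim q by (intro sum_mono powr_mono2) (auto simp: pw_nonneg)
          then have Rb: "0 \<le> R w" "R w \<le> R0" by (auto simp: R_def R0_def sum_nonneg)
          have "C * s powr q * R w \<le> s * R0" using s Rb C by (intro mult_mono) auto
          moreover have "s * S w \<le> s * (real (card A) * B)" using s Sb by (intro mult_left_mono) auto
          moreover have "0 \<le> C * s powr q * R w" "0 \<le> s * S w" "0 \<le> s * R0" "0 \<le> s * (real (card A) * B)"
            using C Rb Sb s R0 B by auto
          ultimately have "\<bar>X w\<bar> \<le> s * K0" unfolding X_def K0_def distrib_left by linarith
          then have "(X w)\<^sup>2 \<le> (s * K0)\<^sup>2" using s R0 by (intro abs_le_square_iff[THEN iffD1]) (simp add: abs_mult)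
          also have "\<dots> \<le> s powr q * K0\<^sup>2" unfolding power_mult_distrib using s2 by (intro mult_right_mono) auto
          finally have "(X w)\<^sup>2 * exp R0 \<le> s powr q * K0\<^sup>2 * exp R0" by (intro mult_right_mono) auto
          then show ?thesis by (simp add: K1_def mult.assoc)
        qed
        finally show ?case .
      qed
      have iX: "integrable D X" "(\<integral>w. X w \<partial>D) = - s + C * s powr q * \<rho>"
        unfolding X_def using iS iR by simp_all
      have "psi (Suc n) s = (\<integral>w. (\<Prod>a\<in>A. psi n (s * pw a w)) \<partial>D)" by (rule psi_Suc[OF Suc.prems])
      also have "\<dots> \<le> (\<integral>w. 1 + X w + s powr q * K1 \<partial>D)"
        unfolding psi_def using iX Suc.prems le[unfolded psi_def]
        by (intro integral_mono_AE integrable_prod_chi) (auto simp: ms_nonneg)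
      also have "\<dots> = 1 - s + C * s powr q * \<rho> + s powr q * K1" using iX by (simp add: D.prob_space)
      also have "\<dots> \<le> 1 - s + C * s powr q"
      proof -
        have "s powr q * K1 \<le> s powr q * (C * (1 - \<rho>))" using C by (intro mult_left_mono) auto
        then show ?thesis by (simp add: algebra_simps)
      qed
      finally show ?thesis .
    qed
  qed
  \<comment> \<open>Solution of C t^q = t / 2: there the bound \<open>1 - t / 2\<close> is uniform
    in \<open>n\<close> and strictly below 1.\<close>
  define t where "t = (1 / (2 * C)) powr (1 / (q - 1))"
  have t: "0 < t" using C by (simp add: t_def)
  have "t powr q = t * t powr (q - 1)" using t powr_add[of t 1 "q - 1"] by simp
  also have "t powr (q - 1) = 1 / (2 * C)" unfolding t_def powr_powr using q C by simp
  finally have "C * t powr q = t / 2" using C by simp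
  then have "psi n t \<le> 1 - t / 2" for n using key[of t n] t by simp
  then have "chi lp t \<le> 1 - t / 2" using psi_tendsto[of t] t by (intro LIMSEQ_le_const2) auto
  then have ne: "chi lp t \<noteq> 1" using t by simp
  show ?thesis
  proof
    assume "AE x in L. lp x = 0"
    then have "chi lp t = (\<integral>x. 1 \<partial>L)" unfolding chi_def
      by (intro integral_cong_AE) (auto elim!: eventually_mono)
    then show False using ne by (simp add: L.prob_space)
  qed
qed

end

section \<open>Mandelbrot measures and their expectation\<close>

declare One_nat_def [simp del]

lemma AE_iff_cong:
  assumes "AE x in M. P x \<longleftrightarrow> Q x"
  shows "(AE x in M. P x) \<longleftrightarrow> (AE x in M. Q x)"
  using assms by (auto elim: eventually_elim2)

definition surv_prob :: "('a, 'w) sponge \<Rightarrow> 'a \<Rightarrow> real" where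
  "surv_prob S a = measure (Om S) {\<omega> \<in> space (Om S). a \<in> surv S [] \<omega>}"

locale mandelbrot =
  fixes S :: "('a, 'w) sponge" and W :: "'a list \<Rightarrow> 'w \<Rightarrow> 'a \<Rightarrow> real"
  assumes rs: "random_sponge S" and mw: "mandelbrot_weights S W"
begin

abbreviation "AA \<equiv> alph S 1"
abbreviation "PA \<equiv> PiM (alph S 1) (\<lambda>_. borel :: real measure)"
abbreviation "CP \<equiv> count_space (Pow (alph S 1))"

lemma finAA: "finite AA" and AA_ne: "AA \<noteq> {}"
proof -
  have "1 \<in> {1..levels S}" using rs by (auto simp: random_sponge_def)
  then have "finite AA \<and> 2 \<le> card AA" using rs unfolding random_sponge_def by blast
  then show "finite AA" "AA \<noteq> {}" by auto
qed

sublocale Om: prob_space "Om S" using rs by (simp add: random_sponge_def)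

definition joint :: "'a list \<Rightarrow> 'w \<Rightarrow> 'a set \<times> ('a \<Rightarrow> real)" where
  "joint u \<omega> = (surv S u \<omega>, restrict (W u \<omega>) AA)"

definition R :: "'a list \<Rightarrow> 'w \<Rightarrow> 'a \<Rightarrow> real" where "R u \<omega> = restrict (W u \<omega>) AA"

lemma joint_indep: "Om.indep_vars (\<lambda>_. CP \<Otimes>\<^sub>M PA) joint (lists AA)"
  and joint_law: "u \<in> lists AA \<Longrightarrow> distr (Om S) (CP \<Otimes>\<^sub>M PA) (joint u) = distr (Om S) (CP \<Otimes>\<^sub>M PA) (joint [])"
  using mw unfolding mandelbrot_weights_def Let_def joint_def[abs_def] by blast+

lemma W_root: "AE \<omega> in Om S. \<forall>a\<in>AA. 0 \<le> W [] \<omega> a \<and> (0 < W [] \<omega> a \<longrightarrow> a \<in> surv S [] \<omega>)"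
  and W_mean: "(\<integral>\<omega>. (\<Sum>a\<in>AA. W [] \<omega> a) \<partial>Om S) = 1"
  using mw by (auto simp: mandelbrot_weights_def Let_def)

lemma joint_meas: "u \<in> lists AA \<Longrightarrow> joint u \<in> measurable (Om S) (CP \<Otimes>\<^sub>M PA)"
  using joint_indep by (auto simp: Om.indep_vars_def)

lemma R_meas: "u \<in> lists AA \<Longrightarrow> R u \<in> measurable (Om S) PA"
  using measurable_compose[OF joint_meas measurable_snd] by (simp add: joint_def R_def[abs_def])

lemma surv_meas: "u \<in> lists AA \<Longrightarrow> surv S u \<in> measurable (Om S) CP"
  using measurable_compose[OF joint_meas measurable_fst] by (simp add: joint_def)

lemma W_meas: "u \<in> lists AA \<Longrightarrow> a \<in> AA \<Longrightarrow> (\<lambda>\<omega>. W u \<omega> a) \<in> borel_measurable (Om S)"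
  using measurable_compose[OF R_meas measurable_component_singleton[of a AA "\<lambda>_. borel"]] by (simp add: R_def)

definition Dw :: "('a \<Rightarrow> real) measure" where "Dw = distr (Om S) PA (R [])"

lemma R_law: "u \<in> lists AA \<Longrightarrow> distr (Om S) PA (R u) = Dw"
proof -
  assume u: "u \<in> lists AA"
  have "distr (Om S) PA (R v) = distr (distr (Om S) (CP \<Otimes>\<^sub>M PA) (joint v)) PA snd" if "v \<in> lists AA" for v
    using joint_meas[OF that] by (subst distr_distr) (auto simp: o_def joint_def R_def[abs_def])
  from this[OF u] this[of "[]"] show ?thesis using joint_law[OF u] by (simp add: Dw_def)
qed

lemma integrable_W: "a \<in> AA \<Longrightarrow> integrable (Om S) (\<lambda>\<omega>. W [] \<omega> a)"
proof (rule Bochner_Integration.integrable_bound)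
  show "integrable (Om S) (\<lambda>\<omega>. \<Sum>a\<in>AA. W [] \<omega> a)"
    using W_mean not_integrable_integral_eq by fastforce
  assume a: "a \<in> AA"
  show "(\<lambda>\<omega>. W [] \<omega> a) \<in> borel_measurable (Om S)" using a by (intro W_meas) auto
  show "AE \<omega> in Om S. norm (W [] \<omega> a) \<le> norm (\<Sum>a\<in>AA. W [] \<omega> a)"
    using W_root
  proof eventually_elim
    case (elim \<omega>)
    then have "W [] \<omega> a \<le> (\<Sum>a\<in>AA. W [] \<omega> a)" using a finAA by (intro member_le_sum) auto
    then show ?case using elim a by auto
  qed
qed

text \<open>By \<open>W_root\<close> the truncation at 0 is invisible almost surely, so integrals
  over the canonical law are those of the given weights.\<close>

lemma Dw_integral:
  assumes a: "a \<in> AA" and h[measurable]: "h \<in> borel_measurable borel"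
  shows "(\<integral>w. h (max 0 (w a)) \<partial>Dw) = (\<integral>\<omega>. h (W [] \<omega> a) \<partial>Om S)"
    and "integrable Dw (\<lambda>w. h (max 0 (w a)) :: real) \<longleftrightarrow> integrable (Om S) (\<lambda>\<omega>. h (W [] \<omega> a))"
proof -
  have m: "(\<lambda>w. h (max 0 (w a))) \<in> borel_measurable PA" using a by measurable
  have W[measurable]: "(\<lambda>\<omega>. W [] \<omega> a) \<in> borel_measurable (Om S)" using a by (intro W_meas) auto
  have ae: "AE \<omega> in Om S. h (max 0 (R [] \<omega> a)) = h (W [] \<omega> a)"
    using W_root by eventually_elim (use a in \<open>auto simp: R_def max_def\<close>)
  have m2: "(\<lambda>\<omega>. h (max 0 (R [] \<omega> a))) \<in> borel_measurable (Om S)" using measurable_compose[OF R_meas m] by simp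
  show "(\<integral>w. h (max 0 (w a)) \<partial>Dw) = (\<integral>\<omega>. h (W [] \<omega> a) \<partial>Om S)"
    unfolding Dw_def using ae m2 by (subst integral_distr[OF R_meas m]) (auto intro!: integral_cong_AE)
  show "integrable Dw (\<lambda>w. h (max 0 (w a))) \<longleftrightarrow> integrable (Om S) (\<lambda>\<omega>. h (W [] \<omega> a))"
    unfolding Dw_def by (subst integrable_distr_eq[OF R_meas m]) (simp, rule integrable_cong_AE[OF m2 _ ae], measurable)
qed

sublocale cas: cascade AA Dw
proof (rule cascade.intro)
  show "finite AA" by (rule finAA)
  show "sets Dw = sets PA" by (simp add: Dw_def)
  show "prob_space Dw" unfolding Dw_def by (rule Om.prob_space_distr[OF R_meas]) simp
  show "integrable Dw (\<lambda>w. max 0 (w a))" if "a \<in> AA" for a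
    using Dw_integral(2)[OF that, of "\<lambda>x. x"] integrable_W[OF that] by simp
  have "(\<Sum>a\<in>AA. \<integral>w. max 0 (w a) \<partial>Dw) = (\<Sum>a\<in>AA. \<integral>\<omega>. W [] \<omega> a \<partial>Om S)"
    using Dw_integral(1)[of _ "\<lambda>x. x"] by (intro sum.cong) auto
  also have "\<dots> = 1" using W_mean integrable_W by (simp add: Bochner_Integration.integral_sum)
  finally show "(\<Sum>a\<in>AA. \<integral>w. max 0 (w a) \<partial>Dw) = 1" .
qed

lemma p_eq: "a \<in> AA \<Longrightarrow> cas.p a = (\<integral>\<omega>. W [] \<omega> a \<partial>Om S)"
  unfolding cas.p_def cas.pw_def using Dw_integral(1)[of a "\<lambda>x. x"] by simp

definition Xs :: "'w \<Rightarrow> 'a list \<Rightarrow> 'a \<Rightarrow> real" where "Xs \<omega> = (\<lambda>u\<in>lists AA. R u \<omega>)"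

lemma sets_L: "sets cas.L = sets (PiM (lists AA) (\<lambda>_. PA))"
  unfolding cas.L_def by (intro sets_PiM_cong refl) (simp add: Dw_def)

lemma Xs_meas: "Xs \<in> measurable (Om S) cas.L"
  unfolding measurable_cong_sets[OF refl sets_L] Xs_def[abs_def]
  by (rule measurable_restrict) (rule R_meas)

text \<open>Independence and equality of the laws make the family of weight vectors a sample of the
  canonical tree; almost sure statements and integrals pass from \<open>cas.L\<close> to
  \<open>Om S\<close> through this identity.\<close>

lemma Xs_law: "distr (Om S) cas.L Xs = cas.L"
proof -
  have ind: "Om.indep_vars (\<lambda>_. PA) R (lists AA)"
    using Om.indep_vars_compose2[OF joint_indep, of "\<lambda>_. snd" "\<lambda>_. PA"]
    by (simp add: joint_def R_def[abs_def])
  have "distr (Om S) cas.L Xs = distr (Om S) (PiM (lists AA) (\<lambda>_. PA)) Xs"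
    by (rule distr_cong) (simp_all add: sets_L)
  also have "\<dots> = PiM (lists AA) (\<lambda>u. distr (Om S) PA (R u))"
    using ind unfolding Xs_def[abs_def] by (subst (asm) Om.indep_vars_iff_distr_eq_PiM') (auto intro!: R_meas simp del: in_lists_conv_set)
  also have "\<dots> = cas.L" unfolding cas.L_def by (intro PiM_cong refl) (simp add: R_law)
  finally show ?thesis .
qed

lemma AE_Xs: "AE x in cas.L. P x \<Longrightarrow> AE \<omega> in Om S. P (Xs \<omega>)"
proof -
  assume "AE x in cas.L. P x"
  then have "AE x in distr (Om S) cas.L Xs. P x" by (simp only: Xs_law)
  then show ?thesis by (rule AE_distrD[OF Xs_meas])
qed

text \<open>Each pair \<open>joint u\<close> has the law of \<open>joint []\<close>, and there are
  only countably many words.\<close>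

lemma AE_root_all:
  assumes P: "{z \<in> space (CP \<Otimes>\<^sub>M PA). P z} \<in> sets (CP \<Otimes>\<^sub>M PA)" and ae: "AE \<omega> in Om S. P (joint [] \<omega>)"
  shows "AE \<omega> in Om S. \<forall>u\<in>lists AA. P (joint u \<omega>)"
proof (subst AE_ball_countable)
  show "countable (lists AA)" using finAA by (intro countable_lists countable_finite)
  show "\<forall>u\<in>lists AA. AE \<omega> in Om S. P (joint u \<omega>)"
  proof
    fix u assume u: "u \<in> lists AA"
    have "AE z in distr (Om S) (CP \<Otimes>\<^sub>M PA) (joint []). P z"
      using ae P by (subst AE_distr_iff[OF joint_meas]) auto
    then have "AE z in distr (Om S) (CP \<Otimes>\<^sub>M PA) (joint u). P z" by (simp only: joint_law[OF u])
    then show "AE \<omega> in Om S. P (joint u \<omega>)" by (rule AE_distrD[OF joint_meas[OF u]])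
  qed
qed

lemma W_nonneg_all: "AE \<omega> in Om S. \<forall>u\<in>lists AA. \<forall>a\<in>AA. 0 \<le> W u \<omega> a"
proof -
  have "AE \<omega> in Om S. \<forall>u\<in>lists AA. (\<lambda>z. \<forall>a\<in>AA. 0 \<le> snd z a) (joint u \<omega>)"
  proof (rule AE_root_all)
    have "(\<lambda>z. snd z a) \<in> borel_measurable (CP \<Otimes>\<^sub>M PA)" if "a \<in> AA" for a
      using that by (intro measurable_compose[OF measurable_snd measurable_component_singleton])
    then show "{z \<in> space (CP \<Otimes>\<^sub>M PA). \<forall>a\<in>AA. 0 \<le> snd z a} \<in> sets (CP \<Otimes>\<^sub>M PA)"
      using finAA by (intro sets.sets_Collect_finite_All borel_measurable_le borel_measurable_const) auto
    show "AE \<omega> in Om S. \<forall>a\<in>AA. 0 \<le> snd (joint [] \<omega>) a"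
      using W_root by eventually_elim (simp add: joint_def)
  qed
  then show ?thesis by eventually_elim (simp add: joint_def)
qed

text \<open>The almost sure event on which the untruncated products and the \<open>lim\<close> in
  the definition of the Mandelbrot measure agree with those of the canonical model.\<close>

definition good :: "'w \<Rightarrow> bool" where
  "good \<omega> \<longleftrightarrow> (\<forall>u\<in>lists AA. \<forall>a\<in>AA. 0 \<le> W u \<omega> a) \<and> (\<forall>u\<in>lists AA. convergent (cas.ms (cas.shf u (Xs \<omega>))))"

lemma AE_good: "AE \<omega> in Om S. good \<omega>"
  using W_nonneg_all AE_Xs[OF cas.AE_convergent_all] unfolding good_def by eventually_elim blast

lemma Qprod_eq:
  assumes g: "good \<omega>" and u: "u \<in> lists AA" and v: "v \<in> lists AA"
  shows "Qprod W u v \<omega> = cas.qp (cas.shf u (Xs \<omega>)) v"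
  unfolding Qprod_def cas.qp_def
proof (rule prod.cong[OF refl])
  fix j assume j: "j \<in> {..<length v}"
  have "take j v \<in> lists AA" "v ! j \<in> AA" using v j by (auto dest: in_set_takeD)
  moreover from this have "u @ take j v \<in> lists AA" using u by auto
  ultimately show "W (u @ take j v) \<omega> (v ! j) = cas.pw (v ! j) (cas.shf u (Xs \<omega>) (take j v))"
    using g unfolding good_def cas.shf_def Xs_def R_def cas.pw_def by (simp del: in_lists_conv_set append_in_lists_conv)
qed

lemma Ylim_eq:
  assumes g: "good \<omega>" and u: "u \<in> lists AA"
  shows "Ylim S W u \<omega> = cas.lp (cas.shf u (Xs \<omega>))"
proof -
  have "(\<Sum>v\<in>{v \<in> lists AA. length v = n}. Qprod W u v \<omega>) = cas.ms (cas.shf u (Xs \<omega>)) n" for n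
    unfolding cas.ms_def cas.words_def by (intro sum.cong refl Qprod_eq g u) auto
  then have "Ylim S W u \<omega> = lim (cas.ms (cas.shf u (Xs \<omega>)))" by (simp add: Ylim_def)
  also have "\<dots> = cas.lp (cas.shf u (Xs \<omega>))"
    using g u by (intro limI cas.LIMSEQ_ms) (auto simp: good_def)
  finally show ?thesis .
qed

lemma shf_Nil: "cas.shf [] (Xs \<omega>) = Xs \<omega>"
  by (auto simp: cas.shf_def Xs_def)

definition mass :: "'a list \<Rightarrow> 'w \<Rightarrow> real" where "mass u \<omega> = Qprod W [] u \<omega> * Ylim S W u \<omega>"

lemma mass_eq:
  "good \<omega> \<Longrightarrow> u \<in> lists AA \<Longrightarrow> mass u \<omega> = cas.qp (Xs \<omega>) u * cas.lp (cas.shf u (Xs \<omega>))"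
  unfolding mass_def by (simp add: Qprod_eq[of \<omega> "[]" u] shf_Nil Ylim_eq del: in_lists_conv_set)

lemma mass_meas[measurable]:
  assumes "u \<in> lists AA"
  shows "mass u \<in> borel_measurable (Om S)"
proof -
  have Q: "(\<lambda>\<omega>. Qprod W u v \<omega>) \<in> borel_measurable (Om S)" if u: "u \<in> lists AA" and v: "v \<in> lists AA" for u v
    unfolding Qprod_def
  proof (intro borel_measurable_prod W_meas)
    fix j assume "j \<in> {..<length v}"
    then show "v ! j \<in> AA" "u @ take j v \<in> lists AA" using u v by (auto dest: in_set_takeD)
  qed
  have "(\<lambda>\<omega>. Ylim S W u \<omega>) \<in> borel_measurable (Om S)"
    unfolding Ylim_def using assms by (intro borel_measurable_lim_metric borel_measurable_sum Q) auto
  then show ?thesis unfolding mass_def[abs_def] using Q[of "[]" u] assms by (intro borel_measurable_times) auto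
qed

text \<open>Countably many measurable equations that decide whether a measure with these cylinder
  masses exists. They are stated in \<open>ennreal\<close> because \<open>mandelbrot_spec\<close>
  sees the masses only there, with negative values cut off at 0.\<close>

definition consistent :: "'w \<Rightarrow> bool" where
  "consistent \<omega> \<longleftrightarrow> (\<forall>u\<in>lists AA. ennreal (mass u \<omega>) = (\<Sum>a\<in>AA. ennreal (mass (u @ [a]) \<omega>)))"

lemma consistent_meas[measurable]: "{\<omega> \<in> space (Om S). consistent \<omega>} \<in> sets (Om S)"
proof -
  have "{\<omega> \<in> space (Om S). \<forall>u\<in>lists AA. ennreal (mass u \<omega>) = (\<Sum>a\<in>AA. ennreal (mass (u @ [a]) \<omega>))} \<in> sets (Om S)"
  proof (rule sets.sets_Collect_countable_All')
    show "countable (lists AA)" using finAA by (intro countable_lists countable_finite)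
    fix u assume "u \<in> lists AA"
    then show "{\<omega> \<in> space (Om S). ennreal (mass u \<omega>) = (\<Sum>a\<in>AA. ennreal (mass (u @ [a]) \<omega>))} \<in> sets (Om S)"
      by (intro borel_measurable_eq measurable_compose[OF mass_meas measurable_ennreal] borel_measurable_sum) auto
  qed
  then show ?thesis by (simp add: consistent_def)
qed

lemma spec_iff: "mandelbrot_spec S W \<omega> m \<longleftrightarrow> sets m = sets (full_shift AA) \<and> (\<forall>u\<in>lists AA. emeasure m (sstart AA u) = ennreal (mass u \<omega>))"
  by (simp add: mandelbrot_spec_def mass_def)

lemma ex_spec_iff: "(\<exists>m. mandelbrot_spec S W \<omega> m) \<longleftrightarrow> consistent \<omega>"
proof
  assume "\<exists>m. mandelbrot_spec S W \<omega> m"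
  then obtain m where s: "sets m = sets (full_shift AA)" and m: "\<And>u. u \<in> lists AA \<Longrightarrow> emeasure m (sstart AA u) = ennreal (mass u \<omega>)"
    unfolding spec_iff by blast
  show "consistent \<omega>" unfolding consistent_def
  proof
    fix u assume u: "u \<in> lists AA"
    have ua: "u @ [a] \<in> lists AA" if "a \<in> AA" for a using u that by simp
    have "sstart AA u = (\<Union>a\<in>AA. sstart AA (u @ [a]))"
    proof (intro set_eqI iffI)
      fix x assume x: "x \<in> sstart AA u"
      then have xs: "x \<in> streams AA" "stake (length u) x = u" unfolding sstart_eq_stake[OF u] by auto
      then have a: "x !! length u \<in> AA" by (simp add: snth_in)
      have "x \<in> sstart AA (u @ [x !! length u])"
        unfolding sstart_eq_stake[OF ua[OF a]] using xs by (simp add: stake_Suc del: stake.simps(2))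
      then show "x \<in> (\<Union>a\<in>AA. sstart AA (u @ [a]))" using a by blast
    next
      fix x assume "x \<in> (\<Union>a\<in>AA. sstart AA (u @ [a]))"
      then obtain a where a: "a \<in> AA" "x \<in> sstart AA (u @ [a])" by blast
      then show "x \<in> sstart AA u"
        unfolding sstart_eq_stake[OF ua[OF a(1)]] sstart_eq_stake[OF u] by (simp add: stake_Suc del: stake.simps(2))
    qed
    then have "emeasure m (sstart AA u) = emeasure m (\<Union>a\<in>AA. sstart AA (u @ [a]))" by simp
    also have "\<dots> = (\<Sum>a\<in>AA. emeasure m (sstart AA (u @ [a])))"
    proof (rule sum_emeasure[symmetric])
      show "(\<lambda>a. sstart AA (u @ [a])) ` AA \<subseteq> sets m" using sstart_sets_full_shift[OF finAA ua] s by auto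
      show "disjoint_family_on (\<lambda>a. sstart AA (u @ [a])) AA"
        unfolding disjoint_family_on_def
      proof (intro ballI impI)
        fix a b assume ab: "a \<in> AA" "b \<in> AA" "a \<noteq> b"
        then show "sstart AA (u @ [a]) \<inter> sstart AA (u @ [b]) = {}"
          unfolding sstart_eq_stake[OF ua[OF ab(1)]] sstart_eq_stake[OF ua[OF ab(2)]] by (auto simp del: stake.simps(2))
      qed
    qed (rule finAA)
    finally show "ennreal (mass u \<omega>) = (\<Sum>a\<in>AA. ennreal (mass (u @ [a]) \<omega>))" using m u ua by simp
  qed
next
  assume c: "consistent \<omega>"
  have "\<exists>\<nu>. sets \<nu> = sets (full_shift AA) \<and> (\<forall>w\<in>lists AA. emeasure \<nu> (sstart AA w) = ennreal (max 0 (mass w \<omega>)))"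
  proof (rule stream_measure_exists[OF finAA AA_ne])
    fix w assume w: "w \<in> lists AA"
    have "ennreal (max 0 (mass w \<omega>)) = (\<Sum>a\<in>AA. ennreal (max 0 (mass (w @ [a]) \<omega>)))"
      using c w unfolding consistent_def by simp
    also have "\<dots> = ennreal (\<Sum>a\<in>AA. max 0 (mass (w @ [a]) \<omega>))" by (rule sum_ennreal) simp
    finally show "max 0 (mass w \<omega>) = (\<Sum>a\<in>AA. max 0 (mass (w @ [a]) \<omega>))"
      by (subst (asm) ennreal_inj) (auto intro: sum_nonneg)
  qed simp
  then show "\<exists>m. mandelbrot_spec S W \<omega> m" unfolding spec_iff by simp
qed

abbreviation "\<mu> \<equiv> mandelbrot_measure S W"

lemma mu_spec: "consistent \<omega> \<Longrightarrow> mandelbrot_spec S W \<omega> (\<mu> \<omega>)"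
proof -
  assume "consistent \<omega>"
  then obtain m where m: "mandelbrot_spec S W \<omega> m" using ex_spec_iff by blast
  have "(THE m. mandelbrot_spec S W \<omega> m) = m"
  proof (rule the_equality[where P="mandelbrot_spec S W \<omega>", OF m])
    fix m' assume m': "mandelbrot_spec S W \<omega> m'"
    show "m' = m"
    proof (rule stream_measure_eqI[OF finAA])
      have "emeasure m' (sstart AA []) = ennreal (mass [] \<omega>)" using m' unfolding spec_iff by blast
      then show "emeasure m' (streams AA) \<noteq> \<infinity>" by simp
    qed (use m m' spec_iff in auto)
  qed
  then show ?thesis using m by (auto simp: mandelbrot_measure_def)
qed

lemma mu_inconsistent: "\<not> consistent \<omega> \<Longrightarrow> \<mu> \<omega> = null_measure (full_shift AA)"
  using ex_spec_iff by (simp add: mandelbrot_measure_def)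

lemma sets_mu: "sets (\<mu> \<omega>) = sets (full_shift AA)"
  using mu_spec[of \<omega>] mu_inconsistent[of \<omega>] by (cases "consistent \<omega>") (auto simp: spec_iff)

lemma space_mu: "space (\<mu> \<omega>) = streams AA"
  using sets_eq_imp_space_eq[OF sets_mu] by (simp add: space_stream_space)

lemma mu_cylinder: "u \<in> lists AA \<Longrightarrow> emeasure (\<mu> \<omega>) (sstart AA u) = (if consistent \<omega> then ennreal (mass u \<omega>) else 0)"
  using mu_spec[of \<omega>] mu_inconsistent[of \<omega>] by (auto simp: spec_iff)

lemma mu_total: "emeasure (\<mu> \<omega>) (streams AA) = (if consistent \<omega> then ennreal (mass [] \<omega>) else 0)"
  using mu_cylinder[of "[]"] by simp

lemma mu_null_iff: "\<mu> \<omega> = null_measure (full_shift AA) \<longleftrightarrow> \<not> (consistent \<omega> \<and> 0 < mass [] \<omega>)"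
proof
  assume "\<mu> \<omega> = null_measure (full_shift AA)"
  then have "emeasure (\<mu> \<omega>) (streams AA) = 0" by simp
  then show "\<not> (consistent \<omega> \<and> 0 < mass [] \<omega>)" unfolding mu_total by (auto simp: ennreal_eq_0_iff)
next
  assume "\<not> (consistent \<omega> \<and> 0 < mass [] \<omega>)"
  then have 0: "emeasure (\<mu> \<omega>) (streams AA) = 0" unfolding mu_total by (auto simp: ennreal_eq_0_iff)
  show "\<mu> \<omega> = null_measure (full_shift AA)"
  proof (rule measure_eqI)
    fix E assume "E \<in> sets (\<mu> \<omega>)"
    then have "emeasure (\<mu> \<omega>) E \<le> emeasure (\<mu> \<omega>) (streams AA)"
      using emeasure_space[of "\<mu> \<omega>" E] by (simp add: space_mu)
    then show "emeasure (\<mu> \<omega>) E = emeasure (null_measure (full_shift AA)) E" using 0 by simp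
  qed (simp add: sets_mu)
qed

lemma good_consistent: "good \<omega> \<Longrightarrow> consistent \<omega>"
  unfolding consistent_def
proof
  fix u assume g: "good \<omega>" and u: "u \<in> lists AA"
  define x where "x = Xs \<omega>"
  have ua: "u @ [a] \<in> lists AA" if "a \<in> AA" for a using u that by simp
  have s: "cas.shf [a] (cas.shf u x) = cas.shf (u @ [a]) x" if "a \<in> AA" for a
    using that by (auto simp: cas.shf_def fun_eq_iff)
  have n: "cas.shf u x [] = x u" by (simp add: cas.shf_def)
  have "cas.lp (cas.shf u x) = (\<Sum>a\<in>AA. cas.pw a (cas.shf u x []) * cas.lp (cas.shf [a] (cas.shf u x)))"
    using g ua by (intro cas.lp_rec(2)) (simp add: s good_def x_def[symmetric])
  also have "\<dots> = (\<Sum>a\<in>AA. cas.pw a (x u) * cas.lp (cas.shf (u @ [a]) x))"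
    unfolding n using s by (intro sum.cong) auto
  finally have "mass u \<omega> = (\<Sum>a\<in>AA. mass (u @ [a]) \<omega>)"
    using mass_eq[OF g u] mass_eq[OF g ua] by (simp add: x_def[symmetric] cas.qp_snoc sum_distrib_left mult.assoc)
  moreover have "0 \<le> mass (u @ [a]) \<omega>" if "a \<in> AA" for a
    using mass_eq[OF g ua[OF that]] by (simp add: cas.qp_nonneg cas.lp_nonneg)
  ultimately show "ennreal (mass u \<omega>) = (\<Sum>a\<in>AA. ennreal (mass (u @ [a]) \<omega>))"
    by (simp add: sum_ennreal)
qed

text \<open>The event of a non-zero measure is consistency together with positive total mass, hence
  measurable; almost surely the total mass is the martingale limit.\<close>

lemma nondegenerate_iff: "nondegenerate S W \<longleftrightarrow> \<not> (AE x in cas.L. cas.lp x = 0)"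
proof -
  define B where "B = {\<omega> \<in> space (Om S). mandelbrot_measure S W \<omega> \<noteq> null_measure (full_shift AA)}"
  have B: "B = {\<omega> \<in> space (Om S). consistent \<omega>} \<inter> {\<omega> \<in> space (Om S). 0 < mass [] \<omega>}"
    unfolding B_def mu_null_iff by auto
  have m0: "mass [] \<in> borel_measurable (Om S)" by (rule mass_meas) simp
  have Bs: "B \<in> sets (Om S)" unfolding B using m0 by (intro sets.Int consistent_meas) simp
  have "nondegenerate S W \<longleftrightarrow> \<not> (AE \<omega> in Om S. \<omega> \<notin> B)"
    unfolding nondegenerate_def B_def[symmetric] using Om.prob_eq_0[OF Bs]
    by (simp add: less_le)
  also have "(AE \<omega> in Om S. \<omega> \<notin> B) \<longleftrightarrow> (AE \<omega> in Om S. cas.lp (Xs \<omega>) = 0)"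
  proof (rule AE_iff_cong)
    show "AE \<omega> in Om S. \<omega> \<notin> B \<longleftrightarrow> cas.lp (Xs \<omega>) = 0"
      using AE_good AE_space
    proof eventually_elim
      case (elim \<omega>)
      then have "mass [] \<omega> = cas.lp (Xs \<omega>)" using mass_eq[of \<omega> "[]"] by (simp add: shf_Nil)
      then show ?case using elim good_consistent[of \<omega>] cas.lp_nonneg[of "Xs \<omega>"] by (auto simp: B less_le)
    qed
  qed
  also have "\<dots> \<longleftrightarrow> (AE x in cas.L. cas.lp x = 0)"
  proof -
    have "(AE x in distr (Om S) cas.L Xs. cas.lp x = 0) \<longleftrightarrow> (AE \<omega> in Om S. cas.lp (Xs \<omega>) = 0)"
      using cas.measurable_lp by (intro AE_distr_iff[OF Xs_meas]) simp
    then show ?thesis by (simp only: Xs_law)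
  qed
  finally show ?thesis .
qed

section \<open>Expectation and dimension of a non-degenerate Mandelbrot measure\<close>

context
  assumes nd: "nondegenerate S W"
begin

lemma nd_lp: "\<not> (AE x in cas.L. cas.lp x = 0)"
  using nd nondegenerate_iff by simp

lemma nn_mu_cylinder:
  assumes u: "u \<in> lists AA"
  shows "(\<integral>\<^sup>+\<omega>. emeasure (\<mu> \<omega>) (sstart AA u) \<partial>Om S) = ennreal (prod_list (map cas.p u))"
proof -
  have m: "(\<lambda>x. ennreal (cas.qp x u * cas.lp (cas.shf u x))) \<in> borel_measurable cas.L"
    using cas.measurable_qp[OF u] measurable_compose[OF cas.measurable_shf[OF u] cas.measurable_lp] by measurable
  have "(\<integral>\<^sup>+\<omega>. emeasure (\<mu> \<omega>) (sstart AA u) \<partial>Om S) = (\<integral>\<^sup>+\<omega>. ennreal (cas.qp (Xs \<omega>) u * cas.lp (cas.shf u (Xs \<omega>))) \<partial>Om S)"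
  proof (rule nn_integral_cong_AE)
    show "AE \<omega> in Om S. emeasure (\<mu> \<omega>) (sstart AA u) = ennreal (cas.qp (Xs \<omega>) u * cas.lp (cas.shf u (Xs \<omega>)))"
      using AE_good by eventually_elim (simp only: mu_cylinder[OF u] good_consistent mass_eq[OF _ u] if_True)
  qed
  also have "\<dots> = (\<integral>\<^sup>+x. ennreal (cas.qp x u * cas.lp (cas.shf u x)) \<partial>distr (Om S) cas.L Xs)"
    by (rule nn_integral_distr[OF Xs_meas, symmetric]) (simp only: Xs_law m)
  also have "\<dots> = ennreal (prod_list (map cas.p u))"
    unfolding Xs_law by (rule cas.nn_qp_lp[OF nd_lp u])
  finally show ?thesis .
qed

definition pv :: "'a \<Rightarrow> real" where "pv a = (if a \<in> AA then \<integral>\<omega>. W [] \<omega> a \<partial>Om S else 0)"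

lemma pv_p: "a \<in> AA \<Longrightarrow> pv a = cas.p a" by (simp add: pv_def p_eq)

lemma pv_prob_vec: "pv \<in> prob_vec AA"
  unfolding prob_vec_def using cas.p_nonneg cas.sum_p by (auto simp: pv_p cong: sum.cong) (simp add: pv_def)

text \<open>Dynkin induction from the cylinders. Measurability and the value of the integral go
  through the induction together, since the integrals over complements and unions use measurability
  of the parts.\<close>

lemma expected_mu:
  assumes b: "bernoulli AA pv \<nu>" and E: "E \<in> sets (full_shift AA)"
  shows "(\<lambda>\<omega>. emeasure (\<mu> \<omega>) E) \<in> borel_measurable (Om S)"
    and "(\<integral>\<^sup>+\<omega>. emeasure (\<mu> \<omega>) E \<partial>Om S) = emeasure \<nu> E"
proof -
  note bD = bernoulliD[OF b finAA pv_prob_vec]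
  interpret nu: prob_space \<nu> by (rule bD(3))
  have tot_fin: "emeasure (\<mu> \<omega>) (streams AA) \<noteq> \<infinity>" for \<omega> unfolding mu_total by simp
  have G: "sstart AA ` lists AA \<union> {{}} \<subseteq> Pow (streams AA)" using sstart_in_streams[of _ AA] by blast
  have eqs: "sets (full_shift AA) = sigma_sets (streams AA) (sstart AA ` lists AA \<union> {{}})"
    using sets_stream_space_sstart[of AA] finAA G by (simp add: countable_finite)
  have cyl: "(\<lambda>\<omega>. emeasure (\<mu> \<omega>) (sstart AA u)) \<in> borel_measurable (Om S)
      \<and> (\<integral>\<^sup>+\<omega>. emeasure (\<mu> \<omega>) (sstart AA u) \<partial>Om S) = emeasure \<nu> (sstart AA u)" if u: "u \<in> lists AA" for u
  proof
    have "map pv u = map cas.p u" using u by (auto simp: pv_p)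
    then show "(\<integral>\<^sup>+\<omega>. emeasure (\<mu> \<omega>) (sstart AA u) \<partial>Om S) = emeasure \<nu> (sstart AA u)"
    proof -
      assume eq: "map pv u = map cas.p u"
      have "emeasure \<nu> (sstart AA u) = ennreal (prod_list (map pv u))" using b u unfolding bernoulli_def by blast
      then show ?thesis using nn_mu_cylinder[OF u] by (simp only: eq)
    qed
    have [measurable]: "Measurable.pred (Om S) consistent" using consistent_meas by (simp add: pred_def)
    show "(\<lambda>\<omega>. emeasure (\<mu> \<omega>) (sstart AA u)) \<in> borel_measurable (Om S)"
      unfolding mu_cylinder[OF u] using mass_meas[OF u] by measurable
  qed
  have tot: "(\<lambda>\<omega>. emeasure (\<mu> \<omega>) (streams AA)) \<in> borel_measurable (Om S)
      \<and> (\<integral>\<^sup>+\<omega>. emeasure (\<mu> \<omega>) (streams AA) \<partial>Om S) = emeasure \<nu> (streams AA)" using cyl[of "[]"] by simp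
  have "(\<lambda>\<omega>. emeasure (\<mu> \<omega>) E) \<in> borel_measurable (Om S) \<and> (\<integral>\<^sup>+\<omega>. emeasure (\<mu> \<omega>) E \<partial>Om S) = emeasure \<nu> E"
    using Int_stable_sstart[of AA] G E[unfolded eqs]
  proof (induction rule: sigma_sets_induct_disjoint)
    case (basic E)
    then consider w where "w \<in> lists AA" "E = sstart AA w" | "E = {}" by blast
    then show ?case by cases (use cyl in simp_all)
  next
    case empty then show ?case by simp
  next
    case (compl E)
    have sE: "E \<in> sets (full_shift AA)" using compl eqs by simp
    have c: "emeasure (\<mu> \<omega>) (streams AA - E) = emeasure (\<mu> \<omega>) (streams AA) - emeasure (\<mu> \<omega>) E" for \<omega>
    proof -
      have "emeasure (\<mu> \<omega>) E \<le> emeasure (\<mu> \<omega>) (streams AA)"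
        using emeasure_space[of "\<mu> \<omega>" E] by (simp add: space_mu)
      then have "emeasure (\<mu> \<omega>) E \<noteq> \<infinity>" using tot_fin[of \<omega>] by (auto simp: top_unique)
      then show ?thesis using emeasure_compl[of E "\<mu> \<omega>"] sE by (simp add: sets_mu space_mu)
    qed
    have "(\<integral>\<^sup>+\<omega>. emeasure (\<mu> \<omega>) (streams AA - E) \<partial>Om S) = (\<integral>\<^sup>+\<omega>. emeasure (\<mu> \<omega>) (streams AA) \<partial>Om S) - (\<integral>\<^sup>+\<omega>. emeasure (\<mu> \<omega>) E \<partial>Om S)"
      unfolding c
    proof (rule nn_integral_diff)
      show "(\<integral>\<^sup>+\<omega>. emeasure (\<mu> \<omega>) E \<partial>Om S) \<noteq> \<infinity>" using compl by (simp add: nu.emeasure_finite)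
      show "AE \<omega> in Om S. emeasure (\<mu> \<omega>) E \<le> emeasure (\<mu> \<omega>) (streams AA)"
        using emeasure_space[of "\<mu> _" E] by (simp add: space_mu)
    qed (use tot compl in auto)
    also have "\<dots> = emeasure \<nu> (streams AA - E)"
      using tot compl emeasure_compl[of E \<nu>] sE by (simp add: bD(1,2) nu.emeasure_finite)
    finally have "(\<integral>\<^sup>+\<omega>. emeasure (\<mu> \<omega>) (streams AA - E) \<partial>Om S) = emeasure \<nu> (streams AA - E)" .
    moreover have "(\<lambda>\<omega>. emeasure (\<mu> \<omega>) (streams AA - E)) \<in> borel_measurable (Om S)"
      unfolding c using tot compl by (intro borel_measurable_minus_ennreal) auto
    ultimately show ?case by simp
  next
    case (union F)
    have sF: "F i \<in> sets (full_shift AA)" for i using union eqs by auto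
    have c: "emeasure (\<mu> \<omega>) (\<Union>i. F i) = (\<Sum>i. emeasure (\<mu> \<omega>) (F i))" for \<omega>
      using union sF by (intro suminf_emeasure[symmetric]) (auto simp: sets_mu)
    have c': "emeasure \<nu> (\<Union>i. F i) = (\<Sum>i. emeasure \<nu> (F i))"
      using union sF by (intro suminf_emeasure[symmetric]) (auto simp: bD(1))
    have [measurable]: "(\<lambda>\<omega>. emeasure (\<mu> \<omega>) (F i)) \<in> borel_measurable (Om S)" for i using union by auto
    have "(\<lambda>\<omega>. \<Sum>i. emeasure (\<mu> \<omega>) (F i)) \<in> borel_measurable (Om S)" by measurable
    then show ?case unfolding c c' using union by (simp add: nn_integral_suminf)
  qed
  then show "(\<lambda>\<omega>. emeasure (\<mu> \<omega>) E) \<in> borel_measurable (Om S)" "(\<integral>\<^sup>+\<omega>. emeasure (\<mu> \<omega>) E \<partial>Om S) = emeasure \<nu> E" by auto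
qed

lemma expected_image_eq:
  assumes b: "bernoulli AA pv \<nu>" and f: "Proj S 1 i ` AA \<subseteq> alph S i"
  shows "expected_image S W i = distr \<nu> (full_shift (alph S i)) (smap (Proj S 1 i))"
proof -
  let ?F = "full_shift (alph S i)" and ?g = "smap (Proj S 1 i)"
  note bD = bernoulliD[OF b finAA pv_prob_vec]
  have g: "?g \<in> measurable (full_shift AA) ?F" by (rule measurable_smap) (use f in auto)
  have g1: "?g \<in> measurable \<nu> ?F" using g measurable_cong_sets[OF bD(1) refl] by blast
  have g2: "?g \<in> measurable (\<mu> \<omega>) ?F" for \<omega> using g measurable_cong_sets[OF sets_mu refl] by blast
  let ?N = "distr \<nu> ?F ?g"
  have "expected_image S W i = measure_of (space ?N) (sets ?N) (emeasure ?N)"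
    unfolding expected_image_def space_distr sets_distr space_stream_space space_count_space
  proof (rule measure_of_eq)
    show "sets ?F \<subseteq> Pow (streams (alph S i))" using sets.space_closed[of ?F] by (simp add: space_stream_space)
    fix B assume "B \<in> sigma_sets (streams (alph S i)) (sets ?F)"
    then have B: "B \<in> sets ?F" using sets.sigma_sets_eq[of ?F] by (simp add: space_stream_space)
    have "(\<integral>\<^sup>+\<omega>. emeasure (distr (\<mu> \<omega>) ?F ?g) B \<partial>Om S) = (\<integral>\<^sup>+\<omega>. emeasure (\<mu> \<omega>) (?g -` B \<inter> streams AA) \<partial>Om S)"
      by (simp add: emeasure_distr[OF g2 B] space_mu)
    also have "\<dots> = emeasure \<nu> (?g -` B \<inter> streams AA)"
      using measurable_sets[OF g B] by (intro expected_mu(2)[OF b]) (simp add: space_stream_space)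
    also have "\<dots> = emeasure ?N B" by (simp add: emeasure_distr[OF g1 B] bD(2))
    finally show "(\<integral>\<^sup>+\<omega>. emeasure (distr (\<mu> \<omega>) ?F ?g) B \<partial>Om S) = emeasure ?N B" .
  qed
  then show ?thesis by (simp only: measure_of_of_measure)
qed

lemma ks_expected_image:
  assumes f: "Proj S 1 i ` AA \<subseteq> alph S i" and fin: "finite (alph S i)"
  shows "ks_entropy (expected_image S W i) stl = shannon (alph S i) (pushv AA (Proj S 1 i) pv)"
proof -
  obtain \<nu> where b: "bernoulli AA pv \<nu>" using bernoulli_exists[OF finAA pv_prob_vec] by blast
  show ?thesis unfolding expected_image_eq[OF b f]
    by (intro bernoulli_ks_entropy[OF bernoulli_image[OF b finAA fin f pv_prob_vec] fin] pushv_prob_vec finAA fin f pv_prob_vec)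
qed

lemma surv_set: "{\<omega> \<in> space (Om S). a \<in> surv S [] \<omega>} \<in> sets (Om S)" if "a \<in> AA"
proof -
  have "{\<omega> \<in> space (Om S). a \<in> surv S [] \<omega>} = surv S [] -` {s. s \<subseteq> AA \<and> a \<in> s} \<inter> space (Om S)"
    using measurable_space[OF surv_meas[of "[]"]] by auto
  also have "\<dots> \<in> sets (Om S)" by (rule measurable_sets[OF surv_meas]) auto
  finally show ?thesis .
qed

lemma integrable_W_ln:
  assumes a: "a \<in> AA"
  shows "integrable (Om S) (\<lambda>\<omega>. W [] \<omega> a * ln (W [] \<omega> a))"
  using cas.integrable_pw_ln[OF nd_lp a] Dw_integral(2)[OF a, of "\<lambda>x. x * ln x"] by (simp add: cas.pw_def)

lemma W_zero:
  assumes a: "a \<in> AA" and 0: "pv a = 0"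
  shows "AE \<omega> in Om S. W [] \<omega> a = 0"
proof -
  have "(\<integral>\<omega>. W [] \<omega> a \<partial>Om S) = 0" using a 0 by (simp add: pv_def)
  moreover have "AE \<omega> in Om S. 0 \<le> W [] \<omega> a" using W_root by eventually_elim (use a in auto)
  ultimately show ?thesis using integral_nonneg_eq_0_iff_AE[OF integrable_W[OF a]] by simp
qed

lemma pv_surv:
  assumes a: "a \<in> AA" and 0: "surv_prob S a = 0"
  shows "pv a = 0"
proof -
  have "AE \<omega> in Om S. a \<notin> surv S [] \<omega>"
    using Om.prob_eq_0[OF surv_set[OF a]] 0 AE_space unfolding surv_prob_def by (auto elim!: eventually_elim2)
  then have "AE \<omega> in Om S. W [] \<omega> a = 0" using W_root
    by eventually_elim (use a in \<open>auto simp: less_le\<close>)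
  then have "(\<integral>\<omega>. W [] \<omega> a \<partial>Om S) = (\<integral>\<omega>. 0 \<partial>Om S)" using W_meas[of "[]" a] a by (intro integral_cong_AE) auto
  then show ?thesis by (simp add: pv_def)
qed

text \<open>The tangent of x ln x at c = \<open>pv a / surv_prob S a\<close> is integrated over the
  event that \<open>a\<close> survives, off which the weight vanishes. The linear terms cancel, as W
  and c times the indicator both have mean \<open>pv a\<close>. Letters with \<open>pv a = 0\<close>
  are separated because there is no tangent at 0.\<close>

lemma W_ln_ge:
  assumes a: "a \<in> AA"
  shows "pv a * ln (pv a) - pv a * ln (surv_prob S a) \<le> (\<integral>\<omega>. W [] \<omega> a * ln (W [] \<omega> a) \<partial>Om S)"
    and "(\<integral>\<omega>. W [] \<omega> a * ln (W [] \<omega> a) \<partial>Om S) = pv a * ln (pv a) - pv a * ln (surv_prob S a) \<Longrightarrow>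
      AE \<omega> in Om S. W [] \<omega> a = pv a / surv_prob S a * indicator (surv S [] \<omega>) a"
proof -
  have *: "pv a * ln (pv a) - pv a * ln (surv_prob S a) \<le> (\<integral>\<omega>. W [] \<omega> a * ln (W [] \<omega> a) \<partial>Om S) \<and>
    ((\<integral>\<omega>. W [] \<omega> a * ln (W [] \<omega> a) \<partial>Om S) = pv a * ln (pv a) - pv a * ln (surv_prob S a) \<longrightarrow>
      (AE \<omega> in Om S. W [] \<omega> a = pv a / surv_prob S a * indicator (surv S [] \<omega>) a))"
  proof (cases "pv a = 0")
    case True
    have "AE \<omega> in Om S. W [] \<omega> a * ln (W [] \<omega> a) = 0" using W_zero[OF a True] by eventually_elim simp
    then have "(\<integral>\<omega>. W [] \<omega> a * ln (W [] \<omega> a) \<partial>Om S) = (\<integral>\<omega>. 0 \<partial>Om S)"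
      using W_meas[of "[]" a] a by (intro integral_cong_AE) auto
    then show ?thesis using True W_zero[OF a True] by simp
  next
    case False
    then have pos: "0 < pv a" using prob_vecD(1)[OF pv_prob_vec finAA, of a] by simp
    have "surv_prob S a \<noteq> 0" using pv_surv[OF a] False by auto
    then have spos: "0 < surv_prob S a" by (simp add: surv_prob_def less_le)
    define c where "c = pv a / surv_prob S a"
    have c: "0 < c" using pos spos by (simp add: c_def)
    define t where "t = (\<lambda>\<omega>. W [] \<omega> a * ln (W [] \<omega> a) - W [] \<omega> a * ln c - W [] \<omega> a + c * indicator {\<omega> \<in> space (Om S). a \<in> surv S [] \<omega>} \<omega>)"
    have ii: "integrable (Om S) (\<lambda>\<omega>. c * indicator {\<omega> \<in> space (Om S). a \<in> surv S [] \<omega>} \<omega>)"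
      using surv_set[OF a] by (auto intro!: integrable_mult_right integrable_real_indicator simp: Om.emeasure_eq_measure)
    have it: "integrable (Om S) t" unfolding t_def
      using integrable_W_ln[OF a] integrable_W[OF a] ii by simp
    have "(\<integral>\<omega>. t \<omega> \<partial>Om S) = (\<integral>\<omega>. W [] \<omega> a * ln (W [] \<omega> a) \<partial>Om S) - pv a * ln c - pv a + c * surv_prob S a"
    proof -
      have "(\<integral>\<omega>. c * indicator {\<omega> \<in> space (Om S). a \<in> surv S [] \<omega>} \<omega> \<partial>Om S) = c * surv_prob S a"
        by (simp add: surv_prob_def) (auto intro!: arg_cong[where f=Om.prob])
      moreover have "(\<integral>\<omega>. W [] \<omega> a * ln c \<partial>Om S) = pv a * ln c" using a by (simp add: pv_def)
      ultimately show ?thesis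
        unfolding t_def using integrable_W_ln[OF a] integrable_W[OF a] ii a by (simp add: pv_def)
    qed
    also have "\<dots> = (\<integral>\<omega>. W [] \<omega> a * ln (W [] \<omega> a) \<partial>Om S) - (pv a * ln (pv a) - pv a * ln (surv_prob S a))"
      using pos spos by (simp add: c_def ln_div algebra_simps)
    finally have ti: "(\<integral>\<omega>. t \<omega> \<partial>Om S) = (\<integral>\<omega>. W [] \<omega> a * ln (W [] \<omega> a) \<partial>Om S) - (pv a * ln (pv a) - pv a * ln (surv_prob S a))" .
    have tp: "AE \<omega> in Om S. 0 \<le> t \<omega> \<and> (t \<omega> = 0 \<longrightarrow> W [] \<omega> a = c * indicator (surv S [] \<omega>) a)"
      using W_root AE_space
    proof eventually_elim
      case (elim \<omega>)
      then have w: "0 \<le> W [] \<omega> a" "a \<notin> surv S [] \<omega> \<Longrightarrow> W [] \<omega> a = 0" using a by (auto simp: less_le)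
      show ?case
      proof (cases "a \<in> surv S [] \<omega>")
        case True
        then have "t \<omega> = W [] \<omega> a * ln (W [] \<omega> a) - (W [] \<omega> a * ln c + W [] \<omega> a - c)" using elim by (simp add: t_def)
        then show ?thesis using xlnx_tangent[OF w(1) c] True by auto
      qed (use w elim in \<open>auto simp: t_def\<close>)
    qed
    have tp0: "AE \<omega> in Om S. 0 \<le> t \<omega>" using tp by eventually_elim simp
    have "0 \<le> (\<integral>\<omega>. t \<omega> \<partial>Om S)" using tp0 by (rule integral_nonneg_AE)
    moreover have "AE \<omega> in Om S. W [] \<omega> a = c * indicator (surv S [] \<omega>) a" if "(\<integral>\<omega>. t \<omega> \<partial>Om S) = 0"
    proof -
      have "AE \<omega> in Om S. t \<omega> = 0" using integral_nonneg_eq_0_iff_AE[OF it tp0] that by simp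
      then show ?thesis using tp by eventually_elim simp
    qed
    ultimately show ?thesis using ti by (simp add: c_def)
  qed
  then show "pv a * ln (pv a) - pv a * ln (surv_prob S a) \<le> (\<integral>\<omega>. W [] \<omega> a * ln (W [] \<omega> a) \<partial>Om S)"
    "(\<integral>\<omega>. W [] \<omega> a * ln (W [] \<omega> a) \<partial>Om S) = pv a * ln (pv a) - pv a * ln (surv_prob S a) \<Longrightarrow>
      AE \<omega> in Om S. W [] \<omega> a = pv a / surv_prob S a * indicator (surv S [] \<omega>) a" by auto
qed

text \<open>Jensen's inequality on \<open>{a \<in> A}\<close>: given \<open>E W\<close>, the entropy is largest when \<open>W\<^sub>a\<close> is constant there.\<close>

lemma dim_e_le:
  shows "dim_e S W \<le> shannon AA pv + (\<Sum>a\<in>AA. pv a * ln (surv_prob S a))"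
    and "dim_e S W = shannon AA pv + (\<Sum>a\<in>AA. pv a * ln (surv_prob S a)) \<Longrightarrow>
      AE \<omega> in Om S. \<forall>a\<in>AA. W [] \<omega> a = pv a / surv_prob S a * indicator (surv S [] \<omega>) a"
proof -
  define g where "g = (\<lambda>a. (\<integral>\<omega>. W [] \<omega> a * ln (W [] \<omega> a) \<partial>Om S) - (pv a * ln (pv a) - pv a * ln (surv_prob S a)))"
  have g: "0 \<le> g a" if "a \<in> AA" for a using W_ln_ge(1)[OF that] by (simp add: g_def)
  have s: "(shannon AA pv + (\<Sum>a\<in>AA. pv a * ln (surv_prob S a))) - dim_e S W = sum g AA"
    by (simp add: g_def dim_e_def shannon_def sum_subtractf)
  have "0 \<le> sum g AA" using g by (rule sum_nonneg)
  then show "dim_e S W \<le> shannon AA pv + (\<Sum>a\<in>AA. pv a * ln (surv_prob S a))" using s by simp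
  assume "dim_e S W = shannon AA pv + (\<Sum>a\<in>AA. pv a * ln (surv_prob S a))"
  then have "sum g AA = 0" using s by simp
  then have "g a = 0" if "a \<in> AA" for a using g that finAA by (subst (asm) sum_nonneg_eq_0_iff) auto
  then have "AE \<omega> in Om S. W [] \<omega> a = pv a / surv_prob S a * indicator (surv S [] \<omega>) a" if "a \<in> AA" for a
    using W_ln_ge(2)[OF that] that by (simp add: g_def)
  then show "AE \<omega> in Om S. \<forall>a\<in>AA. W [] \<omega> a = pv a / surv_prob S a * indicator (surv S [] \<omega>) a"
    using finAA by (intro AE_finite_allI) auto
qed

end

end

section \<open>Weights that are functions of the random alphabet\<close>

locale sponge_space =
  fixes S :: "('a, 'w) sponge"
  assumes rs: "random_sponge S"
begin

sublocale Om: prob_space "Om S" using rs by (simp add: random_sponge_def)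

lemma fin_alph: "finite (alph S 1)"
proof -
  have "1 \<in> {1..levels S}" using rs by (auto simp: random_sponge_def)
  then show ?thesis using rs unfolding random_sponge_def by blast
qed

lemma surv_indep: "Om.indep_vars (\<lambda>_. count_space (Pow (alph S 1))) (surv S) (lists (alph S 1))"
  and surv_law: "u \<in> lists (alph S 1) \<Longrightarrow> distr (Om S) (count_space (Pow (alph S 1))) (surv S u) = distr (Om S) (count_space (Pow (alph S 1))) (surv S [])"
  using rs unfolding random_sponge_def by blast+

lemma surv_meas: "u \<in> lists (alph S 1) \<Longrightarrow> surv S u \<in> measurable (Om S) (count_space (Pow (alph S 1)))"
  using surv_indep by (auto simp: Om.indep_vars_def)

lemma surv_sets: "{\<omega> \<in> space (Om S). a \<in> surv S [] \<omega>} \<in> sets (Om S)"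
proof -
  have "{\<omega> \<in> space (Om S). a \<in> surv S [] \<omega>} = surv S [] -` {s. s \<subseteq> alph S 1 \<and> a \<in> s} \<inter> space (Om S)"
    using measurable_space[OF surv_meas[of "[]"]] by auto
  also have "\<dots> \<in> sets (Om S)" by (rule measurable_sets[OF surv_meas]) auto
  finally show ?thesis .
qed

lemma integral_surv:
  "(\<integral>\<omega>. k * indicator (surv S [] \<omega>) a \<partial>Om S) = k * surv_prob S a"
  "integrable (Om S) (\<lambda>\<omega>. k * indicator (surv S [] \<omega>) a :: real)"
proof -
  have i: "integrable (Om S) (indicator {\<omega> \<in> space (Om S). a \<in> surv S [] \<omega>} :: 'w \<Rightarrow> real)"
    using surv_sets by (auto intro!: integrable_real_indicator simp: Om.emeasure_eq_measure)
  have eq: "indicator (surv S [] \<omega>) a = (indicator {\<omega> \<in> space (Om S). a \<in> surv S [] \<omega>} \<omega> :: real)" if "\<omega> \<in> space (Om S)" for \<omega>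
    using that by (auto simp: indicator_def)
  have "(\<integral>\<omega>. k * indicator (surv S [] \<omega>) a \<partial>Om S) = (\<integral>\<omega>. k * indicator {\<omega> \<in> space (Om S). a \<in> surv S [] \<omega>} \<omega> \<partial>Om S)"
    by (intro Bochner_Integration.integral_cong refl) (simp only: eq)
  also have "\<dots> = k * (\<integral>\<omega>. indicator {\<omega> \<in> space (Om S). a \<in> surv S [] \<omega>} \<omega> \<partial>Om S)"
    by simp
  also have "(\<integral>\<omega>. indicator {\<omega> \<in> space (Om S). a \<in> surv S [] \<omega>} \<omega> \<partial>Om S) = surv_prob S a"
    unfolding surv_prob_def by (simp add: Int_absorb2 Collect_conj_eq[symmetric])
  finally show "(\<integral>\<omega>. k * indicator (surv S [] \<omega>) a \<partial>Om S) = k * surv_prob S a" .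
  have "integrable (Om S) (\<lambda>\<omega>. k * indicator {\<omega> \<in> space (Om S). a \<in> surv S [] \<omega>} \<omega>)" using i by simp
  then show "integrable (Om S) (\<lambda>\<omega>. k * indicator (surv S [] \<omega>) a :: real)"
    by (subst Bochner_Integration.integrable_cong[OF refl]) (simp_all only: eq)
qed

end

text \<open>Weights that are constant on the event of survival; the optimal weights turn out to have
  this form.\<close>

locale survival_weights = sponge_space S for S :: "('a, 'w) sponge" +
  fixes c :: "'a \<Rightarrow> real"
  assumes c_nonneg: "\<And>a. a \<in> alph S 1 \<Longrightarrow> 0 \<le> c a"
    and c_mean: "(\<Sum>a\<in>alph S 1. c a * surv_prob S a) = 1"
begin

definition W :: "'a list \<Rightarrow> 'w \<Rightarrow> 'a \<Rightarrow> real" where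
  "W u \<omega> a = c a * indicator (surv S u \<omega>) a"

lemma weights: "mandelbrot_weights S W"
proof -
  let ?CP = "count_space (Pow (alph S 1))" and ?PA = "PiM (alph S 1) (\<lambda>_. borel :: real measure)"
  define h where "h = (\<lambda>s. (s, \<lambda>a\<in>alph S 1. c a * indicator s a))"
  have h: "h \<in> measurable ?CP (?CP \<Otimes>\<^sub>M ?PA)"
    by (auto simp: h_def space_pair_measure space_PiM)
  have X: "(\<lambda>u \<omega>. (surv S u \<omega>, restrict (W u \<omega>) (alph S 1))) = (\<lambda>u \<omega>. h (surv S u \<omega>))"
    by (simp add: h_def W_def[abs_def])
  have ind: "Om.indep_vars (\<lambda>_. ?CP \<Otimes>\<^sub>M ?PA) (\<lambda>u \<omega>. h (surv S u \<omega>)) (lists (alph S 1))"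
    using Om.indep_vars_compose2[OF surv_indep, of "\<lambda>_. h" "\<lambda>_. ?CP \<Otimes>\<^sub>M ?PA"] h by simp
  have law: "distr (Om S) (?CP \<Otimes>\<^sub>M ?PA) (\<lambda>\<omega>. h (surv S u \<omega>)) = distr (Om S) (?CP \<Otimes>\<^sub>M ?PA) (\<lambda>\<omega>. h (surv S [] \<omega>))"
    if u: "u \<in> lists (alph S 1)" for u
  proof -
    have "distr (Om S) (?CP \<Otimes>\<^sub>M ?PA) (\<lambda>\<omega>. h (surv S v \<omega>)) = distr (distr (Om S) ?CP (surv S v)) (?CP \<Otimes>\<^sub>M ?PA) h"
      if "v \<in> lists (alph S 1)" for v
      using distr_distr[OF h surv_meas[OF that]] by (simp add: o_def)
    from this[OF u] this[of "[]"] show ?thesis using surv_law[OF u] by simp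
  qed
  have mean: "(\<integral>\<omega>. (\<Sum>a\<in>alph S 1. W [] \<omega> a) \<partial>Om S) = 1"
    unfolding W_def by (subst Bochner_Integration.integral_sum[OF integral_surv(2)]) (simp only: integral_surv(1) c_mean)
  show ?thesis
    unfolding mandelbrot_weights_def Let_def X
  proof (intro conjI ballI)
    show "AE \<omega> in Om S. \<forall>a\<in>alph S 1. 0 \<le> W [] \<omega> a \<and> (0 < W [] \<omega> a \<longrightarrow> a \<in> surv S [] \<omega>)"
      using c_nonneg by (intro AE_I2) (auto simp: W_def indicator_def)
  qed (fact ind law mean)+
qed

sublocale mandelbrot S W using rs weights by (simp add: mandelbrot_def)

text \<open>A word with a letter that does not survive carries a factor 0, so its cylinder has mass
  0; countably many such cylinders cover the complement of
  \<open>sponge_K S \<omega>\<close>.\<close>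

lemma supported: "supported_on_K S W"
  unfolding supported_on_K_def
proof (rule AE_I2)
  fix \<omega> assume "\<omega> \<in> space (Om S)"
  define N where "N = {u \<in> lists (alph S 1). \<exists>j<length u. u ! j \<notin> surv S (take j u) \<omega>}"
  have "(\<Union>u\<in>N. sstart (alph S 1) u) \<in> null_sets (mandelbrot_measure S W \<omega>)"
  proof (rule null_sets_UN')
    have "countable (lists (alph S 1))" using fin_alph by (intro countable_lists countable_finite)
    then show "countable N" by (rule countable_subset[rotated]) (auto simp: N_def)
    fix u assume u: "u \<in> N"
    then have uA: "u \<in> lists (alph S 1)" by (simp add: N_def)
    obtain j where "j < length u" "u ! j \<notin> surv S (take j u) \<omega>" using u by (auto simp: N_def)
    then have "Qprod W [] u \<omega> = 0" unfolding Qprod_def by (intro prod_zero bexI[of _ j]) (auto simp: W_def)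
    then have "mass u \<omega> = 0" by (simp add: mass_def)
    then have "emeasure (mandelbrot_measure S W \<omega>) (sstart (alph S 1) u) = 0" using mu_cylinder[OF uA, of \<omega>] by simp
    then show "sstart (alph S 1) u \<in> null_sets (mandelbrot_measure S W \<omega>)"
      using sstart_sets_full_shift[OF fin_alph uA] by (simp add: null_sets_def sets_mu)
  qed
  then show "AE x in mandelbrot_measure S W \<omega>. x \<in> sponge_K S \<omega>"
  proof (rule AE_I')
    show "{x \<in> space (mandelbrot_measure S W \<omega>). x \<notin> sponge_K S \<omega>} \<subseteq> (\<Union>u\<in>N. sstart (alph S 1) u)"
    proof
      fix x assume "x \<in> {x \<in> space (mandelbrot_measure S W \<omega>). x \<notin> sponge_K S \<omega>}"
      then have x: "x \<in> streams (alph S 1)" "x \<notin> sponge_K S \<omega>" by (auto simp: space_mu)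
      then obtain j where j: "1 \<le> j" "x !! (j - 1) \<notin> surv S (stake (j - 1) x) \<omega>"
        by (auto simp: sponge_K_def sponge_K_n_def)
      have sl: "stake j x \<in> lists (alph S 1)" using stake_lists[OF x(1)] .
      moreover have "stake j x ! (j - 1) = x !! (j - 1)" "take (j - 1) (stake j x) = stake (j - 1) x"
        using j by (auto simp: take_stake min_def)
      ultimately have "stake j x \<in> N" using j unfolding N_def
        by (intro CollectI conjI exI[of _ "j - 1"]) (auto simp del: in_lists_conv_set)
      moreover have "x \<in> sstart (alph S 1) (stake j x)" unfolding sstart_eq_stake[OF sl] using x by simp
      ultimately show "x \<in> (\<Union>u\<in>N. sstart (alph S 1) u)" by blast
    qed
  qed
qed

lemma integral_root:
  assumes "h 0 = 0"
  shows "(\<integral>\<omega>. h (W [] \<omega> a) \<partial>Om S) = h (c a) * surv_prob S a"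
proof -
  have "(\<integral>\<omega>. h (W [] \<omega> a) \<partial>Om S) = (\<integral>\<omega>. h (c a) * indicator (surv S [] \<omega>) a \<partial>Om S)"
    by (intro Bochner_Integration.integral_cong refl) (simp add: W_def indicator_def assms)
  then show ?thesis using integral_surv(1) by simp
qed

lemma dim: "dim_e S W = - (\<Sum>a\<in>alph S 1. c a * ln (c a) * surv_prob S a)"
  unfolding dim_e_def using integral_root[of "\<lambda>x. x * ln x"] by simp

text \<open>The mean of the sum of W^q equals 1 at q = 1 and has derivative
  \<open>- dim_e S W\<close> there, so it is below 1 for some q slightly above 1, as
  \<open>nondegenerate_bounded\<close> requires.\<close>

lemma nondegenerate_if_dim_pos:
  assumes d: "0 < dim_e S W"
  shows "nondegenerate S W"
  unfolding nondegenerate_iff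
proof -
  define f where "f = (\<lambda>q. \<Sum>a\<in>alph S 1. c a powr q * surv_prob S a)"
  have "((\<lambda>q. c a powr q * surv_prob S a) has_real_derivative c a * ln (c a) * surv_prob S a) (at 1)" if "a \<in> alph S 1" for a
  proof (cases "c a = 0")
    case False
    then have "0 < c a" using c_nonneg[OF that] by simp
    then show ?thesis by (auto intro!: derivative_eq_intros)
  qed simp
  then have "(f has_real_derivative (\<Sum>a\<in>alph S 1. c a * ln (c a) * surv_prob S a)) (at 1)"
    unfolding f_def by (rule DERIV_sum)
  moreover have "(\<Sum>a\<in>alph S 1. c a * ln (c a) * surv_prob S a) < 0" using d by (simp add: dim)
  ultimately obtain e where e: "0 < e" "\<And>h. 0 < h \<Longrightarrow> h < e \<Longrightarrow> f (1 + h) < f 1"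
    using DERIV_neg_dec_right by blast
  \<comment> \<open>The cap at 1 keeps \<open>q \<le> 2\<close>, and \<open>e / 2\<close> stays
    inside the interval of decrease.\<close>
  define q where "q = 1 + min 1 (e / 2)"
  have q: "1 < q" "q \<le> 2" using e by (auto simp: q_def)
  have "f q < f 1" unfolding q_def using e by (intro e(2)) auto
  also have "f 1 = 1" unfolding f_def using c_mean c_nonneg by (simp cong: sum.cong)
  finally have fq: "f q < 1" .
  define B where "B = (\<Sum>a\<in>alph S 1. c a)"
  have B0: "0 \<le> B" unfolding B_def by (intro sum_nonneg c_nonneg)
  show "\<not> (AE x in cas.L. cas.lp x = 0)"
  proof (rule cas.nondegenerate_bounded[OF B0 _ q])
    have m: "{w \<in> space PA. \<forall>a\<in>AA. cas.pw a w \<le> B} \<in> sets PA"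
      unfolding cas.pw_def using fin_alph by (intro sets.sets_Collect_finite_All borel_measurable_le borel_measurable_max borel_measurable_const measurable_component_singleton) auto
    show "AE w in Dw. \<forall>a\<in>AA. cas.pw a w \<le> B"
      unfolding Dw_def
    proof (subst AE_distr_iff[OF R_meas m])
      show "AE \<omega> in Om S. \<forall>a\<in>AA. cas.pw a (R [] \<omega>) \<le> B"
      proof (intro AE_I2 ballI)
        fix \<omega> a assume a: "a \<in> AA"
        have "c a \<le> B" unfolding B_def using a fin_alph c_nonneg by (intro member_le_sum) auto
        then show "cas.pw a (R [] \<omega>) \<le> B" using a B0 by (simp add: cas.pw_def R_def W_def indicator_def)
      qed
    qed simp
    have "(\<Sum>a\<in>AA. \<integral>w. cas.pw a w powr q \<partial>Dw) = (\<Sum>a\<in>AA. \<integral>\<omega>. W [] \<omega> a powr q \<partial>Om S)"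
      unfolding cas.pw_def using Dw_integral(1)[of _ "\<lambda>x. x powr q"] by (intro sum.cong) auto
    also have "\<dots> = f q" unfolding f_def using integral_root[of "\<lambda>x. x powr q"] by simp
    finally show "(\<Sum>a\<in>AA. \<integral>w. cas.pw a w powr q \<partial>Dw) < 1" using fq by simp
  qed
qed

lemma pv_survival: "nondegenerate S W \<Longrightarrow> a \<in> alph S 1 \<Longrightarrow> pv a = c a * surv_prob S a"
  using integral_root[of "\<lambda>x. x" a] by (simp add: pv_def)

end

text \<open>The relation involves only the pair of weights and survival set at one word, so
  \<open>AE_root_all\<close> spreads it from the root to all words.\<close>

lemma (in mandelbrot) same_weights_survival:
  assumes ae: "AE \<omega> in Om S. \<forall>a\<in>AA. W [] \<omega> a = c a * indicator (surv S [] \<omega>) a"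
  shows "AE \<omega> in Om S. \<forall>u\<in>lists AA. \<forall>a\<in>AA. W u \<omega> a = c a * indicator (surv S u \<omega>) a"
proof -
  have "AE \<omega> in Om S. \<forall>u\<in>lists AA. (\<lambda>z. \<forall>a\<in>AA. snd z a = c a * indicator (fst z) a) (joint u \<omega>)"
  proof (rule AE_root_all)
    have 1: "(\<lambda>z. snd z a) \<in> borel_measurable (CP \<Otimes>\<^sub>M PA)" if "a \<in> AA" for a
      using that by (intro measurable_compose[OF measurable_snd measurable_component_singleton])
    have 2: "(\<lambda>z. c a * indicator (fst z) a :: real) \<in> borel_measurable (CP \<Otimes>\<^sub>M PA)" for a
      by (rule measurable_compose[OF measurable_fst]) simp
    show "{z \<in> space (CP \<Otimes>\<^sub>M PA). \<forall>a\<in>AA. snd z a = c a * indicator (fst z) a} \<in> sets (CP \<Otimes>\<^sub>M PA)"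
      using finAA 1 2 by (intro sets.sets_Collect_finite_All borel_measurable_eq) auto
    show "AE \<omega> in Om S. \<forall>a\<in>AA. snd (joint [] \<omega>) a = c a * indicator (fst (joint [] \<omega>)) a"
      using ae by eventually_elim (simp add: joint_def)
  qed
  then show ?thesis by eventually_elim (simp add: joint_def)
qed

section \<open>Pressures as finite dimensional maxima\<close>

lemma sum_indicator_real: "finite A \<Longrightarrow> (\<Sum>x\<in>A. indicator B x) = real (card (A \<inter> B))"
  by (simp add: indicator_def sum.If_cases)

lemma shannon_superset:
  assumes "finite C" "B \<subseteq> C" "q \<in> prob_vec B"
  shows "shannon C q = shannon B q"
  unfolding shannon_def using assms by (auto simp: prob_vec_def intro!: sum.mono_neutral_right)

lemma pushv_superset:
  assumes "finite C" "B \<subseteq> C" "\<And>b. b \<in> C \<Longrightarrow> b \<notin> B \<Longrightarrow> q b = 0"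
  shows "pushv C f q = pushv B f q"
  unfolding pushv_def using assms by (intro ext sum.mono_neutral_right) auto

locale sponge = sponge_space S for S :: "('a, 'w) sponge" +
  assumes gam_pos: "\<And>i. i \<in> {1..levels S} \<Longrightarrow> 0 < gam S i"
begin

abbreviation "K \<equiv> levels S"
abbreviation "act \<equiv> alph_tilde S"
abbreviation "gs \<equiv> gam_sum S"

lemma K2: "2 \<le> K" using rs by (simp add: random_sponge_def)

lemma fin: "i \<in> {1..K} \<Longrightarrow> finite (alph S i)" using rs unfolding random_sponge_def by blast

lemma Proj_refl: "Proj S i i a = a" by (simp add: Proj_def)

lemma Proj_Suc: "i \<le> j \<Longrightarrow> Proj S i (Suc j) a = fac S j (Proj S i j a)"
  by (simp add: Proj_def)

lemma Proj_comp: "i \<le> j \<Longrightarrow> j \<le> l \<Longrightarrow> Proj S j l (Proj S i j a) = Proj S i l a"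
proof -
  assume "i \<le> j" "j \<le> l"
  then have "[i..<l] = [i..<j] @ [j..<l]" using upt_add_eq_append[of i j "l - j"] by simp
  then show ?thesis by (simp add: Proj_def)
qed

lemma Proj_image: "1 \<le> i \<Longrightarrow> i \<le> j \<Longrightarrow> j \<le> K \<Longrightarrow> Proj S i j ` alph S i = alph S j"
proof (induction j)
  case (Suc j)
  show ?case
  proof (cases "i = Suc j")
    case False
    then have ij: "i \<le> j" "j \<in> {1..<K}" using Suc.prems by auto
    have "Proj S i (Suc j) ` alph S i = fac S j ` (Proj S i j ` alph S i)"
      using ij by (simp add: Proj_Suc image_image)
    also have "\<dots> = fac S j ` alph S j" using Suc ij by simp
    also have "\<dots> = alph S (Suc j)" using rs ij unfolding random_sponge_def by blast
    finally show ?thesis .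
  qed (simp add: Proj_refl)
qed simp

lemma surv_prob_nonneg: "0 \<le> surv_prob S a" by (simp add: surv_prob_def)

lemma surv_subset: "\<omega> \<in> space (Om S) \<Longrightarrow> surv S [] \<omega> \<subseteq> alph S 1"
  using measurable_space[OF surv_meas[of "[]"]] by auto

text \<open>Expected counts are images of the vector of survival probabilities, so those of
  different levels are related by \<open>pushv\<close>, which is the form that
  \<open>lumping\<close> asks for.\<close>

lemma EN_eq: "EN S i = pushv (alph S 1) (Proj S 1 i) (surv_prob S)"
proof
  fix b
  have "EN S i b = (\<integral>\<omega>. (\<Sum>a\<in>{a \<in> alph S 1. Proj S 1 i a = b}. 1 * indicator (surv S [] \<omega>) a) \<partial>Om S)"
    unfolding EN_def
  proof (intro Bochner_Integration.integral_cong refl)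
    fix \<omega> assume "\<omega> \<in> space (Om S)"
    then have "{a \<in> surv S [] \<omega>. Proj S 1 i a = b} = {a \<in> alph S 1. Proj S 1 i a = b} \<inter> surv S [] \<omega>"
      using surv_subset by auto
    then show "real (card {a \<in> surv S [] \<omega>. Proj S 1 i a = b}) = (\<Sum>a\<in>{a \<in> alph S 1. Proj S 1 i a = b}. 1 * indicator (surv S [] \<omega>) a)"
      using fin_alph by (simp add: sum_indicator_real)
  qed
  also have "\<dots> = pushv (alph S 1) (Proj S 1 i) (surv_prob S) b"
    unfolding pushv_def by (subst Bochner_Integration.integral_sum[OF integral_surv(2)]) (simp add: integral_surv(1)[of 1, simplified])
  finally show "EN S i b = pushv (alph S 1) (Proj S 1 i) (surv_prob S) b" .
qed

lemma total: "1 < (\<Sum>a\<in>alph S 1. surv_prob S a)"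
proof -
  have "(\<integral>\<omega>. real (card (surv S [] \<omega>)) \<partial>Om S) = (\<integral>\<omega>. (\<Sum>a\<in>alph S 1. 1 * indicator (surv S [] \<omega>) a) \<partial>Om S)"
  proof (intro Bochner_Integration.integral_cong refl)
    fix \<omega> assume "\<omega> \<in> space (Om S)"
    then have "surv S [] \<omega> = alph S 1 \<inter> surv S [] \<omega>" using surv_subset by auto
    then show "real (card (surv S [] \<omega>)) = (\<Sum>a\<in>alph S 1. 1 * indicator (surv S [] \<omega>) a)"
      using fin_alph by (simp add: sum_indicator_real)
  qed
  also have "\<dots> = (\<Sum>a\<in>alph S 1. surv_prob S a)"
    by (subst Bochner_Integration.integral_sum[OF integral_surv(2)]) (simp add: integral_surv(1)[of 1, simplified])
  finally show ?thesis using rs by (simp add: random_sponge_def)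
qed

lemma EN_nonneg: "0 \<le> EN S i b"
  unfolding EN_eq pushv_def by (intro sum_nonneg surv_prob_nonneg)

lemma EN_1: "a \<in> alph S 1 \<Longrightarrow> EN S 1 a = surv_prob S a"
proof -
  assume "a \<in> alph S 1"
  then have "{a' \<in> alph S 1. Proj S 1 1 a' = a} = {a}" by (auto simp: Proj_refl)
  then show ?thesis by (simp add: EN_eq pushv_def)
qed

lemma at_sub: "act i \<subseteq> alph S i" by (auto simp: alph_tilde_def)

lemma at_fin: "i \<in> {1..K} \<Longrightarrow> finite (act i)" using fin at_sub finite_subset by blast

lemma at_pos: "b \<in> act i \<Longrightarrow> 0 < EN S i b" by (simp add: alph_tilde_def)

lemma EN_push_alph:
  assumes "1 \<le> i" "i \<le> j" "j \<le> K"
  shows "EN S j = pushv (alph S i) (Proj S i j) (EN S i)"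
proof -
  have "EN S j = pushv (alph S 1) (\<lambda>a. Proj S i j (Proj S 1 i a)) (surv_prob S)"
    using assms by (simp add: EN_eq Proj_comp)
  also have "\<dots> = pushv (alph S i) (Proj S i j) (EN S i)"
    unfolding EN_eq using assms Proj_image[of 1 i] by (intro pushv_comp[symmetric] fin) auto
  finally show ?thesis .
qed

lemma EN_push:
  assumes "1 \<le> i" "i \<le> j" "j \<le> K"
  shows "EN S j = pushv (act i) (Proj S i j) (EN S i)"
proof -
  have "EN S i b = 0" if "b \<in> alph S i" "b \<notin> act i" for b
    using that EN_nonneg[of i b] by (auto simp: alph_tilde_def)
  then show ?thesis unfolding EN_push_alph[OF assms] using assms
    by (intro pushv_superset fin at_sub) auto
qed

lemma Proj_at:
  assumes "1 \<le> i" "i \<le> j" "j \<le> K"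
  shows "Proj S i j ` act i \<subseteq> act j"
proof
  fix c assume "c \<in> Proj S i j ` act i"
  then obtain b where b: "b \<in> act i" "c = Proj S i j b" by auto
  have "EN S i b \<le> EN S j c" unfolding EN_push[OF assms] pushv_def using b assms at_fin[of i]
    by (intro member_le_sum) (auto simp: EN_nonneg)
  moreover have "c \<in> alph S j" using Proj_image[OF assms] at_sub b by auto
  ultimately show "c \<in> act j" using at_pos[OF b(1)] by (simp add: alph_tilde_def)
qed

lemma at_ne: "i \<in> {1..K} \<Longrightarrow> act i \<noteq> {}"
proof -
  assume i: "i \<in> {1..K}"
  have "act 1 \<noteq> {}"
  proof
    assume "act 1 = {}"
    then have "surv_prob S a = 0" if "a \<in> alph S 1" for a
      using that EN_1[OF that] surv_prob_nonneg[of a] by (auto simp: alph_tilde_def)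
    then show False using total by simp
  qed
  then show ?thesis using Proj_at[of 1 i] i by auto
qed

lemma gs_pos: "i \<in> {1..K} \<Longrightarrow> 0 < gs i"
  unfolding gam_sum_def by (intro sum_pos gam_pos) auto

lemma gs_Suc: "i \<in> {2..K} \<Longrightarrow> gs i = gs (i - 1) + gam S i"
  by (cases i) (auto simp: gam_sum_def)

definition ell :: "nat \<Rightarrow> ('a \<Rightarrow> real) \<Rightarrow> real" where "ell i q = (\<Sum>b\<in>act i. q b * ln (EN S i b))"
definition Hh :: "nat \<Rightarrow> ('a \<Rightarrow> real) \<Rightarrow> real" where "Hh i q = shannon (act i) q"
definition psh :: "nat \<Rightarrow> nat \<Rightarrow> ('a \<Rightarrow> real) \<Rightarrow> 'a \<Rightarrow> real" where "psh i j q = pushv (act i) (Proj S i j) q"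
text \<open>Value of the pressure functional at the Bernoulli measure with weights \<open>q\<close>.
  The factor \<open>gs i\<close> is kept outside \<open>ell\<close>, so that
  \<open>Hh i q + ell i q\<close> is the dimension bound read at level \<open>i\<close>.\<close>

definition FF :: "nat \<Rightarrow> real \<Rightarrow> ('a \<Rightarrow> real) \<Rightarrow> real" where
  "FF i \<theta> q = \<theta> * gs i * ell i q + gs i * Hh i q + (\<Sum>j=i+1..K. gam S j * Hh j (psh i j q))"

lemma psh_prob_vec: "1 \<le> i \<Longrightarrow> i \<le> j \<Longrightarrow> j \<le> K \<Longrightarrow> q \<in> prob_vec (act i) \<Longrightarrow> psh i j q \<in> prob_vec (act j)"
  unfolding psh_def by (intro pushv_prob_vec at_fin Proj_at) auto

lemma psh_psh: "1 \<le> i \<Longrightarrow> i \<le> j \<Longrightarrow> j \<le> l \<Longrightarrow> l \<le> K \<Longrightarrow> psh j l (psh i j q) = psh i l q"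
  unfolding psh_def using Proj_at[of i j] by (subst pushv_comp) (auto intro: at_fin simp: Proj_comp)

lemma Hh_antimono: "1 \<le> i \<Longrightarrow> i \<le> j \<Longrightarrow> j \<le> K \<Longrightarrow> q \<in> prob_vec (act i) \<Longrightarrow> Hh j (psh i j q) \<le> Hh i q"
  unfolding Hh_def psh_def by (intro shannon_pushv_le at_fin Proj_at) auto

lemma Hh_nonneg: "i \<in> {1..K} \<Longrightarrow> q \<in> prob_vec (act i) \<Longrightarrow> 0 \<le> Hh i q"
  unfolding Hh_def using prob_vecD(1,2)[OF _ at_fin] by (intro shannon_nonneg) auto

text \<open>The dimension bound can only grow under projection. The equality case singles out the
  vectors spread over the fibres proportionally to the expected counts, which later identifies the
  maximizer.\<close>

lemma Hh_ell_le:
  assumes "1 \<le> i" "i \<le> j" "j \<le> K" "q \<in> prob_vec (act i)"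
  shows "Hh i q + ell i q \<le> Hh j (psh i j q) + ell j (psh i j q)"
    and "Hh i q + ell i q = Hh j (psh i j q) + ell j (psh i j q) \<longleftrightarrow>
      (\<forall>a\<in>act i. q a = psh i j q (Proj S i j a) * EN S i a / EN S j (Proj S i j a))"
proof -
  have f: "finite (act i)" "finite (act j)" using assms at_fin by auto
  show "Hh i q + ell i q \<le> Hh j (psh i j q) + ell j (psh i j q)"
    unfolding Hh_def ell_def psh_def
    by (rule lumping(1)[OF f Proj_at[OF assms(1-3)] assms(4)]) (erule at_pos, rule fun_cong[OF EN_push[OF assms(1-3)]])
  show "Hh i q + ell i q = Hh j (psh i j q) + ell j (psh i j q) \<longleftrightarrow>
      (\<forall>a\<in>act i. q a = psh i j q (Proj S i j a) * EN S i a / EN S j (Proj S i j a))"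
    unfolding Hh_def ell_def psh_def
    by (rule lumping(2)[OF f Proj_at[OF assms(1-3)] assms(4)]) (erule at_pos, rule fun_cong[OF EN_push[OF assms(1-3)]])
qed

section \<open>Pressure and equilibrium state at one level\<close>

context
  fixes i assumes i: "i \<in> {1..K}"
begin

interpretation po: pressure_opt "act i" "\<lambda>b. gs i * ln (EN S i b)" "gs i" "{i+1..K}" "gam S" act "Proj S i"
proof
  show "finite (act i)" "act i \<noteq> {}" "0 < gs i" using i at_fin at_ne gs_pos by auto
  show "0 \<le> gam S j" if "j \<in> {i+1..K}" for j using gam_pos[of j] that by auto
  show "finite (act j)" if "j \<in> {i+1..K}" for j using at_fin[of j] that by auto
  show "Proj S i j ` act i \<subseteq> act j" if "j \<in> {i+1..K}" for j using Proj_at[of i j] i that by auto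
qed simp

lemma obj_FF: "po.obj \<theta> q = FF i \<theta> q"
  unfolding po.obj_def FF_def ell_def Hh_def psh_def by (simp add: sum_distrib_left mult_ac)

lemma integral_potential:
  assumes \<nu>: "\<nu> \<in> invariant_measures (act i)"
  shows "(\<integral>x. potential S i x \<partial>\<nu>) = gs i * ell i (ldist \<nu> shd)"
proof -
  note D = invariant_measuresD[OF \<nu>]
  interpret prob_space \<nu> by (rule D(3))
  note sf = simple_function_shd[OF at_fin[OF i] \<nu>]
  have sets: "{x \<in> space \<nu>. shd x = b} \<in> sets \<nu>" for b by (rule simple_function_level_set[OF sf])
  have "(\<integral>x. potential S i x \<partial>\<nu>) = (\<integral>x. (\<Sum>b\<in>act i. gs i * ln (EN S i b) * indicator {x \<in> space \<nu>. shd x = b} x) \<partial>\<nu>)"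
  proof (intro Bochner_Integration.integral_cong refl)
    fix x assume x: "x \<in> space \<nu>"
    then have "shd x \<in> act i" using D(2) by (auto dest: streams_shd)
    then have "(\<Sum>b\<in>act i. gs i * ln (EN S i b) * indicator {x \<in> space \<nu>. shd x = b} x) = (\<Sum>b\<in>{shd x}. gs i * ln (EN S i b) * indicator {x \<in> space \<nu>. shd x = b} x)"
      using x at_fin[OF i] by (intro sum.mono_neutral_right) (auto simp: indicator_def)
    then show "potential S i x = (\<Sum>b\<in>act i. gs i * ln (EN S i b) * indicator {x \<in> space \<nu>. shd x = b} x)"
      using x by (simp add: potential_def)
  qed
  also have "\<dots> = (\<Sum>b\<in>act i. gs i * ln (EN S i b) * measure \<nu> {x \<in> space \<nu>. shd x = b})"
  proof -
    have int: "integrable \<nu> (\<lambda>x. gs i * ln (EN S i b) * indicator {x \<in> space \<nu>. shd x = b} x)" for b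
      using sets by (intro integrable_mult_right integrable_real_indicator) (auto simp: emeasure_eq_measure)
    have each: "(\<integral>x. gs i * ln (EN S i b) * indicator {x \<in> space \<nu>. shd x = b} x \<partial>\<nu>) = gs i * ln (EN S i b) * measure \<nu> {x \<in> space \<nu>. shd x = b}" for b
    proof -
      have "{x \<in> space \<nu>. shd x = b} \<inter> space \<nu> = {x \<in> space \<nu>. shd x = b}" by auto
      then show ?thesis by (simp only: integral_mult_right_zero Bochner_Integration.integral_indicator)
    qed
    show ?thesis by (subst Bochner_Integration.integral_sum[OF int]) (simp only: each)
  qed
  also have "\<dots> = gs i * ell i (ldist \<nu> shd)"
    by (simp add: ell_def ldist_def sum_distrib_left mult_ac)
  finally show ?thesis .
qed

lemma ks_image_le:
  assumes \<nu>: "\<nu> \<in> invariant_measures (act i)" and j: "j \<in> {i+1..K}"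
  shows "ks_entropy (distr \<nu> (full_shift (alph S j)) (smap (Proj S i j))) stl \<le> Hh j (psh i j (ldist \<nu> shd))"
proof -
  have ij: "1 \<le> i" "i \<le> j" "j \<le> K" using i j by auto
  have f: "Proj S i j ` act i \<subseteq> alph S j" using Proj_at[OF ij] at_sub by blast
  have fj: "finite (alph S j)" using ij by (intro fin) auto
  note im = invariant_image[OF at_fin[OF i] fj f \<nu>]
  have "shannon (alph S j) (psh i j (ldist \<nu> shd)) = Hh j (psh i j (ldist \<nu> shd))"
    unfolding Hh_def using ij by (intro shannon_superset fj at_sub psh_prob_vec ldist_shd_prob_vec at_fin i \<nu>)
  then show ?thesis using ks_entropy_le_marginal(1)[OF fj im(1)] by (simp add: im(2) psh_def)
qed

text \<open>The integral of the potential depends on the one-letter marginal alone, and each entropy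
  is at most that of its marginal. As \<open>gs i\<close> is positive, equality is inherited by the
  leading entropy and forces a product measure.\<close>

lemma pressure_functional_le:
  assumes \<nu>: "\<nu> \<in> invariant_measures (act i)"
  shows "pressure_functional S i \<theta> \<nu> \<le> FF i \<theta> (ldist \<nu> shd)"
    and "pressure_functional S i \<theta> \<nu> = FF i \<theta> (ldist \<nu> shd) \<Longrightarrow> bernoulli (act i) (ldist \<nu> shd) \<nu>"
proof -
  let ?q = "ldist \<nu> shd"
  define s1 where "s1 = (\<Sum>j=i+1..K. gam S j * ks_entropy (distr \<nu> (full_shift (alph S j)) (smap (Proj S i j))) stl)"
  define s2 where "s2 = (\<Sum>j=i+1..K. gam S j * Hh j (psh i j ?q))"
  have s: "s1 \<le> s2" unfolding s1_def s2_def
  proof (intro sum_mono mult_left_mono ks_image_le[OF \<nu>])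
    fix j assume "j \<in> {i+1..K}"
    then show "0 \<le> gam S j" using gam_pos[of j] by simp
  qed
  have h: "ks_entropy \<nu> stl \<le> Hh i ?q" unfolding Hh_def by (rule ks_entropy_le_marginal(1)[OF at_fin[OF i] \<nu>])
  then have gh: "gs i * ks_entropy \<nu> stl \<le> gs i * Hh i ?q" using gs_pos[OF i] by (intro mult_left_mono) auto
  have pf: "pressure_functional S i \<theta> \<nu> = \<theta> * gs i * ell i ?q + gs i * ks_entropy \<nu> stl + s1"
    unfolding pressure_functional_def integral_potential[OF \<nu>] s1_def by simp
  have ff: "FF i \<theta> ?q = \<theta> * gs i * ell i ?q + gs i * Hh i ?q + s2" by (simp add: FF_def s2_def)
  show "pressure_functional S i \<theta> \<nu> \<le> FF i \<theta> ?q" unfolding pf ff using s gh by simp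
  assume "pressure_functional S i \<theta> \<nu> = FF i \<theta> ?q"
  then have "gs i * ks_entropy \<nu> stl = gs i * Hh i ?q" using s gh unfolding pf ff by linarith
  then have "ks_entropy \<nu> stl = shannon (act i) ?q" using gs_pos[OF i] by (simp add: Hh_def)
  then show "bernoulli (act i) ?q \<nu>" by (rule ks_entropy_le_marginal(2)[OF at_fin[OF i] \<nu>])
qed

lemma pressure_functional_bernoulli:
  assumes b: "bernoulli (act i) q \<nu>" and q: "q \<in> prob_vec (act i)"
  shows "pressure_functional S i \<theta> \<nu> = FF i \<theta> q"
proof -
  note fi = at_fin[OF i]
  have \<nu>: "\<nu> \<in> invariant_measures (act i)" by (rule bernoulli_invariant[OF b fi q])
  have "ks_entropy (distr \<nu> (full_shift (alph S j)) (smap (Proj S i j))) stl = Hh j (psh i j q)" if j: "j \<in> {i+1..K}" for j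
  proof -
    have ij: "1 \<le> i" "i \<le> j" "j \<le> K" using i j by auto
    have f: "Proj S i j ` act i \<subseteq> alph S j" using Proj_at[OF ij] at_sub by blast
    have fj: "finite (alph S j)" using ij by (intro fin) auto
    have "ks_entropy (distr \<nu> (full_shift (alph S j)) (smap (Proj S i j))) stl = shannon (alph S j) (psh i j q)"
      unfolding psh_def by (intro bernoulli_ks_entropy[OF bernoulli_image[OF b fi fj f q] fj] pushv_prob_vec fi fj f q)
    also have "\<dots> = Hh j (psh i j q)" unfolding Hh_def using ij by (intro shannon_superset fj at_sub psh_prob_vec q)
    finally show ?thesis .
  qed
  moreover have "ks_entropy \<nu> stl = Hh i q" unfolding Hh_def by (rule bernoulli_ks_entropy[OF b fi q])
  ultimately show ?thesis
    unfolding pressure_functional_def integral_potential[OF \<nu>] bernoulli_ldist_shd[OF b fi q] FF_def by simp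
qed

definition eqv :: "real \<Rightarrow> 'a \<Rightarrow> real" where "eqv \<theta> = ldist (equilibrium_state S i \<theta>) shd"

text \<open>Supremum and \<open>THE\<close> are resolved together: a maximizing measure has a
  marginal that maximizes \<open>FF i \<theta>\<close>, hence the unique one, and it is Bernoulli by
  the equality case of \<open>pressure_functional_le\<close>.\<close>

lemma level_aux:
  "pressure S i \<theta> = FF i \<theta> (po.qmax \<theta>) \<and> bernoulli (act i) (po.qmax \<theta>) (equilibrium_state S i \<theta>)"
proof -
  note fi = at_fin[OF i]
  note Q = po.qmax(1)[of \<theta>]
  obtain \<nu>0 where b: "bernoulli (act i) (po.qmax \<theta>) \<nu>0" using bernoulli_exists[OF fi Q] by blast
  have inv: "\<nu>0 \<in> invariant_measures (act i)" by (rule bernoulli_invariant[OF b fi Q])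
  have v0: "pressure_functional S i \<theta> \<nu>0 = FF i \<theta> (po.qmax \<theta>)" by (rule pressure_functional_bernoulli[OF b Q])
  have le: "pressure_functional S i \<theta> \<nu> \<le> FF i \<theta> (po.qmax \<theta>)" if "\<nu> \<in> invariant_measures (act i)" for \<nu>
    using pressure_functional_le(1)[OF that, of \<theta>] po.qmax(2)[OF ldist_shd_prob_vec[OF fi that], of \<theta>]
    unfolding obj_FF by simp
  have P: "pressure S i \<theta> = FF i \<theta> (po.qmax \<theta>)"
    unfolding pressure_def
  proof (rule antisym)
    show "(SUP \<nu>\<in>invariant_measures (act i). pressure_functional S i \<theta> \<nu>) \<le> FF i \<theta> (po.qmax \<theta>)"
      using inv le by (intro cSUP_least) auto
    show "FF i \<theta> (po.qmax \<theta>) \<le> (SUP \<nu>\<in>invariant_measures (act i). pressure_functional S i \<theta> \<nu>)"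
      unfolding v0[symmetric] using le inv by (intro cSUP_upper bdd_aboveI2)
  qed
  have "equilibrium_state S i \<theta> = \<nu>0"
    unfolding equilibrium_state_def
  proof (rule the_equality)
    show "\<nu>0 \<in> invariant_measures (act i) \<and> pressure_functional S i \<theta> \<nu>0 = pressure S i \<theta>" using inv v0 P by simp
    fix \<nu> assume \<nu>: "\<nu> \<in> invariant_measures (act i) \<and> pressure_functional S i \<theta> \<nu> = pressure S i \<theta>"
    then have \<nu>i: "\<nu> \<in> invariant_measures (act i)" by simp
    note pl = ldist_shd_prob_vec[OF fi \<nu>i]
    have "FF i \<theta> (ldist \<nu> shd) \<le> FF i \<theta> (po.qmax \<theta>)" using po.qmax(2)[OF pl, of \<theta>] unfolding obj_FF .
    then have e: "FF i \<theta> (ldist \<nu> shd) = FF i \<theta> (po.qmax \<theta>)" "pressure_functional S i \<theta> \<nu> = FF i \<theta> (ldist \<nu> shd)"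
      using pressure_functional_le(1)[OF \<nu>i, of \<theta>] \<nu> P by auto
    have "ldist \<nu> shd = po.qmax \<theta>" using e(1) by (intro po.qmax_unique[OF pl]) (simp add: obj_FF)
    then have "bernoulli (act i) (po.qmax \<theta>) \<nu>" using pressure_functional_le(2)[OF \<nu>i e(2)] by simp
    then show "\<nu> = \<nu>0" using bernoulli_unique[OF fi] b by blast
  qed
  then show ?thesis using P b by simp
qed

lemma eqv_qmax: "eqv \<theta> = po.qmax \<theta>"
  unfolding eqv_def using level_aux bernoulli_ldist_shd[OF _ at_fin[OF i] po.qmax(1)] by blast

lemma eqv_prob_vec: "eqv \<theta> \<in> prob_vec (act i)" unfolding eqv_qmax by (rule po.qmax(1))

lemma eqv_max: "q \<in> prob_vec (act i) \<Longrightarrow> FF i \<theta> q \<le> FF i \<theta> (eqv \<theta>)"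
  unfolding eqv_qmax obj_FF[symmetric] by (rule po.qmax(2))

lemma eqv_unique: "q \<in> prob_vec (act i) \<Longrightarrow> FF i \<theta> q = FF i \<theta> (eqv \<theta>) \<Longrightarrow> q = eqv \<theta>"
  unfolding eqv_qmax obj_FF[symmetric] by (rule po.qmax_unique)

lemma pressure_eq: "pressure S i \<theta> = FF i \<theta> (eqv \<theta>)"
  unfolding eqv_qmax using level_aux by blast

lemma bernoulli_equilibrium: "bernoulli (act i) (eqv \<theta>) (equilibrium_state S i \<theta>)"
  unfolding eqv_qmax using level_aux by blast

text \<open>As \<open>ell\<close> is the difference of the dimension bound and the entropy
  \<open>Hh i\<close>, the sign of this derivative compares the two at the equilibrium
  vector.\<close>

lemma deriv_pressure: "deriv (pressure S i) \<theta> = gs i * ell i (eqv \<theta>)"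
proof -
  have "pressure S i = (\<lambda>\<theta>. po.obj \<theta> (po.qmax \<theta>))" by (simp add: fun_eq_iff pressure_eq eqv_qmax obj_FF)
  then have "(pressure S i has_real_derivative po.lin \<theta>) (at \<theta>)" using po.has_derivative_obj_qmax[of \<theta>] by simp
  then have "deriv (pressure S i) \<theta> = po.lin \<theta>" by (rule DERIV_imp_deriv)
  also have "\<dots> = gs i * ell i (eqv \<theta>)" by (simp add: po.lin_def ell_def eqv_qmax sum_distrib_left mult_ac)
  finally show ?thesis .
qed

lemma continuous_deriv_pressure: "continuous_on UNIV (deriv (pressure S i))"
proof -
  have "deriv (pressure S i) = po.lin"
    by (simp add: fun_eq_iff deriv_pressure po.lin_def ell_def eqv_qmax sum_distrib_left mult_ac)
  then show ?thesis using po.continuous_on_lin by simp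
qed

end

end

section \<open>The optimization problem\<close>

context sponge
begin

text \<open>\<open>GG p d\<close> is \<open>dim\<^sub>e\<^sup>\<gamma> \<mu>\<close> when \<open>E W = p\<close> and \<open>dim\<^sub>e \<mu> = d\<close>.\<close>

definition GG :: "('a \<Rightarrow> real) \<Rightarrow> real \<Rightarrow> real" where
  "GG p d = gam S 1 * d + (\<Sum>i=2..K. gam S i * min d (Hh i (psh 1 i p)))"

lemma sum_levels_split:
  assumes i: "i \<in> {2..K}"
  shows "(\<Sum>j=2..K. f j) = (\<Sum>j\<in>{2..<i}. f j) + f i + (\<Sum>j=i+1..K. (f j :: real))"
proof -
  have "{2..K} = {2..<i} \<union> ({i} \<union> {i+1..K})" using i by auto
  then show ?thesis by (simp only:) (subst sum.union_disjoint; auto)+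
qed

lemma gs_split: "i \<in> {2..K} \<Longrightarrow> gs (i - 1) = gam S 1 + (\<Sum>j\<in>{2..<i}. gam S j)"
proof -
  assume i: "i \<in> {2..K}"
  have "{1..i - 1} = {1} \<union> {2..<i}" using i by auto
  then show ?thesis unfolding gam_sum_def by (simp only:) (subst sum.union_disjoint; auto)
qed

text \<open>In the equality case the positive coefficient \<open>\<theta> * gs i\<close> of
  \<open>d\<close> forces \<open>d\<close> to attain the bound at level \<open>i\<close>; since
  \<open>d \<le> Hh 1 p + ell 1 p\<close>, which is at most that bound, the whole chain
  collapses.\<close>

lemma GG_upper:
  assumes i: "i \<in> {2..K}" and \<theta>: "gs (i - 1) \<le> \<theta> * gs i" "\<theta> \<le> 1" and p: "p \<in> prob_vec (act 1)"
    and d: "d \<le> Hh 1 p + ell 1 p"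
  shows "GG p d \<le> FF i \<theta> (psh 1 i p)"
    and "GG p d = FF i \<theta> (psh 1 i p) \<Longrightarrow> d = Hh 1 p + ell 1 p \<and> d = Hh i (psh 1 i p) + ell i (psh 1 i p)"
proof -
  define q where "q = psh 1 i p"
  define H where "H = Hh i q"
  define T where "T = (\<Sum>j=i+1..K. gam S j * Hh j (psh i j q))"
  have i1: "1 \<le> i" "i \<le> K" using i by auto
  have gpos: "0 < gs (i - 1)" "0 < gs i" using i by (auto intro!: gs_pos)
  have tpos: "0 < \<theta> * gs i" using gpos \<theta> by simp
  have dl: "d \<le> H + ell i q" using d Hh_ell_le(1)[of 1 i p] i1 p unfolding H_def q_def by simp
  have s1: "(\<Sum>j\<in>{2..<i}. gam S j * min d (Hh j (psh 1 j p))) \<le> (\<Sum>j\<in>{2..<i}. gam S j) * d"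
    unfolding sum_distrib_right
  proof (rule sum_mono)
    fix j assume "j \<in> {2..<i}"
    then show "gam S j * min d (Hh j (psh 1 j p)) \<le> gam S j * d" using gam_pos[of j] i by (intro mult_left_mono) auto
  qed
  have s2: "(\<Sum>j=i+1..K. gam S j * min d (Hh j (psh 1 j p))) \<le> T"
    unfolding T_def
  proof (rule sum_mono)
    fix j assume j: "j \<in> {i+1..K}"
    then have "psh i j q = psh 1 j p" unfolding q_def using i1 by (intro psh_psh) auto
    then show "gam S j * min d (Hh j (psh 1 j p)) \<le> gam S j * Hh j (psh i j q)" using gam_pos[of j] j by (intro mult_left_mono) auto
  qed
  \<comment> \<open>\<open>gam S i\<close> is the sum of two shares that are non-negative exactly in
    the given range of \<open>\<theta>\<close>; the first share of the minimum is bounded by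
    \<open>d\<close>, the second by \<open>H\<close>. With the lower levels the coefficient of
    \<open>d\<close> adds up to \<open>\<theta> * gs i\<close>.\<close>
  have s3: "gam S i * min d H \<le> (\<theta> * gs i - gs (i - 1)) * d + (gs i - \<theta> * gs i) * H"
  proof -
    have "(\<theta> * gs i - gs (i - 1)) * min d H \<le> (\<theta> * gs i - gs (i - 1)) * d" using \<theta> by (intro mult_left_mono) auto
    moreover have "(gs i - \<theta> * gs i) * min d H \<le> (gs i - \<theta> * gs i) * H" using \<theta> gpos by (intro mult_left_mono) auto
    moreover have "gam S i * min d H = (\<theta> * gs i - gs (i - 1)) * min d H + (gs i - \<theta> * gs i) * min d H"
      using gs_Suc[OF i] by (simp add: algebra_simps)
    ultimately show ?thesis by linarith
  qed
  have "GG p d = gam S 1 * d + ((\<Sum>j\<in>{2..<i}. gam S j * min d (Hh j (psh 1 j p))) + gam S i * min d H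
      + (\<Sum>j=i+1..K. gam S j * min d (Hh j (psh 1 j p))))"
    unfolding GG_def sum_levels_split[OF i] H_def q_def ..
  then have "GG p d \<le> (gam S 1 + (\<Sum>j\<in>{2..<i}. gam S j)) * d + ((\<theta> * gs i - gs (i - 1)) * d + (gs i - \<theta> * gs i) * H) + T"
    using s1 s2 s3 by (simp add: distrib_right)
  also have "\<dots> = \<theta> * gs i * d + (gs i - \<theta> * gs i) * H + T"
    unfolding gs_split[OF i, symmetric] by (simp add: algebra_simps)
  finally have 1: "GG p d \<le> \<theta> * gs i * d + (gs i - \<theta> * gs i) * H + T" .
  have 2: "\<theta> * gs i * d \<le> \<theta> * gs i * (H + ell i q)" using dl tpos by (intro mult_left_mono) auto
  have 3: "FF i \<theta> q = \<theta> * gs i * (H + ell i q) + (gs i - \<theta> * gs i) * H + T"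
    by (simp add: FF_def H_def T_def algebra_simps)
  show "GG p d \<le> FF i \<theta> (psh 1 i p)" using 1 2 3 by (simp add: q_def)
  assume "GG p d = FF i \<theta> (psh 1 i p)"
  then have "\<theta> * gs i * d = \<theta> * gs i * (H + ell i q)" using 1 2 3 unfolding q_def by linarith
  then have "d = H + ell i q" using tpos by auto
  then show "d = Hh 1 p + ell 1 p \<and> d = Hh i (psh 1 i p) + ell i (psh 1 i p)"
    using d Hh_ell_le(1)[of 1 i p] i1 p unfolding H_def q_def by auto
qed

text \<open>The preimage of \<open>q\<close> under \<open>psh i j\<close> with the largest \<open>Hh i + ell i\<close>.\<close>

definition lift :: "nat \<Rightarrow> nat \<Rightarrow> ('a \<Rightarrow> real) \<Rightarrow> 'a \<Rightarrow> real" where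
  "lift i j q a = (if a \<in> act i then q (Proj S i j a) * EN S i a / EN S j (Proj S i j a) else 0)"

text \<open>The fibre sums of \<open>EN S i\<close> are \<open>EN S j\<close> by
  \<open>EN_push\<close>, so the proportional redistribution projects back to \<open>q\<close>; it
  realizes the equality case of \<open>Hh_ell_le\<close>.\<close>

lemma lift_push:
  assumes ij: "1 \<le> i" "i \<le> j" "j \<le> K" and q: "q \<in> prob_vec (act j)"
  shows "psh i j (lift i j q) = q" and "lift i j q \<in> prob_vec (act i)"
    and "Hh i (lift i j q) + ell i (lift i j q) = Hh j q + ell j q"
proof -
  have fi: "finite (act i)" "finite (act j)" using ij by (auto intro: at_fin)
  have q0: "0 \<le> q b" for b using prob_vecD(1)[OF q fi(2)] .
  show 1: "psh i j (lift i j q) = q"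
  proof
    fix b
    have "psh i j (lift i j q) b = (\<Sum>a\<in>{a \<in> act i. Proj S i j a = b}. q b / EN S j b * EN S i a)"
      unfolding psh_def pushv_def by (intro sum.cong refl) (auto simp: lift_def)
    also have "\<dots> = q b / EN S j b * EN S j b"
      unfolding sum_distrib_left[symmetric] using EN_push[OF ij] by (simp add: pushv_def)
    also have "\<dots> = q b" using at_pos[of b j] prob_vecD(4)[OF q fi(2), of b] by (cases "b \<in> act j") auto
    finally show "psh i j (lift i j q) b = q b" .
  qed
  have nn: "0 \<le> lift i j q a" for a using q0 EN_nonneg by (simp add: lift_def)
  have "sum (lift i j q) (act i) = (\<Sum>b\<in>act j. pushv (act i) (Proj S i j) (lift i j q) b * 1)"
    using sum_pushv[OF fi Proj_at[OF ij], of "lift i j q" "\<lambda>_. 1"] by simp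
  also have "\<dots> = sum q (act j)" using 1 by (simp add: psh_def)
  finally have "sum (lift i j q) (act i) = 1" using prob_vecD(3)[OF q fi(2)] by simp
  then show 2: "lift i j q \<in> prob_vec (act i)" using nn by (auto simp: prob_vec_def) (simp add: lift_def)
  show "Hh i (lift i j q) + ell i (lift i j q) = Hh j q + ell j q"
    using Hh_ell_le(2)[OF ij 2] unfolding 1 by (simp add: lift_def)
qed

lemma lift_unique:
  assumes ij: "1 \<le> i" "i \<le> j" "j \<le> K" and p: "p \<in> prob_vec (act i)"
    and eq: "Hh i p + ell i p = Hh j (psh i j p) + ell j (psh i j p)"
  shows "p = lift i j (psh i j p)"
proof
  fix a
  have "finite (act i)" using ij by (intro at_fin) auto
  then show "p a = lift i j (psh i j p) a"
    using Hh_ell_le(2)[OF ij p] eq prob_vecD(4)[OF p, of a] by (auto simp: lift_def)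
qed

text \<open>The expected counts of level \<open>i\<close> add up over the fibres of
  \<open>Proj S i j\<close> to those of level \<open>j\<close>, so proportional redistribution from
  level \<open>l\<close> is compatible with an intermediate level.\<close>

lemma psh_lift:
  assumes ij: "1 \<le> i" "i \<le> j" "j \<le> l" "l \<le> K"
  shows "psh i j (lift i l q) = lift j l q"
proof
  fix b
  show "psh i j (lift i l q) b = lift j l q b"
  proof (cases "b \<in> act j")
    case True
    have "psh i j (lift i l q) b = (\<Sum>a\<in>{a \<in> act i. Proj S i j a = b}. q (Proj S j l b) / EN S l (Proj S j l b) * EN S i a)"
      unfolding psh_def pushv_def using ij by (intro sum.cong refl) (auto simp: lift_def Proj_comp)
    also have "\<dots> = q (Proj S j l b) / EN S l (Proj S j l b) * EN S j b"
      unfolding sum_distrib_left[symmetric] using EN_push[of i j] ij by (simp add: pushv_def)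
    finally show ?thesis using True by (simp add: lift_def)
  next
    case False
    then have "{a \<in> act i. Proj S i j a = b} = {}" using Proj_at[of i j] ij by auto
    then have "psh i j (lift i l q) b = 0" unfolding psh_def pushv_def by (simp only: sum.empty)
    then show ?thesis using False by (simp add: lift_def)
  qed
qed

text \<open>The case \<open>i\<^sub>0 = k + 1\<close> is the case of level \<open>k\<close> with \<open>\<theta> = 1\<close>.\<close>

definition i1 :: nat where "i1 = min (i_zero S) K"
definition th :: real where "th = theta_zero S"
definition qst :: "'a \<Rightarrow> real" where "qst = eqv i1 th"
definition dst :: real where "dst = Hh i1 qst + ell i1 qst"
definition pst :: "'a \<Rightarrow> real" where "pst = lift 1 i1 qst"

lemma I_tilde_fin: "finite (I_tilde S)" "I_tilde S \<subseteq> {2..K}" by (auto simp: I_tilde_def)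

lemma i_zero_cases:
  "(i_zero S \<le> K \<and> i_zero S \<in> I_tilde S \<and> (\<forall>j<i_zero S. j \<notin> I_tilde S) \<and> i1 = i_zero S)
   \<or> (i_zero S = K + 1 \<and> I_tilde S = {} \<and> i1 = K \<and> th = 1)"
proof (cases "I_tilde S = {}")
  case True
  then show ?thesis by (simp add: i_zero_def i1_def th_def theta_zero_def)
next
  case False
  then have z: "i_zero S = Min (I_tilde S)" by (simp add: i_zero_def)
  have "i_zero S \<in> I_tilde S" unfolding z using False I_tilde_fin by (intro Min_in)
  moreover from this have "i_zero S \<le> K" using I_tilde_fin by auto
  moreover have "j \<notin> I_tilde S" if "j < i_zero S" for j
    using that Min_le[OF I_tilde_fin(1), of j] unfolding z by (auto simp: not_less[symmetric])
  ultimately show ?thesis by (simp add: i1_def)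
qed

lemma i1_range: "i1 \<in> {2..K}" "i1 \<in> {1..K}"
  using i_zero_cases I_tilde_fin K2 by auto

lemma theta_tilde_le: "i \<in> {2..K} \<Longrightarrow> theta_tilde S i * gs i = gs (i - 1)" "i \<in> {2..K} \<Longrightarrow> theta_tilde S i \<le> 1"
proof -
  assume i: "i \<in> {2..K}"
  have "0 < gs i" using i by (intro gs_pos) auto
  moreover have "0 < gam S i" using i by (intro gam_pos) auto
  ultimately show "theta_tilde S i * gs i = gs (i - 1)" "theta_tilde S i \<le> 1"
    using gs_Suc[OF i] by (auto simp: theta_tilde_def)
qed

text \<open>The derivative is continuous, so the admissible parameters form a compact set, and it
  contains 1 because \<open>i_zero S\<close> lies in \<open>I_tilde S\<close>. Hence the
  \<open>LEAST\<close> is attained.\<close>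

lemma th_least:
  assumes z: "i_zero S \<le> K"
  shows "th \<in> {theta_tilde S i1..1}" "0 \<le> deriv (pressure S i1) th"
    "\<And>\<theta>. theta_tilde S i1 \<le> \<theta> \<Longrightarrow> \<theta> < th \<Longrightarrow> deriv (pressure S i1) \<theta> < 0"
proof -
  have i1: "i1 = i_zero S" "i_zero S \<in> I_tilde S" using i_zero_cases z by auto
  define \<Theta> where "\<Theta> = {\<theta> \<in> {theta_tilde S i1..1}. 0 \<le> deriv (pressure S i1) \<theta>}"
  have "\<Theta> = {theta_tilde S i1..1} \<inter> {\<theta>. 0 \<le> deriv (pressure S i1) \<theta>}" by (auto simp: \<Theta>_def)
  moreover have "closed {\<theta>. 0 \<le> deriv (pressure S i1) \<theta>}"
    by (intro closed_Collect_le continuous_on_const continuous_deriv_pressure i1_range)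
  ultimately have "compact \<Theta>" by (simp add: compact_Int_closed)
  moreover have "1 \<in> \<Theta>" using i1 theta_tilde_le(2)[OF i1_range(1)] by (simp add: \<Theta>_def I_tilde_def)
  ultimately obtain t where t: "t \<in> \<Theta>" "\<And>s. s \<in> \<Theta> \<Longrightarrow> t \<le> s" using compact_attains_inf[of \<Theta>] by blast
  have "th = (LEAST \<theta>. \<theta> \<in> \<Theta>)" using z by (simp add: th_def theta_zero_def \<Theta>_def i1 conj_assoc)
  also have "\<dots> = t" using t by (intro Least_equality) auto
  finally have th: "th = t" .
  show "th \<in> {theta_tilde S i1..1}" "0 \<le> deriv (pressure S i1) th" using t(1) by (auto simp: th \<Theta>_def)
  show "deriv (pressure S i1) \<theta> < 0" if "theta_tilde S i1 \<le> \<theta>" "\<theta> < th" for \<theta>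
    using t(2)[of \<theta>] that th t(1) by (force simp: \<Theta>_def)
qed

lemma th_range: "gs (i1 - 1) \<le> th * gs i1" "th \<le> 1" "theta_tilde S i1 \<le> th"
proof -
  have "theta_tilde S i1 \<le> th \<and> th \<le> 1"
    using i_zero_cases th_least(1) theta_tilde_le(2)[OF i1_range(1)] by auto
  then show "th \<le> 1" "theta_tilde S i1 \<le> th" by auto
  then have "theta_tilde S i1 * gs i1 \<le> th * gs i1" using gs_pos[OF i1_range(2)] by (intro mult_right_mono) auto
  then show "gs (i1 - 1) \<le> th * gs i1" using theta_tilde_le(1)[OF i1_range(1)] by simp
qed

lemma qst_prob_vec: "qst \<in> prob_vec (act i1)" unfolding qst_def by (rule eqv_prob_vec[OF i1_range(2)])

lemma pst_facts: "pst \<in> prob_vec (act 1)" "psh 1 i1 pst = qst" "Hh 1 pst + ell 1 pst = dst"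
  unfolding pst_def dst_def using lift_push[OF _ _ _ qst_prob_vec, of 1] i1_range by auto

lemma ell_qst: "deriv (pressure S i1) th = gs i1 * ell i1 qst"
  unfolding qst_def by (rule deriv_pressure[OF i1_range(2)])

text \<open>A positive derivative at \<open>th\<close> would by continuity be positive slightly to
  the left, still inside the range. So it is 0, and with it \<open>ell i1 qst\<close>, the
  difference of \<open>dst\<close> and \<open>Hh i1 qst\<close>.\<close>

lemma dst_interior:
  assumes z: "i_zero S \<le> K" and gt: "theta_tilde S i1 < th"
  shows "dst = Hh i1 qst"
proof -
  have "deriv (pressure S i1) th \<le> 0"
  proof (rule ccontr)
    assume "\<not> ?thesis"
    then have pos: "th \<in> {\<theta>. 0 < deriv (pressure S i1) \<theta>}" by simp
    have "open {\<theta>. 0 < deriv (pressure S i1) \<theta>}"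
      by (intro open_Collect_less continuous_on_const continuous_deriv_pressure i1_range)
    then obtain e where e: "0 < e" "ball th e \<subseteq> {\<theta>. 0 < deriv (pressure S i1) \<theta>}" using pos openE by blast
    define \<theta> where "\<theta> = max (theta_tilde S i1) (th - e / 2)"
    have "theta_tilde S i1 \<le> \<theta>" "\<theta> < th" "\<theta> \<in> ball th e" using e gt by (auto simp: \<theta>_def dist_real_def)
    then show False using th_least(3)[OF z, of \<theta>] e by fastforce
  qed
  then have "deriv (pressure S i1) th = 0" using th_least(2)[OF z] by simp
  then show ?thesis using ell_qst gs_pos[OF i1_range(2)] by (simp add: dst_def)
qed

text \<open>At the left end point of the parameter range the pressures of two consecutive levels agree,
  \<open>P\<^sub>i (\<theta>~\<^sub>i) = P\<^sub>i\<^sub>-\<^sub>1 (1)\<close>, and their equilibrium vectors correspond under lifting.\<close>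

lemma eqv_lift:
  assumes i: "i \<in> {3..K}"
  shows "eqv (i - 1) 1 = lift (i - 1) i (eqv i (theta_tilde S i))"
proof -
  define q where "q = eqv i (theta_tilde S i)"
  define r where "r = lift (i - 1) i q"
  have ij: "1 \<le> i - 1" "i - 1 \<le> i" "i \<le> K" using i by auto
  have q: "q \<in> prob_vec (act i)" unfolding q_def using i by (intro eqv_prob_vec) auto
  have le: "FF (i - 1) 1 s = gs (i - 1) * (Hh (i - 1) s + ell (i - 1) s) + gam S i * Hh i (psh (i - 1) i s) + (\<Sum>j=i+1..K. gam S j * Hh j (psh i j (psh (i - 1) i s)))" for s
  proof -
    have "{i - 1 + 1..K} = {i} \<union> {i+1..K}" using i by auto
    then have "(\<Sum>j=i - 1 + 1..K. gam S j * Hh j (psh (i - 1) j s)) = gam S i * Hh i (psh (i - 1) i s) + (\<Sum>j=i+1..K. gam S j * Hh j (psh (i - 1) j s))"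
      by (simp only:) (subst sum.union_disjoint; auto)
    also have "(\<Sum>j=i+1..K. gam S j * Hh j (psh (i - 1) j s)) = (\<Sum>j=i+1..K. gam S j * Hh j (psh i j (psh (i - 1) i s)))"
      using i by (intro sum.cong refl) (simp add: psh_psh)
    finally show ?thesis unfolding FF_def by (simp add: algebra_simps)
  qed
  have tt: "theta_tilde S i * gs i = gs (i - 1)" using i by (intro theta_tilde_le) auto
  have up: "FF i (theta_tilde S i) t = gs (i - 1) * (Hh i t + ell i t) + gam S i * Hh i t + (\<Sum>j=i+1..K. gam S j * Hh j (psh i j t))" for t
    unfolding FF_def tt using gs_Suc[of i] i by (simp add: algebra_simps)
  have gp: "0 < gs (i - 1)" using i by (intro gs_pos) auto
  \<comment> \<open>\<open>theta_tilde S i\<close> is the parameter at which the coefficients in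
    \<open>le\<close> and \<open>up\<close> match; \<open>Hh_ell_le\<close> then compares the two
    levels.\<close>
  have all: "FF (i - 1) 1 s \<le> FF i (theta_tilde S i) q" if s: "s \<in> prob_vec (act (i - 1))" for s
  proof -
    have "gs (i - 1) * (Hh (i - 1) s + ell (i - 1) s) \<le> gs (i - 1) * (Hh i (psh (i - 1) i s) + ell i (psh (i - 1) i s))"
      using Hh_ell_le(1)[OF ij s] gp by (intro mult_left_mono) auto
    then have "FF (i - 1) 1 s \<le> FF i (theta_tilde S i) (psh (i - 1) i s)" unfolding le up by simp
    also have "\<dots> \<le> FF i (theta_tilde S i) q" unfolding q_def using ij s by (intro eqv_max psh_prob_vec) auto
    finally show ?thesis .
  qed
  have r: "r \<in> prob_vec (act (i - 1))" "FF (i - 1) 1 r = FF i (theta_tilde S i) q"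
    unfolding r_def le up using lift_push[OF ij q] by auto
  have im: "i - 1 \<in> {1..K}" using i by auto
  have "FF (i - 1) 1 r = FF (i - 1) 1 (eqv (i - 1) 1)"
    using eqv_max[OF im r(1), of 1] all[OF eqv_prob_vec[OF im, of 1]] r(2) by simp
  then have "r = eqv (i - 1) 1" by (rule eqv_unique[OF im r(1)])
  then show ?thesis by (simp add: r_def q_def)
qed

text \<open>At an interior parameter \<open>dst\<close> is the entropy at level \<open>i1\<close>,
  which is below those of lower levels. At the left end point, minimality of \<open>i_zero S\<close>
  makes the derivative at 1 negative for level \<open>i1 - 1\<close>; its equilibrium vector is by
  \<open>eqv_lift\<close> the projection of \<open>pst\<close>, so \<open>dst\<close> is below the
  entropy there. If \<open>I_tilde S\<close> is empty, \<open>ell\<close> is negative at the top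
  level itself.\<close>

lemma optimum_lower_levels:
  assumes j: "j \<in> {2..<i1}"
  shows "dst \<le> Hh j (psh 1 j pst)"
proof -
  have jr: "1 \<le> j" "j \<le> i1" "i1 \<le> K" using j i1_range by auto
  have pj: "psh 1 j pst \<in> prob_vec (act j)" using jr pst_facts by (intro psh_prob_vec) auto
  have "Hh i1 (psh j i1 (psh 1 j pst)) \<le> Hh j (psh 1 j pst)" by (rule Hh_antimono[OF jr pj])
  then have mono: "Hh i1 qst \<le> Hh j (psh 1 j pst)" using jr pst_facts(2) by (simp add: psh_psh)
  show ?thesis
  proof (cases "i_zero S \<le> K")
    case True
    then have z: "i1 = i_zero S" "\<And>j. j < i1 \<Longrightarrow> j \<notin> I_tilde S" using i_zero_cases by auto
    show ?thesis
    proof (cases "theta_tilde S i1 < th")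
      case True
      then show ?thesis using dst_interior[OF \<open>i_zero S \<le> K\<close>] mono by simp
    next
      case False
      then have tt: "th = theta_tilde S i1" using th_range by simp
      have i3: "i1 \<in> {3..K}" using j i1_range by auto
      define r where "r = eqv (i1 - 1) 1"
      have r: "r = lift (i1 - 1) i1 qst" unfolding r_def qst_def tt by (rule eqv_lift[OF i3])
      have ir: "i1 - 1 \<in> {2..K}" "i1 - 1 \<in> {1..K}" using i3 by auto
      have "i1 - 1 \<notin> I_tilde S" using z(2)[of "i1 - 1"] i3 by simp
      then have "deriv (pressure S (i1 - 1)) 1 < 0" using ir by (auto simp: I_tilde_def)
      then have "gs (i1 - 1) * ell (i1 - 1) r < 0" unfolding r_def using deriv_pressure[OF ir(2)] by simp
      then have "ell (i1 - 1) r < 0" using gs_pos[OF ir(2)] by (simp add: mult_less_0_iff)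
      moreover have "Hh (i1 - 1) r + ell (i1 - 1) r = dst"
        unfolding r dst_def using i3 by (intro lift_push qst_prob_vec) auto
      ultimately have lt: "dst < Hh (i1 - 1) r" by simp
      have "psh 1 (i1 - 1) pst = r" unfolding pst_def r using i3 by (intro psh_lift) auto
      moreover have "1 \<le> j" "j \<le> i1 - 1" "i1 - 1 \<le> K" using j i3 by auto
      ultimately have "psh j (i1 - 1) (psh 1 j pst) = r" using psh_psh[of 1 j "i1 - 1" pst] by simp
      moreover have "Hh (i1 - 1) (psh j (i1 - 1) (psh 1 j pst)) \<le> Hh j (psh 1 j pst)"
        using j i3 by (intro Hh_antimono pj) auto
      ultimately show ?thesis using lt by simp
    qed
  next
    case False
    then have z: "I_tilde S = {}" "i1 = K" "th = 1" using i_zero_cases by auto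
    then have "deriv (pressure S i1) th < 0" using i1_range by (auto simp: I_tilde_def)
    then have "ell i1 qst < 0" using ell_qst gs_pos[OF i1_range(2)] by (simp add: mult_less_0_iff)
    then show ?thesis using mono by (simp add: dst_def)
  qed
qed

text \<open>At an interior parameter both arguments of the minimum agree. At the left end point the
  coefficient of \<open>dst\<close> is 0 and the entropy is the smaller argument. If
  \<open>I_tilde S\<close> is empty, \<open>th = 1\<close> makes the coefficient of the entropy 0
  and \<open>dst\<close> is the smaller one; there are then no levels above
  \<open>i1\<close>.\<close>

lemma optimum_same_level:
  "(th * gs i1 - gs (i1 - 1)) * dst + (gs i1 - th * gs i1) * Hh i1 qst = gam S i1 * min dst (Hh i1 qst)"
  and optimum_upper_levels: "i1 < K \<Longrightarrow> Hh i1 qst \<le> dst"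
proof -
  have g: "gs i1 = gs (i1 - 1) + gam S i1" by (rule gs_Suc[OF i1_range(1)])
  have "(th * gs i1 - gs (i1 - 1)) * dst + (gs i1 - th * gs i1) * Hh i1 qst = gam S i1 * min dst (Hh i1 qst)
     \<and> (i1 < K \<longrightarrow> Hh i1 qst \<le> dst)"
  proof (cases "i_zero S \<le> K")
    case True
    have "0 \<le> gs i1 * ell i1 qst" using th_least(2)[OF True] ell_qst by simp
    then have "0 \<le> ell i1 qst" using gs_pos[OF i1_range(2)] by (simp add: zero_le_mult_iff)
    then have Hd: "Hh i1 qst \<le> dst" by (simp add: dst_def)
    show ?thesis
    proof (cases "theta_tilde S i1 < th")
      case True
      then have "dst = Hh i1 qst" by (rule dst_interior[OF \<open>i_zero S \<le> K\<close>])
      then show ?thesis using g by (simp add: algebra_simps)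
    next
      case False
      then have "th = theta_tilde S i1" using th_range by simp
      then have "th * gs i1 = gs (i1 - 1)" using theta_tilde_le(1)[OF i1_range(1)] by simp
      then show ?thesis using Hd g by simp
    qed
  next
    case False
    then have z: "I_tilde S = {}" "i1 = K" "th = 1" using i_zero_cases by auto
    then have "deriv (pressure S i1) th < 0" using i1_range by (auto simp: I_tilde_def)
    then have "ell i1 qst < 0" using ell_qst gs_pos[OF i1_range(2)] by (simp add: mult_less_0_iff)
    then have "dst < Hh i1 qst" by (simp add: dst_def)
    then show ?thesis using z g by simp
  qed
  then show "(th * gs i1 - gs (i1 - 1)) * dst + (gs i1 - th * gs i1) * Hh i1 qst = gam S i1 * min dst (Hh i1 qst)"
    "i1 < K \<Longrightarrow> Hh i1 qst \<le> dst" by auto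
qed

lemma GG_optimum: "GG pst dst = pressure S i1 th"
proof -
  define T where "T = (\<Sum>j=i1+1..K. gam S j * Hh j (psh i1 j qst))"
  have ir: "1 \<le> i1" "i1 \<le> K" using i1_range by auto
  have s1: "(\<Sum>j\<in>{2..<i1}. gam S j * min dst (Hh j (psh 1 j pst))) = (\<Sum>j\<in>{2..<i1}. gam S j) * dst"
    unfolding sum_distrib_right using optimum_lower_levels by (intro sum.cong refl) simp
  have s2: "(\<Sum>j=i1+1..K. gam S j * min dst (Hh j (psh 1 j pst))) = T"
    unfolding T_def
  proof (intro sum.cong refl)
    fix j assume j: "j \<in> {i1+1..K}"
    have e: "psh 1 j pst = psh i1 j qst" using psh_psh[of 1 i1 j pst] j ir pst_facts(2) by simp
    have "Hh j (psh i1 j qst) \<le> Hh i1 qst" using j ir by (intro Hh_antimono qst_prob_vec) auto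
    also have "\<dots> \<le> dst" using j by (intro optimum_upper_levels) auto
    finally show "gam S j * min dst (Hh j (psh 1 j pst)) = gam S j * Hh j (psh i1 j qst)" unfolding e by simp
  qed
  have "GG pst dst = gam S 1 * dst + ((\<Sum>j\<in>{2..<i1}. gam S j) * dst + gam S i1 * min dst (Hh i1 qst) + T)"
    unfolding GG_def sum_levels_split[OF i1_range(1)] s1 s2 pst_facts(2) ..
  also have "\<dots> = (gam S 1 + (\<Sum>j\<in>{2..<i1}. gam S j)) * dst + gam S i1 * min dst (Hh i1 qst) + T" by (simp add: algebra_simps)
  also have "\<dots> = th * gs i1 * dst + (gs i1 - th * gs i1) * Hh i1 qst + T"
    unfolding gs_split[OF i1_range(1), symmetric] optimum_same_level[symmetric] by (simp add: algebra_simps)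
  also have "\<dots> = FF i1 th qst" by (simp add: FF_def T_def dst_def algebra_simps)
  also have "\<dots> = pressure S i1 th" unfolding qst_def by (rule pressure_eq[OF i1_range(2), symmetric])
  finally show ?thesis .
qed

text \<open>Equality makes the projection of \<open>p\<close> to level \<open>i1\<close> the unique
  equilibrium vector and shows that the dimension bound did not grow under this projection;
  \<open>lift_unique\<close> then recovers \<open>p\<close>.\<close>

lemma GG_le:
  assumes p: "p \<in> prob_vec (act 1)" and d: "d \<le> Hh 1 p + ell 1 p"
  shows "GG p d \<le> pressure S i1 th"
    and "GG p d = pressure S i1 th \<Longrightarrow> p = pst \<and> d = dst"
proof -
  have ir: "1 \<le> i1" "i1 \<le> K" using i1_range by auto
  have pp: "psh 1 i1 p \<in> prob_vec (act i1)" using ir p by (intro psh_prob_vec) auto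
  have P: "pressure S i1 th = FF i1 th qst" unfolding qst_def by (rule pressure_eq[OF i1_range(2)])
  have 1: "GG p d \<le> FF i1 th (psh 1 i1 p)" by (rule GG_upper(1)[OF i1_range(1) th_range(1,2) p d])
  have 2: "FF i1 th (psh 1 i1 p) \<le> FF i1 th qst" unfolding qst_def by (rule eqv_max[OF i1_range(2) pp])
  show "GG p d \<le> pressure S i1 th" using 1 2 P by simp
  assume "GG p d = pressure S i1 th"
  then have e: "GG p d = FF i1 th (psh 1 i1 p)" "FF i1 th (psh 1 i1 p) = FF i1 th qst" using 1 2 P by auto
  have q: "psh 1 i1 p = qst" using e(2) eqv_unique[OF i1_range(2) pp] by (simp add: qst_def)
  have "d = Hh 1 p + ell 1 p" "d = Hh i1 (psh 1 i1 p) + ell i1 (psh 1 i1 p)"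
    using GG_upper(2)[OF i1_range(1) th_range(1,2) p d e(1)] by auto
  then have "Hh 1 p + ell 1 p = Hh i1 (psh 1 i1 p) + ell i1 (psh 1 i1 p)" "d = dst" by (auto simp: q dst_def)
  then show "p = pst \<and> d = dst" using lift_unique[of 1 i1 p] ir p q by (simp add: pst_def)
qed

text \<open>Non-degeneracy of the optimal weights rests on this sign. The vector proportional to the
  survival probabilities has dimension bound \<open>ln Z\<close> with Z = E(#A) > 1, so the maximum
  of \<open>GG\<close> is positive; with \<open>dst \<le> 0\<close> every term of
  \<open>GG pst dst\<close> would be at most 0.\<close>

lemma dst_pos: "0 < dst"
proof -
  define Z where "Z = (\<Sum>a\<in>act 1. EN S 1 a)"
  have f1: "finite (act 1)" using K2 by (intro at_fin) auto
  have "(\<Sum>a\<in>alph S 1. surv_prob S a) = (\<Sum>a\<in>alph S 1. EN S 1 a)" by (intro sum.cong refl) (simp add: EN_1)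
  also have "\<dots> = Z" unfolding Z_def using fin_alph at_sub EN_nonneg
    by (intro sum.mono_neutral_right) (auto simp: alph_tilde_def not_less antisym)
  finally have Z: "1 < Z" using total by simp
  define p where "p = (\<lambda>a. if a \<in> act 1 then EN S 1 a / Z else 0)"
  have sp: "sum p (act 1) = 1" using Z by (simp add: p_def Z_def flip: sum_divide_distrib)
  have p: "p \<in> prob_vec (act 1)" unfolding prob_vec_def using sp Z EN_nonneg by (auto simp: p_def)
  have "Hh 1 p + ell 1 p = (\<Sum>a\<in>act 1. p a * (ln (EN S 1 a) - ln (p a)))"
    by (simp add: Hh_def ell_def shannon_def sum_subtractf algebra_simps)
  also have "\<dots> = (\<Sum>a\<in>act 1. p a * ln Z)"
    using Z at_pos by (intro sum.cong refl) (simp add: p_def ln_div)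
  also have "\<dots> = ln Z" using sp by (simp flip: sum_distrib_right)
  finally have D: "Hh 1 p + ell 1 p = ln Z" .
  have lz: "0 < ln Z" using Z by simp
  have "0 < gam S 1 * ln Z" using gam_pos[of 1] K2 lz by simp
  also have "\<dots> \<le> GG p (ln Z)" unfolding GG_def
  proof -
    have "0 \<le> (\<Sum>i=2..K. gam S i * min (ln Z) (Hh i (psh 1 i p)))"
    proof (intro sum_nonneg mult_nonneg_nonneg)
      fix i assume "i \<in> {2..K}"
      then show "0 \<le> gam S i" "0 \<le> min (ln Z) (Hh i (psh 1 i p))"
        using gam_pos[of i] lz Hh_nonneg[of i "psh 1 i p"] psh_prob_vec[of 1 i p] p by auto
    qed
    then show "gam S 1 * ln Z \<le> gam S 1 * ln Z + (\<Sum>i=2..K. gam S i * min (ln Z) (Hh i (psh 1 i p)))" by simp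
  qed
  also have "\<dots> \<le> GG pst dst" unfolding GG_optimum using GG_le(1)[OF p, of "ln Z"] D by simp
  finally have pos: "0 < GG pst dst" .
  show ?thesis
  proof (rule ccontr)
    assume "\<not> 0 < dst"
    then have d0: "dst \<le> 0" by simp
    have "gam S i * min dst (Hh i (psh 1 i pst)) \<le> 0" if "i \<in> {2..K}" for i
      using gam_pos[of i] that d0 by (intro mult_nonneg_nonpos) auto
    then have "(\<Sum>i=2..K. gam S i * min dst (Hh i (psh 1 i pst))) \<le> 0" by (rule sum_nonpos)
    moreover have "gam S 1 * dst \<le> 0" using gam_pos[of 1] K2 d0 by (intro mult_nonneg_nonpos) auto
    ultimately show False using pos by (simp add: GG_def)
  qed
qed

section \<open>From vectors back to Mandelbrot measures\<close>

lemma Hh_alph: "i \<in> {1..K} \<Longrightarrow> q \<in> prob_vec (act i) \<Longrightarrow> shannon (alph S i) q = Hh i q"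
  unfolding Hh_def by (intro shannon_superset fin at_sub)

text \<open>Letters that almost surely do not survive have mean weight 0, so the vector of means
  lives on \<open>act 1\<close>, where the finite dimensional problem is posed.\<close>

lemma dim_e_gam_eq:
  assumes W: "W \<in> mandelbrot_on_K S"
  shows "mandelbrot.pv S W \<in> prob_vec (act 1)" "dim_e_gam S W = GG (mandelbrot.pv S W) (dim_e S W)"
    "dim_e S W \<le> Hh 1 (mandelbrot.pv S W) + ell 1 (mandelbrot.pv S W)"
proof -
  interpret m: mandelbrot S W using W rs by (simp add: mandelbrot_def mandelbrot_on_K_def)
  have nd: "nondegenerate S W" using W by (simp add: mandelbrot_on_K_def)
  have a1: "act 1 = {a \<in> alph S 1. 0 < surv_prob S a}" by (auto simp: alph_tilde_def EN_1)
  have z: "m.pv a = 0" if "a \<in> alph S 1" "a \<notin> act 1" for a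
    using m.pv_surv[OF nd that(1)] that surv_prob_nonneg[of a] by (auto simp: a1)
  have pA: "m.pv \<in> prob_vec (alph S 1)" by (rule m.pv_prob_vec[OF nd])
  have "sum m.pv (act 1) = sum m.pv (alph S 1)"
    using z fin_alph at_sub by (intro sum.mono_neutral_left) auto
  then show p: "m.pv \<in> prob_vec (act 1)" using pA z prob_vecD(1,4)[OF pA fin_alph] prob_vecD(3)[OF pA fin_alph]
    unfolding prob_vec_def by auto
  have ks: "ks_entropy (expected_image S W i) stl = Hh i (psh 1 i m.pv)" if i: "i \<in> {2..K}" for i
  proof -
    have ir: "1 \<le> i" "i \<le> K" "i \<in> {1..K}" using i by auto
    have "ks_entropy (expected_image S W i) stl = shannon (alph S i) (pushv (alph S 1) (Proj S 1 i) m.pv)"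
      using ir Proj_image[of 1 i] by (intro m.ks_expected_image[OF nd] fin) auto
    also have "pushv (alph S 1) (Proj S 1 i) m.pv = psh 1 i m.pv" unfolding psh_def
      by (rule pushv_superset[OF fin_alph at_sub z])
    also have "shannon (alph S i) (psh 1 i m.pv) = Hh i (psh 1 i m.pv)"
      using ir p by (intro Hh_alph psh_prob_vec) auto
    finally show ?thesis .
  qed
  show "dim_e_gam S W = GG m.pv (dim_e S W)" unfolding dim_e_gam_def GG_def using ks by simp
  have "shannon (alph S 1) m.pv = Hh 1 m.pv" using K2 p by (intro Hh_alph) auto
  moreover have "(\<Sum>a\<in>alph S 1. m.pv a * ln (surv_prob S a)) = ell 1 m.pv"
    unfolding ell_def using z fin_alph at_sub by (intro sum.mono_neutral_cong_right) (auto simp: EN_1 alph_tilde_def)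
  ultimately show "dim_e S W \<le> Hh 1 m.pv + ell 1 m.pv" using m.dim_e_le(1)[OF nd] by simp
qed

text \<open>Values of the optimal weights on the event of survival. By \<open>pst_cst\<close> the
  vector \<open>pst\<close> consists of their means.\<close>

definition cst :: "'a \<Rightarrow> real" where
  "cst a = (if Proj S 1 i1 a \<in> act i1 then qst (Proj S 1 i1 a) / EN S i1 (Proj S 1 i1 a) else 0)"

lemma optimal_weights_eq: "optimal_weights S u \<omega> a = cst a * indicator (surv S u \<omega>) a"
proof -
  note b = bernoulli_equilibrium[OF i1_range(2), of th]
  have "measure (equilibrium_state S i1 th) (sstart (act i1) [b]) = qst b" if "b \<in> act i1" for b
    using bernoulliD(4)[OF b at_fin[OF i1_range(2)] eqv_prob_vec[OF i1_range(2)], of "[b]"] that by (simp add: qst_def)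
  then show ?thesis
    by (simp add: optimal_weights_def weights_of_def Let_def i1_def[symmetric] th_def[symmetric] cst_def)
qed

lemma pst_cst: "a \<in> alph S 1 \<Longrightarrow> pst a = cst a * surv_prob S a"
proof -
  assume a: "a \<in> alph S 1"
  have "Proj S 1 i1 a \<in> act i1" if "a \<in> act 1" using that Proj_at[of 1 i1] i1_range by auto
  moreover have "surv_prob S a = 0" if "a \<notin> act 1" using that a surv_prob_nonneg[of a] by (auto simp: alph_tilde_def EN_1)
  ultimately show ?thesis using a by (auto simp: pst_def lift_def cst_def EN_1)
qed

lemma survival_weights_cst: "survival_weights S cst"
proof
  have q0: "0 \<le> qst b" for b using prob_vecD(1)[OF qst_prob_vec at_fin[OF i1_range(2)]] .
  show "0 \<le> cst a" for a using q0 EN_nonneg by (simp add: cst_def)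
  have "(\<Sum>a\<in>alph S 1. cst a * surv_prob S a) = sum pst (alph S 1)" by (intro sum.cong refl) (simp add: pst_cst)
  also have "\<dots> = sum pst (act 1)" using fin_alph at_sub by (intro sum.mono_neutral_right) (auto simp: pst_def lift_def)
  also have "\<dots> = 1" using pst_facts(1) by (simp add: prob_vec_def)
  finally show "(\<Sum>a\<in>alph S 1. cst a * surv_prob S a) = 1" .
qed

lemma optimal_weights_on_K:
  "optimal_weights S \<in> mandelbrot_on_K S" "dim_e S (optimal_weights S) = dst"
  "mandelbrot.pv S (optimal_weights S) = pst"
proof -
  interpret w: survival_weights S cst by (rule survival_weights_cst)
  have W: "optimal_weights S = w.W" by (intro ext) (simp add: optimal_weights_eq w.W_def)
  have "dim_e S w.W = (\<Sum>a\<in>alph S 1. pst a * (ln (EN S 1 a) - ln (pst a)))"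
    unfolding w.dim sum_negf[symmetric]
  proof (rule sum.cong[OF refl])
    fix a assume a: "a \<in> alph S 1"
    show "- (cst a * ln (cst a) * surv_prob S a) = pst a * (ln (EN S 1 a) - ln (pst a))"
    proof (cases "cst a = 0 \<or> surv_prob S a = 0")
      case False
      then have "0 < cst a" "0 < surv_prob S a" using w.c_nonneg[OF a] surv_prob_nonneg[of a] by auto
      then show ?thesis using a by (simp add: pst_cst EN_1 ln_mult algebra_simps)
    qed (auto simp: pst_cst[OF a])
  qed
  also have "\<dots> = (\<Sum>a\<in>act 1. pst a * (ln (EN S 1 a) - ln (pst a)))"
    using fin_alph at_sub by (intro sum.mono_neutral_right) (auto simp: pst_def lift_def)
  also have "\<dots> = Hh 1 pst + ell 1 pst"
    by (simp add: Hh_def ell_def shannon_def sum_subtractf algebra_simps)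
  also have "\<dots> = dst" by (rule pst_facts(3))
  finally have d: "dim_e S w.W = dst" .
  have nd: "nondegenerate S w.W" using dst_pos by (intro w.nondegenerate_if_dim_pos) (simp add: d)
  show "optimal_weights S \<in> mandelbrot_on_K S" "dim_e S (optimal_weights S) = dst"
    unfolding W mandelbrot_on_K_def using w.weights w.supported nd d by auto
  show "mandelbrot.pv S (optimal_weights S) = pst"
  proof
    fix a
    show "mandelbrot.pv S (optimal_weights S) a = pst a" unfolding W
    proof (cases "a \<in> alph S 1")
      case True
      then show "w.pv a = pst a" using w.pv_survival[OF nd True] pst_cst[OF True] by simp
    next
      case False
      then have "a \<notin> act 1" using at_sub by auto
      then show "w.pv a = pst a" using False by (simp add: w.pv_def[OF nd] pst_def lift_def)
    qed
  qed
qed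

theorem maximum_attained_uniquely:
  "is_maximum (dim_e_gam S ` mandelbrot_on_K S) (pressure S i1 th)"
  "W \<in> mandelbrot_on_K S \<Longrightarrow> dim_e_gam S W = pressure S i1 th \<longleftrightarrow> same_weights S W (optimal_weights S)"
proof -
  have le: "dim_e_gam S W \<le> pressure S i1 th" if "W \<in> mandelbrot_on_K S" for W
    using GG_le(1)[OF dim_e_gam_eq(1,3)[OF that]] dim_e_gam_eq(2)[OF that] by simp
  have opt: "dim_e_gam S (optimal_weights S) = pressure S i1 th"
    using dim_e_gam_eq(2)[OF optimal_weights_on_K(1)] GG_optimum by (simp add: optimal_weights_on_K)
  show "is_maximum (dim_e_gam S ` mandelbrot_on_K S) (pressure S i1 th)"
    unfolding is_maximum_def using le opt optimal_weights_on_K(1) by force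
  assume W: "W \<in> mandelbrot_on_K S"
  interpret m: mandelbrot S W using W rs by (simp add: mandelbrot_def mandelbrot_on_K_def)
  have nd: "nondegenerate S W" using W by (simp add: mandelbrot_on_K_def)
  show "dim_e_gam S W = pressure S i1 th \<longleftrightarrow> same_weights S W (optimal_weights S)"
  proof
    assume "dim_e_gam S W = pressure S i1 th"
    then have "m.pv = pst" "dim_e S W = dst"
      using GG_le(2)[OF dim_e_gam_eq(1,3)[OF W]] dim_e_gam_eq(2)[OF W] by auto
    have pA: "pst \<in> prob_vec (act 1)" by (rule pst_facts(1))
    have s1: "shannon (alph S 1) pst = Hh 1 pst" using K2 pA by (intro Hh_alph) auto
    have s2: "(\<Sum>a\<in>alph S 1. pst a * ln (surv_prob S a)) = ell 1 pst"
      unfolding ell_def using fin_alph at_sub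
      by (intro sum.mono_neutral_cong_right) (auto simp: EN_1 alph_tilde_def pst_def lift_def)
    have "dim_e S W = shannon (alph S 1) m.pv + (\<Sum>a\<in>alph S 1. m.pv a * ln (surv_prob S a))"
      unfolding \<open>m.pv = pst\<close> s1 s2 \<open>dim_e S W = dst\<close> by (rule pst_facts(3)[symmetric])
    from m.dim_e_le(2)[OF nd this]
    have ae: "AE \<omega> in Om S. \<forall>a\<in>alph S 1. W [] \<omega> a = pst a / surv_prob S a * indicator (surv S [] \<omega>) a"
      unfolding \<open>m.pv = pst\<close> .
    \<comment> \<open>For letters of survival probability 0 the quotient
      \<open>pst a / surv_prob S a\<close> is 0 while \<open>cst a\<close> may be positive; both are
      multiplied by an indicator that vanishes almost surely.\<close>
    have "AE \<omega> in Om S. \<forall>a\<in>alph S 1. surv_prob S a = 0 \<longrightarrow> a \<notin> surv S [] \<omega>"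
    proof (intro AE_finite_allI fin_alph)
      fix a assume "a \<in> alph S 1"
      show "AE \<omega> in Om S. surv_prob S a = 0 \<longrightarrow> a \<notin> surv S [] \<omega>"
        using Om.prob_eq_0[OF surv_sets[of a]] AE_space unfolding surv_prob_def
        by (cases "measure (Om S) {\<omega> \<in> space (Om S). a \<in> surv S [] \<omega>} = 0") (auto elim!: eventually_elim2)
    qed
    with ae have "AE \<omega> in Om S. \<forall>a\<in>alph S 1. W [] \<omega> a = cst a * indicator (surv S [] \<omega>) a"
    proof eventually_elim
      case (elim \<omega>)
      show ?case
      proof
        fix a assume a: "a \<in> alph S 1"
        show "W [] \<omega> a = cst a * indicator (surv S [] \<omega>) a"
          using elim a pst_cst[OF a] by (cases "surv_prob S a = 0") auto
      qed
    qed
    from m.same_weights_survival[OF this]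
    show "same_weights S W (optimal_weights S)"
      unfolding same_weights_def by (simp add: optimal_weights_eq)
  next
    assume sw: "same_weights S W (optimal_weights S)"
    interpret o: mandelbrot S "optimal_weights S"
      using optimal_weights_on_K(1) rs by (simp add: mandelbrot_def mandelbrot_on_K_def)
    have ndo: "nondegenerate S (optimal_weights S)" using optimal_weights_on_K(1) by (simp add: mandelbrot_on_K_def)
    have ae: "AE \<omega> in Om S. W [] \<omega> a = optimal_weights S [] \<omega> a" if "a \<in> alph S 1" for a
      using sw unfolding same_weights_def by eventually_elim (use that in auto)
    have "dim_e S W = dim_e S (optimal_weights S)"
      unfolding dim_e_def
    proof (intro arg_cong[where f=uminus] sum.cong refl integral_cong_AE)
      fix a assume a: "a \<in> alph S 1"
      show "AE \<omega> in Om S. W [] \<omega> a * ln (W [] \<omega> a) = optimal_weights S [] \<omega> a * ln (optimal_weights S [] \<omega> a)"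
        using ae[OF a] by eventually_elim simp
      have [measurable]: "(\<lambda>\<omega>. W [] \<omega> a) \<in> borel_measurable (Om S)" "(\<lambda>\<omega>. optimal_weights S [] \<omega> a) \<in> borel_measurable (Om S)"
        using a by (auto intro: m.W_meas o.W_meas)
      show "(\<lambda>\<omega>. W [] \<omega> a * ln (W [] \<omega> a)) \<in> borel_measurable (Om S)"
        "(\<lambda>\<omega>. optimal_weights S [] \<omega> a * ln (optimal_weights S [] \<omega> a)) \<in> borel_measurable (Om S)" by measurable
    qed
    moreover have "m.pv = o.pv"
    proof
      fix a
      show "m.pv a = o.pv a"
        unfolding m.pv_def[OF nd] o.pv_def[OF ndo] using ae[of a] m.W_meas[of "[]" a] o.W_meas[of "[]" a]
        by (auto intro!: integral_cong_AE)
    qed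
    ultimately show "dim_e_gam S W = pressure S i1 th"
      using opt dim_e_gam_eq(2)[OF W] dim_e_gam_eq(2)[OF optimal_weights_on_K(1)] by simp
  qed
qed

end

theorem theorem4p5:
  fixes S :: "('a, 'w) sponge" and M :: real
  assumes "random_sponge S"
    and "\<forall>i\<in>{1..levels S}. 0 < gam S i"
    and "2 \<le> card (alph_tilde S (levels S))"
    and "M = (if i_zero S \<le> levels S then pressure S (i_zero S) (theta_zero S)
              else pressure S (levels S) 1)"
  shows "is_maximum (dim_e_gam S ` mandelbrot_on_K S) M \<and>
    optimal_weights S \<in> mandelbrot_on_K S \<and>
    (\<forall>W\<in>mandelbrot_on_K S. dim_e_gam S W = M \<longleftrightarrow> same_weights S W (optimal_weights S))"
proof -
  interpret sponge S using assms(1,2) by unfold_locales auto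
  have "M = pressure S i1 th"
    using i_zero_cases assms(4) by (auto simp: th_def)
  then show ?thesis using maximum_attained_uniquely optimal_weights_on_K(1) by blast
qed

end
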